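(* Let $(R,\mathfrak m)$ be a commutative Artinian local ring with $\mathfrak m^3=0$, and let $\omega$ be its dualizing (canonical) module. The following statements are equivalent: (1) $R$ is Gorenstein. (2) $\operatorname{Tor}_1^R(\omega,\omega)=0$. (3) $\operatorname{Tor}_2^R(\omega,\omega)=\operatorname{Tor}_3^R(\omega,\omega)=0$. (4) $\operatorname{Tor}_j^R(\omega,\omega)=\operatorname{Tor}_{j+1}^R(\omega,\omega)=\operatorname{Tor}_{j+2}^R(\omega,\omega)=0$ for some $j\ge 3$.
   Context: For an Artinian local ring $R$ with residue field $k$, the dualizing module $\omega$ is the injective hull of $k$. *)

theory Defs
  imports "HOL-Algebra.Module" "HOL-Algebra.Ideal_Product" "HOL-Algebra.Ring_Divisibility"
begin

section \<open>Local and Artinian rings\<close>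

definition local_ring :: "('a, 'r) ring_scheme \<Rightarrow> 'a set \<Rightarrow> bool" where
  "local_ring R m \<longleftrightarrow> cring R \<and> maximalideal m R \<and> (\<forall>J. maximalideal J R \<longrightarrow> J = m)"

definition artinian_ring :: "('a, 'r) ring_scheme \<Rightarrow> bool" where
  "artinian_ring R \<longleftrightarrow> ring R \<and>
     (\<forall>I :: nat \<Rightarrow> 'a set. (\<forall>n. ideal (I n) R \<and> I (Suc n) \<subseteq> I n) \<longrightarrow> (\<exists>n. \<forall>k\<ge>n. I k = I n))"


section \<open>Modules\<close>

text \<open>The library's module record extends the ring record.  The fields \<open>mult\<close> and \<open>one\<close>
  are irrelevant for modules and left \<open>undefined\<close> in the constructions below.\<close>

definition module_hom ::
  "('a, 'r) ring_scheme \<Rightarrow> ('a, 'b, 'm) module_scheme \<Rightarrow> ('a, 'c, 'n) module_scheme \<Rightarrow> ('b \<Rightarrow> 'c) set" where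
  "module_hom R M N = {f \<in> carrier M \<rightarrow> carrier N.
     (\<forall>x\<in>carrier M. \<forall>y\<in>carrier M. f (x \<oplus>\<^bsub>M\<^esub> y) = f x \<oplus>\<^bsub>N\<^esub> f y) \<and>
     (\<forall>a\<in>carrier R. \<forall>x\<in>carrier M. f (a \<odot>\<^bsub>M\<^esub> x) = a \<odot>\<^bsub>N\<^esub> f x)}"

definition ring_module :: "('a, 'r) ring_scheme \<Rightarrow> ('a, 'a) module" where
  "ring_module R = \<lparr>carrier = carrier R, monoid.mult = undefined, one = undefined,
     ring.zero = \<zero>\<^bsub>R\<^esub>, ring.add = ring.add R, smult = monoid.mult R\<rparr>"

definition quotient_module :: "('a, 'b, 'm) module_scheme \<Rightarrow> 'b set \<Rightarrow> ('a, 'b set) module" where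
  "quotient_module M N = \<lparr>carrier = a_rcosets\<^bsub>M\<^esub> N, monoid.mult = undefined, one = undefined,
     ring.zero = N, ring.add = set_add M, smult = (\<lambda>a X. N <+>\<^bsub>M\<^esub> ((\<lambda>x. a \<odot>\<^bsub>M\<^esub> x) ` X))\<rparr>"

definition submodule_span ::
  "('a, 'r) ring_scheme \<Rightarrow> ('a, 'b, 'm) module_scheme \<Rightarrow> 'b set \<Rightarrow> 'b set" where
  "submodule_span R M X = \<Inter>{H. submodule H R M \<and> X \<subseteq> H}"

definition trivial_module :: "('a, 'b, 'm) module_scheme \<Rightarrow> bool" where
  "trivial_module M \<longleftrightarrow> carrier M = {\<zero>\<^bsub>M\<^esub>}"


section \<open>Injective modules, injective hulls, Gorenstein rings\<close>

text \<open>HOL cannot quantify over types inside a definition, so the test modules \<open>A\<close>, \<open>B\<close> live on the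
  type of the ring elements.  This is no restriction: these include \<open>R\<close> and its ideals, so Baer's
  argument applies and extension along submodules of modules on arbitrary types follows, see
  \<open>injective_module_extend\<close> below.\<close>

definition injective_module :: "('a, 'r) ring_scheme \<Rightarrow> ('a, 'b, 'm) module_scheme \<Rightarrow> bool" where
  "injective_module R E \<longleftrightarrow> module R E \<and>
     (\<forall>(A :: ('a, 'a) module) (B :: ('a, 'a) module) i f.
        module R A \<and> module R B \<and> i \<in> module_hom R A B \<and> inj_on i (carrier A) \<and> f \<in> module_hom R A E
        \<longrightarrow> (\<exists>g \<in> module_hom R B E. \<forall>x\<in>carrier A. g (i x) = f x))"

definition essential_submodule ::
  "('a, 'r) ring_scheme \<Rightarrow> 'b set \<Rightarrow> ('a, 'b, 'm) module_scheme \<Rightarrow> bool" where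
  "essential_submodule R K E \<longleftrightarrow> submodule K R E \<and>
     (\<forall>H. submodule H R E \<and> H \<inter> K = {\<zero>\<^bsub>E\<^esub>} \<longrightarrow> H = {\<zero>\<^bsub>E\<^esub>})"

definition injective_hull ::
  "('a, 'r) ring_scheme \<Rightarrow> ('a, 'b, 'm) module_scheme \<Rightarrow> ('a, 'c, 'n) module_scheme \<Rightarrow> bool" where
  "injective_hull R M E \<longleftrightarrow> module R M \<and> injective_module R E \<and>
     (\<exists>i \<in> module_hom R M E. inj_on i (carrier M) \<and> essential_submodule R (i ` carrier M) E)"

definition residue_field_module :: "('a, 'r) ring_scheme \<Rightarrow> 'a set \<Rightarrow> ('a, 'a set) module" where
  "residue_field_module R m = quotient_module (ring_module R) m"

definition dualizing_module ::
  "('a, 'r) ring_scheme \<Rightarrow> 'a set \<Rightarrow> ('a, 'b, 'm) module_scheme \<Rightarrow> bool" where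
  "dualizing_module R m \<omega> \<longleftrightarrow> injective_hull R (residue_field_module R m) \<omega>"

definition injective_resolution ::
  "('a, 'r) ring_scheme \<Rightarrow> ('a, 'b, 'm) module_scheme \<Rightarrow> (nat \<Rightarrow> ('a, 'c, 'n) module_scheme)
     \<Rightarrow> (nat \<Rightarrow> 'c \<Rightarrow> 'c) \<Rightarrow> ('b \<Rightarrow> 'c) \<Rightarrow> bool" where
  "injective_resolution R M I d e \<longleftrightarrow>
     (\<forall>n. injective_module R (I n)) \<and>
     e \<in> module_hom R M (I 0) \<and> inj_on e (carrier M) \<and>
     (\<forall>n. d n \<in> module_hom R (I n) (I (Suc n))) \<and>
     e ` carrier M = {x \<in> carrier (I 0). d 0 x = \<zero>\<^bsub>I 1\<^esub>} \<and>
     (\<forall>n. d n ` carrier (I n) = {x \<in> carrier (I (Suc n)). d (Suc n) x = \<zero>\<^bsub>I (Suc (Suc n))\<^esub>})"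

text \<open>Placing the modules \<open>I n\<close> on the type of ring elements is harmless for a Noetherian local ring:
  if \<open>R\<close> is infinite, the modules of its minimal injective resolution have cardinality at most that
  of \<open>R\<close> (each is a direct sum of copies of hulls of \<open>R/p\<close>, \<open>p\<close> prime, each occurring finitely often
  and each a countable union of finite length modules over the localization at \<open>p\<close>); if \<open>R\<close> is
  finite, hence Artinian, finite self-injective dimension means that \<open>R\<close> is injective over itself.\<close>

definition finite_self_injective_dimension :: "('a, 'r) ring_scheme \<Rightarrow> bool" where
  "finite_self_injective_dimension R \<longleftrightarrow>
     (\<exists>n (I :: nat \<Rightarrow> ('a, 'a) module) d e.
        injective_resolution R (ring_module R) I d e \<and> (\<forall>k>n. trivial_module (I k)))"

definition gorenstein_local_ring :: "('a, 'r) ring_scheme \<Rightarrow> 'a set \<Rightarrow> bool" where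
  "gorenstein_local_ring R m \<longleftrightarrow>
     local_ring R m \<and> noetherian_ring R \<and> finite_self_injective_dimension R"


section \<open>Free modules and tensor products\<close>

text \<open>The free module on \<open>S\<close>: finitely supported functions, extended by zero outside \<open>S\<close>.\<close>

definition free_module :: "('a, 'r) ring_scheme \<Rightarrow> 's set \<Rightarrow> ('a, 's \<Rightarrow> 'a) module" where
  "free_module R S = \<lparr>
     carrier = {f. (\<forall>s. f s \<in> carrier R) \<and> (\<forall>s. s \<notin> S \<longrightarrow> f s = \<zero>\<^bsub>R\<^esub>) \<and> finite {s. f s \<noteq> \<zero>\<^bsub>R\<^esub>}},
     monoid.mult = undefined, one = undefined,
     ring.zero = (\<lambda>s. \<zero>\<^bsub>R\<^esub>), ring.add = (\<lambda>f g s. f s \<oplus>\<^bsub>R\<^esub> g s), smult = (\<lambda>a f s. a \<otimes>\<^bsub>R\<^esub> f s)\<rparr>"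

definition basis_vec :: "('a, 'r) ring_scheme \<Rightarrow> 's \<Rightarrow> 's \<Rightarrow> 'a" where
  "basis_vec R s = (\<lambda>t. if t = s then \<one>\<^bsub>R\<^esub> else \<zero>\<^bsub>R\<^esub>)"

text \<open>The linear map from a free module to \<open>M\<close> sending each basis vector \<open>s\<close> to \<open>\<phi> s\<close>.\<close>

definition free_ext ::
  "('a, 'r) ring_scheme \<Rightarrow> ('a, 'b, 'm) module_scheme \<Rightarrow> ('s \<Rightarrow> 'b) \<Rightarrow> ('s \<Rightarrow> 'a) \<Rightarrow> 'b" where
  "free_ext R M \<phi> f = (\<Oplus>\<^bsub>M\<^esub>s\<in>{s. f s \<noteq> \<zero>\<^bsub>R\<^esub>}. f s \<odot>\<^bsub>M\<^esub> \<phi> s)"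

definition tensor_free ::
  "('a, 'r) ring_scheme \<Rightarrow> ('a, 'b, 'm) module_scheme \<Rightarrow> ('a, 'c, 'n) module_scheme
     \<Rightarrow> ('a, 'b \<times> 'c \<Rightarrow> 'a) module" where
  "tensor_free R M N = free_module R (carrier M \<times> carrier N)"

definition tensor_relations ::
  "('a, 'r) ring_scheme \<Rightarrow> ('a, 'b, 'm) module_scheme \<Rightarrow> ('a, 'c, 'n) module_scheme
     \<Rightarrow> ('b \<times> 'c \<Rightarrow> 'a) set" where
  "tensor_relations R M N = (let F = tensor_free R M N; \<delta> = (\<lambda>x y. basis_vec R (x, y)) in
     submodule_span R F
       ({\<delta> (x \<oplus>\<^bsub>M\<^esub> x') y \<ominus>\<^bsub>F\<^esub> (\<delta> x y \<oplus>\<^bsub>F\<^esub> \<delta> x' y) | x x' y.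
           x \<in> carrier M \<and> x' \<in> carrier M \<and> y \<in> carrier N} \<union>
        {\<delta> x (y \<oplus>\<^bsub>N\<^esub> y') \<ominus>\<^bsub>F\<^esub> (\<delta> x y \<oplus>\<^bsub>F\<^esub> \<delta> x y') | x y y'.
           x \<in> carrier M \<and> y \<in> carrier N \<and> y' \<in> carrier N} \<union>
        {\<delta> (a \<odot>\<^bsub>M\<^esub> x) y \<ominus>\<^bsub>F\<^esub> (a \<odot>\<^bsub>F\<^esub> \<delta> x y) | a x y.
           a \<in> carrier R \<and> x \<in> carrier M \<and> y \<in> carrier N} \<union>
        {\<delta> x (a \<odot>\<^bsub>N\<^esub> y) \<ominus>\<^bsub>F\<^esub> (a \<odot>\<^bsub>F\<^esub> \<delta> x y) | a x y.
           a \<in> carrier R \<and> x \<in> carrier M \<and> y \<in> carrier N}))"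

definition tensor_module ::
  "('a, 'r) ring_scheme \<Rightarrow> ('a, 'b, 'm) module_scheme \<Rightarrow> ('a, 'c, 'n) module_scheme
     \<Rightarrow> ('a, ('b \<times> 'c \<Rightarrow> 'a) set) module" where
  "tensor_module R M N = quotient_module (tensor_free R M N) (tensor_relations R M N)"

text \<open>The map \<open>f \<otimes> id\<close> from \<open>M \<otimes> N\<close> to \<open>M' \<otimes> N\<close>.  An element \<open>X\<close> of the source is a coset; all its
  representatives \<open>c\<close> have the same image coset, so the union is that coset.\<close>

definition tensor_map ::
  "('a, 'r) ring_scheme \<Rightarrow> ('a, 'd, 'm) module_scheme \<Rightarrow> ('a, 'c, 'n) module_scheme
     \<Rightarrow> ('b \<Rightarrow> 'd) \<Rightarrow> ('b \<times> 'c \<Rightarrow> 'a) set \<Rightarrow> ('d \<times> 'c \<Rightarrow> 'a) set" where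
  "tensor_map R M' N f X = (\<Union>c\<in>X. tensor_relations R M' N +>\<^bsub>tensor_free R M' N\<^esub>
     free_ext R (tensor_free R M' N) (\<lambda>(x, y). basis_vec R (f x, y)) c)"


section \<open>Homology and Tor\<close>

text \<open>A chain complex is given by modules \<open>C n\<close> and maps \<open>d n\<close> from \<open>C (Suc n)\<close> to \<open>C n\<close>.\<close>

definition cycles :: "(nat \<Rightarrow> ('a, 'b, 'm) module_scheme) \<Rightarrow> (nat \<Rightarrow> 'b \<Rightarrow> 'b) \<Rightarrow> nat \<Rightarrow> 'b set" where
  "cycles C d n = (case n of 0 \<Rightarrow> carrier (C 0)
     | Suc k \<Rightarrow> {x \<in> carrier (C (Suc k)). d k x = \<zero>\<^bsub>C k\<^esub>})"

definition homology ::
  "(nat \<Rightarrow> ('a, 'b, 'm) module_scheme) \<Rightarrow> (nat \<Rightarrow> 'b \<Rightarrow> 'b) \<Rightarrow> nat \<Rightarrow> ('a, 'b set) module" where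
  "homology C d n = quotient_module ((C n)\<lparr>carrier := cycles C d n\<rparr>) (d n ` carrier (C (Suc n)))"

text \<open>The canonical free resolution of \<open>M\<close>.  The term \<open>n\<close> is free on a set \<open>res_basis R M n\<close>:
  in degree \<open>0\<close> there is one generator \<open>Gen x\<close> for each element \<open>x\<close> of \<open>M\<close>; in degree \<open>n + 1\<close> there
  is one generator \<open>Rel xs\<close> for each formal linear combination \<open>xs\<close> of generators of degree \<open>n\<close> that
  is mapped to zero, and the boundary of \<open>Rel xs\<close> is the element represented by \<open>xs\<close>.  Using lists
  instead of elements of the kernel keeps all terms of the resolution on a single type.\<close>

datatype ('a, 'b) res_gen = Gen (gen_of: 'b) | Rel (rel_of: "('a \<times> ('a, 'b) res_gen) list")

definition word_sum :: "('a, 'r) ring_scheme \<Rightarrow> ('a \<times> 's) list \<Rightarrow> 's \<Rightarrow> 'a" where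
  "word_sum R xs = foldr (\<lambda>(a, s) v. (a \<odot>\<^bsub>free_module R UNIV\<^esub> basis_vec R s) \<oplus>\<^bsub>free_module R UNIV\<^esub> v)
     xs \<zero>\<^bsub>free_module R UNIV\<^esub>"

definition res_augmentation ::
  "('a, 'r) ring_scheme \<Rightarrow> ('a, 'b, 'm) module_scheme \<Rightarrow> (('a, 'b) res_gen \<Rightarrow> 'a) \<Rightarrow> 'b" where
  "res_augmentation R M = free_ext R M gen_of"

definition res_boundary ::
  "('a, 'r) ring_scheme \<Rightarrow> (('a, 'b) res_gen \<Rightarrow> 'a) \<Rightarrow> ('a, 'b) res_gen \<Rightarrow> 'a" where
  "res_boundary R = free_ext R (free_module R UNIV) (\<lambda>s. word_sum R (rel_of s))"

fun res_basis ::
  "('a, 'r) ring_scheme \<Rightarrow> ('a, 'b, 'm) module_scheme \<Rightarrow> nat \<Rightarrow> ('a, 'b) res_gen set" where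
  "res_basis R M 0 = Gen ` carrier M"
| "res_basis R M (Suc 0) = {Rel xs | xs. set xs \<subseteq> carrier R \<times> res_basis R M 0 \<and>
     res_augmentation R M (word_sum R xs) = \<zero>\<^bsub>M\<^esub>}"
| "res_basis R M (Suc (Suc n)) = {Rel xs | xs. set xs \<subseteq> carrier R \<times> res_basis R M (Suc n) \<and>
     res_boundary R (word_sum R xs) = \<zero>\<^bsub>free_module R (res_basis R M n)\<^esub>}"

definition free_resolution ::
  "('a, 'r) ring_scheme \<Rightarrow> ('a, 'b, 'm) module_scheme \<Rightarrow> nat \<Rightarrow> ('a, ('a, 'b) res_gen \<Rightarrow> 'a) module" where
  "free_resolution R M n = free_module R (res_basis R M n)"

definition Tor ::
  "('a, 'r) ring_scheme \<Rightarrow> nat \<Rightarrow> ('a, 'b, 'm) module_scheme \<Rightarrow> ('a, 'c, 'n) module_scheme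
     \<Rightarrow> ('a, ((('a, 'b) res_gen \<Rightarrow> 'a) \<times> 'c \<Rightarrow> 'a) set set) module" where
  "Tor R n M N = homology (\<lambda>i. tensor_module R (free_resolution R M i) N)
     (\<lambda>i. tensor_map R (free_resolution R M i) N (res_boundary R)) n"


section \<open>Adequacy of the definitions\<close>

text \<open>Baer's criterion: injectivity as defined above gives the extension property for modules on
  arbitrary types.\<close>

lemma ring_module_module:
  assumes "cring R" shows "module R (ring_module R)"
proof -
  interpret cring R by fact
  show ?thesis
    by (rule moduleI, rule assms, rule abelian_groupI)
      (auto simp: ring_module_def l_distr r_distr a_ac m_assoc intro: l_neg a_inv_closed)
qed

lemma injective_module_extend:
  fixes R :: "('a, 'r) ring_scheme" and E :: "('a, 'b, 'm) module_scheme"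
    and B :: "('a, 'c, 'n) module_scheme"
  assumes E: "injective_module R E" and B: "module R B" and A: "submodule A R B"
    and f: "f \<in> module_hom R (B\<lparr>carrier := A\<rparr>) E"
  shows "\<exists>g \<in> module_hom R B E. \<forall>x\<in>A. g x = f x"
proof -
  have mE: "module R E" using E by (simp add: injective_module_def)
  interpret B: module R B by fact
  interpret E: module R E by fact
  note AE = B.submoduleE[OF A]
  define lin where "lin G \<longleftrightarrow> G \<subseteq> carrier B \<times> carrier E \<and> (\<lambda>x. (x, f x)) ` A \<subseteq> G \<and>
    (\<forall>x y x' y'. (x, y) \<in> G \<longrightarrow> (x', y') \<in> G \<longrightarrow> (x \<oplus>\<^bsub>B\<^esub> x', y \<oplus>\<^bsub>E\<^esub> y') \<in> G) \<and>
    (\<forall>a\<in>carrier R. \<forall>x y. (x, y) \<in> G \<longrightarrow> (a \<odot>\<^bsub>B\<^esub> x, a \<odot>\<^bsub>E\<^esub> y) \<in> G) \<and>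
    (\<forall>y. (\<zero>\<^bsub>B\<^esub>, y) \<in> G \<longrightarrow> y = \<zero>\<^bsub>E\<^esub>)" for G
  have linD:
    "lin G \<Longrightarrow> G \<subseteq> carrier B \<times> carrier E"
    "lin G \<Longrightarrow> (\<lambda>x. (x, f x)) ` A \<subseteq> G"
    "lin G \<Longrightarrow> (x, y) \<in> G \<Longrightarrow> (x', y') \<in> G \<Longrightarrow> (x \<oplus>\<^bsub>B\<^esub> x', y \<oplus>\<^bsub>E\<^esub> y') \<in> G"
    "lin G \<Longrightarrow> a \<in> carrier R \<Longrightarrow> (x, y) \<in> G \<Longrightarrow> (a \<odot>\<^bsub>B\<^esub> x, a \<odot>\<^bsub>E\<^esub> y) \<in> G"
    "lin G \<Longrightarrow> (\<zero>\<^bsub>B\<^esub>, y) \<in> G \<Longrightarrow> y = \<zero>\<^bsub>E\<^esub>" for G x y x' y' a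
    by (simp_all add: lin_def)
  have fE: "x \<in> A \<Longrightarrow> f x \<in> carrier E" and fadd: "x \<in> A \<Longrightarrow> y \<in> A \<Longrightarrow> f (x \<oplus>\<^bsub>B\<^esub> y) = f x \<oplus>\<^bsub>E\<^esub> f y"
    and fsm: "a \<in> carrier R \<Longrightarrow> x \<in> A \<Longrightarrow> f (a \<odot>\<^bsub>B\<^esub> x) = a \<odot>\<^bsub>E\<^esub> f x" for a x y
    using f by (auto simp: module_hom_def)
  have zA: "\<zero>\<^bsub>B\<^esub> \<in> A"
    using A subgroup.one_closed[OF submodule.axioms(1)[OF A]] by simp
  have f0: "f \<zero>\<^bsub>B\<^esub> = \<zero>\<^bsub>E\<^esub>"
    using fsm[of "\<zero>\<^bsub>R\<^esub>" "\<zero>\<^bsub>B\<^esub>"] zA fE by simp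
  have base: "lin ((\<lambda>x. (x, f x)) ` A)"
    unfolding lin_def
  proof (intro conjI allI impI ballI)
    show "(\<lambda>x. (x, f x)) ` A \<subseteq> carrier B \<times> carrier E" using AE(1) fE by blast
    show "(x \<oplus>\<^bsub>B\<^esub> x', y \<oplus>\<^bsub>E\<^esub> y') \<in> (\<lambda>x. (x, f x)) ` A"
      if "(x, y) \<in> (\<lambda>x. (x, f x)) ` A" "(x', y') \<in> (\<lambda>x. (x, f x)) ` A" for x y x' y'
      using that AE(5)[of x x'] fadd[of x x'] by auto
    show "(a \<odot>\<^bsub>B\<^esub> x, a \<odot>\<^bsub>E\<^esub> y) \<in> (\<lambda>x. (x, f x)) ` A"
      if "a \<in> carrier R" "(x, y) \<in> (\<lambda>x. (x, f x)) ` A" for a x y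
      using that AE(4)[of a x] fsm[of a x] by auto
    show "y = \<zero>\<^bsub>E\<^esub>" if "(\<zero>\<^bsub>B\<^esub>, y) \<in> (\<lambda>x. (x, f x)) ` A" for y
      using that f0 by auto
  qed simp
  have "\<exists>G\<in>Collect lin. \<forall>H\<in>Collect lin. G \<subseteq> H \<longrightarrow> H = G"
  proof (rule subset_Zorn_nonempty)
    show "Collect lin \<noteq> {}" using base by auto
  next
    fix \<C> assume ne: "\<C> \<noteq> {}" and ch: "subset.chain (Collect lin) \<C>"
    have l: "lin G" if "G \<in> \<C>" for G using ch that by (auto simp: subset.chain_def)
    have up: "\<exists>G\<in>\<C>. p \<in> G \<and> q \<in> G" if pq: "p \<in> \<Union>\<C>" "q \<in> \<Union>\<C>" for p q
    proof -
      obtain G H where "G \<in> \<C>" "p \<in> G" "H \<in> \<C>" "q \<in> H" using pq by blast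
      moreover from this have "G \<subseteq> H \<or> H \<subseteq> G" using ch by (meson subset_chain_def)
      ultimately show ?thesis by blast
    qed
    have "lin (\<Union>\<C>)"
      unfolding lin_def
    proof (intro conjI allI impI ballI)
      show "\<Union>\<C> \<subseteq> carrier B \<times> carrier E" using linD(1)[OF l] by blast
      show "(\<lambda>x. (x, f x)) ` A \<subseteq> \<Union>\<C>" using linD(2)[OF l] ne by blast
      fix x y x' y' assume "(x, y) \<in> \<Union>\<C>" "(x', y') \<in> \<Union>\<C>"
      then obtain G where G: "G \<in> \<C>" "(x, y) \<in> G" "(x', y') \<in> G" using up by blast
      have "(x \<oplus>\<^bsub>B\<^esub> x', y \<oplus>\<^bsub>E\<^esub> y') \<in> G"
        using linD(3)[OF l[OF G(1)]] G by simp
      then show "(x \<oplus>\<^bsub>B\<^esub> x', y \<oplus>\<^bsub>E\<^esub> y') \<in> \<Union>\<C>" using G by blast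
    next
      fix a x y assume "a \<in> carrier R" "(x, y) \<in> \<Union>\<C>"
      then show "(a \<odot>\<^bsub>B\<^esub> x, a \<odot>\<^bsub>E\<^esub> y) \<in> \<Union>\<C>" using linD(4)[OF l] by blast
    next
      fix y assume "(\<zero>\<^bsub>B\<^esub>, y) \<in> \<Union>\<C>"
      then show "y = \<zero>\<^bsub>E\<^esub>" using linD(5)[OF l] by blast
    qed
    then show "\<Union>\<C> \<in> Collect lin" by simp
  qed
  then obtain G where G: "lin G" and max: "\<And>H. lin H \<Longrightarrow> G \<subseteq> H \<Longrightarrow> H = G" by auto
  have Gc: "x \<in> carrier B" "y \<in> carrier E" if "(x, y) \<in> G" for x y
    using linD(1)[OF G] that by blast+
  note Gadd = linD(3)[OF G] and Gsm = linD(4)[OF G] and G0 = linD(5)[OF G]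
  have Gf: "(x, f x) \<in> G" if "x \<in> A" for x using linD(2)[OF G] that by blast
  have Gneg: "(\<ominus>\<^bsub>B\<^esub> x, \<ominus>\<^bsub>E\<^esub> y) \<in> G" if "(x, y) \<in> G" for x y
    using Gsm[of "\<ominus>\<^bsub>R\<^esub> \<one>\<^bsub>R\<^esub>", OF _ that] Gc[OF that] by (simp add: B.smult_l_minus E.smult_l_minus)
  have Guniq: "y = y'" if "(x, y) \<in> G" "(x, y') \<in> G" for x y y'
  proof -
    have "(\<zero>\<^bsub>B\<^esub>, y \<oplus>\<^bsub>E\<^esub> \<ominus>\<^bsub>E\<^esub> y') \<in> G"
      using Gadd[OF that(1) Gneg[OF that(2)]] Gc[OF that(1)] by (simp add: B.M.r_neg)
    then have "y \<oplus>\<^bsub>E\<^esub> \<ominus>\<^bsub>E\<^esub> y' = \<zero>\<^bsub>E\<^esub>" by (rule G0)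
    then show ?thesis
      using Gc that by (metis E.M.add.inv_equality E.M.minus_minus E.M.add.inv_closed)
  qed
  have total: "\<exists>y. (b, y) \<in> G" if b: "b \<in> carrier B" for b
  proof -
    define J where "J = {r \<in> carrier R. \<exists>y. (r \<odot>\<^bsub>B\<^esub> b, y) \<in> G}"
    define \<phi> where "\<phi> r = (THE y. (r \<odot>\<^bsub>B\<^esub> b, y) \<in> G)" for r
    have \<phi>I: "\<phi> r = y" if "(r \<odot>\<^bsub>B\<^esub> b, y) \<in> G" for r y
      unfolding \<phi>_def using that Guniq by blast
    have \<phi>G: "(r \<odot>\<^bsub>B\<^esub> b, \<phi> r) \<in> G" if "r \<in> J" for r
      using that \<phi>I unfolding J_def by auto
    let ?RR = "ring_module R" and ?J = "(ring_module R)\<lparr>carrier := J\<rparr>"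
    have mR: "module R ?RR" by (rule ring_module_module) (rule B.R.is_cring)
    interpret RR: module R ?RR by (rule mR)
    have Jadd: "(r \<oplus>\<^bsub>R\<^esub> s) \<in> J \<and> \<phi> (r \<oplus>\<^bsub>R\<^esub> s) = \<phi> r \<oplus>\<^bsub>E\<^esub> \<phi> s" if "r \<in> J" "s \<in> J" for r s
      using Gadd[OF \<phi>G[OF that(1)] \<phi>G[OF that(2)]] that b \<phi>I
      by (auto simp: J_def B.smult_l_distr)
    have Jsm: "(a \<otimes>\<^bsub>R\<^esub> r) \<in> J \<and> \<phi> (a \<otimes>\<^bsub>R\<^esub> r) = a \<odot>\<^bsub>E\<^esub> \<phi> r" if "a \<in> carrier R" "r \<in> J" for a r
      using Gsm[OF that(1) \<phi>G[OF that(2)]] that b \<phi>I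
      by (auto simp: J_def B.smult_assoc1)
    have Jc: "J \<subseteq> carrier R" by (auto simp: J_def)
    have J0: "\<zero>\<^bsub>R\<^esub> \<in> J" using Gf[OF zA] b by (auto simp: J_def)
    have Jneg: "\<ominus>\<^bsub>R\<^esub> r \<in> J" if "r \<in> J" for r
      using Jsm[of "\<ominus>\<^bsub>R\<^esub> \<one>\<^bsub>R\<^esub>" r] that Jc by (auto simp: B.R.l_minus)
    have aeq: "\<ominus>\<^bsub>?RR\<^esub> r = \<ominus>\<^bsub>R\<^esub> r" for r
      by (simp add: a_inv_def m_inv_def ring_module_def)
    have "submodule J R ?RR"
    proof (rule RR.submoduleI)
      fix r assume "r \<in> J" then show "\<ominus>\<^bsub>?RR\<^esub> r \<in> J" using Jneg aeq by simp
    qed (use Jc J0 Jadd Jsm in \<open>auto simp: ring_module_def\<close>)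
    then have mJ: "module R ?J" using mR by (rule submodule.submodule_is_module)
    have id: "(\<lambda>x. x) \<in> module_hom R ?J ?RR" using Jc by (auto simp: module_hom_def ring_module_def)
    have ph: "\<phi> \<in> module_hom R ?J E"
      using Jadd Jsm Gc[OF \<phi>G] by (auto simp: module_hom_def ring_module_def)
    have "\<exists>g \<in> module_hom R ?RR E. \<forall>x\<in>carrier ?J. g x = \<phi> x"
      using E mJ mR id ph unfolding injective_module_def by (metis inj_on_id2)
    then obtain g where g: "g \<in> module_hom R ?RR E" and g\<phi>: "\<And>r. r \<in> J \<Longrightarrow> g r = \<phi> r" by auto
    define e where "e = g \<one>\<^bsub>R\<^esub>"
    have e: "e \<in> carrier E" using g by (auto simp: e_def module_hom_def ring_module_def)
    have ge: "g r = r \<odot>\<^bsub>E\<^esub> e" if "r \<in> carrier R" for r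
    proof -
      have "g (r \<otimes>\<^bsub>R\<^esub> \<one>\<^bsub>R\<^esub>) = r \<odot>\<^bsub>E\<^esub> g \<one>\<^bsub>R\<^esub>"
        using g that B.R.one_closed unfolding module_hom_def ring_module_def by (simp del: B.R.r_one)
      then show ?thesis using that by (simp add: e_def)
    qed
    define G' where "G' = {(x \<oplus>\<^bsub>B\<^esub> r \<odot>\<^bsub>B\<^esub> b, y \<oplus>\<^bsub>E\<^esub> r \<odot>\<^bsub>E\<^esub> e) | x y r. (x, y) \<in> G \<and> r \<in> carrier R}"
    have G'I: "(x \<oplus>\<^bsub>B\<^esub> r \<odot>\<^bsub>B\<^esub> b, y \<oplus>\<^bsub>E\<^esub> r \<odot>\<^bsub>E\<^esub> e) \<in> G'" if "(x, y) \<in> G" "r \<in> carrier R" for x y r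
      unfolding G'_def using that by blast
    have sub: "(x, y) \<in> G'" if "(x, y) \<in> G" for x y
      using G'I[OF that B.R.zero_closed] Gc[OF that] b e by simp
    have "lin G'"
      unfolding lin_def
    proof (intro conjI allI impI ballI)
      show "G' \<subseteq> carrier B \<times> carrier E" using Gc b e by (auto simp: G'_def)
      show "(\<lambda>x. (x, f x)) ` A \<subseteq> G'" using Gf sub by auto
      fix u v u' v' assume "(u, v) \<in> G'" "(u', v') \<in> G'"
      then obtain x y r x' y' r' where *: "(x, y) \<in> G" "r \<in> carrier R" "(x', y') \<in> G" "r' \<in> carrier R"
        "u = x \<oplus>\<^bsub>B\<^esub> r \<odot>\<^bsub>B\<^esub> b" "v = y \<oplus>\<^bsub>E\<^esub> r \<odot>\<^bsub>E\<^esub> e" "u' = x' \<oplus>\<^bsub>B\<^esub> r' \<odot>\<^bsub>B\<^esub> b" "v' = y' \<oplus>\<^bsub>E\<^esub> r' \<odot>\<^bsub>E\<^esub> e"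
        by (auto simp: G'_def)
      have "u \<oplus>\<^bsub>B\<^esub> u' = (x \<oplus>\<^bsub>B\<^esub> x') \<oplus>\<^bsub>B\<^esub> (r \<oplus>\<^bsub>R\<^esub> r') \<odot>\<^bsub>B\<^esub> b"
        using * b Gc[OF *(1)] Gc[OF *(3)] by (simp add: B.smult_l_distr B.M.a_ac)
      moreover have "v \<oplus>\<^bsub>E\<^esub> v' = (y \<oplus>\<^bsub>E\<^esub> y') \<oplus>\<^bsub>E\<^esub> (r \<oplus>\<^bsub>R\<^esub> r') \<odot>\<^bsub>E\<^esub> e"
        using * e Gc[OF *(1)] Gc[OF *(3)] by (simp add: E.smult_l_distr E.M.a_ac)
      ultimately show "(u \<oplus>\<^bsub>B\<^esub> u', v \<oplus>\<^bsub>E\<^esub> v') \<in> G'"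
        using G'I[OF Gadd[OF *(1) *(3)] B.R.a_closed[OF *(2) *(4)]] by simp
    next
      fix a u v assume a: "a \<in> carrier R" and "(u, v) \<in> G'"
      then obtain x y r where *: "(x, y) \<in> G" "r \<in> carrier R"
        "u = x \<oplus>\<^bsub>B\<^esub> r \<odot>\<^bsub>B\<^esub> b" "v = y \<oplus>\<^bsub>E\<^esub> r \<odot>\<^bsub>E\<^esub> e" by (auto simp: G'_def)
      have "a \<odot>\<^bsub>B\<^esub> u = a \<odot>\<^bsub>B\<^esub> x \<oplus>\<^bsub>B\<^esub> (a \<otimes>\<^bsub>R\<^esub> r) \<odot>\<^bsub>B\<^esub> b"
        using * a b Gc[OF *(1)] by (simp add: B.smult_r_distr B.smult_assoc1)
      moreover have "a \<odot>\<^bsub>E\<^esub> v = a \<odot>\<^bsub>E\<^esub> y \<oplus>\<^bsub>E\<^esub> (a \<otimes>\<^bsub>R\<^esub> r) \<odot>\<^bsub>E\<^esub> e"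
        using * a e Gc[OF *(1)] by (simp add: E.smult_r_distr E.smult_assoc1)
      ultimately show "(a \<odot>\<^bsub>B\<^esub> u, a \<odot>\<^bsub>E\<^esub> v) \<in> G'"
        using G'I[OF Gsm[OF a *(1)] B.R.m_closed[OF a *(2)]] by simp
    next
      fix v assume "(\<zero>\<^bsub>B\<^esub>, v) \<in> G'"
      then obtain x y r where *: "(x, y) \<in> G" "r \<in> carrier R"
        "\<zero>\<^bsub>B\<^esub> = x \<oplus>\<^bsub>B\<^esub> r \<odot>\<^bsub>B\<^esub> b" "v = y \<oplus>\<^bsub>E\<^esub> r \<odot>\<^bsub>E\<^esub> e" by (auto simp: G'_def)
      have "r \<odot>\<^bsub>B\<^esub> b = \<ominus>\<^bsub>B\<^esub> x"
        using *(3) Gc[OF *(1)] *(2) b by (metis B.M.a_comm B.M.minus_equality B.smult_closed)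
      then have rb: "(r \<odot>\<^bsub>B\<^esub> b, \<ominus>\<^bsub>E\<^esub> y) \<in> G" using Gneg[OF *(1)] by simp
      then have "r \<in> J" using * by (auto simp: J_def)
      then have "r \<odot>\<^bsub>E\<^esub> e = \<ominus>\<^bsub>E\<^esub> y" using g\<phi> ge \<phi>I[OF rb] * by metis
      then show "v = \<zero>\<^bsub>E\<^esub>" using * Gc[OF *(1)] by (simp add: E.M.r_neg)
    qed
    then have "G' = G" using sub by (intro max) auto
    moreover have "(b, e) \<in> G'"
      using G'I[OF Gf[OF zA] B.R.one_closed] f0 b e by simp
    ultimately show ?thesis by blast
  qed
  define g where "g x = (THE y. (x, y) \<in> G)" for x
  have gI: "g x = y" if "(x, y) \<in> G" for x y
    unfolding g_def using that Guniq by blast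
  have gG: "(x, g x) \<in> G" if "x \<in> carrier B" for x using total[OF that] gI by auto
  have "g \<in> module_hom R B E"
    unfolding module_hom_def
    using Gc(2)[OF gG] gI[OF Gadd[OF gG gG]] gI[OF Gsm[OF _ gG]] by simp
  moreover have "g x = f x" if "x \<in> A" for x using gI Gf that by blast
  ultimately show ?thesis by blast
qed

text \<open>The canonical free resolution is a resolution.\<close>

lemma free_module_simps [simp]:
  "\<zero>\<^bsub>free_module R S\<^esub> = (\<lambda>s. \<zero>\<^bsub>R\<^esub>)"
  "f \<oplus>\<^bsub>free_module R S\<^esub> g = (\<lambda>s. f s \<oplus>\<^bsub>R\<^esub> g s)"
  "a \<odot>\<^bsub>free_module R S\<^esub> f = (\<lambda>s. a \<otimes>\<^bsub>R\<^esub> f s)"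
  by (simp_all add: free_module_def)

lemma free_module_carrier:
  "f \<in> carrier (free_module R S) \<longleftrightarrow>
     (\<forall>s. f s \<in> carrier R) \<and> (\<forall>s. s \<notin> S \<longrightarrow> f s = \<zero>\<^bsub>R\<^esub>) \<and> finite {s. f s \<noteq> \<zero>\<^bsub>R\<^esub>}"
  by (simp add: free_module_def)

lemma free_module_module:
  fixes R :: "('a, 'r) ring_scheme" and S :: "'s set"
  assumes "cring R" shows "module R (free_module R S)"
proof -
  interpret cring R by fact
  have fin: "finite {s. f s \<oplus>\<^bsub>R\<^esub> g s \<noteq> \<zero>\<^bsub>R\<^esub>}"
    if "finite {s. f s \<noteq> \<zero>\<^bsub>R\<^esub>}" "finite {s. g s \<noteq> \<zero>\<^bsub>R\<^esub>}" for f g :: "'s \<Rightarrow> 'a"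
    by (rule finite_subset[OF _ finite_UnI[OF that]]) auto
  have fin2: "finite {s. a \<otimes>\<^bsub>R\<^esub> f s \<noteq> \<zero>\<^bsub>R\<^esub>}"
    if "finite {s. f s \<noteq> \<zero>\<^bsub>R\<^esub>}" "a \<in> carrier R" for a and f :: "'s \<Rightarrow> 'a"
    by (rule finite_subset[OF _ that(1)]) (use that(2) in auto)
  show ?thesis
  proof (rule moduleI, rule assms, rule abelian_groupI, goal_cases)
    case (6 f)
    then have "(\<lambda>s. (\<ominus>\<^bsub>R\<^esub> \<one>\<^bsub>R\<^esub>) \<otimes>\<^bsub>R\<^esub> f s) \<in> carrier (free_module R S)"
      using fin2[of f "\<ominus>\<^bsub>R\<^esub> \<one>\<^bsub>R\<^esub>"] by (auto simp: free_module_carrier)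
    moreover have "(\<lambda>s. (\<ominus>\<^bsub>R\<^esub> \<one>\<^bsub>R\<^esub>) \<otimes>\<^bsub>R\<^esub> f s \<oplus>\<^bsub>R\<^esub> f s) = (\<lambda>s. \<zero>\<^bsub>R\<^esub>)"
      using 6 by (auto simp: free_module_carrier l_minus l_neg)
    ultimately show ?case by (intro bexI) auto
  qed (auto simp: free_module_carrier a_ac m_assoc l_distr r_distr fun_eq_iff intro!: fin fin2)
qed

lemma basis_vec_carrier:
  assumes "cring R" "s \<in> S" shows "basis_vec R s \<in> carrier (free_module R S)"
proof -
  interpret cring R by fact
  have "finite {t. basis_vec R s t \<noteq> \<zero>\<^bsub>R\<^esub>}"
    by (rule finite_subset[of _ "{s}"]) (auto simp: basis_vec_def)
  then show ?thesis using assms by (auto simp: free_module_carrier) (auto simp: basis_vec_def)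
qed

lemma free_ext_superset:
  assumes "module R M" "f \<in> carrier (free_module R S)" "\<phi> \<in> S \<rightarrow> carrier M"
    "finite T" "{s. f s \<noteq> \<zero>\<^bsub>R\<^esub>} \<subseteq> T" "T \<subseteq> S"
  shows "free_ext R M \<phi> f = (\<Oplus>\<^bsub>M\<^esub>s\<in>T. f s \<odot>\<^bsub>M\<^esub> \<phi> s)"
proof -
  interpret module R M by fact
  have *: "f s \<odot>\<^bsub>M\<^esub> \<phi> s \<in> carrier M" if "s \<in> T" for s
    using assms(2,3,6) that by (intro smult_closed) (auto simp: free_module_carrier)
  show ?thesis
    unfolding free_ext_def
    by (rule M.add.finprod_mono_neutral_cong_left) (use assms * in \<open>auto simp: Pi_iff subset_iff\<close>)
qed

lemma free_ext_hom:
  assumes M: "module R M" and \<phi>: "\<phi> \<in> S \<rightarrow> carrier M"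
  shows "free_ext R M \<phi> \<in> module_hom R (free_module R S) M"
proof -
  interpret module R M by fact
  interpret F: module R "free_module R S" by (rule free_module_module[OF R.is_cring])
  have c: "f s \<odot>\<^bsub>M\<^esub> \<phi> s \<in> carrier M" if "f \<in> carrier (free_module R S)" "s \<in> S" for f s
    using that \<phi> by (auto simp: free_module_carrier)
  have sup: "finite {s. f s \<noteq> \<zero>\<^bsub>R\<^esub>}" "{s. f s \<noteq> \<zero>\<^bsub>R\<^esub>} \<subseteq> S" if "f \<in> carrier (free_module R S)" for f
    using that by (auto simp: free_module_carrier)
  show ?thesis
    unfolding module_hom_def
  proof (intro CollectI conjI ballI Pi_I)
    fix f assume f: "f \<in> carrier (free_module R S)"
    show "free_ext R M \<phi> f \<in> carrier M"
      unfolding free_ext_def using c[OF f] sup[OF f] by (intro M.finsum_closed) auto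
    fix g assume g: "g \<in> carrier (free_module R S)"
    let ?T = "{s. f s \<noteq> \<zero>\<^bsub>R\<^esub>} \<union> {s. g s \<noteq> \<zero>\<^bsub>R\<^esub>}"
    have T: "finite ?T" "?T \<subseteq> S" using sup[OF f] sup[OF g] by auto
    have fg: "f \<oplus>\<^bsub>free_module R S\<^esub> g \<in> carrier (free_module R S)" using f g by (rule F.M.a_closed)
    have fc: "f s \<in> carrier R" "g s \<in> carrier R" for s using f g by (auto simp: free_module_carrier)
    have "free_ext R M \<phi> (f \<oplus>\<^bsub>free_module R S\<^esub> g) = (\<Oplus>\<^bsub>M\<^esub>s\<in>?T. (f s \<oplus>\<^bsub>R\<^esub> g s) \<odot>\<^bsub>M\<^esub> \<phi> s)"
      by (subst free_ext_superset[OF M fg \<phi> T(1) _ T(2)]) auto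
    also have "\<dots> = (\<Oplus>\<^bsub>M\<^esub>s\<in>?T. f s \<odot>\<^bsub>M\<^esub> \<phi> s \<oplus>\<^bsub>M\<^esub> g s \<odot>\<^bsub>M\<^esub> \<phi> s)"
      by (rule M.finsum_cong') (use fc \<phi> T c[OF f] c[OF g] in \<open>auto simp: smult_l_distr Pi_iff\<close>)
    also have "\<dots> = (\<Oplus>\<^bsub>M\<^esub>s\<in>?T. f s \<odot>\<^bsub>M\<^esub> \<phi> s) \<oplus>\<^bsub>M\<^esub> (\<Oplus>\<^bsub>M\<^esub>s\<in>?T. g s \<odot>\<^bsub>M\<^esub> \<phi> s)"
      by (rule M.finsum_addf) (use T c[OF f] c[OF g] in blast)+
    also have "\<dots> = free_ext R M \<phi> f \<oplus>\<^bsub>M\<^esub> free_ext R M \<phi> g"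
      using free_ext_superset[OF M f \<phi> T(1) _ T(2)] free_ext_superset[OF M g \<phi> T(1) _ T(2)] by simp
    finally show "free_ext R M \<phi> (f \<oplus>\<^bsub>free_module R S\<^esub> g) = free_ext R M \<phi> f \<oplus>\<^bsub>M\<^esub> free_ext R M \<phi> g" .
  next
    fix a f assume a: "a \<in> carrier R" and f: "f \<in> carrier (free_module R S)"
    let ?T = "{s. f s \<noteq> \<zero>\<^bsub>R\<^esub>}"
    have fc: "f s \<in> carrier R" for s using f by (auto simp: free_module_carrier)
    have af: "a \<odot>\<^bsub>free_module R S\<^esub> f \<in> carrier (free_module R S)" using a f by (rule F.smult_closed)
    have "free_ext R M \<phi> (a \<odot>\<^bsub>free_module R S\<^esub> f) = (\<Oplus>\<^bsub>M\<^esub>s\<in>?T. (a \<otimes>\<^bsub>R\<^esub> f s) \<odot>\<^bsub>M\<^esub> \<phi> s)"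
      by (subst free_ext_superset[OF M af \<phi> sup(1)[OF f] _ sup(2)[OF f]]) (use a in auto)
    also have "\<dots> = (\<Oplus>\<^bsub>M\<^esub>s\<in>?T. a \<odot>\<^bsub>M\<^esub> (f s \<odot>\<^bsub>M\<^esub> \<phi> s))"
      by (rule M.finsum_cong')
        (use a fc \<phi> sup(2)[OF f] c[OF f] in \<open>auto simp: smult_assoc1 Pi_iff subset_iff\<close>)
    also have "\<dots> = a \<odot>\<^bsub>M\<^esub> free_ext R M \<phi> f"
      unfolding free_ext_def
      by (rule finsum_smult_ldistr[symmetric]) (use a sup[OF f] c[OF f] in auto)
    finally show "free_ext R M \<phi> (a \<odot>\<^bsub>free_module R S\<^esub> f) = a \<odot>\<^bsub>M\<^esub> free_ext R M \<phi> f" .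
  qed
qed

lemma free_ext_basis_vec:
  assumes M: "module R M" and \<phi>: "\<phi> \<in> S \<rightarrow> carrier M" and s: "s \<in> S"
  shows "free_ext R M \<phi> (basis_vec R s) = \<phi> s"
proof -
  interpret module R M by fact
  have "free_ext R M \<phi> (basis_vec R s) = (\<Oplus>\<^bsub>M\<^esub>t\<in>{s}. basis_vec R s t \<odot>\<^bsub>M\<^esub> \<phi> t)"
    by (rule free_ext_superset[OF M basis_vec_carrier[OF R.is_cring s] \<phi>])
      (use s in \<open>auto simp: basis_vec_def\<close>)
  then show ?thesis using \<phi> s by (simp add: basis_vec_def Pi_iff)
qed

lemma word_sum_Cons:
  "word_sum R ((a, s) # xs) = (a \<odot>\<^bsub>free_module R S\<^esub> basis_vec R s) \<oplus>\<^bsub>free_module R S\<^esub> word_sum R xs"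
  by (simp add: word_sum_def)

lemma word_sum_carrier:
  assumes "cring R" "set xs \<subseteq> carrier R \<times> S"
  shows "word_sum R xs \<in> carrier (free_module R S)"
proof -
  interpret F: module R "free_module R S" by (rule free_module_module) fact
  show ?thesis using assms(2)
  proof (induction xs)
    case Nil
    then show ?case using F.M.zero_closed by (simp add: word_sum_def)
  next
    case (Cons p xs)
    obtain a s where p: "p = (a, s)" by force
    have "a \<odot>\<^bsub>free_module R S\<^esub> basis_vec R s \<in> carrier (free_module R S)"
      using Cons.prems p by (intro F.smult_closed basis_vec_carrier assms) auto
    then show ?case unfolding p word_sum_Cons[where S = S] using Cons by (intro F.M.a_closed) auto
  qed
qed

lemma word_sum_surj:
  assumes "cring R" "f \<in> carrier (free_module R S)"
  obtains xs where "set xs \<subseteq> carrier R \<times> S" "word_sum R xs = f"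
proof -
  interpret cring R by fact
  have "\<exists>xs. set xs \<subseteq> carrier R \<times> S \<and> word_sum R xs = f"
    if "finite T" "{s. f s \<noteq> \<zero>\<^bsub>R\<^esub>} \<subseteq> T" "f \<in> carrier (free_module R S)" for T f
    using that
  proof (induction T arbitrary: f rule: finite_induct)
    case empty
    then have "f = (\<lambda>s. \<zero>\<^bsub>R\<^esub>)" by auto
    then show ?case by (intro exI[of _ "[]"]) (simp add: word_sum_def)
  next
    case (insert t T)
    show ?case
    proof (cases "f t = \<zero>\<^bsub>R\<^esub>")
      case True
      then show ?thesis using insert by blast
    next
      case False
      define g where "g = f(t := \<zero>\<^bsub>R\<^esub>)"
      have "finite {s. f s \<noteq> \<zero>\<^bsub>R\<^esub>}" using insert.prems by (auto simp: free_module_carrier)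
      then have "finite {s. g s \<noteq> \<zero>\<^bsub>R\<^esub>}" by (rule rev_finite_subset) (auto simp: g_def)
      then have "g \<in> carrier (free_module R S)" using insert.prems by (auto simp: free_module_carrier g_def)
      moreover have "{s. g s \<noteq> \<zero>\<^bsub>R\<^esub>} \<subseteq> T" using insert.prems by (auto simp: g_def)
      ultimately obtain xs where xs: "set xs \<subseteq> carrier R \<times> S" "word_sum R xs = g" using insert.IH by blast
      have fc: "f s \<in> carrier R" for s using insert.prems by (auto simp: free_module_carrier)
      have "t \<in> S" using False insert.prems by (auto simp: free_module_carrier)
      moreover have "word_sum R ((f t, t) # xs) = f"
        unfolding word_sum_Cons[where S = UNIV] xs(2) using fc
        by (auto simp: g_def basis_vec_def fun_eq_iff)
      ultimately show ?thesis using xs fc by (intro exI[of _ "(f t, t) # xs"]) auto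
    qed
  qed
  then show thesis using assms that by (auto simp: free_module_carrier) 
qed

context
  fixes R :: "('a, 'r) ring_scheme" and M :: "('a, 'b, 'm) module_scheme"
  assumes M: "module R M"
begin

lemma res_cring: "cring R" using M by (simp add: module_def)

lemma res_basis_Suc:
  "res_basis R M (Suc n) = {Rel xs | xs. set xs \<subseteq> carrier R \<times> res_basis R M n \<and>
     (case n of 0 \<Rightarrow> res_augmentation R M (word_sum R xs) = \<zero>\<^bsub>M\<^esub>
       | Suc k \<Rightarrow> res_boundary R (word_sum R xs) = \<zero>\<^bsub>free_resolution R M k\<^esub>)}"
  by (cases n) (simp_all add: free_resolution_def)

lemma free_ext_UNIV: "free_ext R (free_module R UNIV) \<phi> f = free_ext R (free_module R S) \<phi> f"
  if "f \<in> carrier (free_module R T)" "\<phi> \<in> T \<rightarrow> carrier (free_module R S)"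
proof -
  let ?A = "{s. f s \<noteq> \<zero>\<^bsub>R\<^esub>}"
  interpret U: module R "free_module R UNIV" by (rule free_module_module[OF res_cring])
  interpret V: module R "free_module R S" by (rule free_module_module[OF res_cring])
  have sub: "carrier (free_module R S) \<subseteq> carrier (free_module R UNIV)"
    by (auto simp: free_module_carrier)
  have *: "(\<Oplus>\<^bsub>free_module R UNIV\<^esub>s\<in>A. f s \<odot>\<^bsub>free_module R UNIV\<^esub> \<phi> s)
      = (\<Oplus>\<^bsub>free_module R S\<^esub>s\<in>A. f s \<odot>\<^bsub>free_module R S\<^esub> \<phi> s)"
    if "finite A" "A \<subseteq> ?A" for A
    using that
  proof (induction A rule: finite_induct)
    case empty
    then show ?case by simp
  next
    case (insert t A)
    have c: "f s \<odot>\<^bsub>free_module R S\<^esub> \<phi> s \<in> carrier (free_module R S)" if "s \<in> insert t A" for s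
    proof -
      have "s \<in> T" using that insert.prems \<open>f \<in> _\<close> by (auto simp: free_module_carrier)
      then show ?thesis using \<open>f \<in> _\<close> \<open>\<phi> \<in> _\<close> by (intro V.smult_closed) (auto simp: free_module_carrier[of f])
    qed
    then have c': "f s \<odot>\<^bsub>free_module R UNIV\<^esub> \<phi> s \<in> carrier (free_module R UNIV)" if "s \<in> insert t A" for s
      using sub that by auto
    show ?case
      using insert c c' by (subst U.M.finsum_insert, blast, blast, blast, blast,
          subst V.M.finsum_insert, blast, blast, blast, blast) simp
  qed
  have "finite ?A" using that by (auto simp: free_module_carrier)
  then show ?thesis unfolding free_ext_def using * by blast
qed

lemma res_word:
  assumes "Rel xs \<in> res_basis R M (Suc n)"
  shows "word_sum R xs \<in> carrier (free_resolution R M n)"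
  using assms unfolding res_basis_Suc free_resolution_def by (intro word_sum_carrier res_cring) auto

lemma res_rel: "(\<lambda>s. word_sum R (rel_of s)) \<in> res_basis R M (Suc n) \<rightarrow> carrier (free_resolution R M n)"
proof
  fix s assume "s \<in> res_basis R M (Suc n)"
  moreover from this obtain xs where "s = Rel xs" by (auto simp: res_basis_Suc)
  ultimately show "word_sum R (rel_of s) \<in> carrier (free_resolution R M n)" using res_word by simp
qed

lemma res_augmentation_hom: "res_augmentation R M \<in> module_hom R (free_resolution R M 0) M"
  unfolding res_augmentation_def free_resolution_def by (rule free_ext_hom[OF M]) auto

lemma res_boundary_hom:
  "res_boundary R \<in> module_hom R (free_resolution R M (Suc n)) (free_resolution R M n)"
proof -
  let ?h = "free_ext R (free_resolution R M n) (\<lambda>s. word_sum R (rel_of s))"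
  have h: "?h \<in> module_hom R (free_resolution R M (Suc n)) (free_resolution R M n)"
    using free_ext_hom[OF free_module_module[OF res_cring] res_rel[unfolded free_resolution_def]]
    by (simp add: free_resolution_def)
  have eq: "res_boundary R f = ?h f" if "f \<in> carrier (free_resolution R M (Suc n))" for f
    using free_ext_UNIV[OF that[unfolded free_resolution_def] res_rel[unfolded free_resolution_def]]
    by (simp add: res_boundary_def free_resolution_def)
  interpret F: module R "free_resolution R M (Suc n)"
    unfolding free_resolution_def by (rule free_module_module[OF res_cring])
  show ?thesis
    using h eq F.M.a_closed F.smult_closed unfolding module_hom_def by (simp add: Pi_iff)
qed

lemma res_boundary_basis:
  assumes "Rel xs \<in> res_basis R M (Suc n)"
  shows "res_boundary R (basis_vec R (Rel xs)) = word_sum R xs"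
proof -
  have "(\<lambda>s. word_sum R (rel_of s)) \<in> res_basis R M (Suc n) \<rightarrow> carrier (free_module R UNIV)"
    using res_rel[of n] by (simp add: free_resolution_def free_module_carrier Pi_iff)
  then show ?thesis
    using free_ext_basis_vec[OF free_module_module[OF res_cring] _ assms, of "\<lambda>s. word_sum R (rel_of s)" UNIV]
    by (simp add: res_boundary_def)
qed

lemma hom_zero_word:
  assumes N: "module R N" and h: "h \<in> module_hom R (free_module R S) N"
    and z: "\<And>s. s \<in> S \<Longrightarrow> h (basis_vec R s) = \<zero>\<^bsub>N\<^esub>" and f: "f \<in> carrier (free_module R S)"
  shows "h f = \<zero>\<^bsub>N\<^esub>"
proof -
  interpret N: module R N by fact
  interpret F: module R "free_module R S" by (rule free_module_module[OF res_cring])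
  have hsm: "h (a \<odot>\<^bsub>free_module R S\<^esub> x) = a \<odot>\<^bsub>N\<^esub> h x" if "a \<in> carrier R" "x \<in> carrier (free_module R S)" for a x
    using h that unfolding module_hom_def by blast
  have hadd: "h (x \<oplus>\<^bsub>free_module R S\<^esub> y) = h x \<oplus>\<^bsub>N\<^esub> h y"
    if "x \<in> carrier (free_module R S)" "y \<in> carrier (free_module R S)" for x y
    using h that unfolding module_hom_def by blast
  have hc: "h x \<in> carrier N" if "x \<in> carrier (free_module R S)" for x
    using h that unfolding module_hom_def by blast
  obtain xs where "set xs \<subseteq> carrier R \<times> S" "word_sum R xs = f"
    using word_sum_surj[OF res_cring f] .
  moreover have "h (word_sum R xs) = \<zero>\<^bsub>N\<^esub>" if "set xs \<subseteq> carrier R \<times> S" for xs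
    using that
  proof (induction xs)
    case Nil
    have "h (\<zero>\<^bsub>R\<^esub> \<odot>\<^bsub>free_module R S\<^esub> \<zero>\<^bsub>free_module R S\<^esub>) = \<zero>\<^bsub>N\<^esub>"
      by (subst hsm[OF _ F.M.zero_closed]) (simp_all add: hc[OF F.M.zero_closed] del: free_module_simps)
    then show ?case by (simp add: word_sum_def)
  next
    case (Cons p xs)
    obtain a s where p: "p = (a, s)" by force
    have as: "a \<in> carrier R" "s \<in> S" "set xs \<subseteq> carrier R \<times> S" using Cons.prems p by auto
    note b = basis_vec_carrier[OF res_cring as(2)]
    have "h (word_sum R (p # xs)) = a \<odot>\<^bsub>N\<^esub> h (basis_vec R s) \<oplus>\<^bsub>N\<^esub> h (word_sum R xs)"
      unfolding p word_sum_Cons[where S = S]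
      using hadd[OF F.smult_closed[OF as(1) b] word_sum_carrier[OF res_cring as(3)]] hsm[OF as(1) b] by simp
    then show ?case using as z Cons.IH by simp
  qed
  ultimately show ?thesis by blast
qed

theorem free_resolution_exact:
  "res_augmentation R M ` carrier (free_resolution R M 0) = carrier M"
  "res_boundary R ` carrier (free_resolution R M (Suc 0)) =
     {f \<in> carrier (free_resolution R M 0). res_augmentation R M f = \<zero>\<^bsub>M\<^esub>}"
  "res_boundary R ` carrier (free_resolution R M (Suc (Suc n))) =
     {f \<in> carrier (free_resolution R M (Suc n)). res_boundary R f = \<zero>\<^bsub>free_resolution R M n\<^esub>}"
proof -
  let ?F = "free_resolution R M"
  have F: "module R (?F n)" for n
    unfolding free_resolution_def by (rule free_module_module[OF res_cring])
  show "res_augmentation R M ` carrier (?F 0) = carrier M"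
  proof
    show "res_augmentation R M ` carrier (?F 0) \<subseteq> carrier M"
      using res_augmentation_hom by (auto simp: module_hom_def)
    show "carrier M \<subseteq> res_augmentation R M ` carrier (?F 0)"
    proof
      fix x assume "x \<in> carrier M"
      then have s: "Gen x \<in> res_basis R M 0" by simp
      have "x = res_augmentation R M (basis_vec R (Gen x))"
        unfolding res_augmentation_def by (subst free_ext_basis_vec[OF M _ s]) auto
      then show "x \<in> res_augmentation R M ` carrier (?F 0)"
        unfolding free_resolution_def using basis_vec_carrier[OF res_cring s] by blast
    qed
  qed
  have ex: "res_boundary R ` carrier (?F (Suc n)) = {f \<in> carrier (?F n). h f = \<zero>\<^bsub>N\<^esub>}"
    if N: "module R N" and h: "h \<in> module_hom R (?F n) N"
      and b: "\<And>xs. Rel xs \<in> res_basis R M (Suc n) \<longleftrightarrow>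
        set xs \<subseteq> carrier R \<times> res_basis R M n \<and> h (word_sum R xs) = \<zero>\<^bsub>N\<^esub>"
    for n h and N :: "('a, 'x, 'y) module_scheme"
  proof
    show "{f \<in> carrier (?F n). h f = \<zero>\<^bsub>N\<^esub>} \<subseteq> res_boundary R ` carrier (?F (Suc n))"
    proof
      fix f assume "f \<in> {f \<in> carrier (?F n). h f = \<zero>\<^bsub>N\<^esub>}"
      then have f: "f \<in> carrier (?F n)" "h f = \<zero>\<^bsub>N\<^esub>" by auto
      obtain xs where xs: "set xs \<subseteq> carrier R \<times> res_basis R M n" "word_sum R xs = f"
        using word_sum_surj[OF res_cring f(1)[unfolded free_resolution_def]] .
      then have s: "Rel xs \<in> res_basis R M (Suc n)" using b f by simp
      then show "f \<in> res_boundary R ` carrier (?F (Suc n))"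
        unfolding free_resolution_def
        using res_boundary_basis[OF s] xs basis_vec_carrier[OF res_cring s] by force
    qed
    have bc: "res_boundary R f \<in> carrier (?F n)" if "f \<in> carrier (?F (Suc n))" for f
      using res_boundary_hom[of n] that by (auto simp: module_hom_def)
    have "(\<lambda>f. h (res_boundary R f)) \<in> module_hom R (?F (Suc n)) N"
      using res_boundary_hom[of n] h unfolding module_hom_def by (simp add: Pi_iff)
    moreover have "h (res_boundary R (basis_vec R s)) = \<zero>\<^bsub>N\<^esub>" if s: "s \<in> res_basis R M (Suc n)" for s
    proof -
      obtain xs where xs: "s = Rel xs" using s by (auto simp: res_basis_Suc)
      then show ?thesis using res_boundary_basis[of xs n] s b by simp
    qed
    ultimately have "h (res_boundary R f) = \<zero>\<^bsub>N\<^esub>" if "f \<in> carrier (?F (Suc n))" for f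
      using hom_zero_word[OF N, of "\<lambda>f. h (res_boundary R f)" "res_basis R M (Suc n)" f] that
      by (simp add: free_resolution_def)
    then show "res_boundary R ` carrier (?F (Suc n)) \<subseteq> {f \<in> carrier (?F n). h f = \<zero>\<^bsub>N\<^esub>}"
      using bc by auto
  qed
  show "res_boundary R ` carrier (?F (Suc 0)) = {f \<in> carrier (?F 0). res_augmentation R M f = \<zero>\<^bsub>M\<^esub>}"
    by (rule ex[OF M res_augmentation_hom]) auto
  show "res_boundary R ` carrier (?F (Suc (Suc n))) =
     {f \<in> carrier (?F (Suc n)). res_boundary R f = \<zero>\<^bsub>?F n\<^esub>}"
    by (rule ex[OF F res_boundary_hom]) (auto simp: free_resolution_def)
qed

end

end

theory Submission
  imports Defs
begin

text \<open>For submodules \<open>K\<close>, \<open>L\<close> of free modules \<open>F\<close>, \<open>G\<close>, the group \<open>Tor\<^sub>1(F/K, G/L)\<close> vanishes iff every matrix with columns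
  in \<open>K\<close> and rows in \<open>L\<close> is a sum of products \<open>x y\<^sup>T\<close> with \<open>x \<in> K\<close>, \<open>y \<in> L\<close>.  Applied to the syzygies of a
  minimal free resolution of \<open>\<omega>\<close>, this turns the vanishing of a single Tor group into linear algebra over the
  residue field.  If \<open>\<omega>\<close> needs at least two generators, a symmetric matrix with rows and columns in the first syzygy,
  but with an entry outside \<open>m\<^sup>2\<close>, shows \<open>Tor\<^sub>1 \<noteq> 0\<close>; and \<open>Tor\<^sub>i = 0\<close> for some \<open>i \<ge> 3\<close> forces bounds on the Betti
  numbers that contradict their growth.  Hence \<open>\<omega>\<close> is cyclic, and being faithful it is isomorphic to \<open>R\<close>.
  Conversely, if \<open>R\<close> is Gorenstein then Baer's condition descends along the injective resolution to \<open>R\<close>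
  itself, so \<open>\<omega>\<close> is free and all Tor groups vanish.\<close>

section \<open>Homomorphisms, submodules and free modules\<close>

text \<open>The canonical resolution behind \<open>Tor\<close> has huge bases, so nothing can be
  counted there. The matrix condition involves only submodules of free modules and survives both
  dimension shifting and a change of free cover; it can therefore be carried over to a minimal
  resolution with finite bases. There it takes a different form for each splitting i = a + b + 1 of
  the degree. The counting uses (a, b) = (i - 1, 0), (1, i - 2) and (2, i - 3), which is where i
  \<ge> 3 comes from; for i = 1 only (0, 0) exists, and its symmetry is exploited instead.
  Dimensions over R/m appear as cardinalities of index sets of families that are independent modulo
  m; two families are compared by writing one through the other and reducing the resulting matrix
  modulo m. Duality enters through two facts only: the elements of \<omega> killed by m are the
  multiples of one element \<open>soc\<close>, and every linear map from an ideal to \<omega> is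
  multiplication by an element. The first turns socle-valued maps into functionals, the second
  produces elements with prescribed products.\<close>

lemma module_hom_closed: "f \<in> module_hom R M N \<Longrightarrow> x \<in> carrier M \<Longrightarrow> f x \<in> carrier N"
  and module_hom_add: "f \<in> module_hom R M N \<Longrightarrow> x \<in> carrier M \<Longrightarrow> y \<in> carrier M \<Longrightarrow>
    f (x \<oplus>\<^bsub>M\<^esub> y) = f x \<oplus>\<^bsub>N\<^esub> f y"
  and module_hom_smult: "f \<in> module_hom R M N \<Longrightarrow> a \<in> carrier R \<Longrightarrow> x \<in> carrier M \<Longrightarrow>
    f (a \<odot>\<^bsub>M\<^esub> x) = a \<odot>\<^bsub>N\<^esub> f x"
  by (auto simp: module_hom_def)

lemma module_homI:
  assumes "\<And>x. x \<in> carrier M \<Longrightarrow> f x \<in> carrier N"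
    "\<And>x y. x \<in> carrier M \<Longrightarrow> y \<in> carrier M \<Longrightarrow> f (x \<oplus>\<^bsub>M\<^esub> y) = f x \<oplus>\<^bsub>N\<^esub> f y"
    "\<And>a x. a \<in> carrier R \<Longrightarrow> x \<in> carrier M \<Longrightarrow> f (a \<odot>\<^bsub>M\<^esub> x) = a \<odot>\<^bsub>N\<^esub> f x"
  shows "f \<in> module_hom R M N"
  using assms by (auto simp: module_hom_def)

lemma module_hom_comp:
  "f \<in> module_hom R M N \<Longrightarrow> g \<in> module_hom R N P \<Longrightarrow> (\<lambda>x. g (f x)) \<in> module_hom R M P"
  by (intro module_homI) (auto simp: module_hom_closed module_hom_add module_hom_smult)

lemma module_hom_zero:
  assumes "module R M" "module R N" "f \<in> module_hom R M N"
  shows "f \<zero>\<^bsub>M\<^esub> = \<zero>\<^bsub>N\<^esub>"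
proof -
  interpret M: module R M by fact
  interpret N: module R N by fact
  show ?thesis
    using module_hom_smult[OF assms(3), of "\<zero>\<^bsub>R\<^esub>" "\<zero>\<^bsub>M\<^esub>"] module_hom_closed[OF assms(3)] by simp
qed

lemma module_hom_minus:
  assumes "module R M" "module R N" "f \<in> module_hom R M N" "x \<in> carrier M" "y \<in> carrier M"
  shows "f (x \<ominus>\<^bsub>M\<^esub> y) = f x \<ominus>\<^bsub>N\<^esub> f y"
proof -
  interpret M: module R M by fact
  interpret N: module R N by fact
  have "f (\<ominus>\<^bsub>M\<^esub> y) = \<ominus>\<^bsub>N\<^esub> f y"
    using module_hom_smult[OF assms(3), of "\<ominus>\<^bsub>R\<^esub> \<one>\<^bsub>R\<^esub>" y] assms
    by (simp add: M.smult_l_minus N.smult_l_minus module_hom_closed[OF assms(3)])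
  then show ?thesis using assms by (simp add: a_minus_def module_hom_add[OF assms(3)])
qed

text \<open>Negatives need no clause of their own, being multiples by
  \<open>\<ominus> \<one>\<close>. Working with plain sets lets images, kernels and preimages be
  treated without forming new module records.\<close>

definition is_submodule :: "('a, 'r) ring_scheme \<Rightarrow> ('a, 'b, 'm) module_scheme \<Rightarrow> 'b set \<Rightarrow> bool" where
  "is_submodule R M H \<longleftrightarrow> H \<subseteq> carrier M \<and> \<zero>\<^bsub>M\<^esub> \<in> H \<and> (\<forall>x\<in>H. \<forall>y\<in>H. x \<oplus>\<^bsub>M\<^esub> y \<in> H) \<and>
     (\<forall>a\<in>carrier R. \<forall>x\<in>H. a \<odot>\<^bsub>M\<^esub> x \<in> H)"

lemma is_submoduleI:
  assumes "\<And>x. x \<in> H \<Longrightarrow> x \<in> carrier M" "\<zero>\<^bsub>M\<^esub> \<in> H"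
    "\<And>x y. x \<in> H \<Longrightarrow> y \<in> H \<Longrightarrow> x \<oplus>\<^bsub>M\<^esub> y \<in> H"
    "\<And>a x. a \<in> carrier R \<Longrightarrow> x \<in> H \<Longrightarrow> a \<odot>\<^bsub>M\<^esub> x \<in> H"
  shows "is_submodule R M H"
  using assms by (auto simp: is_submodule_def)

lemma is_submoduleD:
  assumes "is_submodule R M H"
  shows "H \<subseteq> carrier M" "x \<in> H \<Longrightarrow> x \<in> carrier M" "\<zero>\<^bsub>M\<^esub> \<in> H"
    "x \<in> H \<Longrightarrow> y \<in> H \<Longrightarrow> x \<oplus>\<^bsub>M\<^esub> y \<in> H" "a \<in> carrier R \<Longrightarrow> x \<in> H \<Longrightarrow> a \<odot>\<^bsub>M\<^esub> x \<in> H"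
  using assms by (auto simp: is_submodule_def)

lemma (in module) is_submodule_neg: "is_submodule R M H \<Longrightarrow> x \<in> H \<Longrightarrow> \<ominus>\<^bsub>M\<^esub> x \<in> H"
  using is_submoduleD(5)[of R M H "\<ominus> \<one>" x] is_submoduleD(2)[of R M H x] by (simp add: smult_l_minus)

lemma (in module) is_submodule_minus:
  "is_submodule R M H \<Longrightarrow> x \<in> H \<Longrightarrow> y \<in> H \<Longrightarrow> x \<ominus>\<^bsub>M\<^esub> y \<in> H"
  by (simp add: a_minus_def is_submoduleD(4) is_submodule_neg)

lemma (in module) submodule_iff: "submodule H R M \<longleftrightarrow> is_submodule R M H"
proof
  assume "submodule H R M"
  note E = submoduleE[OF this]
  obtain x where "x \<in> H" using E(2) by blast
  then have "\<zero>\<^bsub>M\<^esub> \<in> H" using E(4)[of \<zero> x] E(1) by auto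
  then show "is_submodule R M H" using E by (auto simp: is_submodule_def)
next
  assume H: "is_submodule R M H"
  show "submodule H R M"
    using is_submoduleD[OF H] is_submodule_neg[OF H] by (intro submoduleI) blast+
qed

lemma (in module) is_submodule_carrier: "is_submodule R M (carrier M)"
  by (auto simp: is_submodule_def)

lemma (in module) is_submodule_zero: "is_submodule R M {\<zero>\<^bsub>M\<^esub>}"
  by (auto simp: is_submodule_def)

lemma is_submodule_image:
  assumes "module R M" "module R N" "f \<in> module_hom R M N" "is_submodule R M H"
  shows "is_submodule R N (f ` H)"
proof (rule is_submoduleI)
  note H = is_submoduleD[OF assms(4)]
  show "x \<in> f ` H \<Longrightarrow> x \<in> carrier N" for x using module_hom_closed[OF assms(3)] H(2) by blast
  show "\<zero>\<^bsub>N\<^esub> \<in> f ` H" using module_hom_zero[OF assms(1-3)] H(3) by (auto intro: rev_image_eqI)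
  show "x \<oplus>\<^bsub>N\<^esub> y \<in> f ` H" if xy: "x \<in> f ` H" "y \<in> f ` H" for x y
  proof -
    obtain x' y' where "x' \<in> H" "y' \<in> H" "x = f x'" "y = f y'" using xy by blast
    then show ?thesis using module_hom_add[OF assms(3), of x' y'] H(2,4) by (metis imageI)
  qed
  show "a \<odot>\<^bsub>N\<^esub> x \<in> f ` H" if ax: "a \<in> carrier R" "x \<in> f ` H" for a x
  proof -
    obtain x' where "x' \<in> H" "x = f x'" using ax by blast
    then show ?thesis using module_hom_smult[OF assms(3), of a x'] H(2,5) ax by (metis imageI)
  qed
qed

lemma is_submodule_vimage:
  assumes "module R M" "module R N" "f \<in> module_hom R M N" "is_submodule R N H"
  shows "is_submodule R M {x \<in> carrier M. f x \<in> H}"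
proof -
  interpret M: module R M by fact
  show ?thesis
    using is_submoduleD[OF assms(4)] module_hom_add[OF assms(3)] module_hom_smult[OF assms(3)]
      module_hom_zero[OF assms(1-3)]
    by (intro is_submoduleI) auto
qed

lemma is_submodule_kernel:
  assumes "module R M" "module R N" "f \<in> module_hom R M N"
  shows "is_submodule R M {x \<in> carrier M. f x = \<zero>\<^bsub>N\<^esub>}"
proof -
  interpret N: module R N by fact
  show ?thesis using is_submodule_vimage[OF assms N.is_submodule_zero] by simp
qed

lemma is_submodule_Int:
  "is_submodule R M H \<Longrightarrow> is_submodule R M H' \<Longrightarrow> is_submodule R M (H \<inter> H')"
  by (auto simp: is_submodule_def)

lemma ring_module_simps [simp]:
  "carrier (ring_module R) = carrier R" "\<zero>\<^bsub>ring_module R\<^esub> = \<zero>\<^bsub>R\<^esub>"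
  "x \<oplus>\<^bsub>ring_module R\<^esub> y = x \<oplus>\<^bsub>R\<^esub> y" "a \<odot>\<^bsub>ring_module R\<^esub> x = a \<otimes>\<^bsub>R\<^esub> x"
  by (simp_all add: ring_module_def)

context cring
begin

abbreviation vec :: "'s set \<Rightarrow> ('s \<Rightarrow> 'a) set" where
  "vec S \<equiv> carrier (free_module R S)"

lemma module_free: "module R (free_module R S)"
  by (rule free_module_module) (rule is_cring)

lemma module_ring: "module R (ring_module R)"
  by (rule ring_module_module) (rule is_cring)

lemma vecD: "f \<in> vec S \<Longrightarrow> f s \<in> carrier R" "f \<in> vec S \<Longrightarrow> s \<notin> S \<Longrightarrow> f s = \<zero>"
  "f \<in> vec S \<Longrightarrow> finite {s. f s \<noteq> \<zero>}"
  by (auto simp: free_module_carrier)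

lemma vec_zero [simp, intro]: "(\<lambda>s. \<zero>) \<in> vec S"
  by (auto simp: free_module_carrier)

lemma vec_add [simp, intro]: "f \<in> vec S \<Longrightarrow> g \<in> vec S \<Longrightarrow> (\<lambda>s. f s \<oplus> g s) \<in> vec S"
proof -
  interpret F: module R "free_module R S" by (rule module_free)
  show "f \<in> vec S \<Longrightarrow> g \<in> vec S \<Longrightarrow> ?thesis" using F.M.a_closed by simp
qed

lemma vec_smult [simp, intro]: "a \<in> carrier R \<Longrightarrow> g \<in> vec S \<Longrightarrow> (\<lambda>s. a \<otimes> g s) \<in> vec S"
proof -
  interpret F: module R "free_module R S" by (rule module_free)
  show "a \<in> carrier R \<Longrightarrow> g \<in> vec S \<Longrightarrow> ?thesis" using F.smult_closed by simp
qed

lemma vec_basis [simp, intro]: "s \<in> S \<Longrightarrow> basis_vec R s \<in> vec S"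
  by (rule basis_vec_carrier) (rule is_cring)

lemma free_neg: 
  assumes "f \<in> vec S" shows "\<ominus>\<^bsub>free_module R S\<^esub> f = (\<lambda>s. \<ominus> f s)"
proof -
  interpret F: module R "free_module R S" by (rule module_free)
  have "\<ominus>\<^bsub>free_module R S\<^esub> f = (\<ominus> \<one>) \<odot>\<^bsub>free_module R S\<^esub> f"
    using assms by (simp only: F.smult_l_minus one_closed F.smult_one)
  then show ?thesis using vecD[OF assms] by (simp add: l_minus)
qed

lemma free_minus:
  assumes "f \<in> vec S" "g \<in> vec S" shows "f \<ominus>\<^bsub>free_module R S\<^esub> g = (\<lambda>s. f s \<ominus> g s)"
  using assms by (simp add: a_minus_def free_neg)

lemma vec_neg [simp, intro]: "f \<in> vec S \<Longrightarrow> (\<lambda>s. \<ominus> f s) \<in> vec S"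
proof -
  interpret F: module R "free_module R S" by (rule module_free)
  show "f \<in> vec S \<Longrightarrow> ?thesis" using F.M.a_inv_closed[of f] free_neg[of f S] by simp
qed

lemma vec_minus [simp, intro]: "f \<in> vec S \<Longrightarrow> g \<in> vec S \<Longrightarrow> (\<lambda>s. f s \<ominus> g s) \<in> vec S"
proof -
  interpret F: module R "free_module R S" by (rule module_free)
  show "f \<in> vec S \<Longrightarrow> g \<in> vec S \<Longrightarrow> ?thesis" using F.M.minus_closed[of f g] free_minus[of f S g] by simp
qed

lemma vec_mono: "S \<subseteq> S' \<Longrightarrow> vec S \<subseteq> vec S'"
  by (auto simp: free_module_carrier) (meson subsetD)

lemma vec_finiteI: "finite S \<Longrightarrow> (\<And>s. f s \<in> carrier R) \<Longrightarrow> (\<And>s. s \<notin> S \<Longrightarrow> f s = \<zero>) \<Longrightarrow> f \<in> vec S"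
  unfolding free_module_carrier by (auto intro: rev_finite_subset[of S])

lemma vec_induct [consumes 1, case_names zero add]:
  assumes f: "f \<in> vec S" and "P (\<lambda>s. \<zero>)"
    and step: "\<And>g a s. g \<in> vec S \<Longrightarrow> P g \<Longrightarrow> a \<in> carrier R \<Longrightarrow> s \<in> S \<Longrightarrow>
      P (\<lambda>t. a \<otimes> basis_vec R s t \<oplus> g t)"
  shows "P f"
proof -
  obtain xs where xs: "set xs \<subseteq> carrier R \<times> S" "word_sum R xs = f"
    using word_sum_surj[OF is_cring f] .
  have "P (word_sum R xs)" if "set xs \<subseteq> carrier R \<times> S" for xs
    using that
  proof (induction xs)
    case Nil
    then show ?case using assms by (simp add: word_sum_def)
  next
    case (Cons p xs)
    obtain a s where p: "p = (a, s)" by force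
    have "P (\<lambda>t. a \<otimes> basis_vec R s t \<oplus> word_sum R xs t)"
      using Cons p word_sum_carrier[OF is_cring, of xs S] by (intro step) auto
    then show ?case using p by (simp add: word_sum_Cons[where S = S])
  qed
  then show ?thesis using xs by blast
qed

lemma hom_vec_into:
  assumes "module R N" "h \<in> module_hom R (free_module R S) N" "is_submodule R N X"
    "\<And>s. s \<in> S \<Longrightarrow> h (basis_vec R s) \<in> X" "f \<in> vec S"
  shows "h f \<in> X"
  using assms(5)
proof (induction rule: vec_induct)
  case zero
  have "h \<zero>\<^bsub>free_module R S\<^esub> = \<zero>\<^bsub>N\<^esub>"
    by (rule module_hom_zero[OF module_free assms(1,2)])
  then show ?case using is_submoduleD(3)[OF assms(3)] by simp
next
  case (add g a s)
  have "h (a \<odot>\<^bsub>free_module R S\<^esub> basis_vec R s \<oplus>\<^bsub>free_module R S\<^esub> g) = a \<odot>\<^bsub>N\<^esub> h (basis_vec R s) \<oplus>\<^bsub>N\<^esub> h g"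
    using add module_hom_add[OF assms(2), of "a \<odot>\<^bsub>free_module R S\<^esub> basis_vec R s" g]
      module_hom_smult[OF assms(2), of a "basis_vec R s"] by simp
  then show ?case using add assms(4) is_submoduleD[OF assms(3)] by simp
qed

lemma hom_vec_eq:
  assumes N: "module R N" "h \<in> module_hom R (free_module R S) N" "h' \<in> module_hom R (free_module R S) N"
    "\<And>s. s \<in> S \<Longrightarrow> h (basis_vec R s) = h' (basis_vec R s)" "f \<in> vec S"
  shows "h f = h' f"
  using assms(5)
proof (induction rule: vec_induct)
  case zero
  show ?case
    using module_hom_zero[OF module_free N(1,2)] module_hom_zero[OF module_free N(1,3)] by simp
next
  case (add g a s)
  have "k (a \<odot>\<^bsub>free_module R S\<^esub> basis_vec R s \<oplus>\<^bsub>free_module R S\<^esub> g) = a \<odot>\<^bsub>N\<^esub> k (basis_vec R s) \<oplus>\<^bsub>N\<^esub> k g"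
    if "k \<in> module_hom R (free_module R S) N" for k
    using add module_hom_add[OF that, of "a \<odot>\<^bsub>free_module R S\<^esub> basis_vec R s" g]
      module_hom_smult[OF that, of a "basis_vec R s"] by simp
  from this[OF N(2)] this[OF N(3)] show ?case using add N(4) by simp
qed

lemma hom_vec:
  assumes "f \<in> module_hom R (free_module R S) M"
  shows "x \<in> vec S \<Longrightarrow> y \<in> vec S \<Longrightarrow> f (\<lambda>s. x s \<oplus> y s) = f x \<oplus>\<^bsub>M\<^esub> f y"
    "a \<in> carrier R \<Longrightarrow> x \<in> vec S \<Longrightarrow> f (\<lambda>s. a \<otimes> x s) = a \<odot>\<^bsub>M\<^esub> f x"
    "module R M \<Longrightarrow> f (\<lambda>s. \<zero>) = \<zero>\<^bsub>M\<^esub>"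
    "module R M \<Longrightarrow> x \<in> vec S \<Longrightarrow> y \<in> vec S \<Longrightarrow> f (\<lambda>s. x s \<ominus> y s) = f x \<ominus>\<^bsub>M\<^esub> f y"
  using module_hom_add[OF assms, of x y] module_hom_smult[OF assms, of a x]
    module_hom_zero[OF module_free _ assms] module_hom_minus[OF module_free _ assms, of x y]
  by (auto simp: free_minus)

lemma subm_vec:
  assumes "is_submodule R (free_module R S) K"
  shows "x \<in> K \<Longrightarrow> x \<in> vec S" "(\<lambda>s. \<zero>) \<in> K" "x \<in> K \<Longrightarrow> y \<in> K \<Longrightarrow> (\<lambda>s. x s \<oplus> y s) \<in> K"
    "a \<in> carrier R \<Longrightarrow> x \<in> K \<Longrightarrow> (\<lambda>s. a \<otimes> x s) \<in> K"
    "x \<in> K \<Longrightarrow> y \<in> K \<Longrightarrow> (\<lambda>s. x s \<ominus> y s) \<in> K"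
proof -
  interpret F: module R "free_module R S" by (rule module_free)
  note * = is_submoduleD[OF assms]
  show "x \<in> K \<Longrightarrow> x \<in> vec S" "(\<lambda>s. \<zero>) \<in> K" "x \<in> K \<Longrightarrow> y \<in> K \<Longrightarrow> (\<lambda>s. x s \<oplus> y s) \<in> K"
    "a \<in> carrier R \<Longrightarrow> x \<in> K \<Longrightarrow> (\<lambda>s. a \<otimes> x s) \<in> K"
    using *(2)[of x] *(3) *(4)[of x y] *(5)[of a x] by auto
  show "x \<in> K \<Longrightarrow> y \<in> K \<Longrightarrow> (\<lambda>s. x s \<ominus> y s) \<in> K"
    using F.is_submodule_minus[OF assms, of x y] *(2) by (simp add: free_minus)
qed

end

section \<open>Matrices and the vanishing of Tor\<close>

text \<open>The image of \<open>K \<otimes> L\<close> in the free module on \<open>S \<times> T\<close>, for submodules \<open>K\<close>, \<open>L\<close> of the free modules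
  on \<open>S\<close> and \<open>T\<close>.\<close>

inductive_set tensor_span ::
  "('a, 'r) ring_scheme \<Rightarrow> ('s \<Rightarrow> 'a) set \<Rightarrow> ('t \<Rightarrow> 'a) set \<Rightarrow> ('s \<times> 't \<Rightarrow> 'a) set"
  for R :: "('a, 'r) ring_scheme" and K L where
  zero: "(\<lambda>p. \<zero>\<^bsub>R\<^esub>) \<in> tensor_span R K L"
| add: "z \<in> tensor_span R K L \<Longrightarrow> x \<in> K \<Longrightarrow> y \<in> L \<Longrightarrow>
    (\<lambda>p. x (fst p) \<otimes>\<^bsub>R\<^esub> y (snd p) \<oplus>\<^bsub>R\<^esub> z p) \<in> tensor_span R K L"

text \<open>The condition \<open>Tor\<^sub>1(F/K, G/L) = 0\<close> for \<open>F\<close>, \<open>G\<close> free on \<open>S\<close>, \<open>T\<close>.\<close>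

definition tor_independent ::
  "('a, 'r) ring_scheme \<Rightarrow> 's set \<Rightarrow> ('s \<Rightarrow> 'a) set \<Rightarrow> 't set \<Rightarrow> ('t \<Rightarrow> 'a) set \<Rightarrow> bool" where
  "tor_independent R S K T L \<longleftrightarrow>
     tensor_span R K (carrier (free_module R T)) \<inter> tensor_span R (carrier (free_module R S)) L
       \<subseteq> tensor_span R K L"

text \<open>With matrices read as elements of F \<otimes> G, this is f \<otimes> id, applied to
  every column; \<open>row_map\<close> is id \<otimes> g.\<close>

definition col_map :: "(('s \<Rightarrow> 'a) \<Rightarrow> 's1 \<Rightarrow> 'a) \<Rightarrow> ('s \<times> 't \<Rightarrow> 'a) \<Rightarrow> 's1 \<times> 't \<Rightarrow> 'a" where
  "col_map f z = (\<lambda>p. f (\<lambda>s. z (s, snd p)) (fst p))"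

definition row_map :: "(('t \<Rightarrow> 'a) \<Rightarrow> 't1 \<Rightarrow> 'a) \<Rightarrow> ('s \<times> 't \<Rightarrow> 'a) \<Rightarrow> 's \<times> 't1 \<Rightarrow> 'a" where
  "row_map g z = (\<lambda>p. g (\<lambda>t. z (fst p, t)) (snd p))"

definition transp :: "('s \<times> 't \<Rightarrow> 'a) \<Rightarrow> 't \<times> 's \<Rightarrow> 'a" where
  "transp z = (\<lambda>p. z (snd p, fst p))"

lemma transp_transp [simp]: "transp (transp z) = z"
  by (simp add: transp_def)

lemma row_map_transp: "row_map g z = transp (col_map g (transp z))"
  by (simp add: row_map_def col_map_def transp_def)

lemma tensor_span_mono: "K \<subseteq> K' \<Longrightarrow> L \<subseteq> L' \<Longrightarrow> z \<in> tensor_span R K L \<Longrightarrow> z \<in> tensor_span R K' L'"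
  by (rotate_tac 2, induction rule: tensor_span.induct) (auto intro: tensor_span.intros)

context cring
begin

lemma sub_vecD: "K \<subseteq> vec S \<Longrightarrow> x \<in> K \<Longrightarrow> x s \<in> carrier R"
  by (auto simp: free_module_carrier)

lemma vec_tensor:
  assumes "x \<in> vec S" "y \<in> vec T" shows "(\<lambda>p. x (fst p) \<otimes> y (snd p)) \<in> vec (S \<times> T)"
proof -
  have "finite ({s. x s \<noteq> \<zero>} \<times> {t. y t \<noteq> \<zero>})" using vecD(3)[OF assms(1)] vecD(3)[OF assms(2)] by simp
  moreover have "{p. x (fst p) \<otimes> y (snd p) \<noteq> \<zero>} \<subseteq> {s. x s \<noteq> \<zero>} \<times> {t. y t \<noteq> \<zero>}"
    using vecD(1)[OF assms(1)] vecD(1)[OF assms(2)] by auto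
  ultimately have "finite {p. x (fst p) \<otimes> y (snd p) \<noteq> \<zero>}" by (rule finite_subset[rotated])
  then show ?thesis
    using vecD(1,2)[OF assms(1)] vecD(1,2)[OF assms(2)] by (auto simp: free_module_carrier)
qed

lemma tensor_span_vec:
  assumes "K \<subseteq> vec S" "L \<subseteq> vec T" "z \<in> tensor_span R K L" shows "z \<in> vec (S \<times> T)"
  using assms(3)
proof induction
  case (add z x y)
  then have "x \<in> vec S" "y \<in> vec T" using assms(1,2) by auto
  then show ?case using vec_add[OF vec_tensor add(4)] by blast
qed simp

lemma tensor_span_add:
  assumes "K \<subseteq> vec S" "L \<subseteq> vec T" "z \<in> tensor_span R K L" "z' \<in> tensor_span R K L"
  shows "(\<lambda>p. z p \<oplus> z' p) \<in> tensor_span R K L"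
  using assms(3)
proof induction
  case zero
  then show ?case using assms(4) vecD(1)[OF tensor_span_vec[OF assms(1,2,4)]] by simp
next
  case (add z x y)
  have "x s \<in> carrier R" "y t \<in> carrier R" for s t using sub_vecD[OF assms(1) add(2)] sub_vecD[OF assms(2) add(3)] by simp_all
  then have "(\<lambda>p. x (fst p) \<otimes> y (snd p) \<oplus> z p \<oplus> z' p) = (\<lambda>p. x (fst p) \<otimes> y (snd p) \<oplus> (z p \<oplus> z' p))"
    using vecD(1)[OF tensor_span_vec[OF assms(1,2,4)]] vecD(1)[OF tensor_span_vec[OF assms(1,2) add(1)]]
    by (simp add: a_assoc)
  then show ?case using tensor_span.add[OF add(4,2,3)] by simp
qed

lemma tensor_span_pair:
  assumes "x \<in> K" "y \<in> L" "K \<subseteq> vec S" "L \<subseteq> vec T"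
  shows "(\<lambda>p. x (fst p) \<otimes> y (snd p)) \<in> tensor_span R K L"
proof -
  have "x (fst p) \<otimes> y (snd p) \<in> carrier R" for p using sub_vecD[OF assms(3,1)] sub_vecD[OF assms(4,2)] by simp
  then show ?thesis using tensor_span.add[OF tensor_span.zero assms(1,2), of R] by simp
qed

lemma tensor_span_submodule:
  assumes K: "is_submodule R (free_module R S) K" and L: "L \<subseteq> vec T"
  shows "is_submodule R (free_module R (S \<times> T)) (tensor_span R K L)"
proof (rule is_submoduleI)
  have K': "K \<subseteq> vec S" using is_submoduleD(1)[OF K] .
  show "z \<in> tensor_span R K L \<Longrightarrow> z \<in> vec (S \<times> T)" for z by (rule tensor_span_vec[OF K' L])
  show "\<zero>\<^bsub>free_module R (S \<times> T)\<^esub> \<in> tensor_span R K L" by (simp add: tensor_span.zero)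
  show "z \<oplus>\<^bsub>free_module R (S \<times> T)\<^esub> z' \<in> tensor_span R K L"
    if "z \<in> tensor_span R K L" "z' \<in> tensor_span R K L" for z z'
    using tensor_span_add[OF K' L that] by simp
  show "a \<odot>\<^bsub>free_module R (S \<times> T)\<^esub> z \<in> tensor_span R K L"
    if a: "a \<in> carrier R" and "z \<in> tensor_span R K L" for a z
    using that(2)
  proof induction
    case zero
    then show ?case using a by (simp add: tensor_span.zero)
  next
    case (add z x y)
    have "x s \<in> carrier R" "y t \<in> carrier R" for s t using sub_vecD[OF K' add(2)] sub_vecD[OF L add(3)] by simp_all
    then have "(\<lambda>p. a \<otimes> (x (fst p) \<otimes> y (snd p) \<oplus> z p)) = (\<lambda>p. (a \<otimes> x (fst p)) \<otimes> y (snd p) \<oplus> a \<otimes> z p)"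
      using vecD(1)[OF tensor_span_vec[OF K' L add(1)]] a by (simp add: m_assoc r_distr)
    then show ?case using tensor_span.add[OF _ subm_vec(4)[OF K a add(2)] add(3)] add(4) by simp
  qed
qed

lemma transp_tensor_span:
  assumes "K \<subseteq> vec S" "L \<subseteq> vec T" "z \<in> tensor_span R K L" shows "transp z \<in> tensor_span R L K"
  using assms(3)
proof induction
  case zero
  then show ?case by (simp add: transp_def tensor_span.zero)
next
  case (add z x y)
  have "x s \<in> carrier R" "y t \<in> carrier R" for s t using sub_vecD[OF assms(1) add(2)] sub_vecD[OF assms(2) add(3)] by simp_all
  then have "transp (\<lambda>p. x (fst p) \<otimes> y (snd p) \<oplus> z p) = (\<lambda>p. y (fst p) \<otimes> x (snd p) \<oplus> transp z p)"
    by (simp add: transp_def m_comm)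
  then show ?case using tensor_span.add[OF add(4,3,2)] by simp
qed

lemma tor_independent_sym:
  assumes "K \<subseteq> vec S" "L \<subseteq> vec T" "tor_independent R S K T L" shows "tor_independent R T L S K"
  unfolding tor_independent_def
proof
  fix z assume "z \<in> tensor_span R L (vec S) \<inter> tensor_span R (vec T) K"
  then have "transp z \<in> tensor_span R K (vec T)" "transp z \<in> tensor_span R (vec S) L"
    using transp_tensor_span[OF assms(2) order.refl] transp_tensor_span[OF order.refl assms(1)] by auto
  then show "z \<in> tensor_span R L K"
    using assms(3) transp_tensor_span[OF assms(1,2), of "transp z"] by (auto simp: tor_independent_def)
qed

lemma tensor_span_col:
  assumes K: "is_submodule R (free_module R S) K" and L: "L \<subseteq> vec T" and z: "z \<in> tensor_span R K L"
  shows "(\<lambda>s. z (s, t)) \<in> K"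
  using z
proof induction
  case zero
  then show ?case using subm_vec(2)[OF K] by simp
next
  case (add z x y)
  have y: "y t \<in> carrier R" using sub_vecD[OF L add(3)] .
  have "x s \<otimes> y t = y t \<otimes> x s" for s using y vecD(1)[OF subm_vec(1)[OF K add(2)]] m_comm by simp
  then show ?case using subm_vec(3)[OF K subm_vec(4)[OF K y add(2)] add(4)] by simp
qed

lemma tensor_span_row:
  assumes "K \<subseteq> vec S" "is_submodule R (free_module R T) L" "z \<in> tensor_span R K L"
  shows "(\<lambda>t. z (s, t)) \<in> L"
  using tensor_span_col[OF assms(2,1) transp_tensor_span[OF assms(1) is_submoduleD(1)[OF assms(2)] assms(3)], of s]
  by (simp add: transp_def)

text \<open>A matrix is the sum over t of its column at t times the row vector
  \<open>basis_vec R t\<close>. Only finitely many columns are nonzero, and the induction removes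
  them one by one.\<close>

lemma tensor_spanI_col:
  assumes K: "is_submodule R (free_module R S) K" and z: "z \<in> vec (S \<times> T)"
    and col: "\<And>t. (\<lambda>s. z (s, t)) \<in> K"
  shows "z \<in> tensor_span R K (vec T)"
proof -
  have "z \<in> tensor_span R K (vec T)"
    if "finite A" "A \<subseteq> T" "z \<in> vec (S \<times> T)" "\<And>t. (\<lambda>s. z (s, t)) \<in> K" "\<And>s t. t \<notin> A \<Longrightarrow> z (s, t) = \<zero>" for A z
    using that
  proof (induction A arbitrary: z rule: finite_induct)
    case empty
    then have "z = (\<lambda>p. \<zero>)" by auto
    then show ?case by (simp add: tensor_span.zero)
  next
    case (insert u A)
    define x where "x = (\<lambda>s. z (s, u))"
    define z' where "z' = (\<lambda>p. z p \<ominus> x (fst p) \<otimes> basis_vec R u (snd p))"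
    have xK: "x \<in> K" using insert.prems by (simp add: x_def)
    have xv: "x \<in> vec S" using subm_vec(1)[OF K xK] .
    have b: "basis_vec R u \<in> vec T" using insert.prems by auto
    have z': "z' \<in> vec (S \<times> T)" unfolding z'_def by (intro vec_minus insert.prems(2) vec_tensor[OF xv b])
    have zc: "z p \<in> carrier R" for p using vecD(1)[OF insert.prems(2)] .
    have xc: "x s \<in> carrier R" for s using vecD(1)[OF xv] .
    have *: "z' (s, t) = (if t = u then \<zero> else z (s, t))" for s t
      using zc[of "(s, t)"] xc by (auto simp: z'_def basis_vec_def x_def) (simp_all add: a_minus_def r_neg)
    have "(\<lambda>s. z' (s, t)) \<in> K" for t
      using insert.prems(3)[of t] subm_vec(2)[OF K] by (cases "t = u") (auto simp: *)
    then have "z' \<in> tensor_span R K (vec T)"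
      using insert.prems insert.hyps z' by (intro insert.IH) (auto simp: *)
    then have "(\<lambda>p. x (fst p) \<otimes> basis_vec R u (snd p) \<oplus> z' p) \<in> tensor_span R K (vec T)"
      by (rule tensor_span.add[OF _ xK b])
    moreover have "(\<lambda>p. x (fst p) \<otimes> basis_vec R u (snd p) \<oplus> z' p) = z"
      using zc xc by (auto simp: * basis_vec_def x_def fun_eq_iff)
    ultimately show ?case by simp
  qed
  note main = this
  have 1: "snd ` {p. z p \<noteq> \<zero>} \<subseteq> T" using vecD(2)[OF z] by force
  have 2: "z (s, t) = \<zero>" if "t \<notin> snd ` {p. z p \<noteq> \<zero>}" for s t using that by force
  show ?thesis by (rule main[OF finite_imageI[OF vecD(3)[OF z]] 1 z col 2])
qed

lemma tensor_spanI_row: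
  assumes "is_submodule R (free_module R T) L" "z \<in> vec (S \<times> T)" "\<And>s. (\<lambda>t. z (s, t)) \<in> L"
  shows "z \<in> tensor_span R (vec S) L"
proof -
  have "transp z \<in> vec (T \<times> S)"
  proof -
    have "{p. transp z p \<noteq> \<zero>} \<subseteq> (\<lambda>p. (snd p, fst p)) ` {p. z p \<noteq> \<zero>}"
      by (force simp: transp_def)
    then have "finite {p. transp z p \<noteq> \<zero>}" by (rule finite_surj[OF vecD(3)[OF assms(2)]])
    then show ?thesis using vecD(1,2)[OF assms(2)] by (auto simp: free_module_carrier transp_def)
  qed
  then have "transp z \<in> tensor_span R L (vec S)"
    using assms by (intro tensor_spanI_col) (auto simp: transp_def)
  then show ?thesis using transp_tensor_span[OF is_submoduleD(1)[OF assms(1)] order.refl] by fastforce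
qed

lemma vec_Times: "vec (S \<times> T) = tensor_span R (vec S) (vec T)"
proof -
  interpret F: module R "free_module R S" by (rule module_free)
  interpret G: module R "free_module R T" by (rule module_free)
  have "(\<lambda>s. z (s, t)) \<in> vec S" if "z \<in> vec (S \<times> T)" for z t
  proof -
    have "{s. z (s, t) \<noteq> \<zero>} \<subseteq> fst ` {p. z p \<noteq> \<zero>}" by force
    then have "finite {s. z (s, t) \<noteq> \<zero>}" by (rule finite_surj[OF vecD(3)[OF that]])
    then show ?thesis using vecD(1,2)[OF that] by (simp add: free_module_carrier)
  qed
  then have "vec (S \<times> T) \<subseteq> tensor_span R (vec S) (vec T)"
    by (intro subsetI tensor_spanI_col[OF F.is_submodule_carrier])
  moreover have "tensor_span R (vec S) (vec T) \<subseteq> vec (S \<times> T)"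
    by (intro subsetI tensor_span_vec[OF order.refl order.refl])
  ultimately show ?thesis by (rule equalityI)
qed

lemma vec_col: "z \<in> vec (S \<times> T) \<Longrightarrow> (\<lambda>s. z (s, t)) \<in> vec S"
  and vec_row: "z \<in> vec (S \<times> T) \<Longrightarrow> (\<lambda>t. z (s, t)) \<in> vec T"
  using tensor_span_col[OF module.is_submodule_carrier[OF module_free], of "vec T" T z S t]
    tensor_span_row[OF order.refl module.is_submodule_carrier[OF module_free], of z S T s]
  by (simp_all add: vec_Times)

lemma vec_transp: "z \<in> vec (S \<times> T) \<Longrightarrow> transp z \<in> vec (T \<times> S)"
  unfolding vec_Times by (rule transp_tensor_span) auto

lemma col_map_tensor:
  assumes f: "f \<in> module_hom R (free_module R S) (free_module R S')"
    and K: "K \<subseteq> vec S" and L: "L \<subseteq> vec T" and z: "z \<in> tensor_span R K L" "x \<in> K" "y \<in> L"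
  shows "col_map f (\<lambda>p. x (fst p) \<otimes> y (snd p) \<oplus> z p) = (\<lambda>p. f x (fst p) \<otimes> y (snd p) \<oplus> col_map f z p)"
proof -
  have y: "y t \<in> carrier R" for t using sub_vecD[OF L z(3)] .
  have x: "x \<in> vec S" using z K by blast
  have xy: "(\<lambda>s. x s \<otimes> y t \<oplus> z (s, t)) = (\<lambda>s. y t \<otimes> x s \<oplus> z (s, t))" for t using m_comm[OF vecD(1)[OF x] y] by simp
  have zc: "(\<lambda>s. z (s, t)) \<in> vec S" for t
    using vec_col tensor_span_vec[OF K L z(1)] .
  have fx: "f x \<in> vec S'" using module_hom_closed[OF f x] .
  have "f (\<lambda>s. x s \<otimes> y t \<oplus> z (s, t)) = (\<lambda>s. y t \<otimes> f x s \<oplus> f (\<lambda>s. z (s, t)) s)" for t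
    using hom_vec(1)[OF f vec_smult[OF y x] zc] hom_vec(2)[OF f y x] unfolding xy by simp
  then show ?thesis using y vecD(1)[OF fx] by (simp add: col_map_def m_comm)
qed

lemma col_map_zero:
  assumes f: "f \<in> module_hom R (free_module R S) (free_module R S')"
  shows "col_map f (\<lambda>p. \<zero>) = (\<lambda>p. \<zero>)"
  using hom_vec(3)[OF f module_free] by (simp add: col_map_def)

lemma col_map_span:
  assumes f: "f \<in> module_hom R (free_module R S) (free_module R S')"
    and K: "K \<subseteq> vec S" and L: "L \<subseteq> vec T" and z: "z \<in> tensor_span R K L"
  shows "col_map f z \<in> tensor_span R (f ` K) L"
  using z
proof induction
  case zero
  then show ?case by (simp add: col_map_zero[OF f] tensor_span.zero)
next
  case (add z x y)
  then show ?case using tensor_span.add[OF add(4) imageI[OF add(2)] add(3)]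
    by (simp add: col_map_tensor[OF f K L])
qed

text \<open>Surjections stay surjective after tensoring: in each summand x y of z a preimage of x is
  chosen.\<close>

lemma col_map_lift:
  assumes f: "f \<in> module_hom R (free_module R S) (free_module R S')"
    and K: "K \<subseteq> vec S" and L: "L \<subseteq> vec T" and z: "z \<in> tensor_span R (f ` K) L"
  obtains u where "u \<in> tensor_span R K L" "col_map f u = z"
proof -
  have "\<exists>u \<in> tensor_span R K L. col_map f u = z" using z
  proof induction
    case zero
    show ?case by (rule bexI[OF _ tensor_span.zero]) (rule col_map_zero[OF f])
  next
    case (add z x y)
    then obtain u x' where u: "u \<in> tensor_span R K L" "col_map f u = z" "x' \<in> K" "x = f x'" by blast
    show ?case
      by (rule bexI[OF _ tensor_span.add[OF u(1,3) add(3)]]) (simp add: col_map_tensor[OF f K L u(1,3) add(3)] u)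
  qed
  then show ?thesis using that by blast
qed

lemma col_map_hom:
  assumes f: "f \<in> module_hom R (free_module R S) (free_module R S')"
  shows "col_map f \<in> module_hom R (free_module R (S \<times> T)) (free_module R (S' \<times> T))"
proof (rule module_homI)
  show "col_map f z \<in> vec (S' \<times> T)" if "z \<in> vec (S \<times> T)" for z
  proof -
    have "col_map f z \<in> tensor_span R (f ` vec S) (vec T)"
      using that col_map_span[OF f order.refl order.refl] by (simp add: vec_Times)
    moreover have "f ` vec S \<subseteq> vec S'" using module_hom_closed[OF f] by blast
    ultimately show ?thesis using tensor_span_vec[OF _ order.refl] by blast
  qed
  show "col_map f (z \<oplus>\<^bsub>free_module R (S \<times> T)\<^esub> z') = col_map f z \<oplus>\<^bsub>free_module R (S' \<times> T)\<^esub> col_map f z'"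
    if "z \<in> vec (S \<times> T)" "z' \<in> vec (S \<times> T)" for z z'
    using hom_vec(1)[OF f vec_col[OF that(1)] vec_col[OF that(2)]] by (simp add: col_map_def)
  show "col_map f (a \<odot>\<^bsub>free_module R (S \<times> T)\<^esub> z) = a \<odot>\<^bsub>free_module R (S' \<times> T)\<^esub> col_map f z"
    if "a \<in> carrier R" "z \<in> vec (S \<times> T)" for a z
    using hom_vec(2)[OF f that(1) vec_col[OF that(2)]] by (simp add: col_map_def)
qed

lemma transp_hom: "transp \<in> module_hom R (free_module R (S \<times> T)) (free_module R (T \<times> S))"
  by (rule module_homI) (simp add: vec_transp, simp_all add: transp_def)

lemma row_map_hom:
  assumes g: "g \<in> module_hom R (free_module R T) (free_module R T')"
  shows "row_map g \<in> module_hom R (free_module R (S \<times> T)) (free_module R (S \<times> T'))"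
  using module_hom_comp[OF module_hom_comp[OF transp_hom col_map_hom[OF g]] transp_hom]
  by (simp add: row_map_transp[abs_def])

lemma row_map_span:
  assumes g: "g \<in> module_hom R (free_module R T) (free_module R T')"
    and K: "K \<subseteq> vec S" and L: "L \<subseteq> vec T" and z: "z \<in> tensor_span R K L"
  shows "row_map g z \<in> tensor_span R K (g ` L)"
proof -
  have "g ` L \<subseteq> vec T'" using L module_hom_closed[OF g] by blast
  then show ?thesis
    unfolding row_map_transp
    using transp_tensor_span[OF _ K col_map_span[OF g L K transp_tensor_span[OF K L z]]] by blast
qed

lemma row_map_lift:
  assumes g: "g \<in> module_hom R (free_module R T) (free_module R T')"
    and K: "K \<subseteq> vec S" and L: "L \<subseteq> vec T" and z: "z \<in> tensor_span R K (g ` L)"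
  obtains u where "u \<in> tensor_span R K L" "row_map g u = z"
proof -
  have "g ` L \<subseteq> vec T'" using L module_hom_closed[OF g] by blast
  from transp_tensor_span[OF K this z] obtain u where u: "u \<in> tensor_span R L K" "col_map g u = transp z"
    using col_map_lift[OF g L K] by blast
  have "row_map g (transp u) = z" by (simp add: row_map_transp u)
  then show ?thesis using that transp_tensor_span[OF L K u(1)] by blast
qed

lemma row_map_pair:
  assumes g: "g \<in> module_hom R (free_module R T) (free_module R T')"
    and "y \<in> vec T" "\<And>s. x s \<in> carrier R"
  shows "row_map g (\<lambda>q. x (fst q) \<otimes> y (snd q)) = (\<lambda>q. x (fst q) \<otimes> g y (snd q))"
  using hom_vec(2)[OF g assms(3,2)] by (simp add: row_map_def)

lemma col_map_pair:
  assumes f: "f \<in> module_hom R (free_module R S) (free_module R S')"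
    and x: "x \<in> vec S" and y: "\<And>t. y t \<in> carrier R"
  shows "col_map f (\<lambda>q. x (fst q) \<otimes> y (snd q)) = (\<lambda>q. f x (fst q) \<otimes> y (snd q))"
proof -
  have "(\<lambda>s. x s \<otimes> y t) = (\<lambda>s. y t \<otimes> x s)" for t using m_comm[OF vecD(1)[OF x] y] by simp
  then show ?thesis
    using hom_vec(2)[OF f y x] vecD(1)[OF module_hom_closed[OF f x]] y
    by (simp add: col_map_def m_comm)
qed

lemma col_row_map:
  assumes f: "f \<in> module_hom R (free_module R S) (free_module R S')"
    and g: "g \<in> module_hom R (free_module R T) (free_module R T')"
    and z: "z \<in> vec (S \<times> T)"
  shows "col_map f (row_map g z) = row_map g (col_map f z)"
proof (rule hom_vec_eq[OF module_free _ _ _ z])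
  show "(\<lambda>z. col_map f (row_map g z)) \<in> module_hom R (free_module R (S \<times> T)) (free_module R (S' \<times> T'))"
    by (rule module_hom_comp[OF row_map_hom[OF g] col_map_hom[OF f]])
  show "(\<lambda>z. row_map g (col_map f z)) \<in> module_hom R (free_module R (S \<times> T)) (free_module R (S' \<times> T'))"
    by (rule module_hom_comp[OF col_map_hom[OF f] row_map_hom[OF g]])
  fix p assume "p \<in> S \<times> T"
  then obtain s t where p: "p = (s, t)" "s \<in> S" "t \<in> T" by auto
  have b: "basis_vec R p = (\<lambda>q. basis_vec R s (fst q) \<otimes> basis_vec R t (snd q))"
    by (auto simp: basis_vec_def p fun_eq_iff)
  note s = vec_basis[OF p(2)] and t = vec_basis[OF p(3)]
  have c: "basis_vec R s v \<in> carrier R" "basis_vec R t w \<in> carrier R" for v w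
    by (simp_all add: basis_vec_def)
  have fs: "f (basis_vec R s) \<in> vec S'" and gt: "g (basis_vec R t) \<in> vec T'"
    using module_hom_closed[OF f s] module_hom_closed[OF g t] .
  show "col_map f (row_map g (basis_vec R p)) = row_map g (col_map f (basis_vec R p))"
    unfolding b row_map_pair[where x = "basis_vec R s", OF g t c(1)]
      col_map_pair[where y = "basis_vec R t", OF f s c(2)]
      col_map_pair[where y = "g (basis_vec R t)", OF f s vecD(1)[OF gt]]
      row_map_pair[where x = "f (basis_vec R s)", OF g t vecD(1)[OF fs]] ..
qed

text \<open>Tensoring with a free module is exact: a matrix is killed iff each of its columns is,
  and \<open>tensor_spanI_col\<close> reassembles the columns.\<close>

lemma col_map_kernel:
  assumes f: "f \<in> module_hom R (free_module R S) (free_module R S')" and v: "v \<in> vec (S \<times> T)"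
    and "col_map f v = (\<lambda>p. \<zero>)"
  shows "v \<in> tensor_span R {x \<in> vec S. f x = (\<lambda>s. \<zero>)} (vec T)"
proof (rule tensor_spanI_col[OF _ v])
  show "is_submodule R (free_module R S) {x \<in> vec S. f x = (\<lambda>s. \<zero>)}"
    using is_submodule_kernel[OF module_free module_free f] by simp
  have "f (\<lambda>s. v (s, t)) s' = \<zero>" for t s'
    using assms(3) by (auto simp: col_map_def dest: fun_cong[of _ _ "(s', t)"])
  then show "(\<lambda>s. v (s, t)) \<in> {x \<in> vec S. f x = (\<lambda>s. \<zero>)}" for t
    using vec_col[OF v] by auto
qed

lemma col_map_eq_zero:
  assumes f: "f \<in> module_hom R (free_module R S) (free_module R S')" and "L \<subseteq> vec T"
    and v: "v \<in> tensor_span R {x \<in> vec S. f x = (\<lambda>s. \<zero>)} L"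
  shows "col_map f v = (\<lambda>p. \<zero>)"
proof -
  have "is_submodule R (free_module R S) {x \<in> vec S. f x = (\<lambda>s. \<zero>)}"
    using is_submodule_kernel[OF module_free module_free f] by simp
  from tensor_span_col[OF this assms(2) v] show ?thesis by (simp add: col_map_def)
qed

lemma row_map_kernel:
  assumes g: "g \<in> module_hom R (free_module R T) (free_module R T')" and v: "v \<in> vec (S \<times> T)"
    and "row_map g v = (\<lambda>p. \<zero>)"
  shows "v \<in> tensor_span R (vec S) {x \<in> vec T. g x = (\<lambda>s. \<zero>)}"
proof (rule tensor_spanI_row[OF _ v])
  show "is_submodule R (free_module R T) {x \<in> vec T. g x = (\<lambda>s. \<zero>)}"
    using is_submodule_kernel[OF module_free module_free g] by simp
  have "g (\<lambda>t. v (s, t)) t' = \<zero>" for t' s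
    using assms(3) by (auto simp: row_map_def dest: fun_cong[of _ _ "(s, t')"])
  then show "(\<lambda>t. v (s, t)) \<in> {x \<in> vec T. g x = (\<lambda>s. \<zero>)}" for s
    using vec_row[OF v] by auto
qed

lemma row_map_eq_zero:
  assumes g: "g \<in> module_hom R (free_module R T) (free_module R T')" and "K \<subseteq> vec S"
    and v: "v \<in> tensor_span R K {x \<in> vec T. g x = (\<lambda>s. \<zero>)}"
  shows "row_map g v = (\<lambda>p. \<zero>)"
proof -
  have "is_submodule R (free_module R T) {x \<in> vec T. g x = (\<lambda>s. \<zero>)}"
    using is_submodule_kernel[OF module_free module_free g] by simp
  from tensor_span_row[OF assms(2) this v] show ?thesis by (simp add: row_map_def)
qed

text \<open>Both sides are lifted along \<open>f\<close>; the boundary of a lift is where the hypothesis applies.\<close>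

lemma tor_independent_shift:
  assumes f: "f \<in> module_hom R (free_module R S') (free_module R S)"
    and g: "g \<in> module_hom R (free_module R T') (free_module R T)"
    and ind: "tor_independent R S' {x \<in> vec S'. f x = (\<lambda>s. \<zero>)} T (g ` vec T')"
  shows "tor_independent R S (f ` vec S') T' {x \<in> vec T'. g x = (\<lambda>s. \<zero>)}"
  unfolding tor_independent_def
proof
  let ?K1 = "{x \<in> vec S'. f x = (\<lambda>s. \<zero>)}" and ?L1 = "{x \<in> vec T'. g x = (\<lambda>s. \<zero>)}"
  have K1: "?K1 \<subseteq> vec S'" and L1: "?L1 \<subseteq> vec T'" by auto
  have fK: "f ` vec S' \<subseteq> vec S" and gL: "g ` vec T' \<subseteq> vec T"
    using module_hom_closed[OF f] module_hom_closed[OF g] by auto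
  fix z assume "z \<in> tensor_span R (f ` vec S') (vec T') \<inter> tensor_span R (vec S) ?L1"
  then have z: "z \<in> tensor_span R (f ` vec S') (vec T')" "z \<in> tensor_span R (vec S) ?L1" by auto
  from col_map_lift[OF f order.refl order.refl z(1)]
  obtain u where u: "u \<in> vec (S' \<times> T')" "col_map f u = z" unfolding vec_Times .
  define v where "v = row_map g u"
  have v: "v \<in> tensor_span R (vec S') (g ` vec T')"
    unfolding v_def using row_map_span[OF g order.refl order.refl] u(1) vec_Times by blast
  then have v': "v \<in> vec (S' \<times> T)" by (rule tensor_span_vec[OF order.refl gL])
  have "col_map f v = row_map g z" unfolding v_def using col_row_map[OF f g u(1)] u(2) by simp
  also have "\<dots> = (\<lambda>p. \<zero>)" by (rule row_map_eq_zero[OF g order.refl z(2)])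
  finally have "v \<in> tensor_span R ?K1 (vec T)" by (rule col_map_kernel[OF f v'])
  then have "v \<in> tensor_span R ?K1 (g ` vec T')" using v ind by (auto simp: tor_independent_def)
  then obtain u' where u': "u' \<in> tensor_span R ?K1 (vec T')" "row_map g u' = v"
    using row_map_lift[OF g K1 order.refl] by blast
  have u'v: "u' \<in> vec (S' \<times> T')" by (rule tensor_span_vec[OF K1 order.refl u'(1)])
  \<comment> \<open>Both \<open>u\<close> and \<open>u'\<close> have the same image \<open>v\<close>
    under \<open>row_map g\<close>, while \<open>u'\<close> is killed by \<open>col_map f\<close>.
    The difference is thus a lift of \<open>z\<close> whose rows lie in the kernel of
    \<open>g\<close>.\<close>
  define w where "w = (\<lambda>p. u p \<ominus> u' p)"
  have w: "w \<in> vec (S' \<times> T')" unfolding w_def by (rule vec_minus[OF u(1) u'v])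
  have "v p \<in> carrier R" for p using vecD(1)[OF v'] .
  then have "row_map g w = (\<lambda>p. \<zero>)"
    unfolding w_def hom_vec(4)[OF row_map_hom[OF g] module_free u(1) u'v]
    by (simp only: free_minus[OF v' v'] u'(2) v_def[symmetric]) (simp add: a_minus_def r_neg)
  then have "w \<in> tensor_span R (vec S') ?L1" by (rule row_map_kernel[OF g w])
  then have "col_map f w \<in> tensor_span R (f ` vec S') ?L1" by (rule col_map_span[OF f order.refl L1])
  moreover have "col_map f w = z"
  proof -
    have "z \<in> vec (S \<times> T')" by (rule tensor_span_vec[OF fK order.refl z(1)])
    moreover have "col_map f u' = (\<lambda>p. \<zero>)" by (rule col_map_eq_zero[OF f order.refl u'(1)])
    ultimately show ?thesis
      unfolding w_def hom_vec(4)[OF col_map_hom[OF f] module_free u(1) u'v] u(2)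
      by (simp only: free_minus[OF _ vec_zero]) (simp add: a_minus_def vecD(1))
  qed
  ultimately show "z \<in> tensor_span R (f ` vec S') ?L1" by simp
qed

text \<open>Projectivity of free modules, with the lift confined to \<open>H\<close>: preimages of
  the basis vectors are chosen in \<open>H\<close>. The bounds on Betti numbers need lifts with
  entries in m.\<close>

lemma free_lift_into:
  assumes N: "module R N" "module R M" and p: "p \<in> module_hom R N M" and h: "h \<in> module_hom R (free_module R S) M"
    and H: "is_submodule R N H" and b: "\<And>s. s \<in> S \<Longrightarrow> h (basis_vec R s) \<in> p ` H"
  obtains \<phi> where "\<phi> \<in> module_hom R (free_module R S) N" "\<And>x. x \<in> vec S \<Longrightarrow> p (\<phi> x) = h x"
    "\<And>x. x \<in> vec S \<Longrightarrow> \<phi> x \<in> H"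
proof -
  define n where "n s = (SOME n. n \<in> H \<and> p n = h (basis_vec R s))" for s
  have n: "n s \<in> H \<and> p (n s) = h (basis_vec R s)" if "s \<in> S" for s
  proof -
    obtain y where "y \<in> H \<and> p y = h (basis_vec R s)" using b[OF \<open>s \<in> S\<close>] by (metis imageE)
    then show ?thesis unfolding n_def by (rule someI)
  qed
  then have nS: "n \<in> S \<rightarrow> carrier N" using is_submoduleD(2)[OF H] by (simp add: Pi_iff)
  define \<phi> where "\<phi> = free_ext R N n"
  have \<phi>: "\<phi> \<in> module_hom R (free_module R S) N" unfolding \<phi>_def by (rule free_ext_hom[OF N(1) nS])
  have \<phi>b: "\<phi> (basis_vec R s) = n s" if "s \<in> S" for s
    unfolding \<phi>_def by (rule free_ext_basis_vec[OF N(1) nS that])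
  have 1: "p (\<phi> x) = h x" if "x \<in> vec S" for x
  proof (rule hom_vec_eq[OF N(2) module_hom_comp[OF \<phi> p] h _ that])
    show "p (\<phi> (basis_vec R s)) = h (basis_vec R s)" if "s \<in> S" for s
      using n[OF that] \<phi>b[OF that] by simp
  qed
  have 2: "\<phi> x \<in> H" if "x \<in> vec S" for x
    by (rule hom_vec_into[OF N(1) \<phi> H _ that]) (simp add: \<phi>b n)
  show ?thesis by (rule that[OF \<phi> 1 2])
qed

lemma free_lift:
  assumes N: "module R N" "module R M" and p: "p \<in> module_hom R N M" and h: "h \<in> module_hom R (free_module R S) M"
    and b: "\<And>s. s \<in> S \<Longrightarrow> h (basis_vec R s) \<in> p ` carrier N"
  obtains \<phi> where "\<phi> \<in> module_hom R (free_module R S) N" "\<And>x. x \<in> vec S \<Longrightarrow> p (\<phi> x) = h x"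
proof (rule free_lift_into[OF N p h module.is_submodule_carrier[OF N(1)] b])
  fix \<phi> assume \<phi>: "\<phi> \<in> module_hom R (free_module R S) N" "\<And>x. x \<in> vec S \<Longrightarrow> p (\<phi> x) = h x"
  show thesis by (rule that[OF \<phi>])
qed

text \<open>Schanuel's lemma in disguise: the condition depends only on the module that is covered.\<close>

lemma tor_independent_cover:
  assumes M: "module R M"
    and p: "p \<in> module_hom R (free_module R S) M" "p ` vec S = carrier M"
    and q: "q \<in> module_hom R (free_module R S') M" "q ` vec S' = carrier M"
    and L: "is_submodule R (free_module R T) L"
    and ind: "tor_independent R S {x \<in> vec S. p x = \<zero>\<^bsub>M\<^esub>} T L"
  shows "tor_independent R S' {x \<in> vec S'. q x = \<zero>\<^bsub>M\<^esub>} T L"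
  unfolding tor_independent_def
proof
  let ?K = "{x \<in> vec S. p x = \<zero>\<^bsub>M\<^esub>}" and ?K' = "{x \<in> vec S'. q x = \<zero>\<^bsub>M\<^esub>}"
  have Lv: "L \<subseteq> vec T" using is_submoduleD(1)[OF L] .
  have K: "?K \<subseteq> vec S" and K': "?K' \<subseteq> vec S'" by auto
  have sK': "is_submodule R (free_module R S') ?K'"
    by (rule is_submodule_kernel[OF module_free M q(1)])
  obtain \<phi> where \<phi>: "\<phi> \<in> module_hom R (free_module R S) (free_module R S')" "\<And>x. x \<in> vec S \<Longrightarrow> q (\<phi> x) = p x"
    by (rule free_lift[OF module_free M q(1) p(1)]) (use q p module_hom_closed[OF p(1)] in auto)
  obtain \<psi> where \<psi>: "\<psi> \<in> module_hom R (free_module R S') (free_module R S)" "\<And>x. x \<in> vec S' \<Longrightarrow> p (\<psi> x) = q x"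
    by (rule free_lift[OF module_free M p(1) q(1)]) (use q p module_hom_closed[OF q(1)] in auto)
  have \<phi>c: "\<phi> x \<in> vec S'" if "x \<in> vec S" for x using module_hom_closed[OF \<phi>(1) that] .
  have \<psi>c: "\<psi> x \<in> vec S" if "x \<in> vec S'" for x using module_hom_closed[OF \<psi>(1) that] .
  \<comment> \<open>\<open>\<chi>\<close> measures how far \<open>\<phi>\<close> after
    \<open>\<psi>\<close> is from the identity, and takes values in the kernel of \<open>q\<close>.
    So u splits into a part that passes through the cover \<open>p\<close>, where the hypothesis
    applies, and a part whose columns are moved into the kernel while its rows stay in
    \<open>L\<close>.\<close>
  define \<chi> where "\<chi> x = (\<lambda>s. x s \<ominus> \<phi> (\<psi> x) s)" for x
  interpret M: module R M by fact
  have \<chi>c: "\<chi> x \<in> ?K'" if "x \<in> vec S'" for x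
  proof -
    note c = \<phi>c[OF \<psi>c[OF that]]
    have "q (\<chi> x) = q x \<ominus>\<^bsub>M\<^esub> q (\<phi> (\<psi> x))"
      unfolding \<chi>_def by (rule hom_vec(4)[OF q(1) M that c])
    also have "\<dots> = \<zero>\<^bsub>M\<^esub>"
      using \<phi>(2)[OF \<psi>c[OF that]] \<psi>(2)[OF that] module_hom_closed[OF q(1) that] by (simp add: M.M.r_neg a_minus_def)
    finally show ?thesis unfolding \<chi>_def using vec_minus[OF that c] by simp
  qed
  have \<chi>: "\<chi> \<in> module_hom R (free_module R S') (free_module R S')"
  proof (rule module_homI)
    show "\<chi> x \<in> vec S'" if "x \<in> vec S'" for x using \<chi>c[OF that] by simp
    fix x y assume x: "x \<in> vec S'" and y: "y \<in> vec S'"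
    note cx = vecD(1)[OF x] and cy = vecD(1)[OF y]
    note c = vecD(1)[OF \<phi>c[OF \<psi>c[OF x]]] vecD(1)[OF \<phi>c[OF \<psi>c[OF y]]]
    have "\<phi> (\<psi> (\<lambda>s. x s \<oplus> y s)) = (\<lambda>s. \<phi> (\<psi> x) s \<oplus> \<phi> (\<psi> y) s)"
      using hom_vec(1)[OF \<psi>(1) x y] hom_vec(1)[OF \<phi>(1) \<psi>c[OF x] \<psi>c[OF y]] by simp
    then show "\<chi> (x \<oplus>\<^bsub>free_module R S'\<^esub> y) = \<chi> x \<oplus>\<^bsub>free_module R S'\<^esub> \<chi> y"
      using cx cy c by (simp add: \<chi>_def a_minus_def minus_add a_ac)
  next
    fix a x assume a: "a \<in> carrier R" and x: "x \<in> vec S'"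
    have "\<phi> (\<psi> (\<lambda>s. a \<otimes> x s)) = (\<lambda>s. a \<otimes> \<phi> (\<psi> x) s)"
      using hom_vec(2)[OF \<psi>(1) a x] hom_vec(2)[OF \<phi>(1) a \<psi>c[OF x]] by simp
    then show "\<chi> (a \<odot>\<^bsub>free_module R S'\<^esub> x) = a \<odot>\<^bsub>free_module R S'\<^esub> \<chi> x"
      using vecD(1)[OF x] vecD(1)[OF \<phi>c[OF \<psi>c[OF x]]] a
      by (simp add: \<chi>_def a_minus_def r_distr r_minus)
  qed
  fix u assume "u \<in> tensor_span R ?K' (vec T) \<inter> tensor_span R (vec S') L"
  then have u: "u \<in> tensor_span R ?K' (vec T)" "u \<in> tensor_span R (vec S') L" by auto
  have uv: "u \<in> vec (S' \<times> T)" by (rule tensor_span_vec[OF order.refl Lv u(2)])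
  have "\<psi> ` ?K' \<subseteq> ?K" using \<psi>(2) \<psi>c by auto
  from tensor_span_mono[OF this order.refl col_map_span[OF \<psi>(1) K' order.refl u(1)]]
  have 1: "col_map \<psi> u \<in> tensor_span R ?K (vec T)" .
  have "\<psi> ` vec S' \<subseteq> vec S" using \<psi>c by auto
  from tensor_span_mono[OF this order.refl col_map_span[OF \<psi>(1) order.refl Lv u(2)]]
  have 2: "col_map \<psi> u \<in> tensor_span R (vec S) L" .
  have 3: "col_map \<psi> u \<in> tensor_span R ?K L" using 1 2 ind by (auto simp: tor_independent_def)
  have "\<phi> ` ?K \<subseteq> ?K'" using \<phi>(2) \<phi>c by auto
  from tensor_span_mono[OF this order.refl col_map_span[OF \<phi>(1) K Lv 3]]
  have 4: "col_map \<phi> (col_map \<psi> u) \<in> tensor_span R ?K' L" .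
  have "\<chi> ` vec S' \<subseteq> ?K'" using \<chi>c by auto
  from tensor_span_mono[OF this order.refl col_map_span[OF \<chi> order.refl Lv u(2)]]
  have 5: "col_map \<chi> u \<in> tensor_span R ?K' L" .
  have "col_map \<phi> (col_map \<psi> u) p \<oplus> col_map \<chi> u p = u p" for p
  proof -
    have c: "u (s, t) \<in> carrier R" "\<phi> (\<psi> (\<lambda>s. u (s, t))) s \<in> carrier R" for s t
      using vecD(1)[OF uv] vecD(1)[OF \<phi>c[OF \<psi>c[OF vec_col[OF uv]]]] by auto
    have *: "b \<oplus> (a \<ominus> b) = a" if "a \<in> carrier R" "b \<in> carrier R" for a b
      using that by (simp add: a_minus_def a_lcomm r_neg)
    show ?thesis using *[OF c(1)[of "fst p" "snd p"] c(2)[of "snd p" "fst p"]] by (simp add: col_map_def \<chi>_def)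
  qed
  then show "u \<in> tensor_span R ?K' L" using tensor_span_add[OF K' Lv 4 5] by simp
qed

end

section \<open>Congruence modulo the relations of a tensor product\<close>

lemma submodule_span_superset: "X \<subseteq> submodule_span R M X"
  by (auto simp: submodule_span_def)

lemma (in module) submodule_span_is_submodule:
  assumes "X \<subseteq> carrier M" shows "is_submodule R M (submodule_span R M X)"
proof -
  have "submodule_span R M X \<subseteq> carrier M"
    using assms carrier_is_submodule by (auto simp: submodule_span_def)
  then show ?thesis
    unfolding is_submodule_def submodule_span_def submodule_iff by (auto dest: is_submoduleD)
qed

lemma (in module) submodule_span_least:
  "is_submodule R M H \<Longrightarrow> X \<subseteq> H \<Longrightarrow> submodule_span R M X \<subseteq> H"
  by (auto simp: submodule_span_def submodule_iff)

context cring
begin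

text \<open>Membership in the carrier is part of the relation, so that symmetry, transitivity and
  addition hold without side conditions.\<close>

definition tensor_cong ::
  "('a, 'd, 'm) module_scheme \<Rightarrow> ('a, 'c, 'n) module_scheme \<Rightarrow> ('d \<times> 'c \<Rightarrow> 'a) \<Rightarrow> ('d \<times> 'c \<Rightarrow> 'a) \<Rightarrow> bool" where
  "tensor_cong M N c c' \<longleftrightarrow> c \<in> carrier (tensor_free R M N) \<and> c' \<in> carrier (tensor_free R M N) \<and>
     c \<ominus>\<^bsub>tensor_free R M N\<^esub> c' \<in> tensor_relations R M N"

context
  fixes M :: "('a, 'd, 'm) module_scheme" and N :: "('a, 'c, 'n) module_scheme"
  assumes M: "module R M" and N: "module R N"
begin

interpretation M: module R M by (rule M)
interpretation N: module R N by (rule N)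

lemma module_tensor_free: "module R (tensor_free R M N)"
  unfolding tensor_free_def by (rule module_free)

interpretation F: module R "tensor_free R M N" by (rule module_tensor_free)

lemma tensor_free_basis:
  "x \<in> carrier M \<Longrightarrow> y \<in> carrier N \<Longrightarrow> basis_vec R (x, y) \<in> carrier (tensor_free R M N)"
  unfolding tensor_free_def by (rule vec_basis) simp

lemma tensor_free_into:
  assumes "module R P" "h \<in> module_hom R (tensor_free R M N) P" "is_submodule R P X"
    "\<And>x y. x \<in> carrier M \<Longrightarrow> y \<in> carrier N \<Longrightarrow> h (basis_vec R (x, y)) \<in> X"
    "c \<in> carrier (tensor_free R M N)"
  shows "h c \<in> X"
  using hom_vec_into[OF assms(1) assms(2)[unfolded tensor_free_def] assms(3) _ assms(5)[unfolded tensor_free_def]] assms(4)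
  by auto

text \<open>The four kinds of generators become rules, and the last clause is the minimality of the
  span; later proofs never unfold the union of generating sets again.\<close>

lemma tensor_relations_rules:
  defines "F \<equiv> tensor_free R M N" and "\<delta> \<equiv> \<lambda>x y. basis_vec R (x, y)"
  shows "is_submodule R F (tensor_relations R M N)"
    "x \<in> carrier M \<Longrightarrow> x' \<in> carrier M \<Longrightarrow> y \<in> carrier N \<Longrightarrow>
       \<delta> (x \<oplus>\<^bsub>M\<^esub> x') y \<ominus>\<^bsub>F\<^esub> (\<delta> x y \<oplus>\<^bsub>F\<^esub> \<delta> x' y) \<in> tensor_relations R M N"
    "x \<in> carrier M \<Longrightarrow> y \<in> carrier N \<Longrightarrow> y' \<in> carrier N \<Longrightarrow>
       \<delta> x (y \<oplus>\<^bsub>N\<^esub> y') \<ominus>\<^bsub>F\<^esub> (\<delta> x y \<oplus>\<^bsub>F\<^esub> \<delta> x y') \<in> tensor_relations R M N"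
    "a \<in> carrier R \<Longrightarrow> x \<in> carrier M \<Longrightarrow> y \<in> carrier N \<Longrightarrow>
       \<delta> (a \<odot>\<^bsub>M\<^esub> x) y \<ominus>\<^bsub>F\<^esub> (a \<odot>\<^bsub>F\<^esub> \<delta> x y) \<in> tensor_relations R M N"
    "a \<in> carrier R \<Longrightarrow> x \<in> carrier M \<Longrightarrow> y \<in> carrier N \<Longrightarrow>
       \<delta> x (a \<odot>\<^bsub>N\<^esub> y) \<ominus>\<^bsub>F\<^esub> (a \<odot>\<^bsub>F\<^esub> \<delta> x y) \<in> tensor_relations R M N"
    "\<And>H. is_submodule R F H \<Longrightarrow>
      (\<And>x x' y. x \<in> carrier M \<Longrightarrow> x' \<in> carrier M \<Longrightarrow> y \<in> carrier N \<Longrightarrow>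
        \<delta> (x \<oplus>\<^bsub>M\<^esub> x') y \<ominus>\<^bsub>F\<^esub> (\<delta> x y \<oplus>\<^bsub>F\<^esub> \<delta> x' y) \<in> H) \<Longrightarrow>
      (\<And>x y y'. x \<in> carrier M \<Longrightarrow> y \<in> carrier N \<Longrightarrow> y' \<in> carrier N \<Longrightarrow>
        \<delta> x (y \<oplus>\<^bsub>N\<^esub> y') \<ominus>\<^bsub>F\<^esub> (\<delta> x y \<oplus>\<^bsub>F\<^esub> \<delta> x y') \<in> H) \<Longrightarrow>
      (\<And>a x y. a \<in> carrier R \<Longrightarrow> x \<in> carrier M \<Longrightarrow> y \<in> carrier N \<Longrightarrow>
        \<delta> (a \<odot>\<^bsub>M\<^esub> x) y \<ominus>\<^bsub>F\<^esub> (a \<odot>\<^bsub>F\<^esub> \<delta> x y) \<in> H) \<Longrightarrow>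
      (\<And>a x y. a \<in> carrier R \<Longrightarrow> x \<in> carrier M \<Longrightarrow> y \<in> carrier N \<Longrightarrow>
        \<delta> x (a \<odot>\<^bsub>N\<^esub> y) \<ominus>\<^bsub>F\<^esub> (a \<odot>\<^bsub>F\<^esub> \<delta> x y) \<in> H) \<Longrightarrow> tensor_relations R M N \<subseteq> H"
proof -
  let ?X = "{\<delta> (x \<oplus>\<^bsub>M\<^esub> x') y \<ominus>\<^bsub>F\<^esub> (\<delta> x y \<oplus>\<^bsub>F\<^esub> \<delta> x' y) | x x' y.
           x \<in> carrier M \<and> x' \<in> carrier M \<and> y \<in> carrier N} \<union>
        {\<delta> x (y \<oplus>\<^bsub>N\<^esub> y') \<ominus>\<^bsub>F\<^esub> (\<delta> x y \<oplus>\<^bsub>F\<^esub> \<delta> x y') | x y y'.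
           x \<in> carrier M \<and> y \<in> carrier N \<and> y' \<in> carrier N} \<union>
        {\<delta> (a \<odot>\<^bsub>M\<^esub> x) y \<ominus>\<^bsub>F\<^esub> (a \<odot>\<^bsub>F\<^esub> \<delta> x y) | a x y.
           a \<in> carrier R \<and> x \<in> carrier M \<and> y \<in> carrier N} \<union>
        {\<delta> x (a \<odot>\<^bsub>N\<^esub> y) \<ominus>\<^bsub>F\<^esub> (a \<odot>\<^bsub>F\<^esub> \<delta> x y) | a x y.
           a \<in> carrier R \<and> x \<in> carrier M \<and> y \<in> carrier N}"
  have rel: "tensor_relations R M N = submodule_span R F ?X"
    by (simp add: tensor_relations_def F_def \<delta>_def Let_def)
  have d: "\<delta> x y \<in> carrier F" if "x \<in> carrier M" "y \<in> carrier N" for x y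
    unfolding F_def \<delta>_def by (rule tensor_free_basis[OF that])
  have "?X \<subseteq> carrier F"
    using d F.M.minus_closed F.M.a_closed F.smult_closed unfolding F_def[symmetric] by auto
  then show "is_submodule R F (tensor_relations R M N)"
    unfolding rel unfolding F_def by (rule F.submodule_span_is_submodule)
  have X: "?X \<subseteq> tensor_relations R M N" unfolding rel by (rule submodule_span_superset)
  show "x \<in> carrier M \<Longrightarrow> x' \<in> carrier M \<Longrightarrow> y \<in> carrier N \<Longrightarrow>
       \<delta> (x \<oplus>\<^bsub>M\<^esub> x') y \<ominus>\<^bsub>F\<^esub> (\<delta> x y \<oplus>\<^bsub>F\<^esub> \<delta> x' y) \<in> tensor_relations R M N"
    using X by blast
  show "x \<in> carrier M \<Longrightarrow> y \<in> carrier N \<Longrightarrow> y' \<in> carrier N \<Longrightarrow>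
       \<delta> x (y \<oplus>\<^bsub>N\<^esub> y') \<ominus>\<^bsub>F\<^esub> (\<delta> x y \<oplus>\<^bsub>F\<^esub> \<delta> x y') \<in> tensor_relations R M N"
    using X by blast
  show "a \<in> carrier R \<Longrightarrow> x \<in> carrier M \<Longrightarrow> y \<in> carrier N \<Longrightarrow>
       \<delta> (a \<odot>\<^bsub>M\<^esub> x) y \<ominus>\<^bsub>F\<^esub> (a \<odot>\<^bsub>F\<^esub> \<delta> x y) \<in> tensor_relations R M N"
    using X by blast
  show "a \<in> carrier R \<Longrightarrow> x \<in> carrier M \<Longrightarrow> y \<in> carrier N \<Longrightarrow>
       \<delta> x (a \<odot>\<^bsub>N\<^esub> y) \<ominus>\<^bsub>F\<^esub> (a \<odot>\<^bsub>F\<^esub> \<delta> x y) \<in> tensor_relations R M N"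
    using X by blast
  fix H assume H: "is_submodule R F H"
    "\<And>x x' y. x \<in> carrier M \<Longrightarrow> x' \<in> carrier M \<Longrightarrow> y \<in> carrier N \<Longrightarrow>
        \<delta> (x \<oplus>\<^bsub>M\<^esub> x') y \<ominus>\<^bsub>F\<^esub> (\<delta> x y \<oplus>\<^bsub>F\<^esub> \<delta> x' y) \<in> H"
    "\<And>x y y'. x \<in> carrier M \<Longrightarrow> y \<in> carrier N \<Longrightarrow> y' \<in> carrier N \<Longrightarrow>
        \<delta> x (y \<oplus>\<^bsub>N\<^esub> y') \<ominus>\<^bsub>F\<^esub> (\<delta> x y \<oplus>\<^bsub>F\<^esub> \<delta> x y') \<in> H"
    "\<And>a x y. a \<in> carrier R \<Longrightarrow> x \<in> carrier M \<Longrightarrow> y \<in> carrier N \<Longrightarrow>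
        \<delta> (a \<odot>\<^bsub>M\<^esub> x) y \<ominus>\<^bsub>F\<^esub> (a \<odot>\<^bsub>F\<^esub> \<delta> x y) \<in> H"
    "\<And>a x y. a \<in> carrier R \<Longrightarrow> x \<in> carrier M \<Longrightarrow> y \<in> carrier N \<Longrightarrow>
        \<delta> x (a \<odot>\<^bsub>N\<^esub> y) \<ominus>\<^bsub>F\<^esub> (a \<odot>\<^bsub>F\<^esub> \<delta> x y) \<in> H"
  have "?X \<subseteq> H"
    by (intro Un_least subsetI; elim CollectE exE conjE; hypsubst; rule H(2) H(3) H(4) H(5); assumption)
  then show "tensor_relations R M N \<subseteq> H"
    unfolding rel using H(1) unfolding F_def by (rule F.submodule_span_least[rotated])
qed

lemma tensor_cong_trans: "tensor_cong M N a b \<Longrightarrow> tensor_cong M N b c \<Longrightarrow> tensor_cong M N a c"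
proof -
  assume *: "tensor_cong M N a b" "tensor_cong M N b c"
  then have "(a \<ominus>\<^bsub>tensor_free R M N\<^esub> b) \<oplus>\<^bsub>tensor_free R M N\<^esub> (b \<ominus>\<^bsub>tensor_free R M N\<^esub> c) \<in> tensor_relations R M N"
    using is_submoduleD(4)[OF tensor_relations_rules(1)] by (simp add: tensor_cong_def)
  moreover have "(a \<ominus>\<^bsub>tensor_free R M N\<^esub> b) \<oplus>\<^bsub>tensor_free R M N\<^esub> (b \<ominus>\<^bsub>tensor_free R M N\<^esub> c) = a \<ominus>\<^bsub>tensor_free R M N\<^esub> c"
    using * unfolding tensor_cong_def a_minus_def
    by (metis (no_types, lifting) F.M.a_assoc F.M.a_closed F.M.a_inv_closed F.M.l_neg F.M.l_zero)
  ultimately show "tensor_cong M N a c" using * by (simp add: tensor_cong_def)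
qed

lemma tensor_cong_refl: "c \<in> carrier (tensor_free R M N) \<Longrightarrow> tensor_cong M N c c"
  using is_submoduleD(3)[OF tensor_relations_rules(1)] by (simp add: tensor_cong_def a_minus_def F.M.r_neg)

lemma tensor_cong_sym: "tensor_cong M N a b \<Longrightarrow> tensor_cong M N b a"
proof -
  assume *: "tensor_cong M N a b"
  then have "\<ominus>\<^bsub>tensor_free R M N\<^esub> (a \<ominus>\<^bsub>tensor_free R M N\<^esub> b) \<in> tensor_relations R M N"
    using F.is_submodule_neg[OF tensor_relations_rules(1)] by (simp add: tensor_cong_def)
  then show "tensor_cong M N b a" using * by (simp add: tensor_cong_def a_minus_def F.M.minus_add F.M.a_comm)
qed

lemma tensor_cong_add: "tensor_cong M N a b \<Longrightarrow> tensor_cong M N c d \<Longrightarrow> tensor_cong M N (a \<oplus>\<^bsub>tensor_free R M N\<^esub> c) (b \<oplus>\<^bsub>tensor_free R M N\<^esub> d)"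
proof -
  assume *: "tensor_cong M N a b" "tensor_cong M N c d"
  then have "(a \<ominus>\<^bsub>tensor_free R M N\<^esub> b) \<oplus>\<^bsub>tensor_free R M N\<^esub> (c \<ominus>\<^bsub>tensor_free R M N\<^esub> d) \<in> tensor_relations R M N"
    using is_submoduleD(4)[OF tensor_relations_rules(1)] by (simp add: tensor_cong_def)
  then show ?thesis using * by (simp add: tensor_cong_def a_minus_def F.M.minus_add F.M.a_ac)
qed

lemma tensor_cong_smult: "r \<in> carrier R \<Longrightarrow> tensor_cong M N a b \<Longrightarrow> tensor_cong M N (r \<odot>\<^bsub>tensor_free R M N\<^esub> a) (r \<odot>\<^bsub>tensor_free R M N\<^esub> b)"
proof -
  assume *: "r \<in> carrier R" "tensor_cong M N a b"
  then have "r \<odot>\<^bsub>tensor_free R M N\<^esub> (a \<ominus>\<^bsub>tensor_free R M N\<^esub> b) \<in> tensor_relations R M N"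
    using is_submoduleD(5)[OF tensor_relations_rules(1)] by (simp add: tensor_cong_def)
  then show ?thesis using * by (simp add: tensor_cong_def a_minus_def F.smult_r_distr F.smult_r_minus)
qed

lemma tensor_cong_bilinear:
  "x \<in> carrier M \<Longrightarrow> x' \<in> carrier M \<Longrightarrow> y \<in> carrier N \<Longrightarrow>
    tensor_cong M N (basis_vec R (x \<oplus>\<^bsub>M\<^esub> x', y)) (basis_vec R (x, y) \<oplus>\<^bsub>tensor_free R M N\<^esub> basis_vec R (x', y))"
  "x \<in> carrier M \<Longrightarrow> y \<in> carrier N \<Longrightarrow> y' \<in> carrier N \<Longrightarrow>
    tensor_cong M N (basis_vec R (x, y \<oplus>\<^bsub>N\<^esub> y')) (basis_vec R (x, y) \<oplus>\<^bsub>tensor_free R M N\<^esub> basis_vec R (x, y'))"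
  "a \<in> carrier R \<Longrightarrow> x \<in> carrier M \<Longrightarrow> y \<in> carrier N \<Longrightarrow>
    tensor_cong M N (basis_vec R (a \<odot>\<^bsub>M\<^esub> x, y)) (a \<odot>\<^bsub>tensor_free R M N\<^esub> basis_vec R (x, y))"
  "a \<in> carrier R \<Longrightarrow> x \<in> carrier M \<Longrightarrow> y \<in> carrier N \<Longrightarrow>
    tensor_cong M N (basis_vec R (x, a \<odot>\<^bsub>N\<^esub> y)) (a \<odot>\<^bsub>tensor_free R M N\<^esub> basis_vec R (x, y))"
  by (auto simp: tensor_cong_def tensor_free_basis intro: tensor_relations_rules)

lemma tensor_cong_zero:
  "y \<in> carrier N \<Longrightarrow> tensor_cong M N (basis_vec R (\<zero>\<^bsub>M\<^esub>, y)) (\<zero>\<^bsub>tensor_free R M N\<^esub>)"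
  "x \<in> carrier M \<Longrightarrow> tensor_cong M N (basis_vec R (x, \<zero>\<^bsub>N\<^esub>)) (\<zero>\<^bsub>tensor_free R M N\<^esub>)"
  using tensor_cong_bilinear(3)[of \<zero> "\<zero>\<^bsub>M\<^esub>" y] tensor_cong_bilinear(4)[of \<zero> x "\<zero>\<^bsub>N\<^esub>"]
  by (simp_all add: tensor_free_basis)

lemma tensor_relations_cong: "c \<in> tensor_relations R M N \<longleftrightarrow> tensor_cong M N (c) (\<zero>\<^bsub>tensor_free R M N\<^esub>)"
proof -
  have z: "\<ominus>\<^bsub>tensor_free R M N\<^esub> \<zero>\<^bsub>tensor_free R M N\<^esub> = \<zero>\<^bsub>tensor_free R M N\<^esub>"
    using F.M.r_neg[OF F.M.zero_closed] F.M.l_zero[OF F.M.a_inv_closed[OF F.M.zero_closed]] by simp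
  show ?thesis
    using is_submoduleD(2)[OF tensor_relations_rules(1)] by (auto simp: tensor_cong_def a_minus_def z)
qed

end

end

lemma module_hom_diff:
  assumes "module R N" "f \<in> module_hom R M N" "g \<in> module_hom R M N"
  shows "(\<lambda>x. f x \<ominus>\<^bsub>N\<^esub> g x) \<in> module_hom R M N"
proof -
  interpret N: module R N by fact
  note f = assms(2) and g = assms(3)
  show ?thesis
    by (intro module_homI) (simp_all add: a_minus_def module_hom_closed[OF f] module_hom_closed[OF g]
      module_hom_add[OF f] module_hom_add[OF g] module_hom_smult[OF f] module_hom_smult[OF g]
      N.M.minus_add N.M.a_ac N.smult_r_distr N.smult_r_minus)
qed

lemma module_hom_id: "(\<lambda>x. x) \<in> module_hom R M M"
  by (auto simp: module_hom_def)

lemma (in module) is_submodule_abelian_subgroup: "is_submodule R M H \<Longrightarrow> abelian_subgroup H M"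
  unfolding submodule_iff[symmetric]
  by (intro abelian_subgroupI3 additive_subgroup.intro submodule.axioms(1) M.abelian_group_axioms)

section \<open>Tensor products with a free module as matrices\<close>

locale free_cover = cring R for R :: "('a, 'r) ring_scheme" (structure) +
  fixes N :: "('a, 'c, 'n) module_scheme" and T :: "'t set" and p :: "('t \<Rightarrow> 'a) \<Rightarrow> 'c"
  assumes N: "module R N" and p: "p \<in> module_hom R (free_module R T) N" and surj: "p ` vec T = carrier N"
begin

sublocale N: module R N by (rule N)

definition section_of :: "'c \<Rightarrow> 't \<Rightarrow> 'a" where "section_of = inv_into (vec T) p"

text \<open>The pair (x, y) goes to the rank one matrix with factors x and a chosen preimage of y
  under p. As \<open>section_of\<close> is an arbitrary choice and not linear, the tensor relations
  are respected only up to matrices with rows in the kernel of p. Modulo these,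
  \<open>of_matrix\<close> is the inverse.\<close>

definition to_matrix :: "'s set \<Rightarrow> (('s \<Rightarrow> 'a) \<times> 'c \<Rightarrow> 'a) \<Rightarrow> 's \<times> 't \<Rightarrow> 'a" where
  "to_matrix S = free_ext R (free_module R (S \<times> T)) (\<lambda>xy q. fst xy (fst q) \<otimes> section_of (snd xy) (snd q))"

definition of_matrix :: "'s set \<Rightarrow> ('s \<times> 't \<Rightarrow> 'a) \<Rightarrow> ('s \<Rightarrow> 'a) \<times> 'c \<Rightarrow> 'a" where
  "of_matrix S = free_ext R (tensor_free R (free_module R S) N)
     (\<lambda>q. basis_vec R (basis_vec R (fst q), p (basis_vec R (snd q))))"

lemma section_of: "y \<in> carrier N \<Longrightarrow> section_of y \<in> vec T" "y \<in> carrier N \<Longrightarrow> p (section_of y) = y"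
  unfolding section_of_def using surj by (auto intro: inv_into_into simp: f_inv_into_f)

lemma pair_vec: "x \<in> vec S \<Longrightarrow> y \<in> carrier N \<Longrightarrow> (\<lambda>q. x (fst q) \<otimes> section_of y (snd q)) \<in> vec (S \<times> T)"
  by (rule vec_tensor) (auto intro: section_of)

lemma to_matrix_hom:
  "to_matrix S \<in> module_hom R (tensor_free R (free_module R S) N) (free_module R (S \<times> T))"
  unfolding to_matrix_def tensor_free_def by (rule free_ext_hom[OF module_free]) (auto intro: pair_vec)

lemma to_matrix_basis:
  assumes "x \<in> vec S" "y \<in> carrier N"
  shows "to_matrix S (basis_vec R (x, y)) = (\<lambda>q. x (fst q) \<otimes> section_of y (snd q))"
  unfolding to_matrix_def
  by (subst free_ext_basis_vec[OF module_free, where S = "vec S \<times> carrier N"]) (use assms in \<open>auto intro: pair_vec\<close>)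

lemma p_closed: "x \<in> vec T \<Longrightarrow> p x \<in> carrier N" by (rule module_hom_closed[OF p])

lemma of_matrix_gen:
  "(\<lambda>q. basis_vec R (basis_vec R (fst q), p (basis_vec R (snd q)))) \<in> S \<times> T \<rightarrow> carrier (tensor_free R (free_module R S) N)"
  by (auto intro!: tensor_free_basis module_free N p_closed)

lemma of_matrix_hom:
  "of_matrix S \<in> module_hom R (free_module R (S \<times> T)) (tensor_free R (free_module R S) N)"
  unfolding of_matrix_def by (rule free_ext_hom[OF module_tensor_free[OF module_free N] of_matrix_gen])

lemma of_matrix_basis:
  assumes "s \<in> S" "t \<in> T"
  shows "of_matrix S (basis_vec R (s, t)) = basis_vec R (basis_vec R s, p (basis_vec R t))"
  unfolding of_matrix_def
  by (subst free_ext_basis_vec[OF module_tensor_free[OF module_free N] of_matrix_gen]) (use assms in auto)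

abbreviation cong_tensor where
  "cong_tensor S \<equiv> tensor_cong (free_module R S) N"

text \<open>\<open>of_matrix\<close> is prescribed on matrix units only. Bilinearity of the tensor
  product extends the formula, first in y with x a basis vector, then in x.\<close>

lemma of_matrix_pair:
  fixes x :: "'s \<Rightarrow> 'a"
  assumes x: "x \<in> vec S" and y: "y \<in> vec T"
  shows "cong_tensor S (of_matrix S (\<lambda>q. x (fst q) \<otimes> y (snd q))) (basis_vec R (x, p y))"
proof -
  let ?F = "tensor_free R (free_module R S) N"
  interpret F: module R ?F by (rule module_tensor_free[OF module_free N])
  note rules = tensor_cong_trans[OF module_free N] tensor_cong_add[OF module_free N]
    tensor_cong_smult[OF module_free N] tensor_cong_sym[OF module_free N]
  note bil = tensor_cong_bilinear[OF module_free N]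
  have 1: "cong_tensor S (of_matrix S (\<lambda>q. basis_vec R s (fst q) \<otimes> y (snd q))) (basis_vec R (basis_vec R s, p y))"
    if s: "s \<in> S" and y: "y \<in> vec T" for s y
    using y
  proof (induction rule: vec_induct)
    case zero
    have "(\<lambda>q. basis_vec R s (fst q) \<otimes> \<zero>) = (\<lambda>q :: 's \<times> 't. \<zero>)" by (simp add: basis_vec_def)
    then show ?case
      using hom_vec(3)[OF of_matrix_hom F.module_axioms] hom_vec(3)[OF p N]
        rules(4)[OF tensor_cong_zero(2)[OF module_free N vec_basis[OF s]]] by simp
  next
    case (add y a t)
    let ?e = "\<lambda>q. basis_vec R s (fst q) \<otimes> y (snd q)"
    have e: "?e \<in> vec (S \<times> T)" by (rule vec_tensor[OF vec_basis[OF s] add(1)])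
    have st: "basis_vec R (s, t) \<in> vec (S \<times> T)" using s add by auto
    have yc: "y t \<in> carrier R" for t using vecD(1)[OF add(1)] .
    have "(\<lambda>q. basis_vec R s (fst q) \<otimes> (a \<otimes> basis_vec R t (snd q) \<oplus> y (snd q)))
        = (\<lambda>q. a \<otimes> basis_vec R (s, t) q \<oplus> ?e q)"
      using add(2) yc by (auto simp: basis_vec_def fun_eq_iff)
    then have "of_matrix S (\<lambda>q. basis_vec R s (fst q) \<otimes> (a \<otimes> basis_vec R t (snd q) \<oplus> y (snd q)))
        = a \<odot>\<^bsub>?F\<^esub> basis_vec R (basis_vec R s, p (basis_vec R t)) \<oplus>\<^bsub>?F\<^esub> of_matrix S ?e"
      using hom_vec(1)[OF of_matrix_hom vec_smult[OF add(2) st] e] hom_vec(2)[OF of_matrix_hom add(2) st]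
        of_matrix_basis[OF s add(3)] by simp
    moreover have "p (\<lambda>u. a \<otimes> basis_vec R t u \<oplus> y u) = a \<odot>\<^bsub>N\<^esub> p (basis_vec R t) \<oplus>\<^bsub>N\<^esub> p y"
      using hom_vec(1)[OF p vec_smult[OF add(2) vec_basis[OF add(3)]] add(1)]
        hom_vec(2)[OF p add(2) vec_basis[OF add(3)]] by simp
    moreover have "cong_tensor S (basis_vec R (basis_vec R s, a \<odot>\<^bsub>N\<^esub> p (basis_vec R t) \<oplus>\<^bsub>N\<^esub> p y))
        (basis_vec R (basis_vec R s, a \<odot>\<^bsub>N\<^esub> p (basis_vec R t)) \<oplus>\<^bsub>?F\<^esub> basis_vec R (basis_vec R s, p y))"
      by (rule bil(2)) (use s add p_closed in auto)
    moreover have "cong_tensor S (basis_vec R (basis_vec R s, a \<odot>\<^bsub>N\<^esub> p (basis_vec R t)))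
        (a \<odot>\<^bsub>?F\<^esub> basis_vec R (basis_vec R s, p (basis_vec R t)))"
      by (rule bil(4)) (use s add p_closed in auto)
    ultimately show ?case
      using rules(1)[OF rules(2)[OF rules(4) add(4)] rules(4)] by simp
  qed
  show ?thesis using x
  proof (induction rule: vec_induct)
    case zero
    have "(\<lambda>q. \<zero> \<otimes> y (snd q)) = (\<lambda>q :: 's \<times> 't. \<zero>)" using vecD(1)[OF y] by simp
    then show ?case
      using hom_vec(3)[OF of_matrix_hom F.module_axioms]
        rules(4)[OF tensor_cong_zero(1)[OF module_free N p_closed[OF y]]] by simp
  next
    case (add x a s)
    let ?e = "\<lambda>q. x (fst q) \<otimes> y (snd q)" and ?d = "\<lambda>q. basis_vec R s (fst q) \<otimes> y (snd q)"
    have e: "?e \<in> vec (S \<times> T)" by (rule vec_tensor[OF add(1) y])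
    have d: "?d \<in> vec (S \<times> T)" by (rule vec_tensor[OF vec_basis[OF add(3)] y])
    have "basis_vec R s u \<in> carrier R" for u by (simp add: basis_vec_def)
    then have "(\<lambda>q. (a \<otimes> basis_vec R s (fst q) \<oplus> x (fst q)) \<otimes> y (snd q)) = (\<lambda>q. a \<otimes> ?d q \<oplus> ?e q)"
      using add(2) vecD(1)[OF y] vecD(1)[OF add(1)] by (simp add: l_distr m_assoc)
    then have "of_matrix S (\<lambda>q. (a \<otimes> basis_vec R s (fst q) \<oplus> x (fst q)) \<otimes> y (snd q))
        = a \<odot>\<^bsub>?F\<^esub> of_matrix S ?d \<oplus>\<^bsub>?F\<^esub> of_matrix S ?e"
      using hom_vec(1)[OF of_matrix_hom vec_smult[OF add(2) d] e] hom_vec(2)[OF of_matrix_hom add(2) d] by simp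
    moreover have "cong_tensor S (a \<odot>\<^bsub>?F\<^esub> of_matrix S ?d) (a \<odot>\<^bsub>?F\<^esub> basis_vec R (basis_vec R s, p y))"
      by (rule rules(3)[OF add(2) 1[OF add(3) y]])
    moreover have "cong_tensor S (basis_vec R (\<lambda>u. a \<otimes> basis_vec R s u \<oplus> x u, p y))
        (basis_vec R (\<lambda>u. a \<otimes> basis_vec R s u, p y) \<oplus>\<^bsub>?F\<^esub> basis_vec R (x, p y))"
      using bil(1)[of "\<lambda>u. a \<otimes> basis_vec R s u" S x "p y"] add y p_closed by simp
    moreover have "cong_tensor S (basis_vec R (\<lambda>u. a \<otimes> basis_vec R s u, p y)) (a \<odot>\<^bsub>?F\<^esub> basis_vec R (basis_vec R s, p y))"
      using bil(3)[of a "basis_vec R s" S "p y"] add y p_closed by simp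
    ultimately show ?case
      using rules(1)[OF rules(2)[OF rules(1)[OF _ rules(4)] add(4)] rules(4)] by simp
  qed
qed

definition kernel_of where "kernel_of = {x \<in> vec T. p x = \<zero>\<^bsub>N\<^esub>}"

lemma kernel_of: "is_submodule R (free_module R T) kernel_of" "kernel_of \<subseteq> vec T"
  unfolding kernel_of_def using is_submodule_kernel[OF module_free N p] by auto

lemma of_to_matrix:
  assumes "c \<in> carrier (tensor_free R (free_module R S) N)"
  shows "cong_tensor S c (of_matrix S (to_matrix S c))"
proof -
  let ?F = "tensor_free R (free_module R S) N"
  interpret F: module R ?F by (rule module_tensor_free[OF module_free N])
  have h: "(\<lambda>c. of_matrix S (to_matrix S c)) \<in> module_hom R ?F ?F"
    by (rule module_hom_comp[OF to_matrix_hom of_matrix_hom])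
  note hc = module_hom_closed[OF h]
  have k: "(\<lambda>c. c \<ominus>\<^bsub>?F\<^esub> of_matrix S (to_matrix S c)) \<in> module_hom R ?F ?F"
    by (rule module_hom_diff[OF F.module_axioms module_hom_id h])
  have "c \<ominus>\<^bsub>?F\<^esub> of_matrix S (to_matrix S c) \<in> tensor_relations R (free_module R S) N"
  proof (rule tensor_free_into[OF module_free N F.module_axioms k tensor_relations_rules(1)[OF module_free N] _ assms])
    fix x y assume q: "x \<in> vec S" "y \<in> carrier N"
    have "cong_tensor S (of_matrix S (to_matrix S (basis_vec R (x, y)))) (basis_vec R (x, y))"
      using of_matrix_pair[OF q(1) section_of(1)[OF q(2)]] section_of(2)[OF q(2)]
      by (simp add: to_matrix_basis[OF q])
    from tensor_cong_sym[OF module_free N this]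
    show "basis_vec R (x, y) \<ominus>\<^bsub>?F\<^esub> of_matrix S (to_matrix S (basis_vec R (x, y))) \<in> tensor_relations R (free_module R S) N"
      by (simp add: tensor_cong_def)
  qed
  then show ?thesis using assms hc by (simp add: tensor_cong_def)
qed

lemma section_kernel:
  "y \<in> carrier N \<Longrightarrow> y' \<in> carrier N \<Longrightarrow>
     (\<lambda>t. section_of (y \<oplus>\<^bsub>N\<^esub> y') t \<ominus> (section_of y t \<oplus> section_of y' t)) \<in> kernel_of"
  "a \<in> carrier R \<Longrightarrow> y \<in> carrier N \<Longrightarrow>
     (\<lambda>t. section_of (a \<odot>\<^bsub>N\<^esub> y) t \<ominus> a \<otimes> section_of y t) \<in> kernel_of"
  "x \<in> vec T \<Longrightarrow> (\<lambda>t. section_of (p x) t \<ominus> x t) \<in> kernel_of"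
proof -
  have *: "(\<lambda>t. u t \<ominus> v t) \<in> kernel_of" if "u \<in> vec T" "v \<in> vec T" "p u = p v" for u v
    unfolding kernel_of_def using that hom_vec(4)[OF p N that(1,2)] p_closed[OF that(2)]
    by (simp add: vec_minus a_minus_def N.M.r_neg)
  show "y \<in> carrier N \<Longrightarrow> y' \<in> carrier N \<Longrightarrow>
     (\<lambda>t. section_of (y \<oplus>\<^bsub>N\<^esub> y') t \<ominus> (section_of y t \<oplus> section_of y' t)) \<in> kernel_of"
    by (rule *) (simp_all add: section_of vec_add hom_vec(1)[OF p])
  show "a \<in> carrier R \<Longrightarrow> y \<in> carrier N \<Longrightarrow>
     (\<lambda>t. section_of (a \<odot>\<^bsub>N\<^esub> y) t \<ominus> a \<otimes> section_of y t) \<in> kernel_of"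
    by (rule *) (simp_all add: section_of vec_smult hom_vec(2)[OF p])
  show "x \<in> vec T \<Longrightarrow> (\<lambda>t. section_of (p x) t \<ominus> x t) \<in> kernel_of"
    by (rule *) (simp_all add: section_of p_closed)
qed

text \<open>Relations in the first argument become the zero matrix; those in the second become x
  times a vector of \<open>section_kernel\<close>. Conversely, a matrix x l with p l = 0 represents
  x \<otimes> 0, and \<open>of_to_matrix\<close> leads back to c.\<close>

lemma tensor_relations_iff:
  assumes c: "c \<in> carrier (tensor_free R (free_module R S) N)"
  shows "c \<in> tensor_relations R (free_module R S) N \<longleftrightarrow> to_matrix S c \<in> tensor_span R (vec S) kernel_of"
proof
  let ?F = "tensor_free R (free_module R S) N"
  interpret F: module R ?F by (rule module_tensor_free[OF module_free N])
  interpret S: module R "free_module R S" by (rule module_free)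
  let ?H = "{c \<in> carrier ?F. to_matrix S c \<in> tensor_span R (vec S) kernel_of}"
  note d = tensor_free_basis[OF module_free N]
  note th = module_hom_minus[OF F.module_axioms module_free to_matrix_hom]
    module_hom_add[OF to_matrix_hom] module_hom_smult[OF to_matrix_hom]
  have sub: "is_submodule R (free_module R (S \<times> T)) (tensor_span R (vec S) kernel_of)"
    by (rule tensor_span_submodule[OF S.is_submodule_carrier kernel_of(2)])
  have 0: "(\<lambda>q. \<zero>) \<in> tensor_span R (vec S) kernel_of" by (rule tensor_span.zero)
  have pr: "(\<lambda>q. x (fst q) \<otimes> l (snd q)) \<in> tensor_span R (vec S) kernel_of"
    if "x \<in> vec S" "l \<in> kernel_of" for x l
    by (rule tensor_span_pair[OF that order.refl kernel_of(2)])
  have sc: "section_of y t \<in> carrier R" if "y \<in> carrier N" for y t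
    using vecD(1)[OF section_of(1)[OF that]] .
  have "tensor_relations R (free_module R S) N \<subseteq> ?H"
  proof (rule tensor_relations_rules(6)[OF module_free N])
    show "is_submodule R ?F ?H" by (rule is_submodule_vimage[OF F.module_axioms module_free to_matrix_hom sub])
    show "basis_vec R (x \<oplus>\<^bsub>free_module R S\<^esub> x', y) \<ominus>\<^bsub>?F\<^esub> (basis_vec R (x, y) \<oplus>\<^bsub>?F\<^esub> basis_vec R (x', y)) \<in> ?H"
      if x: "x \<in> vec S" "x' \<in> vec S" and y: "y \<in> carrier N" for x x' y
    proof -
      note dd = d[OF S.M.a_closed[OF x] y] d[OF x(1) y] d[OF x(2) y]
      note pv = pair_vec[OF S.M.a_closed[OF x] y] pair_vec[OF x(1) y] pair_vec[OF x(2) y]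
      have "to_matrix S (basis_vec R (x \<oplus>\<^bsub>free_module R S\<^esub> x', y) \<ominus>\<^bsub>?F\<^esub> (basis_vec R (x, y) \<oplus>\<^bsub>?F\<^esub> basis_vec R (x', y)))
        = (\<lambda>q. (x (fst q) \<oplus> x' (fst q)) \<otimes> section_of y (snd q) \<ominus>
            (x (fst q) \<otimes> section_of y (snd q) \<oplus> x' (fst q) \<otimes> section_of y (snd q)))"
        unfolding th(1)[OF dd(1) F.M.a_closed[OF dd(2,3)]] th(2)[OF dd(2,3)]
          to_matrix_basis[OF S.M.a_closed[OF x] y] to_matrix_basis[OF x(1) y] to_matrix_basis[OF x(2) y]
        using pv by (subst free_minus) (simp_all add: vec_add)
      also have "\<dots> = (\<lambda>q. \<zero>)"
        using vecD(1)[OF x(1)] vecD(1)[OF x(2)] sc[OF y] by (simp add: l_distr a_minus_def r_neg)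
      finally show ?thesis using dd 0 F.M.minus_closed F.M.a_closed by simp
    qed
    show "basis_vec R (x, y \<oplus>\<^bsub>N\<^esub> y') \<ominus>\<^bsub>?F\<^esub> (basis_vec R (x, y) \<oplus>\<^bsub>?F\<^esub> basis_vec R (x, y')) \<in> ?H"
      if x: "x \<in> vec S" and y: "y \<in> carrier N" "y' \<in> carrier N" for x y y'
    proof -
      note dd = d[OF x N.M.a_closed[OF y]] d[OF x y(1)] d[OF x y(2)]
      note pv = pair_vec[OF x N.M.a_closed[OF y]] pair_vec[OF x y(1)] pair_vec[OF x y(2)]
      have "to_matrix S (basis_vec R (x, y \<oplus>\<^bsub>N\<^esub> y') \<ominus>\<^bsub>?F\<^esub> (basis_vec R (x, y) \<oplus>\<^bsub>?F\<^esub> basis_vec R (x, y')))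
        = (\<lambda>q. x (fst q) \<otimes> section_of (y \<oplus>\<^bsub>N\<^esub> y') (snd q) \<ominus>
            (x (fst q) \<otimes> section_of y (snd q) \<oplus> x (fst q) \<otimes> section_of y' (snd q)))"
        unfolding th(1)[OF dd(1) F.M.a_closed[OF dd(2,3)]] th(2)[OF dd(2,3)]
          to_matrix_basis[OF x N.M.a_closed[OF y]] to_matrix_basis[OF x y(1)] to_matrix_basis[OF x y(2)]
        using pv by (subst free_minus) (simp_all add: vec_add)
      also have "\<dots> = (\<lambda>q. x (fst q) \<otimes> (section_of (y \<oplus>\<^bsub>N\<^esub> y') (snd q) \<ominus>
            (section_of y (snd q) \<oplus> section_of y' (snd q))))"
        using vecD(1)[OF x] sc[OF y(1)] sc[OF y(2)] sc[OF N.M.a_closed[OF y]]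
        by (simp add: r_distr a_minus_def r_minus)
      finally show ?thesis
        using pr[OF x section_kernel(1)[OF y]] dd F.M.minus_closed F.M.a_closed by simp
    qed
    show "basis_vec R (a \<odot>\<^bsub>free_module R S\<^esub> x, y) \<ominus>\<^bsub>?F\<^esub> (a \<odot>\<^bsub>?F\<^esub> basis_vec R (x, y)) \<in> ?H"
      if a: "a \<in> carrier R" and x: "x \<in> vec S" and y: "y \<in> carrier N" for a x y
    proof -
      note dd = d[OF S.smult_closed[OF a x] y] d[OF x y]
      note pv = pair_vec[OF S.smult_closed[OF a x] y] pair_vec[OF x y]
      have "to_matrix S (basis_vec R (a \<odot>\<^bsub>free_module R S\<^esub> x, y) \<ominus>\<^bsub>?F\<^esub> (a \<odot>\<^bsub>?F\<^esub> basis_vec R (x, y)))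
        = (\<lambda>q. a \<otimes> x (fst q) \<otimes> section_of y (snd q) \<ominus> a \<otimes> (x (fst q) \<otimes> section_of y (snd q)))"
        unfolding th(1)[OF dd(1) F.smult_closed[OF a dd(2)]] th(3)[OF a dd(2)]
          to_matrix_basis[OF S.smult_closed[OF a x] y] to_matrix_basis[OF x y]
        using pv a by (subst free_minus) (simp_all add: vec_smult)
      also have "\<dots> = (\<lambda>q. \<zero>)"
        using vecD(1)[OF x] a sc[OF y] by (simp add: m_assoc a_minus_def r_neg)
      finally show ?thesis using dd 0 a F.M.minus_closed F.smult_closed by simp
    qed
    show "basis_vec R (x, a \<odot>\<^bsub>N\<^esub> y) \<ominus>\<^bsub>?F\<^esub> (a \<odot>\<^bsub>?F\<^esub> basis_vec R (x, y)) \<in> ?H"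
      if a: "a \<in> carrier R" and x: "x \<in> vec S" and y: "y \<in> carrier N" for a x y
    proof -
      note dd = d[OF x N.smult_closed[OF a y]] d[OF x y]
      note pv = pair_vec[OF x N.smult_closed[OF a y]] pair_vec[OF x y]
      have "to_matrix S (basis_vec R (x, a \<odot>\<^bsub>N\<^esub> y) \<ominus>\<^bsub>?F\<^esub> (a \<odot>\<^bsub>?F\<^esub> basis_vec R (x, y)))
        = (\<lambda>q. x (fst q) \<otimes> section_of (a \<odot>\<^bsub>N\<^esub> y) (snd q) \<ominus> a \<otimes> (x (fst q) \<otimes> section_of y (snd q)))"
        unfolding th(1)[OF dd(1) F.smult_closed[OF a dd(2)]] th(3)[OF a dd(2)]
          to_matrix_basis[OF x N.smult_closed[OF a y]] to_matrix_basis[OF x y]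
        using pv a by (subst free_minus) (simp_all add: vec_smult)
      also have "\<dots> = (\<lambda>q. x (fst q) \<otimes> (section_of (a \<odot>\<^bsub>N\<^esub> y) (snd q) \<ominus> a \<otimes> section_of y (snd q)))"
        using vecD(1)[OF x] a sc[OF y] sc[OF N.smult_closed[OF a y]]
        by (simp add: r_distr a_minus_def r_minus m_lcomm)
      finally show ?thesis
        using pr[OF x section_kernel(2)[OF a y]] dd a F.M.minus_closed F.smult_closed by simp
    qed
  qed
  then show "c \<in> tensor_relations R (free_module R S) N \<Longrightarrow> to_matrix S c \<in> tensor_span R (vec S) kernel_of"
    by blast
next
  let ?F = "tensor_free R (free_module R S) N"
  interpret F: module R ?F by (rule module_tensor_free[OF module_free N])
  note rules = tensor_cong_trans[OF module_free N] tensor_cong_add[OF module_free N]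
  have "cong_tensor S (of_matrix S z) \<zero>\<^bsub>?F\<^esub>" if "z \<in> tensor_span R (vec S) kernel_of" for z
    using that
  proof induction
    case zero
    show ?case
      unfolding hom_vec(3)[OF of_matrix_hom F.module_axioms]
      by (rule tensor_cong_refl[OF module_free N F.M.zero_closed])
  next
    case (add z x l)
    have l: "l \<in> vec T" "p l = \<zero>\<^bsub>N\<^esub>" using add(3) by (auto simp: kernel_of_def)
    have zv: "z \<in> vec (S \<times> T)" by (rule tensor_span_vec[OF order.refl kernel_of(2) add(1)])
    have "of_matrix S (\<lambda>q. x (fst q) \<otimes> l (snd q) \<oplus> z q)
      = of_matrix S (\<lambda>q. x (fst q) \<otimes> l (snd q)) \<oplus>\<^bsub>?F\<^esub> of_matrix S z"
      by (rule hom_vec(1)[OF of_matrix_hom vec_tensor[OF add(2) l(1)] zv])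
    moreover have "cong_tensor S (of_matrix S (\<lambda>q. x (fst q) \<otimes> l (snd q))) \<zero>\<^bsub>?F\<^esub>"
      using rules(1)[OF of_matrix_pair[OF add(2) l(1)]] tensor_cong_zero(2)[OF module_free N add(2)] l(2) by simp
    ultimately show ?case using rules(2)[OF _ add(4)] by fastforce
  qed
  from rules(1)[OF of_to_matrix[OF c] this]
  show "to_matrix S c \<in> tensor_span R (vec S) kernel_of \<Longrightarrow> c \<in> tensor_relations R (free_module R S) N"
    unfolding tensor_relations_cong[OF module_free N] .
qed

lemma to_of_matrix:
  assumes "z \<in> vec (S \<times> T)"
  shows "(\<lambda>q. to_matrix S (of_matrix S z) q \<ominus> z q) \<in> tensor_span R (vec S) kernel_of"
proof -
  interpret S: module R "free_module R S" by (rule module_free)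
  let ?G = "free_module R (S \<times> T)"
  have h: "(\<lambda>z. to_matrix S (of_matrix S z)) \<in> module_hom R ?G ?G"
    by (rule module_hom_comp[OF of_matrix_hom to_matrix_hom])
  have "to_matrix S (of_matrix S z) \<ominus>\<^bsub>?G\<^esub> z \<in> tensor_span R (vec S) kernel_of"
  proof (rule hom_vec_into[OF module_free module_hom_diff[OF module_free h module_hom_id]
        tensor_span_submodule[OF S.is_submodule_carrier kernel_of(2)] _ assms])
    fix q assume "q \<in> S \<times> T"
    then obtain s t where q: "q = (s, t)" "s \<in> S" "t \<in> T" by auto
    note s = vec_basis[OF q(2)] and t = vec_basis[OF q(3)]
    have b: "basis_vec R q = (\<lambda>q. basis_vec R s (fst q) \<otimes> basis_vec R t (snd q))"
      by (auto simp: basis_vec_def q fun_eq_iff)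
    have c: "basis_vec R s u \<in> carrier R" "basis_vec R t v \<in> carrier R"
      "section_of (p (basis_vec R t)) v \<in> carrier R" for u v
      using vecD(1)[OF section_of(1)[OF p_closed[OF t]]] by (auto simp: basis_vec_def)
    have "to_matrix S (of_matrix S (basis_vec R q)) \<ominus>\<^bsub>?G\<^esub> basis_vec R q =
        (\<lambda>q. basis_vec R s (fst q) \<otimes> (section_of (p (basis_vec R t)) (snd q) \<ominus> basis_vec R t (snd q)))"
      unfolding q(1) of_matrix_basis[OF q(2,3)] to_matrix_basis[OF s p_closed[OF t]]
      using q by (subst free_minus[OF pair_vec[OF s p_closed[OF t]] vec_basis])
        (simp_all add: b[unfolded q(1)] c r_distr a_minus_def r_minus)
    then show "to_matrix S (of_matrix S (basis_vec R q)) \<ominus>\<^bsub>?G\<^esub> basis_vec R q \<in> tensor_span R (vec S) kernel_of"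
      using tensor_span_pair[OF s section_kernel(3)[OF t] order.refl kernel_of(2)] by simp
  qed
  then show ?thesis using free_minus[OF module_hom_closed[OF h assms] assms] by simp
qed

text \<open>The map on representatives that underlies \<open>tensor_map\<close>.\<close>

definition lift_map :: "'s1 set \<Rightarrow> (('s \<Rightarrow> 'a) \<Rightarrow> 's1 \<Rightarrow> 'a) \<Rightarrow> (('s \<Rightarrow> 'a) \<times> 'c \<Rightarrow> 'a) \<Rightarrow> ('s1 \<Rightarrow> 'a) \<times> 'c \<Rightarrow> 'a" where
  "lift_map S' f = free_ext R (tensor_free R (free_module R S') N) (\<lambda>(x, y). basis_vec R (f x, y))"

context
  fixes f :: "('s \<Rightarrow> 'a) \<Rightarrow> 's1 \<Rightarrow> 'a" and S S'
  assumes f: "f \<in> module_hom R (free_module R S) (free_module R S')"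
begin

lemma lift_map_gen: "(\<lambda>(x, y). basis_vec R (f x, y)) \<in> vec S \<times> carrier N \<rightarrow> carrier (tensor_free R (free_module R S') N)"
  by (auto intro!: tensor_free_basis module_free N module_hom_closed[OF f])

lemma lift_map_hom:
  "lift_map S' f \<in> module_hom R (tensor_free R (free_module R S) N) (tensor_free R (free_module R S') N)"
  unfolding lift_map_def tensor_free_def[where M = "free_module R S"]
  by (rule free_ext_hom[OF module_tensor_free[OF module_free N] lift_map_gen])

text \<open>This naturality replaces f \<otimes> id on tensors by \<open>col_map f\<close> on
  matrices; both sides are linear and agree on pairs.\<close>

lemma to_matrix_lift_map:
  assumes "c \<in> carrier (tensor_free R (free_module R S) N)"
  shows "to_matrix S' (lift_map S' f c) = col_map f (to_matrix S c)"
proof (rule hom_vec_eq[where h = "\<lambda>c. to_matrix S' (lift_map S' f c)" and h' = "\<lambda>c. col_map f (to_matrix S c)"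
      and f = c and S = "vec S \<times> carrier N", OF module_free])
  show "(\<lambda>c. to_matrix S' (lift_map S' f c)) \<in> module_hom R (free_module R (vec S \<times> carrier N)) (free_module R (S' \<times> T))"
    using module_hom_comp[OF lift_map_hom to_matrix_hom] by (simp add: tensor_free_def)
  show "(\<lambda>c. col_map f (to_matrix S c)) \<in> module_hom R (free_module R (vec S \<times> carrier N)) (free_module R (S' \<times> T))"
    using module_hom_comp[OF to_matrix_hom col_map_hom[OF f]] by (simp add: tensor_free_def)
  show "c \<in> vec (vec S \<times> carrier N)" using assms by (simp add: tensor_free_def)
  fix q assume "q \<in> vec S \<times> carrier N"
  then obtain x y where q: "q = (x, y)" "x \<in> vec S" "y \<in> carrier N" by auto
  have "lift_map S' f (basis_vec R q) = basis_vec R (f x, y)"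
    unfolding lift_map_def
    by (subst free_ext_basis_vec[OF module_tensor_free[OF module_free N] lift_map_gen]) (use q in auto)
  then show "to_matrix S' (lift_map S' f (basis_vec R q)) = col_map f (to_matrix S (basis_vec R q))"
    unfolding q(1) using to_matrix_basis[OF module_hom_closed[OF f q(2)] q(3)] to_matrix_basis[OF q(2,3)]
      col_map_pair[where y = "section_of y", OF f q(2) vecD(1)[OF section_of(1)[OF q(3)]]] by simp
qed

lemma lift_map_relations:
  assumes "c \<in> tensor_relations R (free_module R S) N"
  shows "lift_map S' f c \<in> tensor_relations R (free_module R S') N"
proof -
  have c: "c \<in> carrier (tensor_free R (free_module R S) N)"
    using is_submoduleD(2)[OF tensor_relations_rules(1)[OF module_free N] assms] .
  have "f ` vec S \<subseteq> vec S'" using module_hom_closed[OF f] by auto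
  from tensor_span_mono[OF this order.refl col_map_span[OF f order.refl kernel_of(2)]]
  have "col_map f (to_matrix S c) \<in> tensor_span R (vec S') kernel_of"
    using assms tensor_relations_iff[OF c] by blast
  then show ?thesis
    using tensor_relations_iff[OF module_hom_closed[OF lift_map_hom c]] to_matrix_lift_map[OF c] by simp
qed

end

end

section \<open>Cosets and the homology of a tensored complex\<close>

lemma image_eq_singleton: "A \<noteq> {} \<Longrightarrow> (\<And>x. x \<in> A \<Longrightarrow> f x = b) \<Longrightarrow> f ` A = {b}"
  by auto

context module
begin

lemma is_submodule_minus_trans:
  assumes H: "is_submodule R M H" and c: "a \<in> carrier M" "b \<in> carrier M" "c \<in> carrier M"
    and "a \<ominus>\<^bsub>M\<^esub> b \<in> H" "b \<ominus>\<^bsub>M\<^esub> c \<in> H"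
  shows "a \<ominus>\<^bsub>M\<^esub> c \<in> H"
proof -
  have "(a \<ominus>\<^bsub>M\<^esub> b) \<oplus>\<^bsub>M\<^esub> (b \<ominus>\<^bsub>M\<^esub> c) \<in> H" using is_submoduleD(4)[OF H] assms by blast
  moreover have "(a \<ominus>\<^bsub>M\<^esub> b) \<oplus>\<^bsub>M\<^esub> (b \<ominus>\<^bsub>M\<^esub> c) = a \<ominus>\<^bsub>M\<^esub> c"
  proof -
    have "(a \<oplus>\<^bsub>M\<^esub> \<ominus>\<^bsub>M\<^esub> b) \<oplus>\<^bsub>M\<^esub> (b \<oplus>\<^bsub>M\<^esub> \<ominus>\<^bsub>M\<^esub> c) = a \<oplus>\<^bsub>M\<^esub> ((\<ominus>\<^bsub>M\<^esub> b \<oplus>\<^bsub>M\<^esub> b) \<oplus>\<^bsub>M\<^esub> \<ominus>\<^bsub>M\<^esub> c)"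
      using c by (simp add: M.a_assoc del: M.l_neg)
    then show ?thesis using c by (simp add: a_minus_def M.l_neg)
  qed
  ultimately show ?thesis by simp
qed

lemma is_submodule_minus_sym:
  assumes H: "is_submodule R M H" and c: "a \<in> carrier M" "b \<in> carrier M" and "a \<ominus>\<^bsub>M\<^esub> b \<in> H"
  shows "b \<ominus>\<^bsub>M\<^esub> a \<in> H"
  using is_submodule_neg[OF H assms(4)] c by (simp add: a_minus_def M.minus_add M.a_comm)

lemma minus_zero_right: "a \<in> carrier M \<Longrightarrow> a \<ominus>\<^bsub>M\<^esub> \<zero>\<^bsub>M\<^esub> = a"
proof -
  have z: "\<ominus>\<^bsub>M\<^esub> \<zero>\<^bsub>M\<^esub> = \<zero>\<^bsub>M\<^esub>"
    using M.r_neg[OF M.zero_closed] M.l_zero[OF M.a_inv_closed[OF M.zero_closed]] by simp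
  show "a \<in> carrier M \<Longrightarrow> ?thesis" by (simp add: a_minus_def z)
qed

lemma minus_minus_cancel: "a \<in> carrier M \<Longrightarrow> u \<in> carrier M \<Longrightarrow> a \<ominus>\<^bsub>M\<^esub> (a \<ominus>\<^bsub>M\<^esub> u) = u"
  by (simp add: a_minus_def M.minus_add M.r_neg2)

lemma is_submodule_minus_left:
  assumes H: "is_submodule R M H" and "a \<in> carrier M" "b \<in> H"
  shows "a \<ominus>\<^bsub>M\<^esub> b \<in> H \<longleftrightarrow> a \<in> H"
proof
  assume "a \<ominus>\<^bsub>M\<^esub> b \<in> H"
  moreover have "b \<ominus>\<^bsub>M\<^esub> \<zero>\<^bsub>M\<^esub> \<in> H" using minus_zero_right is_submoduleD(2)[OF H] assms by simp
  ultimately have "a \<ominus>\<^bsub>M\<^esub> \<zero>\<^bsub>M\<^esub> \<in> H"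
    by (intro is_submodule_minus_trans[OF H assms(2) is_submoduleD(2)[OF H assms(3)] M.zero_closed])
  then show "a \<in> H" using minus_zero_right assms(2) by simp
qed (rule is_submodule_minus[OF H _ assms(3)])

lemma is_submodule_minus_right:
  assumes H: "is_submodule R M H" and "a \<in> H" "b \<in> carrier M" "a \<ominus>\<^bsub>M\<^esub> b \<in> H"
  shows "b \<in> H"
  using is_submodule_minus_left[OF H assms(3,2)] is_submodule_minus_sym[OF H _ assms(3,4)]
    is_submoduleD(2)[OF H assms(2)] by simp

end

context free_cover
begin

abbreviation tensor_class where
  "tensor_class S c \<equiv> tensor_relations R (free_module R S) N +>\<^bsub>tensor_free R (free_module R S) N\<^esub> c"

lemma tensor_classes:
  shows "carrier (tensor_module R (free_module R S) N) = tensor_class S ` carrier (tensor_free R (free_module R S) N)"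
    "\<zero>\<^bsub>tensor_module R (free_module R S) N\<^esub> = tensor_relations R (free_module R S) N"
    "c \<in> carrier (tensor_free R (free_module R S) N) \<Longrightarrow> c' \<in> carrier (tensor_free R (free_module R S) N) \<Longrightarrow>
      tensor_class S c \<oplus>\<^bsub>tensor_module R (free_module R S) N\<^esub> tensor_class S c'
        = tensor_class S (c \<oplus>\<^bsub>tensor_free R (free_module R S) N\<^esub> c')"
    "c \<in> carrier (tensor_free R (free_module R S) N) \<Longrightarrow>
      tensor_class S c = tensor_relations R (free_module R S) N \<longleftrightarrow> c \<in> tensor_relations R (free_module R S) N"
    "c \<in> carrier (tensor_free R (free_module R S) N) \<Longrightarrow> c' \<in> carrier (tensor_free R (free_module R S) N) \<Longrightarrow>
      tensor_class S c = tensor_class S c' \<longleftrightarrow>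
        c \<ominus>\<^bsub>tensor_free R (free_module R S) N\<^esub> c' \<in> tensor_relations R (free_module R S) N"
    "tensor_relations R (free_module R S) N = tensor_class S \<zero>\<^bsub>tensor_free R (free_module R S) N\<^esub>"
proof -
  let ?F = "tensor_free R (free_module R S) N" and ?H = "tensor_relations R (free_module R S) N"
  interpret F: module R ?F by (rule module_tensor_free[OF module_free N])
  have sub: "is_submodule R ?F ?H" by (rule tensor_relations_rules(1)[OF module_free N])
  interpret H: abelian_subgroup ?H ?F by (rule F.is_submodule_abelian_subgroup[OF sub])
  show "carrier (tensor_module R (free_module R S) N) = tensor_class S ` carrier ?F"
    by (auto simp: tensor_module_def quotient_module_def A_RCOSETS_def')
  show "\<zero>\<^bsub>tensor_module R (free_module R S) N\<^esub> = ?H"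
    by (simp add: tensor_module_def quotient_module_def)
  show "c \<in> carrier ?F \<Longrightarrow> c' \<in> carrier ?F \<Longrightarrow>
      tensor_class S c \<oplus>\<^bsub>tensor_module R (free_module R S) N\<^esub> tensor_class S c' = tensor_class S (c \<oplus>\<^bsub>?F\<^esub> c')"
    using H.a_rcos_sum by (simp add: tensor_module_def quotient_module_def)
  show 1: "tensor_class S c = ?H \<longleftrightarrow> c \<in> ?H" if "c \<in> carrier ?F" for c
    using F.M.a_coset_join1[OF _ that H.a_subgroup] F.M.a_coset_join2[OF that H.a_subgroup] by blast
  show 0: "?H = tensor_class S \<zero>\<^bsub>?F\<^esub>"
    using 1[OF F.M.zero_closed] is_submoduleD(3)[OF sub] by simp
  show "tensor_class S c = tensor_class S c' \<longleftrightarrow> c \<ominus>\<^bsub>?F\<^esub> c' \<in> ?H"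
    if c: "c \<in> carrier ?F" "c' \<in> carrier ?F" for c c'
  proof
    assume "tensor_class S c = tensor_class S c'"
    then have "c \<in> tensor_class S c'" using H.a_rcos_self[OF c(1)] by simp
    then obtain h where h: "h \<in> ?H" "c = h \<oplus>\<^bsub>?F\<^esub> c'" by (auto simp: a_r_coset_def')
    then have "c \<ominus>\<^bsub>?F\<^esub> c' = h"
      using c is_submoduleD(2)[OF sub] by (simp add: a_minus_def F.M.a_assoc F.M.r_neg)
    then show "c \<ominus>\<^bsub>?F\<^esub> c' \<in> ?H" using h by simp
  next
    assume "c \<ominus>\<^bsub>?F\<^esub> c' \<in> ?H"
    then have "(c \<ominus>\<^bsub>?F\<^esub> c') \<oplus>\<^bsub>?F\<^esub> c' \<in> tensor_class S c'" by (auto simp: a_r_coset_def')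
    then have "c \<in> tensor_class S c'" using c by (simp add: a_minus_def F.M.a_assoc F.M.l_neg)
    then show "tensor_class S c = tensor_class S c'"
      using F.M.a_repr_independence[OF _ c(2) H.a_subgroup] by simp
  qed
qed

lemma tensor_map_class:
  assumes f: "f \<in> module_hom R (free_module R S) (free_module R S')"
    and c: "c \<in> carrier (tensor_free R (free_module R S) N)"
  shows "tensor_map R (free_module R S') N f (tensor_class S c) = tensor_class S' (lift_map S' f c)"
proof -
  let ?F = "tensor_free R (free_module R S) N" and ?H = "tensor_relations R (free_module R S) N"
  interpret F: module R ?F by (rule module_tensor_free[OF module_free N])
  have sub: "is_submodule R ?F ?H" by (rule tensor_relations_rules(1)[OF module_free N])
  interpret H: abelian_subgroup ?H ?F by (rule F.is_submodule_abelian_subgroup[OF sub])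
  have *: "tensor_class S' (lift_map S' f d) = tensor_class S' (lift_map S' f c)" if "d \<in> tensor_class S c" for d
  proof -
    have d: "d \<in> carrier ?F" using that F.M.a_r_coset_subset_G[OF is_submoduleD(1)[OF sub] c] by blast
    have "tensor_class S d = tensor_class S c"
      using F.M.a_repr_independence[OF that c H.a_subgroup] by simp
    then have "d \<ominus>\<^bsub>?F\<^esub> c \<in> ?H" using tensor_classes(5)[OF d c] by simp
    from lift_map_relations[OF f this] show ?thesis
      using tensor_classes(5)[OF module_hom_closed[OF lift_map_hom[OF f] d] module_hom_closed[OF lift_map_hom[OF f] c]]
        module_hom_minus[OF F.module_axioms module_tensor_free[OF module_free N] lift_map_hom[OF f] d c] by simp
  qed
  have "c \<in> tensor_class S c" by (rule H.a_rcos_self[OF c])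
  then have "(\<Union>d\<in>tensor_class S c. tensor_class S' (lift_map S' f d)) = tensor_class S' (lift_map S' f c)"
    using * by blast
  then show ?thesis unfolding tensor_map_def lift_map_def .
qed

text \<open>A cycle lifts to a matrix \<open>z\<close> whose boundary has its columns in the image of \<open>f1\<close> and its rows in
  the kernel of \<open>p\<close>; the cycle is a boundary iff the boundary of \<open>z\<close> is decomposable.\<close>

lemma tensor_homology_trivial_iff:
  fixes S0 S1 S2 :: "'s set"
  assumes f2: "f2 \<in> module_hom R (free_module R S2) (free_module R S1)"
    and f1: "f1 \<in> module_hom R (free_module R S1) (free_module R S0)"
    and exact: "f2 ` vec S2 = {x \<in> vec S1. f1 x = (\<lambda>s. \<zero>)}"
  defines "TM S \<equiv> tensor_module R (free_module R S) N"
  shows "trivial_module (quotient_module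
      ((TM S1)\<lparr>carrier := {X \<in> carrier (TM S1). tensor_map R (free_module R S0) N f1 X = \<zero>\<^bsub>TM S0\<^esub>}\<rparr>)
      (tensor_map R (free_module R S1) N f2 ` carrier (TM S2)))
    \<longleftrightarrow> tor_independent R S0 (f1 ` vec S1) T kernel_of"
    (is "trivial_module (quotient_module ?C ?B) \<longleftrightarrow> _")
proof -
  let ?F = "\<lambda>S. tensor_free R (free_module R S) N" and ?H = "\<lambda>S. tensor_relations R (free_module R S) N"
  let ?g1 = "lift_map S0 f1" and ?g2 = "lift_map S1 f2"
  interpret F0: module R "?F S0" by (rule module_tensor_free[OF module_free N])
  interpret F1: module R "?F S1" by (rule module_tensor_free[OF module_free N])
  interpret F2: module R "?F S2" by (rule module_tensor_free[OF module_free N])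
  note g1 = lift_map_hom[OF f1] and g2 = lift_map_hom[OF f2]
  note g1c = module_hom_closed[OF g1] and g2c = module_hom_closed[OF g2]
  have B: "?B = (\<lambda>c. tensor_class S1 (?g2 c)) ` carrier (?F S2)"
    unfolding TM_def tensor_classes(1) image_image using tensor_map_class[OF f2] by (intro image_cong) auto
  have C: "carrier ?C = tensor_class S1 ` {c \<in> carrier (?F S1). ?g1 c \<in> ?H S0}"
    unfolding TM_def tensor_classes(1,2) using tensor_map_class[OF f1] tensor_classes(4)[OF g1c] by auto
  have zB: "?H S1 \<in> ?B"
    unfolding B using module_hom_zero[OF F2.module_axioms F1.module_axioms g2] F2.M.zero_closed tensor_classes(6)[of S1]
    by (metis (no_types, lifting) image_eqI)
  have cos: "?B +>\<^bsub>?C\<^esub> X = {b \<oplus>\<^bsub>TM S1\<^esub> X | b. b \<in> ?B}" for X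
    by (auto simp: a_r_coset_def')
  have triv: "trivial_module (quotient_module ?C ?B) \<longleftrightarrow> (\<lambda>X. ?B +>\<^bsub>?C\<^esub> X) ` carrier ?C = {?B}"
  proof -
    have "carrier (quotient_module ?C ?B) = a_rcosets\<^bsub>?C\<^esub> ?B" "\<zero>\<^bsub>quotient_module ?C ?B\<^esub> = ?B"
      by (simp_all only: quotient_module_def partial_object.simps monoid.simps ring.simps)
    moreover have "a_rcosets\<^bsub>?C\<^esub> ?B = (\<lambda>X. ?B +>\<^bsub>?C\<^esub> X) ` carrier ?C" unfolding A_RCOSETS_def' by (rule UNION_singleton_eq_range)
    ultimately show ?thesis unfolding trivial_module_def by simp
  qed
  have z1: "\<zero>\<^bsub>?F S1\<^esub> \<in> {c \<in> carrier (?F S1). ?g1 c \<in> ?H S0}"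
    using module_hom_zero[OF F1.module_axioms F0.module_axioms g1]
      is_submoduleD(3)[OF tensor_relations_rules(1)[OF module_free N]] by simp
  \<comment> \<open>Triviality says that every coset of \<open>?B\<close> by a cycle is
    \<open>?B\<close> itself. As the zero class lies in \<open>?B\<close>, each cycle lies in its
    own coset; conversely, \<open>?B\<close> absorbs its own elements because its elements come from
    sums in the degree of \<open>S2\<close>.\<close>
  have "trivial_module (quotient_module ?C ?B) \<longleftrightarrow> carrier ?C \<subseteq> ?B"
    unfolding triv
  proof
    assume t: "(\<lambda>X. ?B +>\<^bsub>?C\<^esub> X) ` carrier ?C = {?B}"
    show "carrier ?C \<subseteq> ?B"
    proof
      fix X assume X: "X \<in> carrier ?C"
      then obtain c where c: "c \<in> carrier (?F S1)" "X = tensor_class S1 c" unfolding C by blast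
      have "?H S1 \<oplus>\<^bsub>TM S1\<^esub> X \<in> ?B +>\<^bsub>?C\<^esub> X" unfolding cos using zB by blast
      moreover have "?H S1 \<oplus>\<^bsub>TM S1\<^esub> X = X"
        unfolding c(2) TM_def using tensor_classes(3)[OF F1.M.zero_closed c(1)] c(1)
        by (simp add: tensor_classes(6)[symmetric])
      moreover have "?B +>\<^bsub>?C\<^esub> X = ?B"
        using imageI[OF X, of "\<lambda>X. ?B +>\<^bsub>?C\<^esub> X"] unfolding t by (simp only: singleton_iff)
      ultimately show "X \<in> ?B" by (simp only:)
    qed
  next
    assume sub: "carrier ?C \<subseteq> ?B"
    have "?B +>\<^bsub>?C\<^esub> X = ?B" if X: "X \<in> carrier ?C" for X
    proof -
      obtain x where x: "x \<in> carrier (?F S2)" "X = tensor_class S1 (?g2 x)" using X sub unfolding B by blast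
      show ?thesis unfolding cos
      proof (intro equalityI subsetI)
        fix Y assume "Y \<in> {b \<oplus>\<^bsub>TM S1\<^esub> X | b. b \<in> ?B}"
        then obtain b where b: "b \<in> carrier (?F S2)" "Y = tensor_class S1 (?g2 b) \<oplus>\<^bsub>TM S1\<^esub> X" unfolding B by blast
        have "Y = tensor_class S1 (?g2 (b \<oplus>\<^bsub>?F S2\<^esub> x))"
          unfolding b(2) x(2) TM_def module_hom_add[OF g2 b(1) x(1)] by (rule tensor_classes(3)[OF g2c g2c]) fact+
        then show "Y \<in> ?B" unfolding B using F2.M.a_closed[OF b(1) x(1)] by blast
      next
        fix Y assume "Y \<in> ?B"
        then obtain b where b: "b \<in> carrier (?F S2)" "Y = tensor_class S1 (?g2 b)" unfolding B by blast
        have bx: "b \<ominus>\<^bsub>?F S2\<^esub> x \<in> carrier (?F S2)" using b x by (intro F2.M.minus_closed)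
        have "(b \<ominus>\<^bsub>?F S2\<^esub> x) \<oplus>\<^bsub>?F S2\<^esub> x = b" using b x by (simp add: a_minus_def F2.M.a_assoc F2.M.l_neg)
        then have "Y = tensor_class S1 (?g2 (b \<ominus>\<^bsub>?F S2\<^esub> x)) \<oplus>\<^bsub>TM S1\<^esub> X"
          unfolding b(2) x(2) TM_def tensor_classes(3)[OF g2c[OF bx] g2c[OF x(1)]]
            module_hom_add[OF g2 bx x(1), symmetric] by simp
        moreover have "tensor_class S1 (?g2 (b \<ominus>\<^bsub>?F S2\<^esub> x)) \<in> ?B" unfolding B using bx by blast
        ultimately show "Y \<in> {b \<oplus>\<^bsub>TM S1\<^esub> X | b. b \<in> ?B}" by blast
      qed
    qed
    moreover have "carrier ?C \<noteq> {}" unfolding C using z1 by blast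
    ultimately show "(\<lambda>X. ?B +>\<^bsub>?C\<^esub> X) ` carrier ?C = {?B}" by (intro image_eq_singleton)
  qed
  also have "\<dots> \<longleftrightarrow> (\<forall>c \<in> carrier (?F S1). ?g1 c \<in> ?H S0 \<longrightarrow>
      (\<exists>c' \<in> carrier (?F S2). c \<ominus>\<^bsub>?F S1\<^esub> ?g2 c' \<in> ?H S1))"
  proof -
    have "tensor_class S1 c \<in> ?B \<longleftrightarrow> (\<exists>c' \<in> carrier (?F S2). c \<ominus>\<^bsub>?F S1\<^esub> ?g2 c' \<in> ?H S1)"
      if c: "c \<in> carrier (?F S1)" for c
      unfolding B image_iff using tensor_classes(5)[OF c g2c] by (intro bex_cong refl)
    then show ?thesis unfolding C image_subset_iff by (simp only: mem_Collect_eq Ball_def) blast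
  qed
  also have "\<dots> \<longleftrightarrow> tor_independent R S0 (f1 ` vec S1) T kernel_of"
  proof -
    let ?D = "\<lambda>S. tensor_span R (vec S) kernel_of" and ?E = "tensor_span R (f1 ` vec S1) kernel_of"
    let ?G = "\<lambda>S. free_module R (S \<times> T)"
    interpret S0: module R "free_module R S0" by (rule module_free)
    interpret S1: module R "free_module R S1" by (rule module_free)
    interpret S2: module R "free_module R S2" by (rule module_free)
    interpret G0: module R "?G S0" by (rule module_free)
    interpret G1: module R "?G S1" by (rule module_free)
    have D1: "is_submodule R (?G S1) (?D S1)"
      by (rule tensor_span_submodule[OF S1.is_submodule_carrier kernel_of(2)])
    have D0: "is_submodule R (?G S0) (?D S0)"
      by (rule tensor_span_submodule[OF S0.is_submodule_carrier kernel_of(2)])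
    have f1S: "f1 ` vec S1 \<subseteq> vec S0" and f2S: "f2 ` vec S2 \<subseteq> vec S1"
      using module_hom_closed[OF f1] module_hom_closed[OF f2] by auto
    have E: "is_submodule R (?G S0) ?E"
      by (rule tensor_span_submodule[OF is_submodule_image[OF module_free module_free f1 S1.is_submodule_carrier] kernel_of(2)])
    have ED: "?E \<subseteq> ?D S0" by (intro subsetI tensor_span_mono[OF f1S order.refl])
    note k1 = col_map_hom[OF f1, where T = T] and k2 = col_map_hom[OF f2, where T = T]
    note k1c = module_hom_closed[OF k1] and k2c = module_hom_closed[OF k2]
    note k1m = module_hom_minus[OF module_free module_free k1] and k2m = module_hom_minus[OF module_free module_free k2]
    note tc = module_hom_closed[OF to_matrix_hom] and oc = module_hom_closed[OF of_matrix_hom]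
    have kk: "col_map f1 (col_map f2 x) = \<zero>\<^bsub>?G S0\<^esub>" if "x \<in> vec (S2 \<times> T)" for x
    proof -
      have "col_map f2 x \<in> tensor_span R (f2 ` vec S2) (vec T)"
        using that col_map_span[OF f2 order.refl order.refl] unfolding vec_Times by blast
      then show ?thesis unfolding exact using col_map_eq_zero[OF f1 order.refl] by simp
    qed
    have to: "to_matrix S (of_matrix S z) \<ominus>\<^bsub>?G S\<^esub> z \<in> ?D S" if "z \<in> vec (S \<times> T)" for z and S :: "'s set"
      using to_of_matrix[OF that] by (simp add: free_minus[OF tc[OF oc[OF that]] that])
    show ?thesis
    proof
    assume *: "\<forall>c \<in> carrier (?F S1). ?g1 c \<in> ?H S0 \<longrightarrow>
      (\<exists>c' \<in> carrier (?F S2). c \<ominus>\<^bsub>?F S1\<^esub> ?g2 c' \<in> ?H S1)"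
    show "tor_independent R S0 (f1 ` vec S1) T kernel_of"
      unfolding tor_independent_def
    proof
      fix v assume "v \<in> tensor_span R (f1 ` vec S1) (vec T) \<inter> ?D S0"
      then have v: "v \<in> tensor_span R (f1 ` vec S1) (vec T)" "v \<in> ?D S0" by auto
      from col_map_lift[OF f1 order.refl order.refl v(1)]
      obtain z where z: "z \<in> vec (S1 \<times> T)" "col_map f1 z = v" unfolding vec_Times .
      define c where "c = of_matrix S1 z"
      have c: "c \<in> carrier (?F S1)" unfolding c_def by (rule oc[OF z(1)])
      \<comment> \<open>Turning \<open>z\<close> into the tensor \<open>c\<close> and back alters it
        by rows in the kernel of p, and f1 carries this error into \<open>?E\<close>. Hence
        \<open>c\<close> is a cycle, and the error does no harm in the conclusion either.\<close>
      have "col_map f1 (to_matrix S1 c \<ominus>\<^bsub>?G S1\<^esub> z) \<in> ?E"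
        unfolding c_def by (rule col_map_span[OF f1 order.refl kernel_of(2) to[OF z(1)]])
      then have cv: "col_map f1 (to_matrix S1 c) \<ominus>\<^bsub>?G S0\<^esub> v \<in> ?E"
        unfolding k1m[OF tc[OF c] z(1)] z(2) .
      then have "col_map f1 (to_matrix S1 c) \<in> ?D S0"
        using G0.is_submodule_minus_left[OF D0 k1c[OF tc[OF c]] v(2)] ED by blast
      then have "?g1 c \<in> ?H S0"
        using tensor_relations_iff[OF g1c[OF c]] to_matrix_lift_map[OF f1 c] by simp
      then obtain c' where c': "c' \<in> carrier (?F S2)" "c \<ominus>\<^bsub>?F S1\<^esub> ?g2 c' \<in> ?H S1"
        using * c by blast
      have "to_matrix S1 (c \<ominus>\<^bsub>?F S1\<^esub> ?g2 c') \<in> ?D S1"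
        using tensor_relations_iff[OF F1.M.minus_closed[OF c g2c[OF c'(1)]]] c'(2) by blast
      then have "to_matrix S1 c \<ominus>\<^bsub>?G S1\<^esub> col_map f2 (to_matrix S2 c') \<in> ?D S1"
        unfolding module_hom_minus[OF F1.module_axioms module_free to_matrix_hom c g2c[OF c'(1)]]
          to_matrix_lift_map[OF f2 c'(1)] .
      from col_map_span[OF f1 order.refl kernel_of(2) this]
      have "col_map f1 (to_matrix S1 c) \<ominus>\<^bsub>?G S0\<^esub> \<zero>\<^bsub>?G S0\<^esub> \<in> ?E"
        unfolding k1m[OF tc[OF c] k2c[OF tc[OF c'(1)]]] kk[OF tc[OF c'(1)]] .
      then have "col_map f1 (to_matrix S1 c) \<in> ?E"
        using G0.minus_zero_right[OF k1c[OF tc[OF c]]] by simp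
      from G0.is_submodule_minus_right[OF E this is_submoduleD(2)[OF D0 v(2)] cv] show "v \<in> ?E" .
    qed
  next
    assume ind: "tor_independent R S0 (f1 ` vec S1) T kernel_of"
    show "\<forall>c \<in> carrier (?F S1). ?g1 c \<in> ?H S0 \<longrightarrow>
      (\<exists>c' \<in> carrier (?F S2). c \<ominus>\<^bsub>?F S1\<^esub> ?g2 c' \<in> ?H S1)"
    proof (intro ballI impI)
      fix c assume c: "c \<in> carrier (?F S1)" and "?g1 c \<in> ?H S0"
      then have "col_map f1 (to_matrix S1 c) \<in> ?D S0"
        using tensor_relations_iff[OF g1c[OF c]] to_matrix_lift_map[OF f1 c] by simp
      moreover have "col_map f1 (to_matrix S1 c) \<in> tensor_span R (f1 ` vec S1) (vec T)"
        by (rule col_map_span[OF f1 order.refl order.refl tc[OF c, unfolded vec_Times]])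
      ultimately have "col_map f1 (to_matrix S1 c) \<in> ?E" using ind unfolding tor_independent_def by blast
      from col_map_lift[OF f1 order.refl kernel_of(2) this]
      obtain u where u: "u \<in> ?D S1" "col_map f1 u = col_map f1 (to_matrix S1 c)" .
      have uv: "u \<in> vec (S1 \<times> T)" by (rule is_submoduleD(2)[OF D1 u(1)])
      \<comment> \<open>What remains of the cycle after removing the matrix \<open>u\<close>, which
        represents the zero tensor. It is killed by f1, so exactness lifts it along f2.\<close>
      define y where "y = to_matrix S1 c \<ominus>\<^bsub>?G S1\<^esub> u"
      have y: "y \<in> vec (S1 \<times> T)" unfolding y_def by (rule G1.M.minus_closed[OF tc[OF c] uv])
      have "col_map f1 y = (\<lambda>p. \<zero>)"
        unfolding y_def k1m[OF tc[OF c] uv] u(2) using G0.M.r_neg[OF k1c[OF tc[OF c]]] by (simp add: a_minus_def)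
      from col_map_kernel[OF f1 y this] have "y \<in> tensor_span R (f2 ` vec S2) (vec T)" unfolding exact .
      from col_map_lift[OF f2 order.refl order.refl this]
      obtain x where x: "x \<in> vec (S2 \<times> T)" "col_map f2 x = y" unfolding vec_Times .
      define c' where "c' = of_matrix S2 x"
      have c': "c' \<in> carrier (?F S2)" unfolding c'_def by (rule oc[OF x(1)])
      have "col_map f2 (to_matrix S2 c' \<ominus>\<^bsub>?G S2\<^esub> x) \<in> tensor_span R (f2 ` vec S2) kernel_of"
        unfolding c'_def by (rule col_map_span[OF f2 order.refl kernel_of(2) to[OF x(1)]])
      then have "col_map f2 (to_matrix S2 c') \<ominus>\<^bsub>?G S1\<^esub> y \<in> ?D S1"
        unfolding k2m[OF tc[OF c'] x(1)] x(2) by (rule tensor_span_mono[OF f2S order.refl])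
      then have 1: "y \<ominus>\<^bsub>?G S1\<^esub> col_map f2 (to_matrix S2 c') \<in> ?D S1"
        by (rule G1.is_submodule_minus_sym[OF D1 k2c[OF tc[OF c']] y])
      have 2: "to_matrix S1 c \<ominus>\<^bsub>?G S1\<^esub> y \<in> ?D S1"
        unfolding y_def G1.minus_minus_cancel[OF tc[OF c] uv] by (rule u(1))
      have "to_matrix S1 (c \<ominus>\<^bsub>?F S1\<^esub> ?g2 c') \<in> ?D S1"
        unfolding module_hom_minus[OF F1.module_axioms module_free to_matrix_hom c g2c[OF c']] to_matrix_lift_map[OF f2 c']
        by (rule G1.is_submodule_minus_trans[OF D1 tc[OF c] y k2c[OF tc[OF c']] 2 1])
      then have "c \<ominus>\<^bsub>?F S1\<^esub> ?g2 c' \<in> ?H S1"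
        using tensor_relations_iff[OF F1.M.minus_closed[OF c g2c[OF c']]] by blast
      then show "\<exists>c' \<in> carrier (?F S2). c \<ominus>\<^bsub>?F S1\<^esub> ?g2 c' \<in> ?H S1" using c' by blast
    qed
  qed
  qed
  finally show ?thesis .
qed

end

text \<open>Homology in degree n + 1 is measured by the image of the boundary in degree n, hence the
  shift from \<open>Suc n\<close> to \<open>n\<close>.\<close>

lemma (in free_cover) Tor_trivial_iff:
  assumes M: "module R M"
  shows "trivial_module (Tor R (Suc n) M N) \<longleftrightarrow>
    tor_independent R (res_basis R M n) (res_boundary R ` vec (res_basis R M (Suc n))) T kernel_of"
proof -
  have ex: "res_boundary R ` vec (res_basis R M (Suc (Suc n))) =
      {x \<in> vec (res_basis R M (Suc n)). res_boundary R x = (\<lambda>s. \<zero>)}"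
    using free_resolution_exact(3)[OF M, of n] by (simp add: free_resolution_def del: res_basis.simps)
  have h: "res_boundary R \<in> module_hom R (free_module R (res_basis R M (Suc k))) (free_module R (res_basis R M k))" for k
    using res_boundary_hom[OF M, of k] by (simp add: free_resolution_def del: res_basis.simps)
  show ?thesis
    using tensor_homology_trivial_iff[OF h h ex]
    by (simp add: Tor_def homology_def cycles_def free_resolution_def del: res_basis.simps)
qed

lemma (in cring) hom_vec_restrict:
  assumes "f \<in> module_hom R (free_module R I) M" "I' \<subseteq> I" shows "f \<in> module_hom R (free_module R I') M"
proof -
  have sub: "vec I' \<subseteq> vec I" by (rule vec_mono[OF assms(2)])
  show ?thesis
    using module_hom_closed[OF assms(1)] module_hom_add[OF assms(1)] module_hom_smult[OF assms(1)] sub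
    by (intro module_homI) (auto simp: subset_iff)
qed

lemma (in cring) coord_hom: "(\<lambda>c. c i) \<in> module_hom R (free_module R I) (ring_module R)"
  by (rule module_homI) (auto simp: vecD)

section \<open>Linear algebra over the residue field\<close>

locale local_cube = cring R for R :: "('a, 'r) ring_scheme" (structure) +
  fixes m :: "'a set"
  assumes local_R: "local_ring R m" and cube_zero: "(m \<cdot> m) \<cdot> m = {\<zero>}"
begin

abbreviation m2 :: "'a set" where "m2 \<equiv> m \<cdot> m"

lemma maximal_m: "maximalideal m R" using local_R by (simp add: local_ring_def)

lemma ideal_m: "ideal m R" using maximal_m by (rule maximalideal.axioms)

lemma ideal_m2: "ideal m2 R" by (rule ideal_prod_is_ideal[OF ideal_m ideal_m])

lemma ideal_simps:
  assumes "ideal I R"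
  shows "x \<in> I \<Longrightarrow> x \<in> carrier R" "\<zero> \<in> I" "x \<in> I \<Longrightarrow> y \<in> I \<Longrightarrow> x \<oplus> y \<in> I" "x \<in> I \<Longrightarrow> \<ominus> x \<in> I"
    "x \<in> I \<Longrightarrow> y \<in> I \<Longrightarrow> x \<ominus> y \<in> I" "a \<in> carrier R \<Longrightarrow> x \<in> I \<Longrightarrow> a \<otimes> x \<in> I"
    "a \<in> carrier R \<Longrightarrow> x \<in> I \<Longrightarrow> x \<otimes> a \<in> I"
proof -
  interpret ideal I R by fact
  show "x \<in> I \<Longrightarrow> x \<in> carrier R" "\<zero> \<in> I" "x \<in> I \<Longrightarrow> y \<in> I \<Longrightarrow> x \<oplus> y \<in> I" "x \<in> I \<Longrightarrow> \<ominus> x \<in> I"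
    "x \<in> I \<Longrightarrow> y \<in> I \<Longrightarrow> x \<ominus> y \<in> I" "a \<in> carrier R \<Longrightarrow> x \<in> I \<Longrightarrow> a \<otimes> x \<in> I"
    "a \<in> carrier R \<Longrightarrow> x \<in> I \<Longrightarrow> x \<otimes> a \<in> I"
    by (auto simp: a_minus_def intro: I_l_closed I_r_closed)
qed

lemmas m_simps = ideal_simps[OF ideal_m] and m2_simps = ideal_simps[OF ideal_m2]

lemma m2I: "a \<in> m \<Longrightarrow> b \<in> m \<Longrightarrow> a \<otimes> b \<in> m2" by (rule ideal_prod.prod)

lemma m3_zero: "a \<in> m2 \<Longrightarrow> b \<in> m \<Longrightarrow> a \<otimes> b = \<zero>" "a \<in> m2 \<Longrightarrow> b \<in> m \<Longrightarrow> b \<otimes> a = \<zero>"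
  using ideal_prod.prod[of a m2 b m R] cube_zero m2_simps(1) m_simps(1) m_comm[of b a] by auto

lemma m_proper: "\<one> \<notin> m" "m \<noteq> carrier R"
proof -
  show "m \<noteq> carrier R" using maximalideal.I_notcarr[OF maximal_m] by simp
  then show "\<one> \<notin> m" using ideal.one_imp_carrier[OF ideal_m] by blast
qed

text \<open>Since \<open>m\<close> is nilpotent, \<open>1 - x\<close> is invertible for \<open>x \<in> m\<close>, by the geometric series.\<close>

lemma unitI: assumes a: "a \<in> carrier R" "a \<notin> m" shows "a \<in> Units R"
proof -
  have "ideal (m <+> PIdl a) R" by (rule add_ideals[OF ideal_m cgenideal_ideal[OF a(1)]])
  moreover have "m \<subseteq> m <+> PIdl a"
  proof
    fix x assume x: "x \<in> m"
    have "\<zero> \<in> PIdl a" using cgenideal_ideal[OF a(1)] ideal_simps(2) by blast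
    then have "x \<oplus> \<zero> \<in> m <+> PIdl a" using x unfolding set_add_def' by blast
    then show "x \<in> m <+> PIdl a" using m_simps(1)[OF x] by simp
  qed
  moreover have am: "a \<in> m <+> PIdl a"
  proof -
    have "\<zero> \<oplus> a \<in> m <+> PIdl a" using m_simps(2) cgenideal_self[OF a(1)] unfolding set_add_def' by blast
    then show ?thesis using a by simp
  qed
  ultimately have "m <+> PIdl a = carrier R"
    using maximalideal.I_maximal[OF maximal_m] ideal.Icarr by (metis a(2) subsetI)
  then have "\<one> \<in> m <+> PIdl a" by simp
  then obtain x r where x: "x \<in> m" and r: "r \<in> carrier R" and e: "\<one> = x \<oplus> r \<otimes> a"
    unfolding set_add_def' cgenideal_def by blast
  note xc = m_simps(1)[OF x]
  have "r \<otimes> a = \<one> \<ominus> x" using e xc r a(1) by (simp add: a_minus_def a_comm r_neg1)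
  moreover have "(\<one> \<ominus> x) \<otimes> (\<one> \<oplus> x \<oplus> x \<otimes> x) = \<one> \<ominus> (x \<otimes> x) \<otimes> x" using xc by algebra
  ultimately have "r \<otimes> a \<otimes> (\<one> \<oplus> x \<oplus> x \<otimes> x) = \<one>"
    using m3_zero(1)[OF m2I[OF x x] x] by (simp add: a_minus_def)
  then have "a \<otimes> (r \<otimes> (\<one> \<oplus> x \<oplus> x \<otimes> x)) = \<one>" using a r xc by (simp add: m_ac)
  moreover have "r \<otimes> (\<one> \<oplus> x \<oplus> x \<otimes> x) \<in> carrier R" using r xc by simp
  ultimately show ?thesis unfolding Units_def using a(1) m_comm[OF a(1)] by auto
qed

lemma m_submodule: "ideal I R \<Longrightarrow> is_submodule R (ring_module R) I"
  using ideal_simps[of I] by (intro is_submoduleI) auto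

text \<open>An injective linear map between vector spaces over the residue field does not lower the dimension;
  the induction step is Gaussian elimination with a unit pivot.\<close>

lemma card_le_functionals:
  assumes "finite J" "finite I"
    and "\<And>j. j \<in> J \<Longrightarrow> f j \<in> module_hom R (free_module R I) (ring_module R)"
    and "\<And>c i. c \<in> vec I \<Longrightarrow> (\<And>j. j \<in> J \<Longrightarrow> f j c \<in> m) \<Longrightarrow> c i \<in> m"
  shows "card I \<le> card J"
  using assms
proof (induction J arbitrary: I f rule: finite_induct)
  case empty
  have "I = {}"
  proof (rule ccontr)
    assume "I \<noteq> {}"
    then obtain i where "i \<in> I" by blast
    then have "basis_vec R i i \<in> m" using empty(3)[OF vec_basis] by blast
    then show False using m_proper(1) by (simp add: basis_vec_def)
  qed
  then show ?case by simp
next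
  case (insert j J)
  have fj: "f j \<in> module_hom R (free_module R I) (ring_module R)" using insert.prems(2) by simp
  show ?case
  proof (cases "\<forall>i\<in>I. f j (basis_vec R i) \<in> m")
    case True
    have *: "f j c \<in> m" if "c \<in> vec I" for c
      using hom_vec_into[OF module_ring fj m_submodule[OF ideal_m] _ that] True by blast
    have "card I \<le> card J"
    proof (rule insert.IH[of I f])
      show "c i \<in> m" if "c \<in> vec I" "\<And>k. k \<in> J \<Longrightarrow> f k c \<in> m" for c i
      proof (rule insert.prems(3)[OF that(1)])
        show "f k c \<in> m" if "k \<in> insert j J" for k
          using that *[OF \<open>c \<in> vec I\<close>] \<open>\<And>k. k \<in> J \<Longrightarrow> f k c \<in> m\<close>[of k] by blast
      qed
    qed (use insert.prems in auto)
    then show ?thesis using insert.hyps by simp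
  next
    case False
    then obtain i where i: "i \<in> I" "f j (basis_vec R i) \<notin> m" by blast
    define u where "u = f j (basis_vec R i)"
    have uc: "u \<in> carrier R" unfolding u_def using module_hom_closed[OF fj vec_basis[OF i(1)]] by simp
    have u: "u \<in> Units R" by (rule unitI[OF uc]) (simp add: i u_def)
    \<comment> \<open>\<open>g\<close> adjusts the coordinate at the pivot \<open>i\<close> so that
      \<open>f j\<close> vanishes. It embeds the vectors supported off \<open>i\<close> into the
      kernel of \<open>f j\<close>, where the remaining functionals still detect everything modulo
      m.\<close>
    define g where "g c = (\<lambda>s. c s \<ominus> (f j c \<otimes> inv u) \<otimes> basis_vec R i s)" for c
    have sub: "vec (I - {i}) \<subseteq> vec I" by (rule vec_mono) blast
    have fjc: "f j c \<otimes> inv u \<in> carrier R" if "c \<in> vec I" for c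
      using module_hom_closed[OF fj that] u by simp
    have gc: "g c \<in> vec I" if "c \<in> vec I" for c
      unfolding g_def by (rule vec_minus[OF that vec_smult[OF fjc[OF that] vec_basis[OF i(1)]]])
    have b: "basis_vec R i s \<in> carrier R" for s by (simp add: basis_vec_def)
    have g: "g \<in> module_hom R (free_module R (I - {i})) (free_module R I)"
    proof (rule module_homI)
      show "g c \<in> vec I" if "c \<in> vec (I - {i})" for c using gc that sub by blast
      fix c d assume c: "c \<in> vec (I - {i})" and d: "d \<in> vec (I - {i})"
      then have cd: "c \<in> vec I" "d \<in> vec I" using sub by auto
      note cc = vecD(1)[OF cd(1)] vecD(1)[OF cd(2)]
        module_hom_closed[OF fj cd(1), simplified] module_hom_closed[OF fj cd(2), simplified]
      show "g (c \<oplus>\<^bsub>free_module R (I - {i})\<^esub> d) = g c \<oplus>\<^bsub>free_module R I\<^esub> g d"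
        using cc u b hom_vec(1)[OF fj cd] by (simp add: g_def l_distr a_minus_def minus_add a_ac)
    next
      fix a c assume a: "a \<in> carrier R" and c: "c \<in> vec (I - {i})"
      then have cd: "c \<in> vec I" using sub by auto
      show "g (a \<odot>\<^bsub>free_module R (I - {i})\<^esub> c) = a \<odot>\<^bsub>free_module R I\<^esub> g c"
        using vecD(1)[OF cd] module_hom_closed[OF fj cd] u b a hom_vec(2)[OF fj a cd]
        by (simp add: g_def r_distr a_minus_def r_minus m_assoc)
    qed
    interpret RM: module R "ring_module R" by (rule module_ring)
    have fjg: "f j (g c) = \<zero>" if c: "c \<in> vec I" for c
    proof -
      have e: "f j (g c) = f j c \<ominus>\<^bsub>ring_module R\<^esub> f j (\<lambda>s. (f j c \<otimes> inv u) \<otimes> basis_vec R i s)"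
        unfolding g_def by (rule hom_vec(4)[OF fj module_ring c vec_smult[OF fjc[OF c] vec_basis[OF i(1)]]])
      have "f j (\<lambda>s. (f j c \<otimes> inv u) \<otimes> basis_vec R i s) = (f j c \<otimes> inv u) \<otimes> u"
        using hom_vec(2)[OF fj fjc[OF c] vec_basis[OF i(1)]] by (simp add: u_def)
      also have "\<dots> = f j c" using module_hom_closed[OF fj c] u uc by (simp add: m_assoc)
      finally have "f j (g c) = f j c \<ominus>\<^bsub>ring_module R\<^esub> f j c" using e by simp
      then show ?thesis using RM.M.r_neg[OF module_hom_closed[OF fj c]] by (simp add: a_minus_def)
    qed
    have "card (I - {i}) \<le> card J"
    proof (rule insert.IH[of "I - {i}" "\<lambda>k c. f k (g c)"])
      show "finite (I - {i})" using insert.prems by simp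
      show "(\<lambda>c. f k (g c)) \<in> module_hom R (free_module R (I - {i})) (ring_module R)" if "k \<in> J" for k
        by (rule module_hom_comp[OF g insert.prems(2)]) (simp add: that)
      fix c s assume c: "c \<in> vec (I - {i})" and k: "\<And>k. k \<in> J \<Longrightarrow> f k (g c) \<in> m"
      have cI: "c \<in> vec I" using c sub by auto
      have "f k (g c) \<in> m" if "k \<in> insert j J" for k
        using that k[of k] fjg[OF cI] m_simps(2) by auto
      then have "g c s \<in> m" by (rule insert.prems(3)[OF gc[OF cI]])
      then show "c s \<in> m"
        using vecD(1,2)[OF c] fjc[OF cI] m_simps(2) by (cases "s = i") (auto simp: g_def basis_vec_def a_minus_def)
    qed
    then show ?thesis using insert.prems(1) insert.hyps i(1) by simp
  qed
qed

text \<open>Writing each \<open>f (basis_vec R i)\<close> through g modulo \<open>X\<close> gives a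
  matrix \<open>A\<close>. If A c has entries in m, then g (A c) and hence f c lie in
  \<open>X\<close>, so c has entries in m. Thus \<open>A\<close> is injective over the residue
  field.\<close>

lemma card_le_span:
  assumes M: "module R M" and X: "is_submodule R M X" and fin: "finite I" "finite J"
    and f: "f \<in> module_hom R (free_module R I) M" and g: "g \<in> module_hom R (free_module R J) M"
    and ind: "\<And>c i. c \<in> vec I \<Longrightarrow> f c \<in> X \<Longrightarrow> c i \<in> m"
    and gen: "\<And>i. i \<in> I \<Longrightarrow> \<exists>a\<in>vec J. f (basis_vec R i) \<ominus>\<^bsub>M\<^esub> g a \<in> X"
    and kill: "\<And>a. a \<in> vec J \<Longrightarrow> (\<And>j. a j \<in> m) \<Longrightarrow> g a \<in> X"
  shows "card I \<le> card J"
proof -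
  interpret M: module R M by fact
  obtain a where a: "\<And>i. i \<in> I \<Longrightarrow> a i \<in> vec J \<and> f (basis_vec R i) \<ominus>\<^bsub>M\<^esub> g (a i) \<in> X"
    using bchoice[of I "\<lambda>i a. a \<in> vec J \<and> f (basis_vec R i) \<ominus>\<^bsub>M\<^esub> g a \<in> X"] gen by (metis (no_types, lifting))
  then have aI: "a \<in> I \<rightarrow> vec J" by simp
  define A where "A = free_ext R (free_module R J) a"
  have A: "A \<in> module_hom R (free_module R I) (free_module R J)"
    unfolding A_def by (rule free_ext_hom[OF module_free aI])
  have Ab: "A (basis_vec R i) = a i" if "i \<in> I" for i
    unfolding A_def by (rule free_ext_basis_vec[OF module_free aI that])
  have *: "f c \<ominus>\<^bsub>M\<^esub> g (A c) \<in> X" if "c \<in> vec I" for c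
    using a Ab by (intro hom_vec_into[OF M module_hom_diff[OF M f module_hom_comp[OF A g]] X _ that]) simp
  show ?thesis
  proof (rule card_le_functionals[OF fin(2,1), where f = "\<lambda>j c. A c j"])
    show "(\<lambda>c. A c j) \<in> module_hom R (free_module R I) (ring_module R)" for j
      by (rule module_hom_comp[OF A coord_hom])
    fix c i assume c: "c \<in> vec I" and j: "\<And>j. j \<in> J \<Longrightarrow> A c j \<in> m"
    have Ac: "A c \<in> vec J" by (rule module_hom_closed[OF A c])
    have "A c j \<in> m" for j using j[of j] vecD(2)[OF Ac, of j] m_simps(2) by (cases "j \<in> J") auto
    then have "g (A c) \<in> X" using kill[OF Ac] by blast
    then have "f c \<in> X"
      using M.is_submodule_minus_left[OF X module_hom_closed[OF f c], of "g (A c)"] *[OF c] by blast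
    then show "c i \<in> m" using ind[OF c] by blast
  qed
qed

text \<open>Among all finite families that generate \<open>Y\<close> modulo \<open>X\<close>, one of
  least cardinality is taken: a relation with a coefficient outside m, that is a unit, would allow
  one generator to be discarded.\<close>

lemma minimal_generators:
  fixes M :: "('a, 'b, 'm) module_scheme" and I0 :: "'i set"
  assumes M: "module R M" and X: "is_submodule R M X" and "finite I0"
    and "f0 \<in> module_hom R (free_module R I0) M" "f0 ` vec I0 \<subseteq> Y"
    and "\<And>y. y \<in> Y \<Longrightarrow> \<exists>c\<in>vec I0. y \<ominus>\<^bsub>M\<^esub> f0 c \<in> X" and Y: "Y \<subseteq> carrier M"
  obtains I :: "'i set" and f where "finite I" "f \<in> module_hom R (free_module R I) M" "f ` vec I \<subseteq> Y"
    "\<And>y. y \<in> Y \<Longrightarrow> \<exists>c\<in>vec I. y \<ominus>\<^bsub>M\<^esub> f c \<in> X" "\<And>c i. c \<in> vec I \<Longrightarrow> f c \<in> X \<Longrightarrow> c i \<in> m"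
proof -
  interpret M: module R M by fact
  define Q where "Q I f \<longleftrightarrow> finite I \<and> f \<in> module_hom R (free_module R I) M \<and> f ` vec I \<subseteq> Y \<and>
    (\<forall>y\<in>Y. \<exists>c\<in>vec I. y \<ominus>\<^bsub>M\<^esub> f c \<in> X)" for I :: "'i set" and f
  have "\<exists>n I f. Q I f \<and> card I = n" using assms unfolding Q_def by blast
  then obtain n where n: "\<exists>I f. Q I f \<and> card I = n" and least: "\<And>k. k < n \<Longrightarrow> \<not> (\<exists>I f. Q I f \<and> card I = k)"
    using exists_least_iff[of "\<lambda>n. \<exists>I f. Q I f \<and> card I = n"] by blast
  obtain I f where If: "Q I f" "card I = n" using n by blast
  then have fin: "finite I" and f: "f \<in> module_hom R (free_module R I) M" and fY: "f ` vec I \<subseteq> Y"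
    and gen: "\<And>y. y \<in> Y \<Longrightarrow> \<exists>c\<in>vec I. y \<ominus>\<^bsub>M\<^esub> f c \<in> X" by (auto simp: Q_def)
  have "c i \<in> m" if c: "c \<in> vec I" and fc: "f c \<in> X" for c i
  proof (rule ccontr)
    assume ci: "c i \<notin> m"
    then have i: "i \<in> I" using vecD(2)[OF c] m_simps(2) by metis
    have u: "c i \<in> Units R" by (rule unitI[OF vecD(1)[OF c] ci])
    have sub: "vec (I - {i}) \<subseteq> vec I" by (rule vec_mono) blast
    have "\<exists>d\<in>vec (I - {i}). y \<ominus>\<^bsub>M\<^esub> f d \<in> X" if y: "y \<in> Y" for y
    proof -
      obtain x where x: "x \<in> vec I" "y \<ominus>\<^bsub>M\<^esub> f x \<in> X" using gen[OF y] by blast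
      \<comment> \<open>Chosen so that subtracting r times the relation \<open>c\<close> clears the
        coordinate at \<open>i\<close>, while f changes only within \<open>X\<close>.\<close>
      define r where "r = x i \<otimes> inv (c i)"
      have r: "r \<in> carrier R" unfolding r_def using vecD(1)[OF x(1)] u by simp
      define d where "d = (\<lambda>s. x s \<ominus> r \<otimes> c s)"
      have rc: "(\<lambda>s. r \<otimes> c s) \<in> vec I" by (rule vec_smult[OF r c])
      have d: "d \<in> vec I" unfolding d_def by (rule vec_minus[OF x(1) rc])
      have "d i = \<zero>"
        using vecD(1)[OF x(1)] vecD(1)[OF c] u by (simp add: d_def r_def m_assoc a_minus_def r_neg)
      then have d': "d \<in> vec (I - {i})" using d by (auto simp: free_module_carrier)
      have fd: "f d = f x \<ominus>\<^bsub>M\<^esub> r \<odot>\<^bsub>M\<^esub> f c"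
        unfolding d_def hom_vec(4)[OF f M x(1) rc] hom_vec(2)[OF f r c] ..
      have yc: "y \<in> carrier M" using y Y by blast
      have rf: "r \<odot>\<^bsub>M\<^esub> f c \<in> X" by (rule is_submoduleD(5)[OF X r fc])
      have "f x \<ominus>\<^bsub>M\<^esub> f d \<in> X"
        unfolding fd M.minus_minus_cancel[OF module_hom_closed[OF f x(1)] is_submoduleD(2)[OF X rf]] by (rule rf)
      then have "y \<ominus>\<^bsub>M\<^esub> f d \<in> X"
        by (rule M.is_submodule_minus_trans[OF X yc module_hom_closed[OF f x(1)] module_hom_closed[OF f d] x(2)])
      then show ?thesis using d' by blast
    qed
    moreover have "f \<in> module_hom R (free_module R (I - {i})) M" by (rule hom_vec_restrict[OF f]) blast
    ultimately have "Q (I - {i}) f" using fin fY sub unfolding Q_def by blast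
    moreover have "card (I - {i}) < n" using If(2) fin i by (metis card_Diff1_less)
    ultimately show False using least by blast
  qed
  then show ?thesis using that[OF fin f fY gen] by blast
qed

end

section \<open>Finitely generated and Noetherian modules\<close>

definition fin_gen :: "('a, 'r) ring_scheme \<Rightarrow> ('a, 'b, 'm) module_scheme \<Rightarrow> 'b set \<Rightarrow> bool" where
  "fin_gen R M H \<longleftrightarrow> (\<exists>A. finite A \<and> A \<subseteq> carrier M \<and> H = submodule_span R M A)"

text \<open>\<open>Y\<close> may be any subset of the module, so that kernels and annihilated parts
  can be used directly as \<open>Y\<close>.\<close>

definition noeth :: "('a, 'r) ring_scheme \<Rightarrow> ('a, 'b, 'm) module_scheme \<Rightarrow> 'b set \<Rightarrow> bool" where
  "noeth R M Y \<longleftrightarrow> (\<forall>H. is_submodule R M H \<longrightarrow> H \<subseteq> Y \<longrightarrow> fin_gen R M H)"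

lemma submodule_span_image:
  assumes M: "module R M" and N: "module R N" and f: "f \<in> module_hom R M N" and A: "A \<subseteq> carrier M"
  shows "submodule_span R N (f ` A) \<subseteq> f ` submodule_span R M A"
proof -
  interpret M: module R M by fact
  interpret N: module R N by fact
  show ?thesis
    by (rule N.submodule_span_least[OF is_submodule_image[OF M N f M.submodule_span_is_submodule[OF A]]])
      (intro image_mono submodule_span_superset)
qed

text \<open>\<open>H\<close> is generated by lifts of generators of f(H) together with generators of
  the part of \<open>H\<close> killed by f.\<close>

lemma noeth_extension:
  assumes M: "module R M" and N: "module R N" and f: "f \<in> module_hom R M N"
    and Z: "noeth R N Z" "f ` Y \<subseteq> Z" and K: "noeth R M {y \<in> Y. f y = \<zero>\<^bsub>N\<^esub>}"
  shows "noeth R M Y"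
  unfolding noeth_def
proof (intro allI impI)
  interpret M: module R M by fact
  interpret N: module R N by fact
  fix H assume H: "is_submodule R M H" "H \<subseteq> Y"
  note Hc = is_submoduleD(2)[OF H(1)]
  have "is_submodule R N (f ` H)" by (rule is_submodule_image[OF M N f H(1)])
  then have "fin_gen R N (f ` H)" using Z H(2) unfolding noeth_def by (metis image_mono order.trans)
  then obtain B where B: "finite B" "f ` H = submodule_span R N B" by (auto simp: fin_gen_def)
  then have "B \<subseteq> f ` H" using submodule_span_superset by metis
  then obtain A where A: "A \<subseteq> H" "finite A" "B = f ` A" using finite_subset_image[OF B(1)] by metis
  have Ac: "A \<subseteq> carrier M" using A(1) Hc by blast
  let ?L = "H \<inter> {x \<in> carrier M. f x = \<zero>\<^bsub>N\<^esub>}"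
  have "is_submodule R M ?L" by (rule is_submodule_Int[OF H(1) is_submodule_kernel[OF M N f]])
  moreover have "?L \<subseteq> {y \<in> Y. f y = \<zero>\<^bsub>N\<^esub>}" using H(2) by blast
  ultimately have "fin_gen R M ?L" using K unfolding noeth_def by blast
  then obtain C where C: "finite C" "C \<subseteq> carrier M" "?L = submodule_span R M C" by (auto simp: fin_gen_def)
  have CL: "C \<subseteq> ?L" using C(3) submodule_span_superset by metis
  let ?S = "submodule_span R M (A \<union> C)"
  have S: "is_submodule R M ?S" using Ac C(2) by (intro M.submodule_span_is_submodule) blast
  have AS: "submodule_span R M A \<subseteq> ?S" and CS: "submodule_span R M C \<subseteq> ?S"
    using submodule_span_superset[of "A \<union> C" R M] by (auto intro!: M.submodule_span_least[OF S])
  have SH: "?S \<subseteq> H" using A(1) CL by (intro M.submodule_span_least[OF H(1)]) blast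
  have "H \<subseteq> ?S"
  proof
    fix h assume h: "h \<in> H"
    then have "f h \<in> f ` submodule_span R M A"
      using B(2) A(3) submodule_span_image[OF M N f Ac] by blast
    then obtain a where a: "a \<in> submodule_span R M A" "f h = f a" by blast
    have aS: "a \<in> ?S" using a AS by blast
    then have aH: "a \<in> H" using SH by blast
    have "f (h \<ominus>\<^bsub>M\<^esub> a) = \<zero>\<^bsub>N\<^esub>"
      using module_hom_minus[OF M N f Hc[OF h] Hc[OF aH]] a(2) module_hom_closed[OF f Hc[OF aH]]
      by (simp add: a_minus_def N.M.r_neg)
    then have "h \<ominus>\<^bsub>M\<^esub> a \<in> ?L" using M.is_submodule_minus[OF H(1) h aH] Hc by blast
    then have "h \<ominus>\<^bsub>M\<^esub> a \<in> ?S" using C(3) CS by blast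
    then show "h \<in> ?S" using M.is_submodule_minus_left[OF S Hc[OF h] aS] by blast
  qed
  then have "H = ?S" using SH by blast
  then show "fin_gen R M H" unfolding fin_gen_def using A(2) C(1,2) Ac by (intro exI[of _ "A \<union> C"]) blast
qed

lemma (in cring) fin_gen_cover:
  fixes M :: "('a, 'c, 'm) module_scheme"
  assumes M: "module R M" and H: "fin_gen R M H"
  obtains I :: "nat set" and f where "finite I" "f \<in> module_hom R (free_module R I) M" "f ` vec I = H"
proof -
  interpret M: module R M by fact
  obtain A where A: "finite A" "A \<subseteq> carrier M" "H = submodule_span R M A" using H by (auto simp: fin_gen_def)
  obtain h where h: "bij_betw h {0..<card A} A" using ex_bij_betw_nat_finite[OF A(1)] by blast
  let ?I = "{0..<card A}"
  have hI: "h \<in> ?I \<rightarrow> carrier M" using h A(2) by (auto simp: bij_betw_def)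
  define f where "f = free_ext R M h"
  have f: "f \<in> module_hom R (free_module R ?I) M" unfolding f_def by (rule free_ext_hom[OF M hI])
  have fb: "f (basis_vec R i) = h i" if "i \<in> ?I" for i unfolding f_def by (rule free_ext_basis_vec[OF M hI that])
  have Hs: "is_submodule R M H" unfolding A(3) by (rule M.submodule_span_is_submodule[OF A(2)])
  have AH: "A \<subseteq> H" unfolding A(3) by (rule submodule_span_superset)
  have hA: "h i \<in> A" if "i \<in> ?I" for i using h that by (auto simp: bij_betw_def)
  have "f c \<in> H" if "c \<in> vec ?I" for c
    using hA AH fb by (intro hom_vec_into[OF M f Hs _ that]) auto
  moreover have "H \<subseteq> f ` vec ?I"
    unfolding A(3)
  proof (rule M.submodule_span_least)
    show "is_submodule R M (f ` vec ?I)"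
      by (rule is_submodule_image[OF module_free M f module.is_submodule_carrier[OF module_free]])
    show "A \<subseteq> f ` vec ?I"
    proof
      fix x assume "x \<in> A"
      then have "x \<in> h ` ?I" using bij_betw_imp_surj_on[OF h] by simp
      then obtain i where i: "i \<in> ?I" "x = h i" by (elim imageE)
      then show "x \<in> f ` vec ?I" using fb[OF i(1)] vec_basis[OF i(1)] by (metis imageI)
    qed
  qed
  ultimately show ?thesis using that[of ?I f] f by blast
qed

context cring
begin

lemma is_submodule_ring: "is_submodule R (ring_module R) I \<longleftrightarrow> ideal I R"
proof
  assume I: "is_submodule R (ring_module R) I"
  note * = is_submoduleD[OF I, simplified]
  have "\<ominus> x \<in> I" if "x \<in> I" for x
    using *(5)[of "\<ominus> \<one>" x] *(2)[OF that] that by (simp add: l_minus)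
  then have "subgroup I (add_monoid R)"
    using *(1,3,4) by (intro subgroup.intro) (simp_all add: a_inv_def)
  moreover have "x \<otimes> a \<in> I" if "x \<in> I" "a \<in> carrier R" for x a
    using *(5)[OF that(2,1)] m_comm[OF *(2)[OF that(1)] that(2)] by simp
  ultimately show "ideal I R"
    using *(5) by (intro idealI[OF ring_axioms]) simp_all
next
  assume "ideal I R"
  then interpret ideal I R .
  show "is_submodule R (ring_module R) I" by (intro is_submoduleI) (auto intro: I_l_closed)
qed

lemma noeth_ring_imp_noetherian:
  assumes "noeth R (ring_module R) (carrier R)" shows "noetherian_ring R"
proof (rule noetherian_ringI)
  fix I assume I: "ideal I R"
  have "I \<subseteq> carrier R" by (rule subsetI) (rule ideal.Icarr[OF I])
  then have "fin_gen R (ring_module R) I" using assms I unfolding noeth_def is_submodule_ring by blast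
  then obtain A where A: "finite A" "A \<subseteq> carrier R" "I = submodule_span R (ring_module R) A"
    by (auto simp: fin_gen_def)
  interpret RM: module R "ring_module R" by (rule module_ring)
  have "I = Idl A" unfolding A(3) submodule_span_def genideal_def RM.submodule_iff is_submodule_ring ..
  then show "\<exists>A\<subseteq>carrier R. finite A \<and> I = Idl A" using A by blast
qed

lemma noeth_zero:
  assumes "module R M" shows "noeth R M {\<zero>\<^bsub>M\<^esub>}"
  unfolding noeth_def
proof (intro allI impI)
  interpret M: module R M by fact
  fix H assume H: "is_submodule R M H" "H \<subseteq> {\<zero>\<^bsub>M\<^esub>}"
  have "submodule_span R M {} \<subseteq> H" by (rule M.submodule_span_least[OF H(1)]) simp
  moreover have "H \<subseteq> submodule_span R M {}"
    using H(2) is_submoduleD(3)[OF M.submodule_span_is_submodule[of "{}"]] by auto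
  ultimately show "fin_gen R M H" unfolding fin_gen_def by (intro exI[of _ "{}"]) auto
qed

lemma is_submodule_free_mono:
  assumes "is_submodule R (free_module R I) K" "I \<subseteq> J" shows "is_submodule R (free_module R J) K"
  using is_submoduleD[OF assms(1)] vec_mono[OF assms(2)] by (intro is_submoduleI) auto

text \<open>One coordinate is split off at a time. The ambient module is free on all natural
  numbers, so that it stays fixed while the support grows.\<close>

lemma noeth_vec:
  assumes "noeth R (ring_module R) (carrier R)" "finite I"
  shows "noeth R (free_module R UNIV) (vec (I :: nat set))"
  using assms(2)
proof induction
  case empty
  have "vec {} = {\<zero>\<^bsub>free_module R (UNIV :: nat set)\<^esub>}" by (auto simp: free_module_carrier)
  then show ?case using noeth_zero[OF module_free] by simp
next
  case (insert i I)
  have eq: "{y \<in> vec (insert i I). y i = \<zero>} = vec I" using insert.hyps by (auto simp: free_module_carrier)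
  show ?case
  proof (rule noeth_extension[OF module_free module_ring coord_hom assms(1)])
    show "(\<lambda>c. c i) ` vec (insert i I) \<subseteq> carrier R" using vecD(1) by auto
    show "noeth R (free_module R UNIV) {y \<in> vec (insert i I). y i = \<zero>\<^bsub>ring_module R\<^esub>}"
      using insert.IH eq by simp
  qed
qed

end

section \<open>Minimal covers, and finite generation over Artinian rings\<close>

context local_cube
begin

text \<open>The case X = 0 of \<open>minimal_generators\<close>: generation modulo zero is
  generation, and independence modulo zero says that no relation has a unit coefficient.\<close>

lemma minimal_cover:
  fixes M :: "('a, 'b, 'm) module_scheme"
  assumes M: "module R M" and H: "is_submodule R M H" "fin_gen R M H"
  obtains I :: "nat set" and f where "finite I" "f \<in> module_hom R (free_module R I) M" "f ` vec I = H"
    "\<And>c i. c \<in> vec I \<Longrightarrow> f c = \<zero>\<^bsub>M\<^esub> \<Longrightarrow> c i \<in> m"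
proof -
  interpret M: module R M by fact
  note Hc = is_submoduleD(1)[OF H(1)]
  obtain I0 :: "nat set" and f0 where f0: "finite I0" "f0 \<in> module_hom R (free_module R I0) M" "f0 ` vec I0 = H"
    by (rule fin_gen_cover[OF M H(2)])
  have "\<exists>c\<in>vec I0. y \<ominus>\<^bsub>M\<^esub> f0 c \<in> {\<zero>\<^bsub>M\<^esub>}" if y: "y \<in> H" for y
  proof -
    obtain c where c: "c \<in> vec I0" "y = f0 c" using y f0(3) by blast
    have "y \<in> carrier M" using y Hc by blast
    then show ?thesis using c M.M.r_neg[of y] by (intro bexI[of _ c]) (auto simp: a_minus_def)
  qed
  from minimal_generators[OF M M.is_submodule_zero f0(1,2) _ this Hc] f0(3)
  obtain I :: "nat set" and f where f: "finite I" "f \<in> module_hom R (free_module R I) M" "f ` vec I \<subseteq> H"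
    "\<And>y. y \<in> H \<Longrightarrow> \<exists>c\<in>vec I. y \<ominus>\<^bsub>M\<^esub> f c \<in> {\<zero>\<^bsub>M\<^esub>}" "\<And>c i. c \<in> vec I \<Longrightarrow> f c \<in> {\<zero>\<^bsub>M\<^esub>} \<Longrightarrow> c i \<in> m"
    by (metis order.refl)
  have "H \<subseteq> f ` vec I"
  proof
    fix y assume y: "y \<in> H"
    then obtain c where c: "c \<in> vec I" "y \<ominus>\<^bsub>M\<^esub> f c = \<zero>\<^bsub>M\<^esub>" using f(4) by blast
    have "y \<in> carrier M" using y Hc by blast
    have "f c = y \<ominus>\<^bsub>M\<^esub> (y \<ominus>\<^bsub>M\<^esub> f c)"
      by (rule M.minus_minus_cancel[symmetric, OF \<open>y \<in> carrier M\<close> module_hom_closed[OF f(2) c(1)]])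
    then have "f c = y" unfolding c(2) using M.minus_zero_right[OF \<open>y \<in> carrier M\<close>] by simp
    then show "y \<in> f ` vec I" using c(1) by blast
  qed
  then have "f ` vec I = H" using f(3) by blast
  then show ?thesis using that[OF f(1,2)] f(5) by blast
qed

lemma ideal_add_multiples:
  assumes J: "ideal J R" and y: "y \<in> carrier R"
  defines "I \<equiv> {j \<oplus> r \<otimes> y | j r. j \<in> J \<and> r \<in> carrier R}"
  shows "ideal I R" "J \<subseteq> I" "y \<in> I"
proof -
  interpret ideal J R by fact
  have I: "j \<oplus> r \<otimes> y \<in> I" if "j \<in> J" "r \<in> carrier R" for j r using that unfolding I_def by blast
  show "J \<subseteq> I"
  proof
    fix j assume "j \<in> J" then show "j \<in> I" using I[of j \<zero>] y Icarr[of j] by simp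
  qed
  show "y \<in> I" using I[of \<zero> \<one>] y by simp
  show "ideal I R"
    unfolding is_submodule_ring[symmetric]
  proof (rule is_submoduleI)
    show "x \<in> I \<Longrightarrow> x \<in> carrier (ring_module R)" for x using y Icarr unfolding I_def by auto
    show "\<zero>\<^bsub>ring_module R\<^esub> \<in> I" using I[of \<zero> \<zero>] y by simp
  next
    fix x x' assume "x \<in> I" "x' \<in> I"
    then obtain j r j' r' where *: "j \<in> J" "r \<in> carrier R" "j' \<in> J" "r' \<in> carrier R"
      "x = j \<oplus> r \<otimes> y" "x' = j' \<oplus> r' \<otimes> y" unfolding I_def by blast
    have "x \<oplus> x' = (j \<oplus> j') \<oplus> (r \<oplus> r') \<otimes> y"
      using * y Icarr[of j] Icarr[of j'] by (simp add: l_distr a_ac)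
    then show "x \<oplus>\<^bsub>ring_module R\<^esub> x' \<in> I" using I[of "j \<oplus> j'" "r \<oplus> r'"] * by simp
  next
    fix a x assume a: "a \<in> carrier R" and "x \<in> I"
    then obtain j r where *: "j \<in> J" "r \<in> carrier R" "x = j \<oplus> r \<otimes> y" unfolding I_def by blast
    have "a \<otimes> x = a \<otimes> j \<oplus> (a \<otimes> r) \<otimes> y" using * y a Icarr[of j] by (simp add: r_distr m_assoc)
    then show "a \<odot>\<^bsub>ring_module R\<^esub> x \<in> I" using I[of "a \<otimes> j" "a \<otimes> r"] * a I_l_closed by simp
  qed
qed

text \<open>A vector space over the residue field in which descending chains of subspaces stabilise is
  finite-dimensional: otherwise hyperplanes could be split off forever.\<close>

lemma artinian_finite_generation:
  assumes art: "artinian_ring R" and X: "ideal X R" and Y: "ideal Y R" and XY: "X \<subseteq> Y"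
    and kill: "\<And>a y. a \<in> m \<Longrightarrow> y \<in> Y \<Longrightarrow> a \<otimes> y \<in> X"
  obtains A where "finite A" "A \<subseteq> Y" "\<And>I. ideal I R \<Longrightarrow> X \<subseteq> I \<Longrightarrow> A \<subseteq> I \<Longrightarrow> Y \<subseteq> I"
proof -
  \<comment> \<open>\<open>P J\<close> says that Y/J is finitely generated. It holds for
    \<open>Y\<close>, and the claim is that it holds for \<open>X\<close>.\<close>
  define P where "P J \<longleftrightarrow> ideal J R \<and> X \<subseteq> J \<and> J \<subseteq> Y \<and>
    (\<exists>A. finite A \<and> A \<subseteq> Y \<and> (\<forall>I. ideal I R \<longrightarrow> J \<subseteq> I \<longrightarrow> A \<subseteq> I \<longrightarrow> Y \<subseteq> I))" for J
  have PY: "P Y" unfolding P_def using Y XY by blast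
  have step: "\<exists>J'. P J' \<and> J' \<subset> J" if J: "P J" "J \<noteq> X" for J
  proof -
    have Ji: "ideal J R" "X \<subseteq> J" "J \<subseteq> Y" using J(1) by (auto simp: P_def)
    obtain A where A: "finite A" "A \<subseteq> Y" "\<And>I. ideal I R \<Longrightarrow> J \<subseteq> I \<Longrightarrow> A \<subseteq> I \<Longrightarrow> Y \<subseteq> I"
      using J(1) by (auto simp: P_def)
    obtain t where t: "t \<in> J" "t \<notin> X" using J(2) Ji(2) by blast
    \<comment> \<open>A maximal element of \<open>Z\<close> is a hyperplane of J/X missing
      \<open>t\<close>. Enlarging it by any further y of \<open>J\<close> brings in
      \<open>t\<close>, with y occurring with a unit coefficient because m y lies in
      \<open>X\<close>; so \<open>t\<close> spans the quotient.\<close>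
    define Z where "Z = {J'. ideal J' R \<and> X \<subseteq> J' \<and> J' \<subseteq> J \<and> t \<notin> J'}"
    have "\<exists>M\<in>Z. \<forall>N\<in>Z. M \<subseteq> N \<longrightarrow> N = M"
    proof (rule subset_Zorn_nonempty)
      show "Z \<noteq> {}" using X Ji(2) t(2) unfolding Z_def by blast
      fix \<C> assume C: "\<C> \<noteq> {}" "subset.chain Z \<C>"
      have CZ: "\<C> \<subseteq> Z" using C(2) by (simp add: subset_chain_def)
      have "ideal (\<Union>\<C>) R"
        unfolding is_submodule_ring[symmetric]
      proof (rule is_submoduleI)
        have sub: "is_submodule R (ring_module R) J'" if "J' \<in> \<C>" for J'
          using that CZ unfolding is_submodule_ring Z_def by blast
        show "x \<in> \<Union>\<C> \<Longrightarrow> x \<in> carrier (ring_module R)" for x using is_submoduleD(2)[OF sub] by blast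
        show "\<zero>\<^bsub>ring_module R\<^esub> \<in> \<Union>\<C>" using is_submoduleD(3)[OF sub] C(1) by blast
        show "a \<in> carrier R \<Longrightarrow> x \<in> \<Union>\<C> \<Longrightarrow> a \<odot>\<^bsub>ring_module R\<^esub> x \<in> \<Union>\<C>" for a x
          using is_submoduleD(5)[OF sub] by blast
        fix x y assume "x \<in> \<Union>\<C>" "y \<in> \<Union>\<C>"
        then obtain J1 J2 where J12: "J1 \<in> \<C>" "x \<in> J1" "J2 \<in> \<C>" "y \<in> J2" by blast
        then have "J1 \<subseteq> J2 \<or> J2 \<subseteq> J1" using C(2) by (meson subset_chain_def)
        then obtain J3 where "J3 \<in> \<C>" "x \<in> J3" "y \<in> J3" using J12 by blast
        then show "x \<oplus>\<^bsub>ring_module R\<^esub> y \<in> \<Union>\<C>" using is_submoduleD(4)[OF sub] by blast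
      qed
      then show "\<Union>\<C> \<in> Z" using CZ C(1) unfolding Z_def by blast
    qed
    then obtain J' where J': "J' \<in> Z" "\<And>N. N \<in> Z \<Longrightarrow> J' \<subseteq> N \<Longrightarrow> N = J'" by blast
    have J'i: "ideal J' R" "X \<subseteq> J'" "J' \<subseteq> J" "t \<notin> J'" using J'(1) by (auto simp: Z_def)
    have gen: "J \<subseteq> I" if I: "ideal I R" "J' \<subseteq> I" "t \<in> I" for I
    proof
      fix y assume y: "y \<in> J"
      show "y \<in> I"
      proof (cases "y \<in> J'")
        case False
        have yc: "y \<in> carrier R" using ideal_simps(1)[OF Ji(1) y] .
        define N where "N = {j \<oplus> r \<otimes> y | j r. j \<in> J' \<and> r \<in> carrier R}"
        note N = ideal_add_multiples[OF J'i(1) yc, folded N_def]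
        have "N \<subseteq> J"
          using J'i(3) ideal_simps(3,6)[OF Ji(1)] y unfolding N_def by blast
        moreover have "N \<noteq> J'" using N(3) False by blast
        ultimately have "t \<in> N" using J'(2)[of N] N(1,2) J'i(2) unfolding Z_def by blast
        then obtain j r where jr: "j \<in> J'" "r \<in> carrier R" "t = j \<oplus> r \<otimes> y" unfolding N_def by blast
        have jc: "j \<in> carrier R" using ideal_simps(1)[OF J'i(1) jr(1)] .
        have "r \<notin> m"
        proof
          assume "r \<in> m"
          then have "r \<otimes> y \<in> J'" using kill y Ji(3) J'i(2) by blast
          then show False using jr J'i(4) ideal_simps(3)[OF J'i(1)] by blast
        qed
        then have r: "r \<in> Units R" by (rule unitI[OF jr(2)])
        have "t \<ominus> j = r \<otimes> y" using jr yc jc by (simp add: a_minus_def a_comm r_neg1)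
        then have "inv r \<otimes> (t \<ominus> j) = y" using r yc jr(2) by (simp add: m_assoc[symmetric])
        moreover have "inv r \<otimes> (t \<ominus> j) \<in> I"
          using I jr(1) r ideal_simps(5,6)[OF I(1)] by blast
        ultimately show ?thesis by simp
      qed (use I in blast)
    qed
    have "P J'"
      unfolding P_def
    proof (intro conjI exI[of _ "insert t A"] allI impI)
      show "Y \<subseteq> I" if "ideal I R" "J' \<subseteq> I" "insert t A \<subseteq> I" for I
        using A(3)[OF that(1) gen[OF that(1,2)]] that(3) by blast
    qed (use J'i A t Ji in auto)
    then show ?thesis using J'i(3,4) t(1) by blast
  qed
  have "P X"
  proof (rule ccontr)
    assume nX: "\<not> P X"
    have "\<exists>F. \<forall>n. P (F n) \<and> F (Suc n) \<subset> F n"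
    proof (rule dependent_nat_choice)
      show "\<exists>J. P J" using PY by blast
      show "\<exists>J'. P J' \<and> J' \<subset> J" if "P J" for J n using step[OF that] nX that by blast
    qed
    then obtain F where F: "\<And>n. P (F n)" "\<And>n. F (Suc n) \<subset> F n" by blast
    have "ideal (F n) R" for n using F(1)[of n] by (simp add: P_def)
    then have "\<forall>n. ideal (F n) R \<and> F (Suc n) \<subseteq> F n" using F(2) by (simp add: psubset_imp_subset)
    then obtain n where n: "\<forall>k\<ge>n. F k = F n" using art unfolding artinian_ring_def by blast
    have "F (Suc n) = F n" by (rule n[rule_format]) simp
    then show False using F(2)[of n] by blast
  qed
  then show ?thesis using that unfolding P_def by blast
qed

lemma proper_ideal_subset: "ideal I R \<Longrightarrow> I \<noteq> carrier R \<Longrightarrow> I \<subseteq> m"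
proof
  fix x assume I: "ideal I R" "I \<noteq> carrier R" and x: "x \<in> I"
  show "x \<in> m"
  proof (rule ccontr)
    assume "x \<notin> m"
    then have "x \<in> Units R" by (rule unitI[OF ideal_simps(1)[OF I(1) x]])
    then have "\<one> \<in> I" using ideal_simps(6)[OF I(1) _ x, of "inv x"] by simp
    then show False using I ideal.one_imp_carrier by blast
  qed
qed

text \<open>For a proper ideal, m kills both factors of the chain from H over
  \<open>H \<inter> m2\<close> to 0, the lower one by m^3 = 0. So
  \<open>artinian_finite_generation\<close> applies twice.\<close>

lemma artinian_noeth:
  assumes art: "artinian_ring R" shows "noeth R (ring_module R) (carrier R)"
  unfolding noeth_def is_submodule_ring
proof (intro allI impI)
  fix H assume H: "ideal H R"
  interpret RM: module R "ring_module R" by (rule module_ring)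
  have gen: "fin_gen R (ring_module R) H"
    if A: "finite A" "A \<subseteq> H" "\<And>I. ideal I R \<Longrightarrow> A \<subseteq> I \<Longrightarrow> H \<subseteq> I" for A
  proof -
    have Ac: "A \<subseteq> carrier (ring_module R)" using A(2) ideal_simps(1)[OF H] by auto
    have "H \<subseteq> submodule_span R (ring_module R) A"
      using A(3) RM.submodule_span_is_submodule[OF Ac] submodule_span_superset[of A R "ring_module R"]
      unfolding is_submodule_ring by blast
    moreover have "submodule_span R (ring_module R) A \<subseteq> H"
      using RM.submodule_span_least[of H A] H A(2) unfolding is_submodule_ring by blast
    ultimately show ?thesis unfolding fin_gen_def using A(1) Ac by blast
  qed
  show "fin_gen R (ring_module R) H"
  proof (cases "H = carrier R")
    case True
    show ?thesis by (rule gen[of "{\<one>}"]) (auto simp: True dest: ideal.one_imp_carrier)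
  next
    case False
    then have Hm: "H \<subseteq> m" using proper_ideal_subset H by blast
    have X: "ideal (H \<inter> m2) R" by (rule i_intersect[OF H ideal_m2])
    have Z: "ideal {\<zero>} R" by (rule zeroideal)
    obtain A where A: "finite A" "A \<subseteq> H" "\<And>I. ideal I R \<Longrightarrow> H \<inter> m2 \<subseteq> I \<Longrightarrow> A \<subseteq> I \<Longrightarrow> H \<subseteq> I"
    proof (rule artinian_finite_generation[OF art X H])
      show "a \<otimes> y \<in> H \<inter> m2" if "a \<in> m" "y \<in> H" for a y
        using that Hm m2I ideal_simps(6)[OF H] m_simps(1) by blast
    qed auto
    obtain B where B: "finite B" "B \<subseteq> H \<inter> m2" "\<And>I. ideal I R \<Longrightarrow> {\<zero>} \<subseteq> I \<Longrightarrow> B \<subseteq> I \<Longrightarrow> H \<inter> m2 \<subseteq> I"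
    proof (rule artinian_finite_generation[OF art Z X])
      show "{\<zero>} \<subseteq> H \<inter> m2" using ideal_simps(2)[OF X] by blast
      show "a \<otimes> y \<in> {\<zero>}" if "a \<in> m" "y \<in> H \<inter> m2" for a y using that m3_zero(2) by blast
    qed auto
    show ?thesis
    proof (rule gen[of "A \<union> B"])
      show "H \<subseteq> I" if "ideal I R" "A \<union> B \<subseteq> I" for I
        using A(3)[OF that(1) B(3)[OF that(1)]] ideal_simps(2)[OF that(1)] that(2) by blast
    qed (use A B in auto)
  qed
qed

end

section \<open>Annihilators, socles and Baer's condition\<close>

lemma (in module) is_submodule_multiples:
  assumes "z \<in> carrier M" shows "is_submodule R M {r \<odot>\<^bsub>M\<^esub> z | r. r \<in> carrier R}" "z \<in> {r \<odot>\<^bsub>M\<^esub> z | r. r \<in> carrier R}"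
proof -
  have I: "r \<odot>\<^bsub>M\<^esub> z \<in> {r \<odot>\<^bsub>M\<^esub> z | r. r \<in> carrier R}" if "r \<in> carrier R" for r using that by blast
  show "z \<in> {r \<odot>\<^bsub>M\<^esub> z | r. r \<in> carrier R}" using I[of \<one>] assms by simp
  show "is_submodule R M {r \<odot>\<^bsub>M\<^esub> z | r. r \<in> carrier R}"
  proof (rule is_submoduleI)
    show "\<zero>\<^bsub>M\<^esub> \<in> {r \<odot>\<^bsub>M\<^esub> z | r. r \<in> carrier R}" using I[of \<zero>] assms by simp
    fix x y assume "x \<in> {r \<odot>\<^bsub>M\<^esub> z | r. r \<in> carrier R}" "y \<in> {r \<odot>\<^bsub>M\<^esub> z | r. r \<in> carrier R}"
    then obtain r s where "r \<in> carrier R" "s \<in> carrier R" "x = r \<odot>\<^bsub>M\<^esub> z" "y = s \<odot>\<^bsub>M\<^esub> z" by blast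
    then show "x \<oplus>\<^bsub>M\<^esub> y \<in> {r \<odot>\<^bsub>M\<^esub> z | r. r \<in> carrier R}"
      using I[of "r \<oplus> s"] assms by (simp add: smult_l_distr)
  next
    fix a x assume a: "a \<in> carrier R" and "x \<in> {r \<odot>\<^bsub>M\<^esub> z | r. r \<in> carrier R}"
    then obtain r where "r \<in> carrier R" "x = r \<odot>\<^bsub>M\<^esub> z" by blast
    then show "a \<odot>\<^bsub>M\<^esub> x \<in> {r \<odot>\<^bsub>M\<^esub> z | r. r \<in> carrier R}"
      using I[of "a \<otimes> r"] a assms by (simp add: smult_assoc1)
  qed (use assms in auto)
qed

lemma (in module) ideal_annihilator:
  assumes "z \<in> carrier M" shows "ideal {a \<in> carrier R. a \<odot>\<^bsub>M\<^esub> z = \<zero>\<^bsub>M\<^esub>} R"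
  unfolding is_submodule_ring[symmetric]
  using assms by (intro is_submoduleI) (auto simp: smult_l_distr smult_assoc1)

lemma (in module) smult_hom: "a \<in> carrier R \<Longrightarrow> (\<lambda>x. a \<odot>\<^bsub>M\<^esub> x) \<in> module_hom R M M"
  by (intro module_homI) (simp_all add: smult_r_distr smult_assoc1[symmetric] m_comm)

lemma (in module) inv_smult_cancel: "u \<in> Units R \<Longrightarrow> x \<in> carrier M \<Longrightarrow> inv u \<odot>\<^bsub>M\<^esub> (u \<odot>\<^bsub>M\<^esub> x) = x"
  by (subst smult_assoc1[symmetric]) (auto simp: R.Units_closed)

text \<open>Multiplication by one \<open>v\<close> maps \<open>Y\<close> into the Noetherian
  \<open>Z\<close>, and its kernel is treated with the remaining elements of
  \<open>S\<close>.\<close>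

lemma noeth_annihilated:
  assumes M: "module R M" and S: "finite S" "S \<subseteq> carrier R" and Z: "noeth R M Z"
    and "\<And>v y. v \<in> S \<Longrightarrow> y \<in> Y \<Longrightarrow> v \<odot>\<^bsub>M\<^esub> y \<in> Z"
    and "noeth R M {y \<in> Y. \<forall>v\<in>S. v \<odot>\<^bsub>M\<^esub> y = \<zero>\<^bsub>M\<^esub>}"
  shows "noeth R M Y"
  using S(1,2) assms(5,6)
proof (induction S arbitrary: Y rule: finite_induct)
  case empty
  then show ?case by simp
next
  case (insert v S)
  interpret M: module R M by fact
  let ?Y = "{y \<in> Y. v \<odot>\<^bsub>M\<^esub> y = \<zero>\<^bsub>M\<^esub>}"
  have ker: "noeth R M ?Y"
  proof (rule insert.IH)
    have "{y \<in> ?Y. \<forall>v\<in>S. v \<odot>\<^bsub>M\<^esub> y = \<zero>\<^bsub>M\<^esub>} = {y \<in> Y. \<forall>v\<in>insert v S. v \<odot>\<^bsub>M\<^esub> y = \<zero>\<^bsub>M\<^esub>}" by auto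
    then show "noeth R M {y \<in> ?Y. \<forall>v\<in>S. v \<odot>\<^bsub>M\<^esub> y = \<zero>\<^bsub>M\<^esub>}" using insert.prems(3) by simp
  qed (use insert.prems in auto)
  have img: "(\<lambda>y. v \<odot>\<^bsub>M\<^esub> y) ` Y \<subseteq> Z" using insert.prems(2) by auto
  have "v \<in> carrier R" using insert.prems(1) by simp
  then show ?case by (rule noeth_extension[OF M M M.smult_hom Z img ker])
qed

context local_cube
begin

lemma zero_product_in_m:
  assumes "r \<in> carrier R" "t \<in> carrier R" "t \<noteq> \<zero>" "r \<otimes> t = \<zero>" shows "r \<in> m"
proof (rule ccontr)
  assume "r \<notin> m"
  then have u: "r \<in> Units R" by (rule unitI[OF assms(1)])
  have "t = inv r \<otimes> (r \<otimes> t)" using u assms(1,2) by (simp add: m_assoc[symmetric])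
  then show False using assms(3,4) u by simp
qed

text \<open>r is multiplied by elements of m as long as the product can be kept nonzero; as m^3 = 0,
  at most two factors are needed.\<close>

lemma socle_of_ring:
  assumes r: "r \<in> carrier R" "r \<noteq> \<zero>"
  obtains u where "u \<in> carrier R" "u \<otimes> r \<noteq> \<zero>" "\<And>a. a \<in> m \<Longrightarrow> a \<otimes> (u \<otimes> r) = \<zero>"
proof (cases "\<forall>a\<in>m. a \<otimes> r = \<zero>")
  case True
  then show ?thesis using that[of \<one>] r by simp
next
  case False
  then obtain a where a: "a \<in> m" "a \<otimes> r \<noteq> \<zero>" by blast
  note ac = m_simps(1)[OF a(1)]
  show ?thesis
  proof (cases "\<forall>b\<in>m. b \<otimes> (a \<otimes> r) = \<zero>")
    case True
    then show ?thesis using that[of a] a ac by simp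
  next
    case False
    then obtain b where b: "b \<in> m" "b \<otimes> (a \<otimes> r) \<noteq> \<zero>" by blast
    note bc = m_simps(1)[OF b(1)]
    have "c \<otimes> ((b \<otimes> a) \<otimes> r) = \<zero>" if "c \<in> m" for c
      using m3_zero(2)[OF m2I[OF b(1) a(1)] that] m_simps(1)[OF that] ac bc r by (simp add: m_assoc[symmetric])
    then show ?thesis using that[of "b \<otimes> a"] b ac bc r by (simp add: m_assoc)
  qed
qed

lemma ring_socle_element:
  obtains t where "t \<in> carrier R" "t \<noteq> \<zero>" "\<And>a. a \<in> m \<Longrightarrow> a \<otimes> t = \<zero>"
proof -
  have "\<one> \<noteq> \<zero>" using m_proper m_simps(2) by auto
  then obtain t where "t \<in> carrier R" "t \<otimes> \<one> \<noteq> \<zero>" "\<And>a. a \<in> m \<Longrightarrow> a \<otimes> (t \<otimes> \<one>) = \<zero>"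
    using socle_of_ring[OF one_closed] by blast
  then show ?thesis using that by auto
qed

text \<open>Baer's criterion for the submodule \<open>Z\<close>, stated inside \<open>E\<close>: a
  map from an ideal into \<open>Z\<close> is multiplication by an element of \<open>Z\<close>. In
  this form it applies to the kernels in an injective resolution without making them
  modules.\<close>

definition baer_submodule :: "('a, 'c, 'n) module_scheme \<Rightarrow> 'c set \<Rightarrow> bool" where
  "baer_submodule E Z \<longleftrightarrow> (\<forall>A f. ideal A R \<longrightarrow> f \<in> module_hom R ((ring_module R)\<lparr>carrier := A\<rparr>) E \<longrightarrow> f ` A \<subseteq> Z \<longrightarrow>
     (\<exists>x\<in>Z. \<forall>a\<in>A. f a = a \<odot>\<^bsub>E\<^esub> x))"

lemma injective_baer:
  assumes E: "injective_module R E" shows "baer_submodule E (carrier E)"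
  unfolding baer_submodule_def
proof (intro allI impI)
  fix A f assume A: "ideal A R" and f: "f \<in> module_hom R ((ring_module R)\<lparr>carrier := A\<rparr>) E"
  interpret RM: module R "ring_module R" by (rule module_ring)
  have "submodule A R (ring_module R)" using A unfolding RM.submodule_iff is_submodule_ring .
  then obtain g where g: "g \<in> module_hom R (ring_module R) E" "\<And>a. a \<in> A \<Longrightarrow> g a = f a"
    using injective_module_extend[OF E module_ring _ f] by blast
  have "f a = a \<odot>\<^bsub>E\<^esub> g \<one>" if "a \<in> A" for a
    using g(2)[OF that] module_hom_smult[OF g(1), of a \<one>] ideal.Icarr[OF A that] by simp
  moreover have "g \<one> \<in> carrier E" using module_hom_closed[OF g(1), of \<one>] by simp
  ultimately show "\<exists>x\<in>carrier E. \<forall>a\<in>A. f a = a \<odot>\<^bsub>E\<^esub> x" by blast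
qed

text \<open>On the ideal B + R t the rule b + r t \<mapsto> r z is well defined because of
  \<open>kill\<close>; Baer's condition makes it multiplication by some h. With B = 0 this produces
  preimages under multiplication by a socle element t.\<close>

lemma baer_extension:
  assumes E: "module R E" and Z: "is_submodule R E Z" "baer_submodule E Z" and B: "ideal B R" and t: "t \<in> carrier R"
    and z: "z \<in> Z" and kill: "\<And>r. r \<in> carrier R \<Longrightarrow> r \<otimes> t \<in> B \<Longrightarrow> r \<odot>\<^bsub>E\<^esub> z = \<zero>\<^bsub>E\<^esub>"
  obtains h where "h \<in> Z" "\<And>b. b \<in> B \<Longrightarrow> b \<odot>\<^bsub>E\<^esub> h = \<zero>\<^bsub>E\<^esub>" "t \<odot>\<^bsub>E\<^esub> h = z"
proof -
  interpret E: module R E by fact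
  interpret B: ideal B R by fact
  note zc = is_submoduleD(2)[OF Z(1) z]
  define A where "A = {b \<oplus> r \<otimes> t | b r. b \<in> B \<and> r \<in> carrier R}"
  note A = ideal_add_multiples[OF B t, folded A_def]
  define f where "f a = (SOME y. \<exists>b r. b \<in> B \<and> r \<in> carrier R \<and> a = b \<oplus> r \<otimes> t \<and> y = r \<odot>\<^bsub>E\<^esub> z)" for a
  have f: "f (b \<oplus> r \<otimes> t) = r \<odot>\<^bsub>E\<^esub> z" if b: "b \<in> B" and r: "r \<in> carrier R" for b r
    unfolding f_def
  proof (rule some_equality)
    show "\<exists>b' r'. b' \<in> B \<and> r' \<in> carrier R \<and> b \<oplus> r \<otimes> t = b' \<oplus> r' \<otimes> t \<and> r \<odot>\<^bsub>E\<^esub> z = r' \<odot>\<^bsub>E\<^esub> z" using b r by blast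
    fix y assume "\<exists>b' r'. b' \<in> B \<and> r' \<in> carrier R \<and> b \<oplus> r \<otimes> t = b' \<oplus> r' \<otimes> t \<and> y = r' \<odot>\<^bsub>E\<^esub> z"
    then obtain b' r' where b': "b' \<in> B" "r' \<in> carrier R" "b \<oplus> r \<otimes> t = b' \<oplus> r' \<otimes> t" "y = r' \<odot>\<^bsub>E\<^esub> z" by blast
    note c = B.Icarr[OF b] B.Icarr[OF b'(1)] r b'(2) t
    have "(r \<ominus> r') \<otimes> t = (b \<oplus> r \<otimes> t) \<ominus> b \<ominus> r' \<otimes> t" using c by algebra
    also have "\<dots> = b' \<ominus> b" unfolding b'(3) using c by algebra
    also have "\<dots> \<in> B" using b b'(1) by (simp add: a_minus_def)
    finally have "(r \<ominus> r') \<odot>\<^bsub>E\<^esub> z = \<zero>\<^bsub>E\<^esub>" using c by (intro kill) simp_all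
    then have "r \<odot>\<^bsub>E\<^esub> z \<oplus>\<^bsub>E\<^esub> \<ominus>\<^bsub>E\<^esub> (r' \<odot>\<^bsub>E\<^esub> z) = \<zero>\<^bsub>E\<^esub>" using c zc by (simp add: a_minus_def E.smult_l_distr E.smult_l_minus)
    then show "y = r \<odot>\<^bsub>E\<^esub> z" unfolding b'(4) using c zc by (metis E.M.minus_equality E.M.minus_minus E.smult_closed E.M.a_inv_closed)
  qed
  have AE: "\<exists>b r. b \<in> B \<and> r \<in> carrier R \<and> a = b \<oplus> r \<otimes> t" if "a \<in> A" for a using that unfolding A_def by blast
  have "f \<in> module_hom R ((ring_module R)\<lparr>carrier := A\<rparr>) E"
  proof (rule module_homI; simp)
    fix a assume "a \<in> A"
    then obtain b r where br: "b \<in> B" "r \<in> carrier R" "a = b \<oplus> r \<otimes> t" using AE by blast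
    show "f a \<in> carrier E" unfolding br(3) f[OF br(1,2)] using br(2) zc by simp
    show "f (s \<otimes> a) = s \<odot>\<^bsub>E\<^esub> f a" if s: "s \<in> carrier R" for s
    proof -
      have "s \<otimes> a = s \<otimes> b \<oplus> (s \<otimes> r) \<otimes> t" unfolding br(3) using s br(2) t B.Icarr[OF br(1)] by (simp add: r_distr m_assoc)
      then have "f (s \<otimes> a) = (s \<otimes> r) \<odot>\<^bsub>E\<^esub> z" using f[OF B.I_l_closed[OF br(1) s], of "s \<otimes> r"] s br(2) by simp
      then show ?thesis unfolding br(3) f[OF br(1,2)] using s br(2) zc by (simp add: E.smult_assoc1)
    qed
    fix a' assume "a' \<in> A"
    then obtain b' r' where br': "b' \<in> B" "r' \<in> carrier R" "a' = b' \<oplus> r' \<otimes> t" using AE by blast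
    have "a \<oplus> a' = (b \<oplus> b') \<oplus> (r \<oplus> r') \<otimes> t"
      unfolding br(3) br'(3) using br(2) br'(2) t B.Icarr[OF br(1)] B.Icarr[OF br'(1)] by (simp add: l_distr a_ac)
    then have "f (a \<oplus> a') = (r \<oplus> r') \<odot>\<^bsub>E\<^esub> z" using f[of "b \<oplus> b'" "r \<oplus> r'"] br(1,2) br'(1,2) by simp
    then show "f (a \<oplus> a') = f a \<oplus>\<^bsub>E\<^esub> f a'"
      unfolding br(3) br'(3) f[OF br(1,2)] f[OF br'(1,2)] using br(2) br'(2) zc by (simp add: E.smult_l_distr)
  qed
  note fh = this
  have fZ: "f ` A \<subseteq> Z"
  proof
    fix y assume "y \<in> f ` A"
    then obtain b r where br: "b \<in> B" "r \<in> carrier R" "y = f (b \<oplus> r \<otimes> t)" using AE by blast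
    show "y \<in> Z" unfolding br(3) f[OF br(1,2)] by (rule is_submoduleD(5)[OF Z(1) br(2) z])
  qed
  have "\<exists>h\<in>Z. \<forall>a\<in>A. f a = a \<odot>\<^bsub>E\<^esub> h"
    using Z(2)[unfolded baer_submodule_def, THEN spec, THEN spec, THEN mp, OF A(1), THEN mp, OF fh, THEN mp, OF fZ] .
  then obtain h where h: "h \<in> Z" "\<And>a. a \<in> A \<Longrightarrow> f a = a \<odot>\<^bsub>E\<^esub> h" by blast
  show ?thesis
  proof (rule that[OF h(1)])
    fix b assume b: "b \<in> B"
    have "f (b \<oplus> \<zero> \<otimes> t) = \<zero>\<^bsub>E\<^esub>" unfolding f[OF b zero_closed] using zc by simp
    then show "b \<odot>\<^bsub>E\<^esub> h = \<zero>\<^bsub>E\<^esub>" using h(2)[of b] A(2) b t B.Icarr[OF b] by auto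
  next
    have "f (\<zero> \<oplus> \<one> \<otimes> t) = z" unfolding f[OF B.zero_closed one_closed] using zc by simp
    then show "t \<odot>\<^bsub>E\<^esub> h = z" using h(2)[OF A(3)] t by simp
  qed
qed

end

section \<open>The dualizing module\<close>

locale dualizing_cube = local_cube R m for R :: "('a, 'r) ring_scheme" (structure) and m +
  fixes \<omega> :: "('a, 'b, 'w) module_scheme"
  assumes artinian: "artinian_ring R" and dualizing: "dualizing_module R m \<omega>"
begin

lemma injective_omega: "injective_module R \<omega>"
  using dualizing by (simp add: dualizing_module_def injective_hull_def)

lemma module_omega: "module R \<omega>" using injective_omega by (simp add: injective_module_def)

sublocale W: module R \<omega> by (rule module_omega)

abbreviation smult_omega (infixl \<open>\<cdot>\<^sub>w\<close> 70) where "a \<cdot>\<^sub>w x \<equiv> a \<odot>\<^bsub>\<omega>\<^esub> x"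

abbreviation zero_omega (\<open>\<zero>\<^sub>w\<close>) where "\<zero>\<^sub>w \<equiv> \<zero>\<^bsub>\<omega>\<^esub>"

text \<open>Scalar multiplication in the quotient adds \<open>m\<close> once more to the multiple of
  a coset; the extra summand is absorbed since m is an ideal.\<close>

lemma residue_field_classes:
  defines "cl x \<equiv> m +>\<^bsub>ring_module R\<^esub> x" and "k \<equiv> residue_field_module R m"
  shows "carrier k = cl ` carrier R" "\<zero>\<^bsub>k\<^esub> = m"
    "x \<in> carrier R \<Longrightarrow> cl x = m \<longleftrightarrow> x \<in> m"
    "a \<in> carrier R \<Longrightarrow> x \<in> carrier R \<Longrightarrow> a \<odot>\<^bsub>k\<^esub> cl x = cl (a \<otimes> x)"
proof -
  interpret RM: module R "ring_module R" by (rule module_ring)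
  interpret H: abelian_subgroup m "ring_module R"
    by (rule RM.is_submodule_abelian_subgroup[OF m_submodule[OF ideal_m]])
  show "carrier k = cl ` carrier R"
    by (auto simp: k_def cl_def residue_field_module_def quotient_module_def A_RCOSETS_def')
  show "\<zero>\<^bsub>k\<^esub> = m" by (simp add: k_def residue_field_module_def quotient_module_def)
  show "cl x = m \<longleftrightarrow> x \<in> m" if "x \<in> carrier R" for x
  proof -
    have x: "x \<in> carrier (ring_module R)" using that by simp
    show ?thesis
      using RM.M.a_coset_join1[OF _ x H.a_subgroup] RM.M.a_coset_join2[OF x H.a_subgroup] unfolding cl_def by blast
  qed
  fix a x assume a: "a \<in> carrier R" and x: "x \<in> carrier R"
  have "a \<odot>\<^bsub>k\<^esub> cl x = {h \<oplus> a \<otimes> (h' \<oplus> x) | h h'. h \<in> m \<and> h' \<in> m}"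
    by (auto simp: k_def cl_def residue_field_module_def quotient_module_def set_add_def' a_r_coset_def')
  also have "\<dots> = {h \<oplus> a \<otimes> x | h. h \<in> m}"
  proof (intro equalityI subsetI)
    fix y assume "y \<in> {h \<oplus> a \<otimes> (h' \<oplus> x) | h h'. h \<in> m \<and> h' \<in> m}"
    then obtain h h' where h: "h \<in> m" "h' \<in> m" "y = h \<oplus> a \<otimes> (h' \<oplus> x)" by blast
    then have "y = (h \<oplus> a \<otimes> h') \<oplus> a \<otimes> x"
      using a x m_simps(1)[OF h(1)] m_simps(1)[OF h(2)] by (simp add: r_distr a_assoc)
    moreover have "h \<oplus> a \<otimes> h' \<in> m" using h a m_simps(3,6) by simp
    ultimately show "y \<in> {h \<oplus> a \<otimes> x | h. h \<in> m}" by blast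
  next
    fix y assume "y \<in> {h \<oplus> a \<otimes> x | h. h \<in> m}"
    then obtain h where h: "h \<in> m" "y = h \<oplus> a \<otimes> x" by blast
    then have "y = h \<oplus> a \<otimes> (\<zero> \<oplus> x)" using a x by simp
    then show "y \<in> {h \<oplus> a \<otimes> (h' \<oplus> x) | h h'. h \<in> m \<and> h' \<in> m}" using h(1) m_simps(2) by blast
  qed
  also have "\<dots> = cl (a \<otimes> x)" by (auto simp: cl_def a_r_coset_def')
  finally show "a \<odot>\<^bsub>k\<^esub> cl x = cl (a \<otimes> x)" .
qed

text \<open>The witness is the image of the class of 1 under the embedding of the residue field. By
  essentiality a nonzero submodule contains some x s \<noteq> 0; then x is a unit, since m kills
  s.\<close>

lemma socle_generator_exists:
  "\<exists>s. s \<in> carrier \<omega> \<and> s \<noteq> \<zero>\<^sub>w \<and> (\<forall>a\<in>m. a \<cdot>\<^sub>w s = \<zero>\<^sub>w) \<and>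
     (\<forall>H. is_submodule R \<omega> H \<longrightarrow> H \<noteq> {\<zero>\<^sub>w} \<longrightarrow> s \<in> H)"
proof -
  let ?k = "residue_field_module R m" and ?cl = "\<lambda>x. m +>\<^bsub>ring_module R\<^esub> x"
  note cl = residue_field_classes
  obtain i where mk: "module R ?k" and i: "i \<in> module_hom R ?k \<omega>" "inj_on i (carrier ?k)"
    and ess: "essential_submodule R (i ` carrier ?k) \<omega>"
    using dualizing by (auto simp: dualizing_module_def injective_hull_def)
  define s where "s = i (?cl \<one>)"
  have c1: "?cl \<one> \<in> carrier ?k" unfolding cl(1) by blast
  have s: "s \<in> carrier \<omega>" unfolding s_def by (rule module_hom_closed[OF i(1) c1])
  have zk: "m \<in> carrier ?k" unfolding cl(1) using cl(3)[OF zero_closed] m_simps(2) by (metis imageI zero_closed)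
  have im: "i m = \<zero>\<^sub>w" using module_hom_zero[OF mk module_omega i(1)] by (simp add: cl(2))
  have icl: "i (?cl x) = x \<cdot>\<^sub>w s" if x: "x \<in> carrier R" for x
    unfolding s_def using module_hom_smult[OF i(1) x c1] cl(4)[OF x one_closed] x by simp
  have s0: "s \<noteq> \<zero>\<^sub>w"
  proof
    assume "s = \<zero>\<^sub>w"
    then have "?cl \<one> = m" using inj_onD[OF i(2) _ c1 zk] im by (simp add: s_def)
    then show False using cl(3)[OF one_closed] m_proper(1) by simp
  qed
  have ms: "a \<cdot>\<^sub>w s = \<zero>\<^sub>w" if "a \<in> m" for a
    using icl[OF m_simps(1)[OF that]] cl(3)[OF m_simps(1)[OF that]] that im by simp
  have "s \<in> H" if H: "is_submodule R \<omega> H" "H \<noteq> {\<zero>\<^sub>w}" for H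
  proof -
    have "H \<inter> i ` carrier ?k \<noteq> {\<zero>\<^sub>w}" using ess H unfolding essential_submodule_def W.submodule_iff by blast
    moreover have "\<zero>\<^sub>w \<in> H \<inter> i ` carrier ?k" using is_submoduleD(3)[OF H(1)] im zk by (metis IntI imageI)
    ultimately obtain z where z: "z \<in> H" "z \<in> i ` carrier ?k" "z \<noteq> \<zero>\<^sub>w" by blast
    then obtain x where x: "x \<in> carrier R" "z = x \<cdot>\<^sub>w s" using icl unfolding cl(1) by auto
    have "x \<notin> m" using ms x z(3) by blast
    then have u: "x \<in> Units R" by (rule unitI[OF x(1)])
    have "inv x \<cdot>\<^sub>w z = s" using W.inv_smult_cancel[OF u s] x(2) by simp
    then show "s \<in> H" using is_submoduleD(5)[OF H(1) _ z(1), of "inv x"] u by simp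
  qed
  then show ?thesis using s s0 ms by blast
qed

definition soc :: 'b where
  "soc = (SOME s. s \<in> carrier \<omega> \<and> s \<noteq> \<zero>\<^sub>w \<and> (\<forall>a\<in>m. a \<cdot>\<^sub>w s = \<zero>\<^sub>w) \<and>
     (\<forall>H. is_submodule R \<omega> H \<longrightarrow> H \<noteq> {\<zero>\<^sub>w} \<longrightarrow> s \<in> H))"

lemma soc: "soc \<in> carrier \<omega>" "soc \<noteq> \<zero>\<^sub>w" "a \<in> m \<Longrightarrow> a \<cdot>\<^sub>w soc = \<zero>\<^sub>w"
    "is_submodule R \<omega> H \<Longrightarrow> H \<noteq> {\<zero>\<^sub>w} \<Longrightarrow> soc \<in> H"
  using someI_ex[OF socle_generator_exists] unfolding soc_def[symmetric] by blast+

text \<open>A nonzero z has \<open>soc\<close> among its multiples, and the coefficient is a unit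
  because elements of m kill z.\<close>

lemma socle:
  assumes z: "z \<in> carrier \<omega>" and "\<And>a. a \<in> m \<Longrightarrow> a \<cdot>\<^sub>w z = \<zero>\<^sub>w"
  obtains r where "r \<in> carrier R" "z = r \<cdot>\<^sub>w soc"
proof (cases "z = \<zero>\<^sub>w")
  case True
  then show ?thesis using that[of \<zero>] soc(1) by simp
next
  case False
  then have "soc \<in> {r \<cdot>\<^sub>w z | r. r \<in> carrier R}"
    using W.is_submodule_multiples[OF z] by (intro soc(4)) auto
  then obtain r where r: "r \<in> carrier R" "soc = r \<cdot>\<^sub>w z" by blast
  have "r \<notin> m"
  proof
    assume "r \<in> m"
    from assms(2)[OF this] show False using r(2) soc(2) by simp
  qed
  then have u: "r \<in> Units R" by (rule unitI[OF r(1)])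
  then have "z = inv r \<cdot>\<^sub>w soc" using W.inv_smult_cancel[OF _ z, of r] r(2) by simp
  then show ?thesis using that[of "inv r"] u by simp
qed

text \<open>Some multiple u r lies in the socle of R, and the map from R u r to \<omega> sending u r
  to \<open>soc\<close> is multiplication by an x. So r x cannot vanish.\<close>

lemma faithful:
  assumes r: "r \<in> carrier R" "r \<noteq> \<zero>"
  obtains x where "x \<in> carrier \<omega>" "r \<cdot>\<^sub>w x \<noteq> \<zero>\<^sub>w"
proof -
  obtain u where u: "u \<in> carrier R" "u \<otimes> r \<noteq> \<zero>" "\<And>a. a \<in> m \<Longrightarrow> a \<otimes> (u \<otimes> r) = \<zero>"
    by (rule socle_of_ring[OF r]) (blast intro: that)
  have tc: "u \<otimes> r \<in> carrier R" using u r by simp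
  have "c \<cdot>\<^sub>w soc = \<zero>\<^sub>w" if "c \<in> carrier R" "c \<otimes> (u \<otimes> r) \<in> {\<zero>}" for c
    using soc(3)[OF zero_product_in_m[OF that(1) tc u(2)]] that(2) by simp
  then obtain x where x: "x \<in> carrier \<omega>" "(u \<otimes> r) \<cdot>\<^sub>w x = soc"
    using baer_extension[OF module_omega W.is_submodule_carrier injective_baer[OF injective_omega] zeroideal tc soc(1)] by metis
  then have "u \<cdot>\<^sub>w (r \<cdot>\<^sub>w x) \<noteq> \<zero>\<^sub>w" using soc(2) u r x(1) by (simp add: W.smult_assoc1)
  then have "r \<cdot>\<^sub>w x \<noteq> \<zero>\<^sub>w" using u(1) by auto
  then show ?thesis using that x(1) by blast
qed

lemma m_generators:
  obtains A where "finite A" "A \<subseteq> m" "\<And>I. ideal I R \<Longrightarrow> A \<subseteq> I \<Longrightarrow> m \<subseteq> I"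
proof -
  interpret RM: module R "ring_module R" by (rule module_ring)
  have "fin_gen R (ring_module R) m"
    using artinian_noeth[OF artinian] ideal_m m_simps(1) unfolding noeth_def is_submodule_ring by blast
  then obtain A where A: "finite A" "m = submodule_span R (ring_module R) A" by (auto simp: fin_gen_def)
  show ?thesis
  proof (rule that[OF A(1)])
    show "A \<subseteq> m" unfolding A(2) by (rule submodule_span_superset)
    show "m \<subseteq> I" if "ideal I R" "A \<subseteq> I" for I
      unfolding A(2) by (rule RM.submodule_span_least) (use that is_submodule_ring in auto)
  qed
qed

text \<open>The elements killed by m, by m^2 and by m^3 = 0 form three layers. The lowest is
  generated by \<open>soc\<close>, and multiplication by the finitely many generators of m leads
  from each layer into the one below.\<close>

lemma noeth_omega: "noeth R \<omega> (carrier \<omega>)"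
proof -
  obtain A where A: "finite A" "A \<subseteq> m" "\<And>I. ideal I R \<Longrightarrow> A \<subseteq> I \<Longrightarrow> m \<subseteq> I"
    by (rule m_generators) (blast intro: that)
  have Ac: "A \<subseteq> carrier R" using A(2) m_simps(1) by blast
  define S where "S = {z \<in> carrier \<omega>. \<forall>a\<in>m. a \<cdot>\<^sub>w z = \<zero>\<^sub>w}"
  have S: "noeth R \<omega> S"
    unfolding noeth_def
  proof (intro allI impI)
    fix H assume H: "is_submodule R \<omega> H" "H \<subseteq> S"
    show "fin_gen R \<omega> H"
    proof (cases "H = {\<zero>\<^sub>w}")
      case True
      then show ?thesis using noeth_zero[OF module_omega] H(1) unfolding noeth_def by blast
    next
      case False
      then have sH: "soc \<in> H" by (rule soc(4)[OF H(1)])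
      let ?T = "submodule_span R \<omega> {soc}"
      have T: "is_submodule R \<omega> ?T" using soc(1) by (intro W.submodule_span_is_submodule) simp
      have sT: "soc \<in> ?T" using submodule_span_superset[of "{soc}" R \<omega>] by simp
      have "H \<subseteq> ?T"
      proof
        fix z assume z: "z \<in> H"
        then have "z \<in> carrier \<omega>" "\<And>a. a \<in> m \<Longrightarrow> a \<cdot>\<^sub>w z = \<zero>\<^sub>w" using H(2) by (auto simp: S_def)
        then obtain r where "r \<in> carrier R" "z = r \<cdot>\<^sub>w soc" by (rule socle)
        then show "z \<in> ?T" using is_submoduleD(5)[OF T _ sT] by simp
      qed
      moreover have "?T \<subseteq> H" by (rule W.submodule_span_least[OF H(1)]) (use sH in simp)
      ultimately show ?thesis unfolding fin_gen_def using soc(1) by (intro exI[of _ "{soc}"]) auto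
    qed
  qed
  have AS: "{z \<in> Y. \<forall>v\<in>A. v \<cdot>\<^sub>w z = \<zero>\<^sub>w} \<subseteq> S" if "Y \<subseteq> carrier \<omega>" for Y
  proof
    fix z assume z: "z \<in> {z \<in> Y. \<forall>v\<in>A. v \<cdot>\<^sub>w z = \<zero>\<^sub>w}"
    then have zc: "z \<in> carrier \<omega>" using that by blast
    have "m \<subseteq> {a \<in> carrier R. a \<cdot>\<^sub>w z = \<zero>\<^sub>w}"
      using z Ac by (intro A(3) W.ideal_annihilator[OF zc]) auto
    then show "z \<in> S" using zc by (auto simp: S_def)
  qed
  have sub: "noeth R \<omega> Y'" if "noeth R \<omega> Y" "Y' \<subseteq> Y" for Y Y'
    using that unfolding noeth_def by blast
  define Y2 where "Y2 = {z \<in> carrier \<omega>. \<forall>a\<in>m. \<forall>b\<in>m. a \<cdot>\<^sub>w (b \<cdot>\<^sub>w z) = \<zero>\<^sub>w}"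
  have "noeth R \<omega> Y2"
  proof (rule noeth_annihilated[OF module_omega A(1) Ac S])
    show "v \<cdot>\<^sub>w y \<in> S" if "v \<in> A" "y \<in> Y2" for v y
      using that A(2) Ac by (auto simp: S_def Y2_def)
    show "noeth R \<omega> {y \<in> Y2. \<forall>v\<in>A. v \<cdot>\<^sub>w y = \<zero>\<^sub>w}"
      by (rule sub[OF S AS]) (auto simp: Y2_def)
  qed
  then show ?thesis
  proof (rule noeth_annihilated[OF module_omega A(1) Ac])
    show "v \<cdot>\<^sub>w y \<in> Y2" if v: "v \<in> A" and y: "y \<in> carrier \<omega>" for v y
    proof -
      have vm: "v \<in> m" using v A(2) by blast
      have "a \<cdot>\<^sub>w (b \<cdot>\<^sub>w (v \<cdot>\<^sub>w y)) = \<zero>\<^sub>w" if ab: "a \<in> m" "b \<in> m" for a b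
      proof -
        note c = m_simps(1)[OF ab(1)] m_simps(1)[OF ab(2)] m_simps(1)[OF vm]
        have "a \<cdot>\<^sub>w (b \<cdot>\<^sub>w (v \<cdot>\<^sub>w y)) = ((a \<otimes> b) \<otimes> v) \<cdot>\<^sub>w y" using c y by (simp add: W.smult_assoc1)
        then show ?thesis using m3_zero(1)[OF m2I[OF ab] vm] y by simp
      qed
      then show ?thesis using m_simps(1)[OF vm] y by (auto simp: Y2_def)
    qed
    show "noeth R \<omega> {y \<in> carrier \<omega>. \<forall>v\<in>A. v \<cdot>\<^sub>w y = \<zero>\<^sub>w}"
      by (rule sub[OF S AS]) auto
  qed
qed

end

section \<open>Vectors with entries in an ideal, and maps on blocks of coordinates\<close>

context cring
begin

text \<open>As supports are finite, this is the submodule J F of the free module F on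
  \<open>S\<close>.\<close>

definition ivec :: "'a set \<Rightarrow> 's set \<Rightarrow> ('s \<Rightarrow> 'a) set" where
  "ivec J S = {c \<in> vec S. \<forall>s. c s \<in> J}"

lemma ivec_submodule:
  assumes "ideal J R" shows "is_submodule R (free_module R S) (ivec J S)"
proof -
  interpret ideal J R by fact
  show ?thesis by (intro is_submoduleI) (auto simp: ivec_def intro: I_l_closed)
qed

lemma hom_ivec_into:
  assumes M: "module R M" and f: "f \<in> module_hom R (free_module R S) M" and X: "is_submodule R M X"
    and gen: "\<And>a s. a \<in> J \<Longrightarrow> s \<in> S \<Longrightarrow> a \<odot>\<^bsub>M\<^esub> f (basis_vec R s) \<in> X" and c: "c \<in> ivec J S" and J: "ideal J R"
  shows "f c \<in> X"
proof -
  interpret M: module R M by fact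
  interpret J: ideal J R by fact
  have main: "f c \<in> X" if "finite A" "{s. c s \<noteq> \<zero>} \<subseteq> A" "A \<subseteq> S" "c \<in> ivec J S" for A c
    using that
  proof (induction A arbitrary: c rule: finite_induct)
    case empty
    then have "c = (\<lambda>s. \<zero>)" by auto
    then show ?case using hom_vec(3)[OF f M] is_submoduleD(3)[OF X] by simp
  next
    case (insert t A)
    have cv: "c \<in> vec S" "\<And>s. c s \<in> J" using insert.prems(3) by (auto simp: ivec_def)
    have t: "t \<in> S" using insert.prems(2) by simp
    define d where "d = (\<lambda>s. if s = t then \<zero> else c s)"
    have "{s. d s \<noteq> \<zero>} \<subseteq> {s. c s \<noteq> \<zero>}" by (auto simp: d_def)
    then have "finite {s. d s \<noteq> \<zero>}" using vecD(3)[OF cv(1)] by (rule finite_subset)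
    then have dv: "d \<in> vec S" using vecD(1,2)[OF cv(1)] by (simp add: free_module_carrier d_def)
    have "d \<in> ivec J S" using dv cv(2) by (auto simp: ivec_def d_def)
    moreover have "{s. d s \<noteq> \<zero>} \<subseteq> A" using insert.prems(1) by (auto simp: d_def)
    ultimately have fd: "f d \<in> X" using insert.IH insert.prems(2) by blast
    note tv = vec_smult[OF vecD(1)[OF cv(1)] vec_basis[OF t], of t]
    have "(\<lambda>s. c t \<otimes> basis_vec R t s \<oplus> d s) = c"
      using vecD(1)[OF cv(1)] by (auto simp: d_def basis_vec_def fun_eq_iff)
    then have "f c = c t \<odot>\<^bsub>M\<^esub> f (basis_vec R t) \<oplus>\<^bsub>M\<^esub> f d"
      using hom_vec(1)[OF f tv dv] hom_vec(2)[OF f vecD(1)[OF cv(1)] vec_basis[OF t], of t] by simp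
    then show ?case using is_submoduleD(4)[OF X gen[OF cv(2) t] fd] by simp
  qed
  have cv: "c \<in> vec S" using c by (simp add: ivec_def)
  have "{s. c s \<noteq> \<zero>} \<subseteq> S" using vecD(2)[OF cv] by blast
  then show ?thesis by (rule main[OF vecD(3)[OF cv] order.refl _ c])
qed

text \<open>This is id \<otimes> g, read as a map from F \<otimes> G to F \<otimes> R = F. If g maps
  onto an ideal J, it maps onto J F for finite bases, as \<open>diag_map_surj\<close> shows.\<close>

definition diag_map :: "(('t \<Rightarrow> 'a) \<Rightarrow> 'a) \<Rightarrow> ('s \<times> 't \<Rightarrow> 'a) \<Rightarrow> 's \<Rightarrow> 'a" where
  "diag_map g z = (\<lambda>s. g (\<lambda>t. z (s, t)))"

lemma diag_map_hom:
  assumes g: "g \<in> module_hom R (free_module R T) (ring_module R)" and S: "finite S"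
  shows "diag_map g \<in> module_hom R (free_module R (S \<times> T)) (free_module R S)"
proof (rule module_homI)
  show "diag_map g z \<in> vec S" if z: "z \<in> vec (S \<times> T)" for z
  proof (rule vec_finiteI[OF S])
    show "diag_map g z s \<in> carrier R" for s
      using module_hom_closed[OF g vec_row[OF z]] by (simp add: diag_map_def)
    show "diag_map g z s = \<zero>" if "s \<notin> S" for s
    proof -
      have "(\<lambda>t. z (s, t)) = (\<lambda>t. \<zero>)" using vecD(2)[OF z] that by auto
      then show ?thesis using hom_vec(3)[OF g module_ring] by (simp add: diag_map_def)
    qed
  qed
  show "diag_map g (z \<oplus>\<^bsub>free_module R (S \<times> T)\<^esub> z') = diag_map g z \<oplus>\<^bsub>free_module R S\<^esub> diag_map g z'"
    if "z \<in> vec (S \<times> T)" "z' \<in> vec (S \<times> T)" for z z'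
    using hom_vec(1)[OF g vec_row[OF that(1)] vec_row[OF that(2)]] by (simp add: diag_map_def)
  show "diag_map g (a \<odot>\<^bsub>free_module R (S \<times> T)\<^esub> z) = a \<odot>\<^bsub>free_module R S\<^esub> diag_map g z"
    if "a \<in> carrier R" "z \<in> vec (S \<times> T)" for a z
    using hom_vec(2)[OF g that(1) vec_row[OF that(2)]] by (simp add: diag_map_def)
qed

lemma diag_map_surj:
  assumes g: "g \<in> module_hom R (free_module R T) (ring_module R)" and fin: "finite S" "finite T"
    and c: "c \<in> ivec (g ` vec T) S"
  obtains z where "z \<in> vec (S \<times> T)" "diag_map g z = c"
proof -
  have "\<exists>x. x \<in> vec T \<and> g x = c s" for s using c by (auto simp: ivec_def image_iff) metis
  then obtain h where h: "\<And>s. h s \<in> vec T" "\<And>s. g (h s) = c s" by metis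
  define z where "z = (\<lambda>p. if fst p \<in> S then h (fst p) (snd p) else \<zero>)"
  have "z \<in> vec (S \<times> T)"
  proof (rule vec_finiteI)
    show "finite (S \<times> T)" using fin by simp
    show "z p \<in> carrier R" for p using vecD(1)[OF h(1)] by (simp add: z_def)
    show "z p = \<zero>" if "p \<notin> S \<times> T" for p
      using that vecD(2)[OF h(1), of "snd p" "fst p"] by (cases p) (auto simp: z_def)
  qed
  moreover have "diag_map g z = c"
  proof
    fix s
    show "diag_map g z s = c s"
    proof (cases "s \<in> S")
      case True
      then show ?thesis using h(2)[of s] by (simp add: diag_map_def z_def)
    next
      case False
      then show ?thesis using hom_vec(3)[OF g module_ring] c vecD(2)[of c S s]
        by (simp add: diag_map_def z_def ivec_def)
    qed
  qed
  ultimately show ?thesis using that by blast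
qed

definition sum_map ::
  "('a, 'c, 'm) module_scheme \<Rightarrow> (('s \<Rightarrow> 'a) \<Rightarrow> 'c) \<Rightarrow> (('t \<Rightarrow> 'a) \<Rightarrow> 'c) \<Rightarrow> ('s + 't \<Rightarrow> 'a) \<Rightarrow> 'c" where
  "sum_map M f g c = f (\<lambda>s. c (Inl s)) \<oplus>\<^bsub>M\<^esub> g (\<lambda>t. c (Inr t))"

lemma vec_Plus:
  "c \<in> vec (Sum_Type.Plus S T) \<Longrightarrow> (\<lambda>s. c (Inl s)) \<in> vec S" "c \<in> vec (Sum_Type.Plus S T) \<Longrightarrow> (\<lambda>t. c (Inr t)) \<in> vec T"
proof -
  assume c: "c \<in> vec (Sum_Type.Plus S T)"
  have "finite {s. c (Inl s) \<noteq> \<zero>}" using finite_vimageI[OF vecD(3)[OF c], of Inl] by (simp add: vimage_def)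
  then show "(\<lambda>s. c (Inl s)) \<in> vec S" using vecD(1,2)[OF c] by (auto simp: free_module_carrier)
  have "finite {s. c (Inr s) \<noteq> \<zero>}" using finite_vimageI[OF vecD(3)[OF c], of Inr] by (simp add: vimage_def)
  then show "(\<lambda>s. c (Inr s)) \<in> vec T" using vecD(1,2)[OF c] by (auto simp: free_module_carrier)
qed

lemma sum_map_hom:
  assumes M: "module R M" and f: "f \<in> module_hom R (free_module R S) M" and g: "g \<in> module_hom R (free_module R T) M"
  shows "sum_map M f g \<in> module_hom R (free_module R (Sum_Type.Plus S T)) M"
proof -
  interpret M: module R M by fact
  note fc = module_hom_closed[OF f] and gc = module_hom_closed[OF g]
  show ?thesis
  proof (rule module_homI)
    show "sum_map M f g c \<in> carrier M" if "c \<in> vec (Sum_Type.Plus S T)" for c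
      using fc[OF vec_Plus(1)[OF that]] gc[OF vec_Plus(2)[OF that]] by (simp add: sum_map_def)
    show "sum_map M f g (c \<oplus>\<^bsub>free_module R (Sum_Type.Plus S T)\<^esub> d) = sum_map M f g c \<oplus>\<^bsub>M\<^esub> sum_map M f g d"
      if "c \<in> vec (Sum_Type.Plus S T)" "d \<in> vec (Sum_Type.Plus S T)" for c d
      using hom_vec(1)[OF f vec_Plus(1)[OF that(1)] vec_Plus(1)[OF that(2)]]
        hom_vec(1)[OF g vec_Plus(2)[OF that(1)] vec_Plus(2)[OF that(2)]]
        fc[OF vec_Plus(1)[OF that(1)]] gc[OF vec_Plus(2)[OF that(1)]]
        fc[OF vec_Plus(1)[OF that(2)]] gc[OF vec_Plus(2)[OF that(2)]]
      by (simp add: sum_map_def M.M.a_ac)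
    show "sum_map M f g (a \<odot>\<^bsub>free_module R (Sum_Type.Plus S T)\<^esub> c) = a \<odot>\<^bsub>M\<^esub> sum_map M f g c"
      if "a \<in> carrier R" "c \<in> vec (Sum_Type.Plus S T)" for a c
      using hom_vec(2)[OF f that(1) vec_Plus(1)[OF that(2)]] hom_vec(2)[OF g that(1) vec_Plus(2)[OF that(2)]]
        fc[OF vec_Plus(1)[OF that(2)]] gc[OF vec_Plus(2)[OF that(2)]] that(1)
      by (simp add: sum_map_def M.smult_r_distr)
  qed
qed

lemma sum_map_surj:
  assumes M: "module R M" and f: "f \<in> module_hom R (free_module R S) M" and g: "g \<in> module_hom R (free_module R T) M"
    and c: "c \<in> vec S" "d \<in> vec T"
  obtains a where "a \<in> vec (Sum_Type.Plus S T)" "sum_map M f g a = f c \<oplus>\<^bsub>M\<^esub> g d"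
proof -
  define a where "a = case_sum c d"
  have "{x. a x \<noteq> \<zero>} \<subseteq> Sum_Type.Plus {s. c s \<noteq> \<zero>} {t. d t \<noteq> \<zero>}"
  proof
    fix x assume "x \<in> {x. a x \<noteq> \<zero>}"
    then show "x \<in> Sum_Type.Plus {s. c s \<noteq> \<zero>} {t. d t \<noteq> \<zero>}" by (cases x) (auto simp: a_def)
  qed
  then have "finite {x. a x \<noteq> \<zero>}"
    by (rule finite_subset) (intro finite_Plus vecD(3)[OF c(1)] vecD(3)[OF c(2)])
  moreover have "a x \<in> carrier R" for x using vecD(1)[OF c(1)] vecD(1)[OF c(2)] by (cases x) (auto simp: a_def)
  moreover have "a x = \<zero>" if "x \<notin> Sum_Type.Plus S T" for x
    using that vecD(2)[OF c(1)] vecD(2)[OF c(2)] by (cases x) (auto simp: a_def)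
  ultimately have "a \<in> vec (Sum_Type.Plus S T)" by (simp add: free_module_carrier)
  moreover have "sum_map M f g a = f c \<oplus>\<^bsub>M\<^esub> g d" by (simp add: sum_map_def a_def)
  ultimately show ?thesis using that by blast
qed

lemma tensor_span_ideal:
  assumes J: "ideal J R" and L: "L \<subseteq> vec T" and K: "\<And>x s. x \<in> K \<Longrightarrow> x s \<in> J" and z: "z \<in> tensor_span R K L"
  shows "z p \<in> J"
  using z
proof induction
  interpret J: ideal J R by fact
  case zero
  then show ?case by simp
next
  interpret J: ideal J R by fact
  case (add z x y)
  have "x (fst p) \<otimes> y (snd p) \<in> J" by (rule J.I_r_closed[OF K[OF add(2)] sub_vecD[OF L add(3)]])
  then show ?case using add(4) by simp
qed

lemma tensor_span_ideal':
  assumes J: "ideal J R" and K: "K \<subseteq> vec S" and L: "\<And>x s. x \<in> L \<Longrightarrow> x s \<in> J" and z: "z \<in> tensor_span R K L"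
  shows "z p \<in> J"
  using z
proof induction
  interpret J: ideal J R by fact
  case zero
  then show ?case by simp
next
  interpret J: ideal J R by fact
  case (add z x y)
  have "x (fst p) \<otimes> y (snd p) \<in> J" by (rule J.I_l_closed[OF L[OF add(3)] sub_vecD[OF K add(2)]])
  then show ?case using add(4) by simp
qed

end

section \<open>Minimal resolutions\<close>

text \<open>Minimality is expressed by \<open>eps_kernel\<close> and \<open>d_kernel\<close>: no
  relation has a unit coefficient. All bases are sets of natural numbers, so that every degree lives
  on one type.\<close>

locale minimal_resolution = dualizing_cube R m \<omega> for R :: "('a, 'r) ring_scheme" (structure) and m
    and \<omega> :: "('a, 'b, 'w) module_scheme" +
  fixes I :: "nat \<Rightarrow> nat set" and \<epsilon> :: "(nat \<Rightarrow> 'a) \<Rightarrow> 'b" and d :: "nat \<Rightarrow> (nat \<Rightarrow> 'a) \<Rightarrow> nat \<Rightarrow> 'a"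
  assumes fin: "finite (I n)"
    and eps: "\<epsilon> \<in> module_hom R (free_module R (I 0)) \<omega>" and eps_surj: "\<epsilon> ` vec (I 0) = carrier \<omega>"
    and eps_kernel: "c \<in> vec (I 0) \<Longrightarrow> \<epsilon> c = \<zero>\<^sub>w \<Longrightarrow> c i \<in> m"
    and d: "d n \<in> module_hom R (free_module R (I (Suc n))) (free_module R (I n))"
    and exact_0: "d 0 ` vec (I 1) = {c \<in> vec (I 0). \<epsilon> c = \<zero>\<^sub>w}"
    and exact_Suc: "d (Suc n) ` vec (I (Suc (Suc n))) = {c \<in> vec (I (Suc n)). d n c = (\<lambda>s. \<zero>)}"
    and d_kernel: "c \<in> vec (I (Suc n)) \<Longrightarrow> d n c = (\<lambda>s. \<zero>) \<Longrightarrow> c i \<in> m"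
begin

definition K :: "nat \<Rightarrow> (nat \<Rightarrow> 'a) set" where "K n = d n ` vec (I (Suc n))"

lemma d_closed: "c \<in> vec (I (Suc n)) \<Longrightarrow> d n c \<in> vec (I n)" by (rule module_hom_closed[OF d])

lemma K_0: "K 0 = {c \<in> vec (I 0). \<epsilon> c = \<zero>\<^sub>w}" using exact_0 by (simp add: K_def)

lemma K_Suc: "K (Suc n) = {c \<in> vec (I (Suc n)). d n c = (\<lambda>s. \<zero>)}" using exact_Suc by (simp add: K_def)

lemma K_ideal: "x \<in> K n \<Longrightarrow> x s \<in> m"
  by (cases n) (auto simp: K_0 K_Suc intro: eps_kernel d_kernel)

lemma K_vec: "K n \<subseteq> vec (I n)" by (cases n) (auto simp: K_0 K_Suc)

lemma K_submodule: "is_submodule R (free_module R (I n)) (K n)"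
  unfolding K_def by (rule is_submodule_image[OF module_free module_free d module.is_submodule_carrier[OF module_free]])

text \<open>By dimension shifting the condition says \<open>Tor\<^sub>i(\<omega>, \<omega>) = 0\<close> for \<open>i = a + b + 1\<close>.\<close>

abbreviation tor_vanishes :: "nat \<Rightarrow> nat \<Rightarrow> bool" where
  "tor_vanishes a b \<equiv> tor_independent R (I a) (K a) (I b) (K b)"

lemma tor_vanishes_sym: "tor_vanishes a b \<Longrightarrow> tor_vanishes b a"
  by (rule tor_independent_sym[OF K_vec K_vec])

lemma tor_vanishes_Suc: "tor_vanishes (Suc a) b \<Longrightarrow> tor_vanishes a (Suc b)"
  using tor_independent_shift[OF d d, of a b] by (simp add: K_Suc[symmetric] K_def[symmetric])

text \<open>Shifting only moves degrees from the first index to the second; symmetry therefore first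
  provides the start (a + b, 0).\<close>

lemma tor_vanishes_shift:
  assumes "tor_vanishes 0 (a + b)" shows "tor_vanishes a b"
proof -
  have "tor_vanishes (a + b) 0" by (rule tor_vanishes_sym[OF assms])
  moreover have "tor_vanishes (a + b) c \<Longrightarrow> tor_vanishes a (b + c)" for c
  proof (induction b arbitrary: c)
    case (Suc b)
    then show ?case using tor_vanishes_Suc[of "a + b" c] Suc.IH[of "Suc c"] by simp
  qed simp
  ultimately show ?thesis by (metis add_0_right)
qed

text \<open>The generators of \<open>K a\<close> and \<open>K b\<close> have linearly independent products modulo \<open>m\<close>.\<close>

lemma products_independent:
  assumes T: "tor_vanishes (Suc a) b" and c: "c \<in> vec (I (Suc a) \<times> I (Suc b))"
    and z: "col_map (d a) (row_map (d b) c) = (\<lambda>p. \<zero>)"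
  shows "c p \<in> m"
proof -
  define v where "v = row_map (d b) c"
  have v: "v \<in> tensor_span R (vec (I (Suc a))) (K b)"
    unfolding v_def K_def using row_map_span[OF d order.refl order.refl] c unfolding vec_Times by blast
  have vv: "v \<in> vec (I (Suc a) \<times> I b)" by (rule tensor_span_vec[OF order.refl K_vec v])
  have "v \<in> tensor_span R (K (Suc a)) (vec (I b))"
    unfolding K_Suc by (rule col_map_kernel[OF d vv z[folded v_def]])
  then have "v \<in> tensor_span R (K (Suc a)) (K b)" using T v unfolding tor_independent_def by blast
  then have "v \<in> tensor_span R (K (Suc a)) (d b ` vec (I (Suc b)))" by (simp add: K_def)
  from row_map_lift[OF d K_vec order.refl this]
  obtain u where u: "u \<in> tensor_span R (K (Suc a)) (vec (I (Suc b)))" "row_map (d b) u = v" .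
  have uv: "u \<in> vec (I (Suc a) \<times> I (Suc b))" by (rule tensor_span_vec[OF K_vec order.refl u(1)])
  \<comment> \<open>Now c = w + u, where the rows of w lie in \<open>K (Suc b)\<close> and the
    columns of u in \<open>K (Suc a)\<close>. By minimality both summands have entries in m.\<close>
  define w where "w = (\<lambda>p. c p \<ominus> u p)"
  have wv: "w \<in> vec (I (Suc a) \<times> I (Suc b))" unfolding w_def by (rule vec_minus[OF c uv])
  have "row_map (d b) w = (\<lambda>p. \<zero>)"
    unfolding w_def hom_vec(4)[OF row_map_hom[OF d] module_free c uv] u(2) v_def[symmetric] free_minus[OF vv vv]
    using vecD(1)[OF vv] by (simp add: a_minus_def r_neg)
  from row_map_kernel[OF d wv this] have wK: "w \<in> tensor_span R (vec (I (Suc a))) (K (Suc b))" unfolding K_Suc .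
  have "w p \<in> m" by (rule tensor_span_ideal'[OF ideal_m order.refl _ wK]) (rule K_ideal)
  moreover have "u p \<in> m" by (rule tensor_span_ideal[OF ideal_m order.refl _ u(1)]) (rule K_ideal)
  moreover have "c p = w p \<oplus> u p"
    using vecD(1)[OF c] vecD(1)[OF uv] by (simp add: w_def a_minus_def a_assoc l_neg)
  ultimately show ?thesis using m_simps(3) by simp
qed

end

section \<open>Existence of minimal resolutions, bases of ideals\<close>

context dualizing_cube
begin

text \<open>The cover is built inside the free module on all natural numbers, where
  \<open>noeth_vec\<close> applies, and its target is narrowed to \<open>I\<close>
  afterwards.\<close>

lemma minimal_cover_free:
  fixes I :: "nat set"
  assumes I: "finite I" and H: "is_submodule R (free_module R I) H"
  shows "\<exists>(J :: nat set) f. finite J \<and> f \<in> module_hom R (free_module R J) (free_module R I) \<and> f ` vec J = H \<and>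
    (\<forall>c i. c \<in> vec J \<longrightarrow> f c = (\<lambda>s. \<zero>) \<longrightarrow> c i \<in> m)"
proof -
  have HU: "is_submodule R (free_module R UNIV) H" by (rule is_submodule_free_mono[OF H]) simp
  have "fin_gen R (free_module R UNIV) H"
    using noeth_vec[OF artinian_noeth[OF artinian] I] HU is_submoduleD(1)[OF H] unfolding noeth_def by blast
  from minimal_cover[OF module_free HU this]
  obtain J :: "nat set" and f where f: "finite J" "f \<in> module_hom R (free_module R J) (free_module R UNIV)"
    "f ` vec J = H" "\<And>c i. c \<in> vec J \<Longrightarrow> f c = \<zero>\<^bsub>free_module R (UNIV :: nat set)\<^esub> \<Longrightarrow> c i \<in> m"
    by blast
  have fh: "f \<in> module_hom R (free_module R J) (free_module R I)"
    using f(3) is_submoduleD(1)[OF H] module_hom_add[OF f(2)] module_hom_smult[OF f(2)]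
    by (intro module_homI) auto
  show ?thesis
    by (intro exI[of _ J] exI[of _ f] conjI allI impI f(1) fh f(3)) (use f(4) in simp)
qed

text \<open>The state of the dependent choice is a basis together with the submodule to be covered
  next. The maps relate consecutive states only, so they are chosen once the states are
  fixed.\<close>

lemma minimal_resolution_exists:
  obtains I :: "nat \<Rightarrow> nat set" and \<epsilon> d where "minimal_resolution R m \<omega> I \<epsilon> d"
proof -
  define step where "step IH JK \<longleftrightarrow> (\<exists>f. f \<in> module_hom R (free_module R (fst JK)) (free_module R (fst IH)) \<and>
    f ` vec (fst JK) = snd IH \<and> snd JK = {c \<in> vec (fst JK). f c = (\<lambda>s. \<zero>)} \<and>
    (\<forall>c i. c \<in> vec (fst JK) \<longrightarrow> f c = (\<lambda>s. \<zero>) \<longrightarrow> c i \<in> m))" for IH JK :: "nat set \<times> (nat \<Rightarrow> 'a) set"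
  define good where "good IH \<longleftrightarrow> finite (fst IH) \<and> is_submodule R (free_module R (fst IH)) (snd IH)"
    for IH :: "nat set \<times> (nat \<Rightarrow> 'a) set"
  have "fin_gen R \<omega> (carrier \<omega>)" using noeth_omega W.is_submodule_carrier unfolding noeth_def by blast
  from minimal_cover[OF module_omega W.is_submodule_carrier this]
  obtain I0 :: "nat set" and \<epsilon> where e: "finite I0" "\<epsilon> \<in> module_hom R (free_module R I0) \<omega>" "\<epsilon> ` vec I0 = carrier \<omega>"
    "\<And>c i. c \<in> vec I0 \<Longrightarrow> \<epsilon> c = \<zero>\<^sub>w \<Longrightarrow> c i \<in> m" by blast
  define st0 where "st0 = (I0, {c \<in> vec I0. \<epsilon> c = \<zero>\<^sub>w})"
  have g0: "good st0"
    unfolding good_def st0_def using e(1) is_submodule_kernel[OF module_free module_omega e(2)] by simp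
  have "\<exists>F. \<forall>n. (good (F n) \<and> (n = 0 \<longrightarrow> F n = st0)) \<and> step (F n) (F (Suc n))"
  proof (rule dependent_nat_choice)
    show "\<exists>x. good x \<and> (0 = 0 \<longrightarrow> x = st0)" using g0 by blast
    fix x and n :: nat assume x: "good x \<and> (n = 0 \<longrightarrow> x = st0)"
    then have "finite (fst x)" "is_submodule R (free_module R (fst x)) (snd x)" by (simp_all add: good_def)
    from minimal_cover_free[OF this] obtain J :: "nat set" and f where f: "finite J"
      "f \<in> module_hom R (free_module R J) (free_module R (fst x))" "f ` vec J = snd x"
      "\<forall>c i. c \<in> vec J \<longrightarrow> f c = (\<lambda>s. \<zero>) \<longrightarrow> c i \<in> m"
      by (elim exE conjE)
    have "is_submodule R (free_module R J) {c \<in> vec J. f c = (\<lambda>s. \<zero>)}"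
      using is_submodule_kernel[OF module_free module_free f(2)] by simp
    then show "\<exists>y. (good y \<and> (Suc n = 0 \<longrightarrow> y = st0)) \<and> step x y"
      using f unfolding good_def step_def by (intro exI[of _ "(J, {c \<in> vec J. f c = (\<lambda>s. \<zero>)})"]) auto
  qed
  then obtain F where F: "\<And>n. good (F n)" "F 0 = st0" "\<And>n. step (F n) (F (Suc n))" by blast
  from F(3) have "\<forall>n. \<exists>f. f \<in> module_hom R (free_module R (fst (F (Suc n)))) (free_module R (fst (F n))) \<and>
      f ` vec (fst (F (Suc n))) = snd (F n) \<and> snd (F (Suc n)) = {c \<in> vec (fst (F (Suc n))). f c = (\<lambda>s. \<zero>)} \<and>
      (\<forall>c i. c \<in> vec (fst (F (Suc n))) \<longrightarrow> f c = (\<lambda>s. \<zero>) \<longrightarrow> c i \<in> m)"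
    unfolding step_def by (rule allI)
  from choice[OF this] obtain d where
    "\<forall>n. d n \<in> module_hom R (free_module R (fst (F (Suc n)))) (free_module R (fst (F n))) \<and>
      d n ` vec (fst (F (Suc n))) = snd (F n) \<and> snd (F (Suc n)) = {c \<in> vec (fst (F (Suc n))). d n c = (\<lambda>s. \<zero>)} \<and>
      (\<forall>c i. c \<in> vec (fst (F (Suc n))) \<longrightarrow> d n c = (\<lambda>s. \<zero>) \<longrightarrow> c i \<in> m)"
    by (elim exE)
  then have d: "\<And>n. d n \<in> module_hom R (free_module R (fst (F (Suc n)))) (free_module R (fst (F n)))"
    "\<And>n. d n ` vec (fst (F (Suc n))) = snd (F n)"
    "\<And>n. snd (F (Suc n)) = {c \<in> vec (fst (F (Suc n))). d n c = (\<lambda>s. \<zero>)}"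
    "\<And>n c i. c \<in> vec (fst (F (Suc n))) \<Longrightarrow> d n c = (\<lambda>s. \<zero>) \<Longrightarrow> c i \<in> m"
    by blast+
  have "minimal_resolution R m \<omega> (\<lambda>n. fst (F n)) \<epsilon> d"
  proof
    show "finite (fst (F n))" for n using F(1) by (simp add: good_def)
    show "d 0 ` vec (fst (F 1)) = {c \<in> vec (fst (F 0)). \<epsilon> c = \<zero>\<^sub>w}"
      using d(2)[of 0] by (simp add: F(2) st0_def)
    show "d (Suc n) ` vec (fst (F (Suc (Suc n)))) = {c \<in> vec (fst (F (Suc n))). d n c = (\<lambda>s. \<zero>)}" for n
      using d(2)[of "Suc n"] d(3)[of n] by simp
  qed (use d e in \<open>simp_all add: F(2) st0_def\<close>)
  then show ?thesis using that by blast
qed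

lemma ideal_basis:
  assumes J: "ideal J R"
  obtains E :: "nat set" and v where "finite E" "v \<in> module_hom R (free_module R E) (ring_module R)" "v ` vec E = J"
    "\<And>c i. c \<in> vec E \<Longrightarrow> v c = \<zero> \<Longrightarrow> c i \<in> m"
proof -
  have J': "is_submodule R (ring_module R) J" using J by (simp add: is_submodule_ring)
  then have fg: "fin_gen R (ring_module R) J"
    using artinian_noeth[OF artinian] is_submoduleD(1)[OF J'] unfolding noeth_def by simp
  show ?thesis
    by (rule minimal_cover[OF module_ring J' fg]) (use that in simp)
qed

text \<open>A minimal cover of m excludes relations v c = 0 with unit coefficients. If v c only lies
  in m^2, then v c = v b for some b with entries in m, and c - b is a true relation; this is
  independence in m/m^2.\<close>

lemma m_basis:
  obtains E :: "nat set" and v where "finite E" "v \<in> module_hom R (free_module R E) (ring_module R)" "v ` vec E = m"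
    "\<And>c i. c \<in> vec E \<Longrightarrow> v c \<in> m2 \<Longrightarrow> c i \<in> m"
proof -
  obtain E :: "nat set" and v where v: "finite E" "v \<in> module_hom R (free_module R E) (ring_module R)" "v ` vec E = m"
    "\<And>c i. c \<in> vec E \<Longrightarrow> v c = \<zero> \<Longrightarrow> c i \<in> m" by (rule ideal_basis[OF ideal_m]) (blast intro: that)
  have lift: "\<exists>b \<in> ivec m E. v b = z" if "z \<in> m2" for z
    using that
  proof (induction rule: ideal_prod.induct)
    case (prod a b)
    obtain c where c: "c \<in> vec E" "v c = b" using v(3) prod(2) by blast
    note ac = m_simps(1)[OF prod(1)]
    have "a \<otimes> c s \<in> m" for s using m_simps(7)[OF vecD(1)[OF c(1)] prod(1)] .
    then have "(\<lambda>s. a \<otimes> c s) \<in> ivec m E" using vec_smult[OF ac c(1)] by (simp add: ivec_def)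
    moreover have "v (\<lambda>s. a \<otimes> c s) = a \<otimes> b" using hom_vec(2)[OF v(2) ac c(1)] c(2) by simp
    ultimately show ?case by blast
  next
    case (sum x y)
    then obtain b c where bc: "b \<in> ivec m E" "v b = x" "c \<in> ivec m E" "v c = y" by blast
    have "v (\<lambda>s. b s \<oplus> c s) = x \<oplus> y" using hom_vec(1)[OF v(2), of b c] bc by (simp add: ivec_def)
    moreover have "(\<lambda>s. b s \<oplus> c s) \<in> ivec m E" using subm_vec(3)[OF ivec_submodule[OF ideal_m] bc(1,3)] .
    ultimately show ?case by blast
  qed
  have "c i \<in> m" if c: "c \<in> vec E" "v c \<in> m2" for c i
  proof -
    obtain b where b: "b \<in> ivec m E" "v b = v c" using lift[OF c(2)] by blast
    have bv: "b \<in> vec E" "b i \<in> m" using b(1) by (auto simp: ivec_def)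
    interpret RM: module R "ring_module R" by (rule module_ring)
    have "v (\<lambda>s. c s \<ominus> b s) = \<zero>"
      using hom_vec(4)[OF v(2) module_ring c(1) bv(1)] RM.M.r_neg[OF module_hom_closed[OF v(2) c(1)]] b(2)
      by (simp add: a_minus_def)
    then have "c i \<ominus> b i \<in> m" using v(4)[OF vec_minus[OF c(1) bv(1)]] by blast
    then have "(c i \<ominus> b i) \<oplus> b i \<in> m" using bv(2) m_simps(3) by blast
    then show ?thesis using vecD(1)[OF c(1)] vecD(1)[OF bv(1)] by (simp add: a_minus_def a_assoc l_neg)
  qed
  then show ?thesis using that[OF v(1-3)] by blast
qed

text \<open>A socle-valued map lifts along r \<mapsto> r soc and so becomes a functional on the free
  module, to which \<open>card_le_functionals\<close> applies.\<close>

lemma socle_coefficients: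
  assumes h: "h \<in> module_hom R (free_module R S) \<omega>" and "\<And>c a. c \<in> vec S \<Longrightarrow> a \<in> m \<Longrightarrow> a \<cdot>\<^sub>w h c = \<zero>\<^sub>w"
  obtains f where "f \<in> module_hom R (free_module R S) (ring_module R)" "\<And>c. c \<in> vec S \<Longrightarrow> h c = f c \<cdot>\<^sub>w soc"
proof -
  have p: "(\<lambda>r. r \<cdot>\<^sub>w soc) \<in> module_hom R (ring_module R) \<omega>"
    using soc(1) by (intro module_homI) (simp_all add: W.smult_l_distr W.smult_assoc1)
  have "h (basis_vec R s) \<in> (\<lambda>r. r \<cdot>\<^sub>w soc) ` carrier (ring_module R)" if s: "s \<in> S" for s
  proof -
    obtain r where "r \<in> carrier R" "h (basis_vec R s) = r \<cdot>\<^sub>w soc"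
      by (rule socle[OF module_hom_closed[OF h vec_basis[OF s]] assms(2)[OF vec_basis[OF s]]])
    then show ?thesis by auto
  qed
  then show ?thesis
    using free_lift[OF module_ring module_omega p h] that by metis
qed

lemma socle_submodule:
  assumes H: "is_submodule R \<omega> H" "H \<noteq> {\<zero>\<^sub>w}" and z: "z \<in> carrier \<omega>" "\<And>a. a \<in> m \<Longrightarrow> a \<cdot>\<^sub>w z = \<zero>\<^sub>w"
  shows "z \<in> H"
proof -
  obtain r where "r \<in> carrier R" "z = r \<cdot>\<^sub>w soc" by (rule socle[OF z])
  then show ?thesis using is_submoduleD(5)[OF H(1) _ soc(4)[OF H]] by simp
qed

lemma annihilated_by_m:
  assumes v: "v \<in> module_hom R (free_module R E) (ring_module R)" "v ` vec E = m"
    and z: "z \<in> carrier \<omega>" "\<And>i. i \<in> E \<Longrightarrow> v (basis_vec R i) \<cdot>\<^sub>w z = \<zero>\<^sub>w" and a: "a \<in> m"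
  shows "a \<cdot>\<^sub>w z = \<zero>\<^sub>w"
proof -
  have X: "is_submodule R (ring_module R) {a \<in> carrier R. a \<cdot>\<^sub>w z = \<zero>\<^sub>w}"
    unfolding is_submodule_ring by (rule W.ideal_annihilator[OF z(1)])
  obtain c where "c \<in> vec E" "a = v c" using a v(2) by blast
  moreover have "v c \<in> {a \<in> carrier R. a \<cdot>\<^sub>w z = \<zero>\<^sub>w}" if "c \<in> vec E" for c
    using z(2) module_hom_closed[OF v(1) vec_basis] by (intro hom_vec_into[OF module_ring v(1) X _ that]) simp
  ultimately show ?thesis by blast
qed

end

section \<open>The case of vanishing Tor in degree one\<close>

context minimal_resolution
begin

text \<open>These are m \<omega> and m^2 \<omega>. Taking them as images of m F and m^2 F avoids
  sums of products in \<omega>.\<close>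

definition mw :: "'b set" where "mw = \<epsilon> ` ivec m (I 0)"
definition m2w :: "'b set" where "m2w = \<epsilon> ` ivec m2 (I 0)"

lemma mw: "is_submodule R \<omega> mw" "z \<in> carrier \<omega> \<Longrightarrow> a \<in> m \<Longrightarrow> a \<cdot>\<^sub>w z \<in> mw"
  and m2w: "is_submodule R \<omega> m2w" "z \<in> carrier \<omega> \<Longrightarrow> a \<in> m2 \<Longrightarrow> a \<cdot>\<^sub>w z \<in> m2w"
    "z \<in> mw \<Longrightarrow> a \<in> m \<Longrightarrow> a \<cdot>\<^sub>w z \<in> m2w" "z \<in> m2w \<Longrightarrow> a \<in> m \<Longrightarrow> a \<cdot>\<^sub>w z = \<zero>\<^sub>w"
proof -
  show "is_submodule R \<omega> mw" "is_submodule R \<omega> m2w"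
    unfolding mw_def m2w_def
    by (rule is_submodule_image[OF module_free module_omega eps ivec_submodule], rule ideal_m ideal_m2)+
  have sm: "(\<lambda>s. a \<otimes> c s) \<in> ivec J (I 0) \<and> a \<cdot>\<^sub>w \<epsilon> c = \<epsilon> (\<lambda>s. a \<otimes> c s)"
    if "a \<in> carrier R" "c \<in> vec (I 0)" "\<And>s. a \<otimes> c s \<in> J" for a c J
    using hom_vec(2)[OF eps that(1,2)] vec_smult[OF that(1,2)] that(3) by (simp add: ivec_def)
  show "a \<cdot>\<^sub>w z \<in> mw" if z: "z \<in> carrier \<omega>" and a: "a \<in> m" for a z
  proof -
    obtain c where c: "c \<in> vec (I 0)" "z = \<epsilon> c" using z eps_surj by blast
    show ?thesis
      unfolding c(2) mw_def using sm[OF m_simps(1)[OF a] c(1) m_simps(7)[OF vecD(1)[OF c(1)] a]] by auto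
  qed
  show "a \<cdot>\<^sub>w z \<in> m2w" if z: "z \<in> carrier \<omega>" and a: "a \<in> m2" for a z
  proof -
    obtain c where c: "c \<in> vec (I 0)" "z = \<epsilon> c" using z eps_surj by blast
    show ?thesis
      unfolding c(2) m2w_def using sm[OF m2_simps(1)[OF a] c(1) m2_simps(7)[OF vecD(1)[OF c(1)] a]] by auto
  qed
  show "a \<cdot>\<^sub>w z \<in> m2w" if z: "z \<in> mw" and a: "a \<in> m" for a z
  proof -
    obtain c where c: "c \<in> vec (I 0)" "\<And>s. c s \<in> m" "z = \<epsilon> c" using z by (auto simp: mw_def ivec_def)
    show ?thesis unfolding c(3) m2w_def using sm[OF m_simps(1)[OF a] c(1) m2I[OF a c(2)]] by auto
  qed
  show "a \<cdot>\<^sub>w z = \<zero>\<^sub>w" if z: "z \<in> m2w" and a: "a \<in> m" for a z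
  proof -
    obtain c where c: "c \<in> vec (I 0)" "\<And>s. c s \<in> m2" "z = \<epsilon> c" using z by (auto simp: m2w_def ivec_def)
    have "(\<lambda>s. a \<otimes> c s) = (\<lambda>s. \<zero>)" using m3_zero(2)[OF c(2) a] by simp
    then show ?thesis unfolding c(3) using hom_vec(2)[OF eps m_simps(1)[OF a] c(1)] hom_vec(3)[OF eps module_omega] by simp
  qed
qed

lemma eps_pair:
  assumes "i \<in> I 0" "j \<in> I 0" "x \<in> carrier R" "y \<in> carrier R"
  shows "(\<lambda>s. x \<otimes> basis_vec R i s \<oplus> y \<otimes> basis_vec R j s) \<in> vec (I 0)"
    "\<epsilon> (\<lambda>s. x \<otimes> basis_vec R i s \<oplus> y \<otimes> basis_vec R j s)
      = x \<cdot>\<^sub>w \<epsilon> (basis_vec R i) \<oplus>\<^bsub>\<omega>\<^esub> y \<cdot>\<^sub>w \<epsilon> (basis_vec R j)"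
proof -
  note i = vec_basis[OF assms(1)] and j = vec_basis[OF assms(2)]
  note v = vec_smult[OF assms(3) i] vec_smult[OF assms(4) j]
  show "(\<lambda>s. x \<otimes> basis_vec R i s \<oplus> y \<otimes> basis_vec R j s) \<in> vec (I 0)" by (rule vec_add[OF v])
  show "\<epsilon> (\<lambda>s. x \<otimes> basis_vec R i s \<oplus> y \<otimes> basis_vec R j s)
      = x \<cdot>\<^sub>w \<epsilon> (basis_vec R i) \<oplus>\<^bsub>\<omega>\<^esub> y \<cdot>\<^sub>w \<epsilon> (basis_vec R j)"
    using hom_vec(1)[OF eps v] hom_vec(2)[OF eps assms(3) i] hom_vec(2)[OF eps assms(4) j] by simp
qed

text \<open>A socle element t of R sends the generators to p soc and q soc. The coefficients q t and
  -(p t) then form a relation; if q t = 0, already t times the second generator vanishes.\<close>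

lemma K_0_nonzero:
  assumes i: "i \<in> I 0" and j: "j \<in> I 0" "i \<noteq> j"
  obtains x where "x \<in> K 0" "x \<noteq> (\<lambda>s. \<zero>)"
proof -
  obtain t where t: "t \<in> carrier R" "t \<noteq> \<zero>" "\<And>a. a \<in> m \<Longrightarrow> a \<otimes> t = \<zero>" by (rule ring_socle_element) (blast intro: that)
  have wc: "\<epsilon> (basis_vec R k) \<in> carrier \<omega>" if "k \<in> I 0" for k using module_hom_closed[OF eps vec_basis[OF that]] .
  have "\<exists>r\<in>carrier R. t \<cdot>\<^sub>w \<epsilon> (basis_vec R k) = r \<cdot>\<^sub>w soc" if k: "k \<in> I 0" for k
  proof -
    have "a \<cdot>\<^sub>w (t \<cdot>\<^sub>w \<epsilon> (basis_vec R k)) = \<zero>\<^sub>w" if "a \<in> m" for a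
      using t(3)[OF that] wc[OF k] W.smult_assoc1[OF m_simps(1)[OF that] t(1) wc[OF k]] by simp
    then obtain r where "r \<in> carrier R" "t \<cdot>\<^sub>w \<epsilon> (basis_vec R k) = r \<cdot>\<^sub>w soc"
      using socle[OF W.smult_closed[OF t(1) wc[OF k]]] by blast
    then show ?thesis by blast
  qed
  then obtain p q where p: "p \<in> carrier R" "t \<cdot>\<^sub>w \<epsilon> (basis_vec R i) = p \<cdot>\<^sub>w soc"
    and q: "q \<in> carrier R" "t \<cdot>\<^sub>w \<epsilon> (basis_vec R j) = q \<cdot>\<^sub>w soc" using i j(1) by metis
  let ?y = "\<lambda>s. (q \<otimes> t) \<otimes> basis_vec R i s \<oplus> (\<ominus> (p \<otimes> t)) \<otimes> basis_vec R j s"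
  have qt: "q \<otimes> t \<in> carrier R" "\<ominus> (p \<otimes> t) \<in> carrier R" using p q t by auto
  have "\<epsilon> ?y = (q \<otimes> p) \<cdot>\<^sub>w soc \<oplus>\<^bsub>\<omega>\<^esub> \<ominus>\<^bsub>\<omega>\<^esub> ((p \<otimes> q) \<cdot>\<^sub>w soc)"
    using eps_pair(2)[OF i j(1) qt] p q t(1) wc[OF i] wc[OF j(1)] soc(1)
    by (simp add: W.smult_l_minus W.smult_assoc1)
  then have "\<epsilon> ?y = \<zero>\<^sub>w" using p q soc(1) by (simp add: m_comm W.M.r_neg)
  then have yK: "?y \<in> K 0" using eps_pair(1)[OF i j(1) qt] by (simp add: K_0)
  show ?thesis
  proof (cases "q \<otimes> t = \<zero>")
    case False
    have "?y i = q \<otimes> t" using qt j(2) by (simp add: basis_vec_def)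
    then have "?y \<noteq> (\<lambda>s. \<zero>)" using False by metis
    then show ?thesis using that yK by blast
  next
    case True
    have "q \<in> m"
    proof (rule ccontr)
      assume "q \<notin> m"
      then have u: "q \<in> Units R" by (rule unitI[OF q(1)])
      have "t = inv q \<otimes> (q \<otimes> t)" using u q(1) t(1) by (simp add: m_assoc[symmetric])
      then show False using True u t(2) by simp
    qed
    then have "t \<cdot>\<^sub>w \<epsilon> (basis_vec R j) = \<zero>\<^sub>w" using q(2) soc(3) by simp
    then have "(\<lambda>s. t \<otimes> basis_vec R j s) \<in> K 0"
      using hom_vec(2)[OF eps t(1) vec_basis[OF j(1)]] vec_smult[OF t(1) vec_basis[OF j(1)]] by (simp add: K_0)
    moreover have "(\<lambda>s. t \<otimes> basis_vec R j s) j = t" using t(1) by (simp add: basis_vec_def)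
    then have "(\<lambda>s. t \<otimes> basis_vec R j s) \<noteq> (\<lambda>s. \<zero>)" using t(2) by metis
    ultimately show ?thesis using that by blast
  qed
qed

text \<open>As m kills m^2 \<omega>, it lies in the one-dimensional socle, so one nonzero product of
  an element of m^2 with a generator spans it. If m^2 \<omega> = 0, any index serves.\<close>

lemma m2w_multiple:
  assumes "I 0 \<noteq> {}"
  obtains i where "i \<in> I 0" "\<And>z. z \<in> m2w \<Longrightarrow> \<exists>\<beta>\<in>m2. z = \<beta> \<cdot>\<^sub>w \<epsilon> (basis_vec R i)"
proof (cases "m2w = {\<zero>\<^sub>w}")
  case True
  obtain i where i: "i \<in> I 0" using assms by blast
  have z: "\<zero>\<^sub>w = \<zero> \<cdot>\<^sub>w \<epsilon> (basis_vec R i)" using module_hom_closed[OF eps vec_basis[OF i]] by simp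
  show ?thesis
  proof (rule that[OF i])
    fix z assume "z \<in> m2w"
    then show "\<exists>\<beta>\<in>m2. z = \<beta> \<cdot>\<^sub>w \<epsilon> (basis_vec R i)"
      using True z m2_simps(2) by (intro bexI[of _ \<zero>]) simp_all
  qed
next
  case False
  have "\<exists>i\<in>I 0. \<exists>a\<in>m2. a \<cdot>\<^sub>w \<epsilon> (basis_vec R i) \<noteq> \<zero>\<^sub>w"
  proof (rule ccontr)
    assume *: "\<not> ?thesis"
    have "\<epsilon> c \<in> {\<zero>\<^sub>w}" if "c \<in> ivec m2 (I 0)" for c
      by (rule hom_ivec_into[OF module_omega eps W.is_submodule_zero _ that ideal_m2]) (use * in blast)
    then have "m2w \<subseteq> {\<zero>\<^sub>w}" by (auto simp: m2w_def)
    then show False using False is_submoduleD(3)[OF m2w(1)] by blast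
  qed
  then obtain i a where i: "i \<in> I 0" and a: "a \<in> m2" "a \<cdot>\<^sub>w \<epsilon> (basis_vec R i) \<noteq> \<zero>\<^sub>w" by blast
  note wc = module_hom_closed[OF eps vec_basis[OF i]] and ac = m2_simps(1)[OF a(1)]
  have aw: "a \<cdot>\<^sub>w \<epsilon> (basis_vec R i) \<in> m2w" by (rule m2w(2)[OF wc a(1)])
  obtain u where u: "u \<in> carrier R" "a \<cdot>\<^sub>w \<epsilon> (basis_vec R i) = u \<cdot>\<^sub>w soc"
    by (rule socle[OF is_submoduleD(2)[OF m2w(1) aw] m2w(4)[OF aw]])
  have "u \<notin> m" using a(2) u(2) soc(3) by auto
  then have uU: "u \<in> Units R" by (rule unitI[OF u(1)])
  have "\<exists>\<beta>\<in>m2. z = \<beta> \<cdot>\<^sub>w \<epsilon> (basis_vec R i)" if z: "z \<in> m2w" for z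
  proof -
    obtain r where r: "r \<in> carrier R" "z = r \<cdot>\<^sub>w soc"
      by (rule socle[OF is_submoduleD(2)[OF m2w(1) z] m2w(4)[OF z]])
    have "((r \<otimes> inv u) \<otimes> a) \<cdot>\<^sub>w \<epsilon> (basis_vec R i) = r \<cdot>\<^sub>w (inv u \<cdot>\<^sub>w (u \<cdot>\<^sub>w soc))"
      using r uU ac wc u soc(1) by (simp add: W.smult_assoc1)
    also have "\<dots> = z" using W.inv_smult_cancel[OF uU soc(1)] r by simp
    finally show ?thesis using m2_simps(6)[OF _ a(1), of "r \<otimes> inv u"] r uU by (metis Units_inv_closed m_closed)
  qed
  then show ?thesis using that[OF i] by blast
qed

end

lemma (in local_cube) tensor_span_m2:
  assumes "\<And>x s. x \<in> K \<Longrightarrow> x s \<in> m" "\<And>y t. y \<in> L \<Longrightarrow> y t \<in> m" "z \<in> tensor_span R K L"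
  shows "z p \<in> m2"
  using assms(3)
proof induction
  case zero
  then show ?case by (rule m2_simps(2))
next
  case (add z x y)
  show ?case by (rule m2_simps(3)[OF m2I[OF assms(1)[OF add(2)] assms(2)[OF add(3)]] add(4)])
qed

context minimal_resolution
begin

text \<open>Multiplication pairs m/m^2 with m \<omega> / m^2 \<omega> into the socle. An element of
  m \<omega> that pairs to zero is itself in the socle, which lies in the nonzero submodule m^2
  \<omega>; so \<open>card E\<close> functionals detect \<open>S\<close>.\<close>

lemma card_le_m_basis:
  assumes E: "finite E" "v \<in> module_hom R (free_module R E) (ring_module R)" "v ` vec E = m" and S: "finite S"
    and h: "h \<in> module_hom R (free_module R S) \<omega>" "\<And>c. c \<in> vec S \<Longrightarrow> h c \<in> mw" and ne: "m2w \<noteq> {\<zero>\<^sub>w}"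
    and ind: "\<And>c i. c \<in> vec S \<Longrightarrow> h c \<in> m2w \<Longrightarrow> c i \<in> m"
  shows "card S \<le> card E"
proof -
  define k where "k i = (\<lambda>c. v (basis_vec R i) \<cdot>\<^sub>w h c)" for i
  have vb: "v (basis_vec R i) \<in> m" if "i \<in> E" for i using E(3) vec_basis[OF that] by blast
  have "\<exists>f. f \<in> module_hom R (free_module R S) (ring_module R) \<and> (\<forall>c\<in>vec S. k i c = f c \<cdot>\<^sub>w soc)" if i: "i \<in> E" for i
  proof -
    have ki: "k i \<in> module_hom R (free_module R S) \<omega>"
      unfolding k_def by (rule module_hom_comp[OF h(1) W.smult_hom[OF m_simps(1)[OF vb[OF i]]]])
    have k0: "a \<cdot>\<^sub>w k i c = \<zero>\<^sub>w" if "c \<in> vec S" "a \<in> m" for a c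
      unfolding k_def by (rule m2w(4)[OF m2w(3)[OF h(2)[OF that(1)] vb[OF i]] that(2)])
    show ?thesis
    proof (rule socle_coefficients[OF ki k0])
      fix f assume f: "f \<in> module_hom R (free_module R S) (ring_module R)" "\<And>c. c \<in> vec S \<Longrightarrow> k i c = f c \<cdot>\<^sub>w soc"
      show ?thesis by (intro exI[of _ f] conjI ballI f)
    qed
  qed
  then have "\<forall>i\<in>E. \<exists>f. f \<in> module_hom R (free_module R S) (ring_module R) \<and> (\<forall>c\<in>vec S. k i c = f c \<cdot>\<^sub>w soc)" by (rule ballI)
  from bchoice[OF this] obtain f where "\<forall>i\<in>E. f i \<in> module_hom R (free_module R S) (ring_module R) \<and> (\<forall>c\<in>vec S. k i c = f i c \<cdot>\<^sub>w soc)" ..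
  then have f: "\<And>i. i \<in> E \<Longrightarrow> f i \<in> module_hom R (free_module R S) (ring_module R)"
    "\<And>i c. i \<in> E \<Longrightarrow> c \<in> vec S \<Longrightarrow> k i c = f i c \<cdot>\<^sub>w soc" by (blast, blast)
  show ?thesis
  proof (rule card_le_functionals[OF E(1) S f(1)])
    fix c i assume c: "c \<in> vec S" and fm: "\<And>j. j \<in> E \<Longrightarrow> f j c \<in> m"
    have "v (basis_vec R j) \<cdot>\<^sub>w h c = \<zero>\<^sub>w" if "j \<in> E" for j
      using f(2)[OF that c] soc(3)[OF fm[OF that]] by (simp add: k_def)
    then have "a \<cdot>\<^sub>w h c = \<zero>\<^sub>w" if "a \<in> m" for a
      using annihilated_by_m[OF E(2,3) module_hom_closed[OF h(1) c] _ that] by blast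
    then have "h c \<in> m2w" by (rule socle_submodule[OF m2w(1) ne module_hom_closed[OF h(1) c]])
    then show "c i \<in> m" by (rule ind[OF c])
  qed
qed

text \<open>Counting dimensions: if multiplication by \<open>w\<close> embeds \<open>m/m\<^sup>2\<close> into \<open>m\<omega>/m\<^sup>2\<omega>\<close>, it is onto, because
  pairing with \<open>m\<close> embeds \<open>m\<omega>/m\<^sup>2\<omega>\<close> into the dual of \<open>m/m\<^sup>2\<close>.\<close>

lemma mw_multiple:
  assumes w: "w \<in> carrier \<omega>" and nd: "\<And>a. a \<in> m \<Longrightarrow> a \<cdot>\<^sub>w w \<in> m2w \<Longrightarrow> a \<in> m2"
    and a0: "a0 \<in> m" "a0 \<notin> m2" and x: "x \<in> mw"
  obtains b where "b \<in> m" "x \<oplus>\<^bsub>\<omega>\<^esub> b \<cdot>\<^sub>w w \<in> m2w"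
proof -
  have xc: "x \<in> carrier \<omega>" by (rule is_submoduleD(2)[OF mw(1) x])
  have "\<exists>b\<in>m. x \<oplus>\<^bsub>\<omega>\<^esub> b \<cdot>\<^sub>w w \<in> m2w"
  proof (cases "m2w = {\<zero>\<^sub>w}")
    case True
    \<comment> \<open>If m^2 \<omega> = 0, then m \<omega> lies in the socle and is one-dimensional;
      the nonzero element \<open>a0\<close> w already spans it.\<close>
    have killed: "b \<cdot>\<^sub>w y = \<zero>\<^sub>w" if "y \<in> mw" "b \<in> m" for b y
      using m2w(3)[OF that] True by blast
    have aw: "a0 \<cdot>\<^sub>w w \<in> mw" by (rule mw(2)[OF w a0(1)])
    obtain u where u: "u \<in> carrier R" "a0 \<cdot>\<^sub>w w = u \<cdot>\<^sub>w soc"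
      by (rule socle[OF is_submoduleD(2)[OF mw(1) aw] killed[OF aw]])
    have "a0 \<cdot>\<^sub>w w \<noteq> \<zero>\<^sub>w" using nd[OF a0(1)] a0(2) True by auto
    then have "u \<notin> m" using u(2) soc(3) by auto
    then have uU: "u \<in> Units R" by (rule unitI[OF u(1)])
    obtain r where r: "r \<in> carrier R" "x = r \<cdot>\<^sub>w soc" by (rule socle[OF xc killed[OF x]])
    have c: "\<ominus> (r \<otimes> inv u) \<in> carrier R" "r \<otimes> inv u \<in> carrier R" using r uU by auto
    note a0c = m_simps(1)[OF a0(1)]
    have "((r \<otimes> inv u) \<otimes> a0) \<cdot>\<^sub>w w = r \<cdot>\<^sub>w (inv u \<cdot>\<^sub>w (u \<cdot>\<^sub>w soc))"
      using r uU a0c w u soc(1) by (simp add: W.smult_assoc1)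
    also have "\<dots> = x" using W.inv_smult_cancel[OF uU soc(1)] r by simp
    finally have "x \<oplus>\<^bsub>\<omega>\<^esub> (\<ominus> ((r \<otimes> inv u) \<otimes> a0)) \<cdot>\<^sub>w w = \<zero>\<^sub>w"
      using W.smult_l_minus[of "(r \<otimes> inv u) \<otimes> a0" w] c a0c w xc by (simp add: W.M.r_neg)
    moreover have "\<ominus> ((r \<otimes> inv u) \<otimes> a0) \<in> m" using m_simps(4,6) c(2) a0(1) by blast
    ultimately show ?thesis using True by blast
  next
    case False
    show ?thesis
    proof (rule ccontr)
      assume neg: "\<not> ?thesis"
      obtain E :: "nat set" and v where E: "finite E" "v \<in> module_hom R (free_module R E) (ring_module R)" "v ` vec E = m"
        and vi: "\<And>c i. c \<in> vec E \<Longrightarrow> v c \<in> m2 \<Longrightarrow> c i \<in> m" by (rule m_basis) (blast intro: that)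
      have vm: "v c \<in> m" if "c \<in> vec E" for c using E(3) that by blast
      have pw: "(\<lambda>c. v c \<cdot>\<^sub>w w) \<in> module_hom R (free_module R E) \<omega>"
      proof (rule module_hom_comp[OF E(2)])
        show "(\<lambda>r. r \<cdot>\<^sub>w w) \<in> module_hom R (ring_module R) \<omega>"
          using w by (intro module_homI) (simp_all add: W.smult_l_distr W.smult_assoc1)
      qed
      have px: "(\<lambda>c. c () \<cdot>\<^sub>w x) \<in> module_hom R (free_module R (UNIV :: unit set)) \<omega>"
      proof (rule module_hom_comp[OF coord_hom])
        show "(\<lambda>r. r \<cdot>\<^sub>w x) \<in> module_hom R (ring_module R) \<omega>"
          using xc by (intro module_homI) (simp_all add: W.smult_l_distr W.smult_assoc1)
      qed
      let ?P = "Sum_Type.Plus E (UNIV :: unit set)"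
      \<comment> \<open>If x were not congruent to any element of m w, then x and the products of w
        with a basis of m/m^2 would be independent modulo m^2 \<omega>: one element more than
        \<open>card_le_m_basis\<close> permits.\<close>
      define h where "h = sum_map \<omega> (\<lambda>c. v c \<cdot>\<^sub>w w) (\<lambda>c :: unit \<Rightarrow> 'a. c () \<cdot>\<^sub>w x)"
      have h: "h \<in> module_hom R (free_module R ?P) \<omega>" unfolding h_def by (rule sum_map_hom[OF module_omega pw px])
      have he: "h c = v (\<lambda>s. c (Inl s)) \<cdot>\<^sub>w w \<oplus>\<^bsub>\<omega>\<^esub> c (Inr ()) \<cdot>\<^sub>w x" for c by (simp add: h_def sum_map_def)
      have hm: "h c \<in> mw" if c: "c \<in> vec ?P" for c
        unfolding he by (intro is_submoduleD(4)[OF mw(1)] mw(2)[OF w vm[OF vec_Plus(1)[OF c]]]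
          is_submoduleD(5)[OF mw(1) vecD(1)[OF c] x])
      have "card ?P \<le> card E"
      proof (rule card_le_m_basis[OF E _ h hm False])
        show "finite ?P" using E(1) by simp
        fix c i assume c: "c \<in> vec ?P" and hc: "h c \<in> m2w"
        define r where "r = c (Inr ())"
        define b where "b = v (\<lambda>s. c (Inl s))"
        have r: "r \<in> carrier R" unfolding r_def by (rule vecD(1)[OF c])
        have b: "b \<in> m" unfolding b_def by (rule vm[OF vec_Plus(1)[OF c]])
        note bc = m_simps(1)[OF b]
        have hbr: "h c = b \<cdot>\<^sub>w w \<oplus>\<^bsub>\<omega>\<^esub> r \<cdot>\<^sub>w x" unfolding he b_def r_def ..
        have rm: "r \<in> m"
        proof (rule ccontr)
          assume "r \<notin> m"
          then have u: "r \<in> Units R" by (rule unitI[OF r])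
          have "inv r \<cdot>\<^sub>w h c = (inv r \<otimes> b) \<cdot>\<^sub>w w \<oplus>\<^bsub>\<omega>\<^esub> x"
            unfolding hbr using u bc w r xc W.inv_smult_cancel[OF u xc]
            by (simp add: W.smult_r_distr W.smult_assoc1)
          moreover have "inv r \<cdot>\<^sub>w h c \<in> m2w" using is_submoduleD(5)[OF m2w(1) _ hc] u by simp
          moreover have "inv r \<otimes> b \<in> m" using m_simps(6)[OF _ b] u by simp
          ultimately show False using neg W.M.a_comm[OF xc, of "(inv r \<otimes> b) \<cdot>\<^sub>w w"] w m_simps(1) by auto
        qed
        have rx: "r \<cdot>\<^sub>w x \<in> m2w" by (rule m2w(3)[OF x rm])
        have "h c \<ominus>\<^bsub>\<omega>\<^esub> r \<cdot>\<^sub>w x = b \<cdot>\<^sub>w w"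
          unfolding hbr using bc w r xc by (simp add: a_minus_def W.M.a_assoc W.M.r_neg)
        then have "b \<cdot>\<^sub>w w \<in> m2w" using W.is_submodule_minus[OF m2w(1) hc rx] by simp
        then have "b \<in> m2" by (rule nd[OF b])
        then have cl: "c (Inl s) \<in> m" for s using vi[OF vec_Plus(1)[OF c]] by (simp add: b_def)
        show "c i \<in> m"
        proof (cases i)
          case (Inl s)
          then show ?thesis using cl by simp
        next
          case (Inr s)
          then show ?thesis using rm by (simp add: r_def)
        qed
      qed
      then show False using E(1) by (simp add: card_Plus)
    qed
  qed
  then show ?thesis using that by blast
qed

text \<open>If m = m^2, then m^2 = m^3 = 0 and m = 0, but a nonzero vector of \<open>K 0\<close> has
  a nonzero entry in m.\<close>

lemma m_neq_m2:
  assumes "x \<in> K 0" "x \<noteq> (\<lambda>s. \<zero>)" obtains a where "a \<in> m" "a \<notin> m2"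
proof -
  have "\<not> m \<subseteq> m2"
  proof
    assume *: "m \<subseteq> m2"
    have "a \<otimes> b = \<zero>" if "a \<in> m" "b \<in> m" for a b using m3_zero(1) that * by blast
    note mm = this
    have "z = \<zero>" if "z \<in> m2" for z using that by (induction rule: ideal_prod.induct) (simp_all add: mm)
    then have "x s = \<zero>" for s using * K_ideal[OF assms(1)] by blast
    then show False using assms(2) by auto
  qed
  then show ?thesis using that by blast
qed

text \<open>The symmetric matrix with entries \<open>a\<close>, \<open>b\<close>, \<open>c\<close> built below annihilates the generators of \<open>\<omega>\<close>,
  so its rows and columns lie in \<open>K 0\<close>; if \<open>Tor\<^sub>1\<close> vanishes it is a sum of products of vectors with
  entries in \<open>m\<close>, hence has entries in \<open>m\<^sup>2\<close>.\<close>

theorem cyclic_if_tor_1_vanishes: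
  assumes T: "tor_vanishes 0 0" shows "card (I 0) \<le> 1"
proof (rule ccontr)
  assume "\<not> ?thesis"
  then have c2: "1 < card (I 0)" by simp
  then have "I 0 \<noteq> {}" by auto
  then obtain i where i: "i \<in> I 0" and i_m2w: "\<And>z. z \<in> m2w \<Longrightarrow> \<exists>\<beta>\<in>m2. z = \<beta> \<cdot>\<^sub>w \<epsilon> (basis_vec R i)"
    by (rule m2w_multiple) (blast intro: that)
  obtain j where j: "j \<in> I 0" "i \<noteq> j"
  proof -
    have "\<not> I 0 \<subseteq> {i}" using card_mono[of "{i}" "I 0"] c2 by auto
    then show ?thesis using that by blast
  qed
  obtain x0 where x0: "x0 \<in> K 0" "x0 \<noteq> (\<lambda>s. \<zero>)" by (rule K_0_nonzero[OF i j])
  obtain a0 where a0: "a0 \<in> m" "a0 \<notin> m2" by (rule m_neq_m2[OF x0])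
  define w where "w = \<epsilon> (basis_vec R i)"
  define w' where "w' = \<epsilon> (basis_vec R j)"
  have wc: "w \<in> carrier \<omega>" "w' \<in> carrier \<omega>"
    unfolding w_def w'_def by (rule module_hom_closed[OF eps vec_basis], fact)+
  \<comment> \<open>The matrix with rows (a, b) and (b, c) is to annihilate (w, w') modulo m^2
    \<omega>. If some a outside m^2 already sends w into m^2 \<omega>, the other entries are
    zero.\<close>
  have "\<exists>a\<in>m. \<exists>b\<in>m. \<exists>c\<in>m. \<not> (a \<in> m2 \<and> b \<in> m2 \<and> c \<in> m2) \<and>
      a \<cdot>\<^sub>w w \<oplus>\<^bsub>\<omega>\<^esub> b \<cdot>\<^sub>w w' \<in> m2w \<and> b \<cdot>\<^sub>w w \<oplus>\<^bsub>\<omega>\<^esub> c \<cdot>\<^sub>w w' \<in> m2w"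
  proof (cases "\<exists>a\<in>m. a \<notin> m2 \<and> a \<cdot>\<^sub>w w \<in> m2w")
    case True
    then obtain a where "a \<in> m" "a \<notin> m2" "a \<cdot>\<^sub>w w \<in> m2w" by blast
    then show ?thesis
      using wc m_simps(1,2) is_submoduleD(3)[OF m2w(1)] by (intro bexI[of _ a] bexI[of _ \<zero>]) auto
  next
    case False
    then have nd: "\<And>a. a \<in> m \<Longrightarrow> a \<cdot>\<^sub>w w \<in> m2w \<Longrightarrow> a \<in> m2" by blast
    \<comment> \<open>\<open>a0\<close> is put at the lower right. Then b balances it in the second
      row, symmetry puts b into the first row, and a balances it there. The triple is not contained
      in m^2 because \<open>a0\<close> is not.\<close>
    obtain b where b: "b \<in> m" "a0 \<cdot>\<^sub>w w' \<oplus>\<^bsub>\<omega>\<^esub> b \<cdot>\<^sub>w w \<in> m2w"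
      by (rule mw_multiple[OF wc(1) nd a0 mw(2)[OF wc(2) a0(1)]])
    obtain a where a: "a \<in> m" "b \<cdot>\<^sub>w w' \<oplus>\<^bsub>\<omega>\<^esub> a \<cdot>\<^sub>w w \<in> m2w"
      by (rule mw_multiple[OF wc(1) nd a0 mw(2)[OF wc(2) b(1)]])
    have "a \<cdot>\<^sub>w w \<oplus>\<^bsub>\<omega>\<^esub> b \<cdot>\<^sub>w w' \<in> m2w" "b \<cdot>\<^sub>w w \<oplus>\<^bsub>\<omega>\<^esub> a0 \<cdot>\<^sub>w w' \<in> m2w"
      using a b a0(1) wc m_simps(1) by (simp_all add: W.M.a_comm)
    then show ?thesis using a(1) b(1) a0 by blast
  qed
  then obtain a b c where abc: "a \<in> m" "b \<in> m" "c \<in> m" "\<not> (a \<in> m2 \<and> b \<in> m2 \<and> c \<in> m2)"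
    and 1: "a \<cdot>\<^sub>w w \<oplus>\<^bsub>\<omega>\<^esub> b \<cdot>\<^sub>w w' \<in> m2w" and 2: "b \<cdot>\<^sub>w w \<oplus>\<^bsub>\<omega>\<^esub> c \<cdot>\<^sub>w w' \<in> m2w" by blast
  note cc = m_simps(1)[OF abc(1)] m_simps(1)[OF abc(2)] m_simps(1)[OF abc(3)]
  let ?q = "b \<cdot>\<^sub>w w \<oplus>\<^bsub>\<omega>\<^esub> c \<cdot>\<^sub>w w'" and ?p = "a \<cdot>\<^sub>w w \<oplus>\<^bsub>\<omega>\<^esub> b \<cdot>\<^sub>w w'"
  \<comment> \<open>The rows still have an error in m^2 \<omega>, all of whose elements are
    multiples of w by elements of m^2. The correction \<open>\<beta>\<close> of the second row must
    enter both off-diagonal entries to keep symmetry; \<open>\<gamma>\<close> then corrects the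
    first row, including the new term \<open>\<beta>\<close> w'.\<close>
  obtain \<beta> where \<beta>: "\<beta> \<in> m2" "\<ominus>\<^bsub>\<omega>\<^esub> ?q = \<beta> \<cdot>\<^sub>w w"
    using i_m2w[OF W.is_submodule_neg[OF m2w(1) 2]] unfolding w_def by blast
  note \<beta>c = m2_simps(1)[OF \<beta>(1)]
  have "\<beta> \<cdot>\<^sub>w w' \<in> m2w" by (rule m2w(2)[OF wc(2) \<beta>(1)])
  from is_submoduleD(4)[OF m2w(1) 1 this] obtain \<gamma> where \<gamma>: "\<gamma> \<in> m2" "\<ominus>\<^bsub>\<omega>\<^esub> (?p \<oplus>\<^bsub>\<omega>\<^esub> \<beta> \<cdot>\<^sub>w w') = \<gamma> \<cdot>\<^sub>w w"
    using i_m2w[OF W.is_submodule_neg[OF m2w(1)]] unfolding w_def by blast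
  note \<gamma>c = m2_simps(1)[OF \<gamma>(1)]
  define A B where "A = a \<oplus> \<gamma>" and "B = b \<oplus> \<beta>"
  have ABc: "A \<in> carrier R" "B \<in> carrier R" using cc \<beta>c \<gamma>c by (simp_all add: A_def B_def)
  have "A \<cdot>\<^sub>w w \<oplus>\<^bsub>\<omega>\<^esub> B \<cdot>\<^sub>w w' = (?p \<oplus>\<^bsub>\<omega>\<^esub> \<beta> \<cdot>\<^sub>w w') \<oplus>\<^bsub>\<omega>\<^esub> \<gamma> \<cdot>\<^sub>w w"
    using cc \<beta>c \<gamma>c wc by (simp add: A_def B_def W.smult_l_distr W.M.a_ac)
  also have "\<dots> = \<zero>\<^sub>w" using \<gamma>(2)[symmetric] cc \<beta>c wc by (simp add: W.M.r_neg)
  finally have row_i: "A \<cdot>\<^sub>w w \<oplus>\<^bsub>\<omega>\<^esub> B \<cdot>\<^sub>w w' = \<zero>\<^sub>w" .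
  have "B \<cdot>\<^sub>w w \<oplus>\<^bsub>\<omega>\<^esub> c \<cdot>\<^sub>w w' = ?q \<oplus>\<^bsub>\<omega>\<^esub> \<beta> \<cdot>\<^sub>w w"
    using cc \<beta>c wc by (simp add: B_def W.smult_l_distr W.M.a_ac)
  also have "\<dots> = \<zero>\<^sub>w" using \<beta>(2)[symmetric] cc wc by (simp add: W.M.r_neg)
  finally have row_j: "B \<cdot>\<^sub>w w \<oplus>\<^bsub>\<omega>\<^esub> c \<cdot>\<^sub>w w' = \<zero>\<^sub>w" .
  define x where "x = (\<lambda>s. A \<otimes> basis_vec R i s \<oplus> B \<otimes> basis_vec R j s)"
  define y where "y = (\<lambda>s. B \<otimes> basis_vec R i s \<oplus> c \<otimes> basis_vec R j s)"
  have xK: "x \<in> K 0" unfolding K_0 x_def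
    using eps_pair[OF i j(1) ABc] row_i by (simp add: w_def w'_def)
  have yK: "y \<in> K 0" unfolding K_0 y_def
    using eps_pair[OF i j(1) ABc(2) cc(3)] row_j by (simp add: w_def w'_def)
  have xs: "x s = (if s = i then A else if s = j then B else \<zero>)" for s
    using ABc j(2) by (simp add: x_def basis_vec_def)
  have ys: "y s = (if s = i then B else if s = j then c else \<zero>)" for s
    using ABc cc(3) j(2) by (simp add: y_def basis_vec_def)
  define z where "z = (\<lambda>p. if fst p = i then x (snd p) else if fst p = j then y (snd p) else \<zero>)"
  have z0K: "(\<lambda>s. \<zero>) \<in> K 0" by (rule subm_vec(2)[OF K_submodule])
  have row: "(\<lambda>t. z (s, t)) \<in> K 0" for s
    using xK yK z0K by (cases "s = i"; cases "s = j") (simp_all add: z_def)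
  have sym: "z (s, t) = z (t, s)" for s t by (simp add: z_def xs ys)
  have col: "(\<lambda>s. z (s, t)) \<in> K 0" for t using row[of t] by (simp add: sym[of _ t])
  have zv: "z \<in> vec (I 0 \<times> I 0)"
  proof (rule vec_finiteI)
    show "finite (I 0 \<times> I 0)" using fin by simp
    show "z p \<in> carrier R" for p using vecD(1)[of "\<lambda>t. z (fst p, t)" "I 0" "snd p"] row K_vec by auto
    show "z p = \<zero>" if "p \<notin> I 0 \<times> I 0" for p
      using that i j(1) by (cases p) (auto simp: z_def xs ys)
  qed
  have "z \<in> tensor_span R (K 0) (vec (I 0))" by (rule tensor_spanI_col[OF K_submodule zv col])
  moreover have "z \<in> tensor_span R (vec (I 0)) (K 0)" by (rule tensor_spanI_row[OF K_submodule zv row])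
  ultimately have zt: "z \<in> tensor_span R (K 0) (K 0)" using T unfolding tor_independent_def by blast
  \<comment> \<open>A product of two vectors of \<open>K 0\<close> has entries in m^2; the
    corrections lie there too, so the original a, b, c would as well.\<close>
  have z2: "z p \<in> m2" for p by (rule tensor_span_m2[OF _ _ zt]) (rule K_ideal, assumption)+
  have "A \<in> m2" "B \<in> m2" "c \<in> m2" using z2[of "(i, i)"] z2[of "(i, j)"] z2[of "(j, j)"] j(2) by (simp_all add: z_def xs ys)
  moreover have "A \<ominus> \<gamma> = a" "B \<ominus> \<beta> = b" using cc \<gamma>c \<beta>c by (simp_all add: A_def B_def a_minus_def a_assoc r_neg)
  ultimately have "a \<in> m2" "b \<in> m2" "c \<in> m2" using m2_simps(5) \<gamma>(1) \<beta>(1) by metis+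
  then show False using abc(4) by blast
qed

end

section \<open>Comparing numbers of generators\<close>

context local_cube
begin

text \<open>\<open>X\<close> is what counts as zero: below it is 0 for dimensions inside m^2 F,
  which m kills, and m^2 F for dimensions of m F / m^2 F.\<close>

lemma card_le_cover:
  assumes M: "module R M" and X: "is_submodule R M X" and fin: "finite S" "finite T"
    and f: "f \<in> module_hom R (free_module R S) M" and g: "g \<in> module_hom R (free_module R T) M"
    and ind: "\<And>c i. c \<in> vec S \<Longrightarrow> f c \<in> X \<Longrightarrow> c i \<in> m"
    and gen: "\<And>i. i \<in> S \<Longrightarrow> f (basis_vec R i) \<in> g ` vec T"
    and kill: "\<And>a. a \<in> ivec m T \<Longrightarrow> g a \<in> X"
  shows "card S \<le> card T"
proof (rule card_le_span[OF M X fin f g])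
  show "c i \<in> m" if "c \<in> vec S" "f c \<in> X" for c i using that by (rule ind)
next
  interpret M: module R M by fact
  fix i assume "i \<in> S"
  then have "f (basis_vec R i) \<in> g ` vec T" by (rule gen)
  then obtain a where a: "a \<in> vec T" "f (basis_vec R i) = g a" by blast
  have "f (basis_vec R i) \<ominus>\<^bsub>M\<^esub> g a \<in> X"
    unfolding a(2) a_minus_def using M.M.r_neg[OF module_hom_closed[OF g a(1)]] is_submoduleD(3)[OF X] by simp
  then show "\<exists>a\<in>vec T. f (basis_vec R i) \<ominus>\<^bsub>M\<^esub> g a \<in> X" using a(1) by blast
next
  show "g a \<in> X" if "a \<in> vec T" "\<And>j. a j \<in> m" for a using that by (intro kill) (simp add: ivec_def)
qed

lemma hom_ivec_product:
  assumes f: "f \<in> module_hom R (free_module R S) (free_module R T)" and J: "ideal J R" and c: "c \<in> ivec J S"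
    and im: "\<And>s. s \<in> S \<Longrightarrow> f (basis_vec R s) \<in> ivec J' T" and H: "ideal H R"
    and prod: "\<And>a b. a \<in> J \<Longrightarrow> b \<in> J' \<Longrightarrow> a \<otimes> b \<in> H"
  shows "f c \<in> ivec H T"
proof (rule hom_ivec_into[OF module_free f ivec_submodule[OF H] _ c J])
  fix a s assume a: "a \<in> J" and s: "s \<in> S"
  have "f (basis_vec R s) \<in> vec T" "\<And>t. f (basis_vec R s) t \<in> J'" using im[OF s] by (simp_all add: ivec_def)
  then show "a \<odot>\<^bsub>free_module R T\<^esub> f (basis_vec R s) \<in> ivec H T"
    using vec_smult[OF ideal_simps(1)[OF J a]] prod[OF a] by (simp add: ivec_def)
qed

lemma ivec_zero [simp]: "c \<in> ivec {\<zero>} S \<longleftrightarrow> c = (\<lambda>s. \<zero>)"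
proof
  show "c \<in> ivec {\<zero>} S \<Longrightarrow> c = (\<lambda>s. \<zero>)" by (auto simp: ivec_def)
  show "c = (\<lambda>s. \<zero>) \<Longrightarrow> c \<in> ivec {\<zero>} S" by (simp add: ivec_def)
qed

lemma ivec_basis:
  assumes "t \<in> T" "u \<in> J" "ideal J R" shows "(\<lambda>s. u \<otimes> basis_vec R t s) \<in> ivec J T"
  using vec_smult[OF ideal_simps(1)[OF assms(3,2)] vec_basis[OF assms(1)]] assms(2) ideal_simps(1,2)[OF assms(3)]
  by (auto simp: ivec_def basis_vec_def)

end

section \<open>Betti numbers\<close>

text \<open>Thus \<open>card E\<close> and \<open>card L\<close> are the dimensions of \<open>m/m\<^sup>2\<close> and \<open>m\<^sup>2\<close>.\<close>

locale counted_resolution = minimal_resolution R m \<omega> I \<epsilon> d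
  for R :: "('a, 'r) ring_scheme" (structure) and m and \<omega> :: "('a, 'b, 'w) module_scheme" and I \<epsilon> d +
  fixes E L :: "nat set" and v w :: "(nat \<Rightarrow> 'a) \<Rightarrow> 'a"
  assumes E: "finite E" and v: "v \<in> module_hom R (free_module R E) (ring_module R)" and v_image: "v ` vec E = m"
    and v_ind: "c \<in> vec E \<Longrightarrow> v c \<in> m2 \<Longrightarrow> c i \<in> m"
    and L: "finite L" and w: "w \<in> module_hom R (free_module R L) (ring_module R)" and w_image: "w ` vec L = m2"
    and w_ind: "c \<in> vec L \<Longrightarrow> w c = \<zero> \<Longrightarrow> c i \<in> m"
begin

lemma zero_submodule: "is_submodule R (free_module R S) {\<lambda>s. \<zero>}"
  using module.is_submodule_zero[OF module_free] by simp

text \<open>For F free on \<open>S\<close>, the four parts say that \<open>diag_map v\<close>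
  induces an isomorphism from the residue field space on \<open>S \<times> E\<close> to m F / m^2 F.
  In particular this quotient has dimension \<open>card S\<close> times
  \<open>card E\<close>.\<close>

lemma diag_v:
  assumes "finite S"
  shows "z \<in> vec (S \<times> E) \<Longrightarrow> diag_map v z \<in> ivec m S" "ivec m S \<subseteq> diag_map v ` vec (S \<times> E)"
    "z \<in> ivec m (S \<times> E) \<Longrightarrow> diag_map v z \<in> ivec m2 S"
    "z \<in> vec (S \<times> E) \<Longrightarrow> diag_map v z \<in> ivec m2 S \<Longrightarrow> z p \<in> m"
proof -
  note hom = diag_map_hom[OF v assms]
  show 1: "diag_map v z \<in> ivec m S" if z: "z \<in> vec (S \<times> E)" for z
  proof -
    have "diag_map v z s \<in> m" for s
      using v_image vec_row[OF z, of s] by (auto simp: diag_map_def)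
    then show ?thesis using module_hom_closed[OF hom z] by (simp add: ivec_def)
  qed
  show "ivec m S \<subseteq> diag_map v ` vec (S \<times> E)"
  proof
    fix c assume "c \<in> ivec m S"
    then have "c \<in> ivec (v ` vec E) S" by (simp add: v_image)
    from diag_map_surj[OF v assms E this] obtain z where "z \<in> vec (S \<times> E)" "diag_map v z = c" .
    then show "c \<in> diag_map v ` vec (S \<times> E)" by blast
  qed
  show "diag_map v z \<in> ivec m2 S" if "z \<in> ivec m (S \<times> E)"
    by (rule hom_ivec_product[OF hom ideal_m that 1 ideal_m2 m2I]) (rule vec_basis)
  show "z p \<in> m" if z: "z \<in> vec (S \<times> E)" and "diag_map v z \<in> ivec m2 S"
  proof -
    have "v (\<lambda>t. z (fst p, t)) \<in> m2" using that(2) by (simp add: ivec_def diag_map_def)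
    from v_ind[OF vec_row[OF z] this, of "snd p"] show ?thesis by simp
  qed
qed

text \<open>The analogue of \<open>diag_v\<close> for m^2 F, where m^3 = 0 makes the target itself a
  vector space.\<close>

lemma diag_w:
  assumes "finite S"
  shows "z \<in> vec (S \<times> L) \<Longrightarrow> diag_map w z \<in> ivec m2 S" "ivec m2 S \<subseteq> diag_map w ` vec (S \<times> L)"
    "z \<in> ivec m (S \<times> L) \<Longrightarrow> diag_map w z = (\<lambda>s. \<zero>)"
    "z \<in> vec (S \<times> L) \<Longrightarrow> diag_map w z = (\<lambda>s. \<zero>) \<Longrightarrow> z p \<in> m"
proof -
  note hom = diag_map_hom[OF w assms]
  show 1: "diag_map w z \<in> ivec m2 S" if z: "z \<in> vec (S \<times> L)" for z
  proof -
    have "diag_map w z s \<in> m2" for s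
      using w_image vec_row[OF z, of s] by (auto simp: diag_map_def)
    then show ?thesis using module_hom_closed[OF hom z] by (simp add: ivec_def)
  qed
  show "ivec m2 S \<subseteq> diag_map w ` vec (S \<times> L)"
  proof
    fix c assume "c \<in> ivec m2 S"
    then have "c \<in> ivec (w ` vec L) S" by (simp add: w_image)
    from diag_map_surj[OF w assms L this] obtain z where "z \<in> vec (S \<times> L)" "diag_map w z = c" .
    then show "c \<in> diag_map w ` vec (S \<times> L)" by blast
  qed
  show "diag_map w z = (\<lambda>s. \<zero>)" if "z \<in> ivec m (S \<times> L)"
  proof -
    have "diag_map w z \<in> ivec {\<zero>} S"
      by (rule hom_ivec_product[OF hom ideal_m that 1 zeroideal]) (simp_all add: m3_zero vec_basis)
    then show ?thesis by simp
  qed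
  show "z p \<in> m" if z: "z \<in> vec (S \<times> L)" and "diag_map w z = (\<lambda>s. \<zero>)"
  proof -
    have "w (\<lambda>t. z (fst p, t)) = \<zero>" using fun_cong[OF that(2), of "fst p"] by (simp add: diag_map_def)
    from w_ind[OF vec_row[OF z] this, of "snd p"] show ?thesis by simp
  qed
qed

text \<open>By minimality the matrix of \<open>d n\<close> has entries in m, so each application
  raises the power of m by one.\<close>

lemma d_ivec: "c \<in> vec (I (Suc n)) \<Longrightarrow> d n c \<in> ivec m (I n)"
    "c \<in> ivec m (I (Suc n)) \<Longrightarrow> d n c \<in> ivec m2 (I n)" "c \<in> ivec m2 (I (Suc n)) \<Longrightarrow> d n c = (\<lambda>s. \<zero>)"
proof -
  show 1: "d n c \<in> ivec m (I n)" if "c \<in> vec (I (Suc n))" for c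
  proof -
    have "d n c \<in> K n" unfolding K_def using that by blast
    from K_ideal[OF this] show ?thesis using d_closed[OF that] by (simp add: ivec_def)
  qed
  show "d n c \<in> ivec m2 (I n)" if "c \<in> ivec m (I (Suc n))" for c
    by (rule hom_ivec_product[OF d ideal_m that 1 ideal_m2 m2I]) (rule vec_basis)
  show "d n c = (\<lambda>s. \<zero>)" if "c \<in> ivec m2 (I (Suc n))" for c
  proof -
    have "d n c \<in> ivec {\<zero>} (I n)"
      by (rule hom_ivec_product[OF d ideal_m2 that 1 zeroideal]) (simp_all add: m3_zero vec_basis)
    then show ?thesis by simp
  qed
qed

text \<open>The first syzygy is nonzero by \<open>K_0_nonzero\<close>. Later ones contain t times a
  basis vector, t a socle element of R, because \<open>d n\<close> of that basis vector has entries
  in m.\<close>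

lemma I_nonempty:
  assumes "card (I 0) \<ge> 2" shows "I k \<noteq> {}"
proof -
  obtain t where t: "t \<in> carrier R" "t \<noteq> \<zero>" "\<And>a. a \<in> m \<Longrightarrow> a \<otimes> t = \<zero>" by (rule ring_socle_element) (blast intro: that)
  have next_nonempty: "I (Suc n) \<noteq> {}" if "x \<in> K n" "x \<noteq> (\<lambda>s. \<zero>)" for x n
  proof
    assume e: "I (Suc n) = {}"
    obtain c where c: "c \<in> vec (I (Suc n))" "x = d n c" using \<open>x \<in> K n\<close> unfolding K_def by blast
    have "c = (\<lambda>s. \<zero>)" using vecD(2)[OF c(1)] e by auto
    then show False using that(2) c(2) hom_vec(3)[OF d module_free] by simp
  qed
  have "I (Suc n) \<noteq> {}" for n
  proof (induction n)
    case 0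
    have "I 0 \<noteq> {}" using assms by auto
    then obtain i where i: "i \<in> I 0" by blast
    have "\<not> I 0 \<subseteq> {i}" using card_mono[of "{i}" "I 0"] assms by auto
    then obtain j where j: "j \<in> I 0" "i \<noteq> j" by blast
    obtain x where "x \<in> K 0" "x \<noteq> (\<lambda>s. \<zero>)" by (rule K_0_nonzero[OF i j])
    then show ?case by (rule next_nonempty)
  next
    case (Suc n)
    then obtain i where i: "i \<in> I (Suc n)" by blast
    let ?x = "\<lambda>s. t \<otimes> basis_vec R i s"
    have "d n (basis_vec R i) s \<in> m" for s using d_ivec(1)[OF vec_basis[OF i]] by (simp add: ivec_def)
    then have "t \<otimes> d n (basis_vec R i) s = \<zero>" for s 
      using t(3)[of "d n (basis_vec R i) s"] t(1) m_simps(1) m_comm[OF t(1)] by metis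
    then have "d n ?x = (\<lambda>s. \<zero>)" using hom_vec(2)[OF d t(1) vec_basis[OF i]] by simp
    then have "?x \<in> K (Suc n)" unfolding K_Suc using vec_smult[OF t(1) vec_basis[OF i]] by simp
    moreover have "?x i \<noteq> \<zero>" using t by (simp add: basis_vec_def)
    then have "?x \<noteq> (\<lambda>s. \<zero>)" by metis
    ultimately show ?case by (rule next_nonempty)
  qed
  moreover have "I 0 \<noteq> {}" using assms by auto
  ultimately show ?thesis by (cases k) simp_all
qed

end

section \<open>Inequalities between Betti numbers\<close>

context counted_resolution
begin

text \<open>\<open>d k\<close> maps m F_{k+1} onto m (\<open>K k\<close>). By minimality this lies
  in m^2 F_k, a vector space of dimension \<open>card L\<close> times
  \<open>card (I k)\<close>.\<close>

lemma dm_basis: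
  obtains Q :: "nat set" and \<delta> where "finite Q" "\<delta> \<in> module_hom R (free_module R Q) (free_module R (I k))"
    "\<delta> ` vec Q = d k ` ivec m (I (Suc k))" "\<And>c i. c \<in> vec Q \<Longrightarrow> \<delta> c = (\<lambda>s. \<zero>) \<Longrightarrow> c i \<in> m"
    "card Q \<le> card L * card (I k)"
proof -
  have H: "is_submodule R (free_module R (I k)) (d k ` ivec m (I (Suc k)))"
    by (rule is_submodule_image[OF module_free module_free d ivec_submodule[OF ideal_m]])
  from minimal_cover_free[OF fin H] obtain Q :: "nat set" and \<delta> where
    Q: "finite Q" "\<delta> \<in> module_hom R (free_module R Q) (free_module R (I k))" "\<delta> ` vec Q = d k ` ivec m (I (Suc k))"
    and ind: "\<And>c i. c \<in> vec Q \<Longrightarrow> \<delta> c = (\<lambda>s. \<zero>) \<Longrightarrow> c i \<in> m" by blast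
  have "card Q \<le> card (I k \<times> L)"
  proof (rule card_le_cover[OF module_free zero_submodule Q(1) _ Q(2) diag_map_hom[OF w fin]])
    show "finite (I k \<times> L)" using fin L by simp
    show "c i \<in> m" if "c \<in> vec Q" "\<delta> c \<in> {\<lambda>s. \<zero>}" for c i using that by (intro ind) simp_all
    show "\<delta> (basis_vec R i) \<in> diag_map w ` vec (I k \<times> L)" if "i \<in> Q" for i
    proof -
      have "\<delta> (basis_vec R i) \<in> d k ` ivec m (I (Suc k))" unfolding Q(3)[symmetric] by (rule imageI[OF vec_basis[OF that]])
      then have "\<delta> (basis_vec R i) \<in> ivec m2 (I k)" using d_ivec(2)[of _ k] by auto
      then show ?thesis using diag_w(2)[OF fin] by blast
    qed
    show "diag_map w a \<in> {\<lambda>s. \<zero>}" if "a \<in> ivec m (I k \<times> L)" for a using diag_w(3)[OF fin that] by simp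
  qed
  then have le: "card Q \<le> card L * card (I k)" by (simp add: card_cartesian_product mult.commute)
  show ?thesis by (rule that[OF Q _ le]) (rule ind)
qed

text \<open>The b_{j+1} b_1 products of minimal generators of \<open>K j\<close> and
  \<open>K 0\<close> are independent by \<open>products_independent\<close>. The first factors have
  entries in m, so each product has its rows in m (\<open>K 0\<close>), and all of them lie in a
  space of dimension b_j times \<open>card Q\<close>.\<close>

lemma bound_products:
  assumes T: "tor_vanishes (Suc j) 0" and Q: "finite Q" "\<delta> \<in> module_hom R (free_module R Q) (free_module R (I 0))"
    "\<delta> ` vec Q = d 0 ` ivec m (I 1)"
  shows "card (I (Suc j)) * card (I 1) \<le> card (I j) * card Q"
proof -
  have "card (I (Suc j) \<times> I 1) \<le> card (I j \<times> Q)"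
  proof (rule card_le_cover[OF module_free zero_submodule])
    show "finite (I (Suc j) \<times> I 1)" "finite (I j \<times> Q)" using fin Q(1) by simp_all
    show "(\<lambda>c. col_map (d j) (row_map (d 0) c)) \<in>
        module_hom R (free_module R (I (Suc j) \<times> I 1)) (free_module R (I j \<times> I 0))"
      using module_hom_comp[OF row_map_hom[OF d[of 0]] col_map_hom[OF d]] by simp
    show "row_map \<delta> \<in> module_hom R (free_module R (I j \<times> Q)) (free_module R (I j \<times> I 0))"
      by (rule row_map_hom[OF Q(2)])
    show "c i \<in> m" if "c \<in> vec (I (Suc j) \<times> I 1)" "col_map (d j) (row_map (d 0) c) \<in> {\<lambda>s. \<zero>}" for c i
      using products_independent[OF T, of c i] that by simp
    show "row_map \<delta> a \<in> {\<lambda>s. \<zero>}" if a: "a \<in> ivec m (I j \<times> Q)" for a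
    proof -
      have b: "\<delta> (basis_vec R t) \<in> ivec m2 (I 0)" if "t \<in> Q" for t
      proof -
        have "\<delta> (basis_vec R t) \<in> d 0 ` ivec m (I 1)" unfolding Q(3)[symmetric] by (rule imageI[OF vec_basis[OF that]])
        then show ?thesis using d_ivec(2)[of _ 0] by auto
      qed
      have "(\<lambda>t. a (s, t)) \<in> ivec m Q" for s using a vec_row[of a "I j" Q s] by (simp add: ivec_def)
      then have "\<delta> (\<lambda>t. a (s, t)) \<in> ivec {\<zero>} (I 0)" for s
        by (rule hom_ivec_product[OF Q(2) ideal_m _ b zeroideal]) (simp_all add: m3_zero)
      then show ?thesis by (simp add: row_map_def)
    qed
    fix p assume p: "p \<in> I (Suc j) \<times> I 1"
    let ?e = "d j (basis_vec R (fst p))" and ?f = "basis_vec R (snd p)"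
    have st: "fst p \<in> I (Suc j)" "snd p \<in> I 1" using p by auto
    have e: "?e \<in> vec (I j)" "\<And>s. ?e s \<in> m" using d_ivec(1)[OF vec_basis[OF st(1)]] by (simp_all add: ivec_def)
    have f: "?f \<in> vec (I (Suc 0))" using st(2) by (simp add: vec_basis)
    have fc: "d 0 ?f t \<in> carrier R" for t by (rule vecD(1)[OF d_closed[OF f]])
    have bp: "basis_vec R p = (\<lambda>q. basis_vec R (fst p) (fst q) \<otimes> ?f (snd q))"
      by (cases p) (auto simp: basis_vec_def fun_eq_iff)
    have bc: "basis_vec R (fst p) s \<in> carrier R" for s by (simp add: basis_vec_def)
    have "col_map (d j) (row_map (d 0) (basis_vec R p)) = (\<lambda>q. ?e (fst q) \<otimes> d 0 ?f (snd q))"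
      unfolding bp row_map_pair[where x = "basis_vec R (fst p)", OF d f bc]
      by (rule col_map_pair[OF d vec_basis[OF st(1)] fc])
    also have "\<dots> \<in> row_map \<delta> ` vec (I j \<times> Q)"
    proof -
      have D: "is_submodule R (free_module R (I 0)) (\<delta> ` vec Q)"
        by (rule is_submodule_image[OF module_free module_free Q(2) module.is_submodule_carrier[OF module_free]])
      have "(\<lambda>q. ?e (fst q) \<otimes> d 0 ?f (snd q)) \<in> tensor_span R (vec (I j)) (\<delta> ` vec Q)"
      proof (rule tensor_spanI_row[OF D])
        show "(\<lambda>q. ?e (fst q) \<otimes> d 0 ?f (snd q)) \<in> vec (I j \<times> I 0)" by (rule vec_tensor[OF e(1) d_closed[OF f]])
        fix s
        have "(\<lambda>t. ?e s \<otimes> ?f t) \<in> ivec m (I (Suc 0))" using ivec_basis[OF _ e(2) ideal_m] st(2) by simp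
        moreover have "d 0 (\<lambda>t. ?e s \<otimes> ?f t) = (\<lambda>t. ?e s \<otimes> d 0 ?f t)"
          using hom_vec(2)[OF d m_simps(1)[OF e(2)] f] by simp
        ultimately show "(\<lambda>t. ?e (fst (s, t)) \<otimes> d 0 ?f (snd (s, t))) \<in> \<delta> ` vec Q"
          unfolding Q(3) by (simp add: image_iff) metis
      qed
      from row_map_lift[OF Q(2) order.refl order.refl this]
      obtain u where "u \<in> tensor_span R (vec (I j)) (vec Q)" "row_map \<delta> u = (\<lambda>q. ?e (fst q) \<otimes> d 0 ?f (snd q))" .
      then show ?thesis unfolding vec_Times by (metis imageI)
    qed
    finally show "col_map (d j) (row_map (d 0) (basis_vec R p)) \<in> row_map \<delta> ` vec (I j \<times> Q)" .
  qed
  then show ?thesis by (simp add: card_cartesian_product)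
qed

text \<open>A matrix over \<open>I 1 \<times> I (Suc j)\<close> with entries in m^2 has its columns
  in \<open>K 1\<close> and its rows in \<open>K (Suc j)\<close>, since d kills m^2 F. Vanishing of
  Tor makes it a combination of products of generators of these two syzygies; the number of such
  products is the right-hand side.\<close>

lemma bound_socle:
  assumes T: "tor_vanishes 1 (Suc j)"
  shows "card (I 1) * card (I (Suc j)) * card L \<le> card (I 2) * card (I (Suc (Suc j)))"
proof -
  have fin': "finite (I 1 \<times> I (Suc j))" using fin by simp
  have two: "(2 :: nat) = Suc 1" by simp
  have "card ((I 1 \<times> I (Suc j)) \<times> L) \<le> card (I 2 \<times> I (Suc (Suc j)))"
  proof (rule card_le_cover[OF module_free zero_submodule])
    show "finite ((I 1 \<times> I (Suc j)) \<times> L)" "finite (I 2 \<times> I (Suc (Suc j)))" using fin L by simp_all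
    show "diag_map w \<in> module_hom R (free_module R ((I 1 \<times> I (Suc j)) \<times> L)) (free_module R (I 1 \<times> I (Suc j)))"
      by (rule diag_map_hom[OF w fin'])
    show "(\<lambda>c. col_map (d 1) (row_map (d (Suc j)) c)) \<in>
        module_hom R (free_module R (I 2 \<times> I (Suc (Suc j)))) (free_module R (I 1 \<times> I (Suc j)))"
      unfolding two by (rule module_hom_comp[OF row_map_hom[OF d] col_map_hom[OF d]])
    show "c i \<in> m" if "c \<in> vec ((I 1 \<times> I (Suc j)) \<times> L)" "diag_map w c \<in> {\<lambda>s. \<zero>}" for c i
      using diag_w(4)[OF fin' that(1)] that(2) by simp
    show "col_map (d 1) (row_map (d (Suc j)) a) \<in> {\<lambda>s. \<zero>}" if a: "a \<in> ivec m (I 2 \<times> I (Suc (Suc j)))" for a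
    proof -
      have av: "a \<in> vec (I 2 \<times> I (Suc (Suc j)))" using a by (simp add: ivec_def)
      have "(\<lambda>t. a (s, t)) \<in> ivec m (I (Suc (Suc j)))" for s
        using a vec_row[OF av, of s] by (simp add: ivec_def)
      then have "row_map (d (Suc j)) a p \<in> m2" for p
        using d_ivec(2)[of "\<lambda>t. a (fst p, t)" "Suc j"] by (simp add: row_map_def ivec_def)
      moreover have "(\<lambda>s. row_map (d (Suc j)) a (s, t)) \<in> vec (I 2)" for t
        by (rule vec_col[OF module_hom_closed[OF row_map_hom[OF d] av]])
      ultimately have "(\<lambda>s. row_map (d (Suc j)) a (s, t)) \<in> ivec m2 (I (Suc 1))" for t
        by (simp add: ivec_def two)
      from d_ivec(3)[OF this] show ?thesis by (simp add: col_map_def)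
    qed
    fix i assume i: "i \<in> (I 1 \<times> I (Suc j)) \<times> L"
    define z where "z = diag_map w (basis_vec R i)"
    have z: "z \<in> vec (I 1 \<times> I (Suc j))" "\<And>p. z p \<in> m2"
      using diag_w(1)[OF fin' vec_basis[OF i]] unfolding z_def ivec_def by blast+
    have killed: "x \<in> K (Suc n)" if "x \<in> vec (I (Suc n))" "\<And>s. x s \<in> m2" for x n
      unfolding K_Suc using that d_ivec(3)[of x n] by (simp add: ivec_def)
    have "z \<in> tensor_span R (K 1) (vec (I (Suc j)))"
      by (rule tensor_spanI_col[OF K_submodule z(1)]) (use killed[of _ 0] vec_col[OF z(1)] z(2) in simp)
    moreover have "z \<in> tensor_span R (vec (I 1)) (K (Suc j))"
      by (rule tensor_spanI_row[OF K_submodule z(1)]) (rule killed[OF vec_row[OF z(1)] z(2)])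
    ultimately have zT: "z \<in> tensor_span R (K 1) (d (Suc j) ` vec (I (Suc (Suc j))))"
      using T unfolding tor_independent_def K_def[of "Suc j"] by blast
    from row_map_lift[OF d K_vec order.refl zT]
    obtain u where u: "u \<in> tensor_span R (K 1) (vec (I (Suc (Suc j))))" "row_map (d (Suc j)) u = z" .
    from u(1) have "u \<in> tensor_span R (d 1 ` vec (I (Suc 1))) (vec (I (Suc (Suc j))))" by (simp add: K_def)
    from col_map_lift[OF d order.refl order.refl this]
    obtain y where y: "y \<in> tensor_span R (vec (I (Suc 1))) (vec (I (Suc (Suc j))))" "col_map (d 1) y = u" .
    have yv: "y \<in> vec (I 2 \<times> I (Suc (Suc j)))" using y(1) unfolding vec_Times two .
    have "col_map (d 1) (row_map (d (Suc j)) y) = z"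
      using col_row_map[OF d d, of y 1 "Suc j"] yv y(2) u(2) by (simp add: two)
    then show "diag_map w (basis_vec R i) \<in> (\<lambda>c. col_map (d 1) (row_map (d (Suc j)) c)) ` vec (I 2 \<times> I (Suc (Suc j)))"
      unfolding z_def[symmetric] using yv by blast
  qed
  then show ?thesis by (simp add: card_cartesian_product)
qed

end

text \<open>Here \<open>b i\<close> are the Betti numbers, \<open>e = dim m/m\<^sup>2\<close>, \<open>l = dim m\<^sup>2\<close>, and \<open>q\<close> is the dimension of \<open>m\<close> times the
  first syzygy.  The hypotheses give \<open>b 0 * q < (b 1)\<^sup>2\<close>, and then \<open>b i * q < b (i + 1) * b 1\<close> propagates by induction.\<close>

lemma no_growth:
  fixes b :: "nat \<Rightarrow> int" and e l q :: int
  assumes pos: "\<And>i. 0 < b i" "0 \<le> q" "0 \<le> l" "0 \<le> e" and r: "2 \<le> b 0"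
    and D: "b (Suc (Suc k)) * b 1 \<le> b (Suc k) * q" and S: "b 1 * b (Suc k) * l \<le> b 2 * b (Suc (Suc k))"
    and C: "b 2 + q \<le> e * b 1" and G: "\<And>i. e * b (Suc i) \<le> b (Suc (Suc i)) + l * b i"
    and B: "0 < l \<Longrightarrow> q < l * b 0" and q: "q \<le> l * b 0" and A: "0 < l \<Longrightarrow> e * b 0 \<le> b 1 + e"
  shows False
proof -
  define n where "n = b 1"
  have n: "0 < n" unfolding n_def by (rule pos(1))
  have "0 < b (Suc k) * q" using D pos(1)[of "Suc (Suc k)"] pos(1)[of 1] by (meson less_le_trans mult_pos_pos)
  then have q0: "0 < q" using pos(1)[of "Suc k"] by (simp add: zero_less_mult_iff)
  then have "0 < l * b 0" using q by linarith
  then have l: "0 < l" using pos(1)[of 0] by (simp add: zero_less_mult_iff)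
  \<comment> \<open>Multiplying \<open>S\<close> by b_1 and eliminating b_{k+2} by means of
    \<open>D\<close> leaves b_1^2 l \<le> b_2 q; then \<open>C\<close> bounds b_2.\<close>
  have "n * (n * b (Suc k) * l) \<le> n * (b 2 * b (Suc (Suc k)))"
    using S n by (intro mult_left_mono) (simp_all add: n_def)
  also have "\<dots> = b 2 * (b (Suc (Suc k)) * n)" by (simp add: mult.commute mult.left_commute)
  also have "\<dots> \<le> b 2 * (b (Suc k) * q)"
    using D pos(1)[of 2] by (intro mult_left_mono) (simp_all add: n_def)
  finally have "b (Suc k) * (n * n * l) \<le> b (Suc k) * (b 2 * q)" by (simp add: mult.commute mult.left_commute)
  then have "n * n * l \<le> b 2 * q" using pos(1)[of "Suc k"] by (simp add: mult_le_cancel_left)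
  also have "\<dots> \<le> (e * n - q) * q" using C q0 by (intro mult_right_mono) (simp_all add: n_def)
  finally have K: "n * n * l \<le> (e * n - q) * q" .
  \<comment> \<open>Completing the square removes q from \<open>K\<close> and leaves the bound 4 l
    \<le> e^2 on the ring alone.\<close>
  have "4 * ((e * n - q) * q) \<le> (e * n) * (e * n)"
    using zero_le_square[of "e * n - 2 * q"] by (simp add: algebra_simps)
  then have "(n * n) * (4 * l) \<le> (n * n) * (e * e)" using K by (simp add: algebra_simps)
  then have le: "4 * l \<le> e * e" using n by (simp add: mult_le_cancel_left)
  \<comment> \<open>Otherwise \<open>B\<close> and 4 l \<le> e^2 give 4 n^2 < (e b_0)^2. But
    \<open>A\<close> says e (b_0 - 1) \<le> n, and b_0 \<le> 2 (b_0 - 1) because b_0 \<ge> 2, so e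
    b_0 \<le> 2 n.\<close>
  have nn: "b 0 * q < n * n"
  proof (rule ccontr)
    assume "\<not> ?thesis"
    then have 1: "n * n \<le> b 0 * q" by simp
    have "q < l * b 0" by (rule B[OF l])
    then have "b 0 * q < b 0 * (l * b 0)" using r by (intro mult_strict_left_mono) simp_all
    then have "4 * (n * n) < (4 * l) * (b 0 * b 0)" using 1 by (simp add: algebra_simps)
    also have "\<dots> \<le> (e * e) * (b 0 * b 0)" using le by (intro mult_right_mono) simp_all
    finally have 2: "4 * (n * n) < (e * b 0) * (e * b 0)" by (simp add: algebra_simps)
    have "e * (b 0 - 1) \<le> n" using A[OF l] by (simp add: n_def algebra_simps)
    moreover have "e * b 0 \<le> e * (2 * (b 0 - 1))" using r pos(4) by (intro mult_left_mono) simp_all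
    ultimately have "e * b 0 \<le> 2 * n" by (simp add: algebra_simps)
    moreover have "0 \<le> e * b 0" using pos(4) r by simp
    ultimately have "(e * b 0) * (e * b 0) \<le> (2 * n) * (2 * n)" using mult_mono[of "e * b 0" "2 * n" "e * b 0" "2 * n"] n by simp
    then show False using 2 by simp
  qed
  have "b i * q < b (Suc i) * n" for i
  proof (induction i)
    case 0
    then show ?case using nn by (simp add: n_def)
  next
    case (Suc i)
    \<comment> \<open>The factor n l is introduced to make \<open>K\<close> applicable. After
      cancelling q, \<open>G\<close> converts the bound on l b_i into one on b_{i+2}.\<close>
    have "n * l * (b i * q) < n * l * (b (Suc i) * n)" using Suc n l by (intro mult_strict_left_mono) simp_all
    also have "\<dots> = b (Suc i) * (n * n * l)" by (simp add: mult.commute mult.left_commute)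
    also have "\<dots> \<le> b (Suc i) * ((e * n - q) * q)" using K pos(1)[of "Suc i"] by (intro mult_left_mono) simp_all
    finally have "q * (n * l * b i) < q * (b (Suc i) * (e * n - q))" by (simp add: algebra_simps)
    then have 1: "n * l * b i < b (Suc i) * (e * n - q)" using q0 by (simp add: mult_less_cancel_left)
    have "(e * b (Suc i)) * n \<le> (b (Suc (Suc i)) + l * b i) * n" using G n by (intro mult_right_mono) simp_all
    then show ?case using 1 by (simp add: algebra_simps)
  qed
  \<comment> \<open>At i = k + 1 the strict inequality is the opposite of \<open>D\<close>.\<close>
  from this[of "Suc k"] show False using D by (simp add: n_def)
qed

context counted_resolution
begin

text \<open>If \<open>d 1 c\<close> has entries in m^2, its product with the boundary of any basis
  vector of F_{k+1} lies in m^3 = 0. Independence of products then forces the coefficients of c into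
  m, so minimal generators of \<open>K 1\<close> are independent even modulo m^2 F_1.\<close>

lemma coefficients_in_m:
  assumes T: "tor_vanishes 2 k" and ne: "I (Suc k) \<noteq> {}" and c: "c \<in> vec (I 2)" "d 1 c \<in> ivec m2 (I 1)"
  shows "c i \<in> m"
proof -
  obtain t where t: "t \<in> I (Suc k)" using ne by blast
  have two: "(2 :: nat) = Suc 1" by simp
  note e = vec_basis[OF t] and cv = c(1)[unfolded two]
  have bc: "basis_vec R t s \<in> carrier R" for s by (simp add: basis_vec_def)
  have dc: "d k (basis_vec R t) s \<in> carrier R" for s by (rule vecD(1)[OF d_closed[OF e]])
  let ?z = "\<lambda>q. c (fst q) \<otimes> basis_vec R t (snd q)"
  have "col_map (d 1) (row_map (d k) ?z) = (\<lambda>q. d 1 c (fst q) \<otimes> d k (basis_vec R t) (snd q))"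
    unfolding row_map_pair[where x = c, OF d e vecD(1)[OF cv]] by (rule col_map_pair[OF d cv dc])
  also have "\<dots> = (\<lambda>q. \<zero>)"
    using d_ivec(1)[OF e] c(2) m3_zero(1) by (simp add: ivec_def)
  finally have "?z (i, t) \<in> m"
    using products_independent[OF T[unfolded two] vec_tensor[OF cv e]] by blast
  then show ?thesis using vecD(1)[OF cv] by (simp add: basis_vec_def)
qed

text \<open>Both families live in m F_1 / m^2 F_1, of dimension \<open>card E\<close> times b_1: the
  minimal generators of \<open>K 1\<close>, and lifts of a basis of m (\<open>K 0\<close>). Applying
  \<open>d 0\<close>, which kills \<open>K 1\<close> and m^2 F_1, separates the lifts; the
  generators of \<open>K 1\<close> are then independent by \<open>coefficients_in_m\<close>.\<close>

lemma bound_second: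
  assumes T: "tor_vanishes 2 k" and ne: "I (Suc k) \<noteq> {}"
    and Q: "finite Q" "\<delta> \<in> module_hom R (free_module R Q) (free_module R (I 0))"
    "\<delta> ` vec Q = d 0 ` ivec m (I 1)" and ind: "\<And>c i. c \<in> vec Q \<Longrightarrow> \<delta> c = (\<lambda>s. \<zero>) \<Longrightarrow> c i \<in> m"
  shows "card (I 2) + card Q \<le> card E * card (I 1)"
proof -
  have d0: "d 0 \<in> module_hom R (free_module R (I 1)) (free_module R (I 0))" using d[of 0] by simp
  have d1: "d 1 \<in> module_hom R (free_module R (I 2)) (free_module R (I 1))" using d[of 1] by (simp add: numeral_2_eq_2)
  have "\<delta> (basis_vec R s) \<in> d 0 ` ivec m (I 1)" if "s \<in> Q" for s
    unfolding Q(3)[symmetric] by (rule imageI[OF vec_basis[OF that]])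
  from free_lift_into[OF module_free module_free d0 Q(2) ivec_submodule[OF ideal_m] this]
  obtain \<phi> where \<phi>: "\<phi> \<in> module_hom R (free_module R Q) (free_module R (I 1))"
    "\<And>x. x \<in> vec Q \<Longrightarrow> d 0 (\<phi> x) = \<delta> x" "\<And>x. x \<in> vec Q \<Longrightarrow> \<phi> x \<in> ivec m (I 1)"
    by blast
  let ?f = "sum_map (free_module R (I 1)) (d 1) \<phi>"
  have f: "?f \<in> module_hom R (free_module R (Sum_Type.Plus (I 2) Q)) (free_module R (I 1))"
    by (rule sum_map_hom[OF module_free d1 \<phi>(1)])
  have fm: "?f c \<in> ivec m (I 1)" if c: "c \<in> vec (Sum_Type.Plus (I 2) Q)" for c
    using subm_vec(3)[OF ivec_submodule[OF ideal_m] d_ivec(1)[of _ 1] \<phi>(3)[OF vec_Plus(2)[OF c]]] vec_Plus(1)[OF c]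
    by (simp add: sum_map_def numeral_2_eq_2)
  have "card (Sum_Type.Plus (I 2) Q) \<le> card (I 1 \<times> E)"
  proof (rule card_le_cover[OF module_free ivec_submodule[OF ideal_m2] _ _ f diag_map_hom[OF v fin]])
    show "finite (Sum_Type.Plus (I 2) Q)" "finite (I 1 \<times> E)" using fin Q(1) E by simp_all
    show "?f (basis_vec R i) \<in> diag_map v ` vec (I 1 \<times> E)" if "i \<in> Sum_Type.Plus (I 2) Q" for i
      using diag_v(2)[OF fin] fm[OF vec_basis[OF that]] by blast
    show "diag_map v a \<in> ivec m2 (I 1)" if "a \<in> ivec m (I 1 \<times> E)" for a by (rule diag_v(3)[OF fin that])
    fix c i assume c: "c \<in> vec (Sum_Type.Plus (I 2) Q)" and fc: "?f c \<in> ivec m2 (I 1)"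
    let ?a = "\<lambda>s. c (Inl s)" and ?b = "\<lambda>t. c (Inr t)"
    have a: "?a \<in> vec (I 2)" and b: "?b \<in> vec Q" by (rule vec_Plus[OF c])+
    have da: "d 1 ?a \<in> vec (I 1)" by (rule module_hom_closed[OF d1 a])
    have pb: "\<phi> ?b \<in> vec (I 1)" by (rule module_hom_closed[OF \<phi>(1) b])
    have fe: "?f c = (\<lambda>s. d 1 ?a s \<oplus> \<phi> ?b s)" by (simp add: sum_map_def)
    have "d 1 ?a \<in> K 1" unfolding K_def using a by (simp add: numeral_2_eq_2)
    then have da0: "d 0 (d 1 ?a) = (\<lambda>s. \<zero>)" using K_Suc[of 0] by simp
    have "\<delta> ?b = (\<lambda>s. d 0 (d 1 ?a) s \<oplus> d 0 (\<phi> ?b) s)"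
      using da0 \<phi>(2)[OF b] vecD(1)[OF module_hom_closed[OF Q(2) b]] by simp
    also have "\<dots> = d 0 (?f c)" unfolding fe using hom_vec(1)[OF d0 da pb] by simp
    also have "\<dots> = (\<lambda>s. \<zero>)" using d_ivec(3)[of "?f c" 0] fc by simp
    finally have bm: "c (Inr s) \<in> m" for s using ind[OF b] by blast
    then have "?b \<in> ivec m Q" using b by (simp add: ivec_def)
    then have "\<phi> ?b \<in> ivec m2 (I 1)"
      by (rule hom_ivec_product[OF \<phi>(1) ideal_m _ \<phi>(3) ideal_m2 m2I]) (rule vec_basis)
    then have "(\<lambda>s. ?f c s \<ominus> \<phi> ?b s) \<in> ivec m2 (I 1)" using subm_vec(5)[OF ivec_submodule[OF ideal_m2] fc] by blast
    moreover have "(\<lambda>s. ?f c s \<ominus> \<phi> ?b s) = d 1 ?a"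
      unfolding fe using vecD(1)[OF da] vecD(1)[OF pb] by (simp add: a_minus_def a_assoc r_neg)
    ultimately have am: "c (Inl s) \<in> m" for s using coefficients_in_m[OF T ne a] by simp
    show "c i \<in> m" using am bm by (cases i) simp_all
  qed
  then show ?thesis using fin Q(1) by (simp add: card_cartesian_product card_Plus mult.commute)
qed

text \<open>\<open>d k\<close> maps m F_{k+1} onto m (\<open>K k\<close>) with kernel
  \<open>K (Suc k)\<close>. So lifts of a basis of m (\<open>K k\<close>) and the generators of
  \<open>K (Suc k)\<close> together generate m F_{k+1}, whose quotient by m^2 F_{k+1} has dimension
  \<open>card E\<close> times b_{k+1}.\<close>

lemma bound_growth: "card E * card (I (Suc k)) \<le> card (I (Suc (Suc k))) + card L * card (I k)"
proof -
  obtain Q :: "nat set" and \<delta> where Q: "finite Q" "\<delta> \<in> module_hom R (free_module R Q) (free_module R (I k))"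
    "\<delta> ` vec Q = d k ` ivec m (I (Suc k))" "card Q \<le> card L * card (I k)"
    by (rule dm_basis[of k]) (blast intro: that)
  have "\<delta> (basis_vec R s) \<in> d k ` ivec m (I (Suc k))" if "s \<in> Q" for s
    unfolding Q(3)[symmetric] by (rule imageI[OF vec_basis[OF that]])
  from free_lift_into[OF module_free module_free d Q(2) ivec_submodule[OF ideal_m] this]
  obtain \<phi> where \<phi>: "\<phi> \<in> module_hom R (free_module R Q) (free_module R (I (Suc k)))"
    "\<And>x. x \<in> vec Q \<Longrightarrow> d k (\<phi> x) = \<delta> x" "\<And>x. x \<in> vec Q \<Longrightarrow> \<phi> x \<in> ivec m (I (Suc k))"
    by blast
  let ?g = "sum_map (free_module R (I (Suc k))) (d (Suc k)) \<phi>"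
  have "card (I (Suc k) \<times> E) \<le> card (Sum_Type.Plus (I (Suc (Suc k))) Q)"
  proof (rule card_le_cover[OF module_free ivec_submodule[OF ideal_m2] _ _ diag_map_hom[OF v fin] sum_map_hom[OF module_free d \<phi>(1)]])
    show "finite (I (Suc k) \<times> E)" "finite (Sum_Type.Plus (I (Suc (Suc k))) Q)" using fin Q(1) E by simp_all
    show "c i \<in> m" if "c \<in> vec (I (Suc k) \<times> E)" "diag_map v c \<in> ivec m2 (I (Suc k))" for c i
      by (rule diag_v(4)[OF fin that])
    show "?g a \<in> ivec m2 (I (Suc k))" if a: "a \<in> ivec m (Sum_Type.Plus (I (Suc (Suc k))) Q)" for a
    proof (rule hom_ivec_product[OF sum_map_hom[OF module_free d \<phi>(1)] ideal_m a _ ideal_m2 m2I])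
      fix s assume "s \<in> Sum_Type.Plus (I (Suc (Suc k))) Q"
      note c = vec_basis[OF this]
      show "?g (basis_vec R s) \<in> ivec m (I (Suc k))"
        using subm_vec(3)[OF ivec_submodule[OF ideal_m] d_ivec(1)[OF vec_Plus(1)[OF c]] \<phi>(3)[OF vec_Plus(2)[OF c]]]
        by (simp add: sum_map_def)
    qed
    fix i assume i: "i \<in> I (Suc k) \<times> E"
    define y where "y = diag_map v (basis_vec R i)"
    have y: "y \<in> ivec m (I (Suc k))" unfolding y_def by (rule diag_v(1)[OF fin vec_basis[OF i]])
    then have yv: "y \<in> vec (I (Suc k))" by (simp add: ivec_def)
    have "d k y \<in> \<delta> ` vec Q" unfolding Q(3) using y by blast
    then obtain b where b: "b \<in> vec Q" "d k y = \<delta> b" by blast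
    have pb: "\<phi> b \<in> vec (I (Suc k))" by (rule module_hom_closed[OF \<phi>(1) b(1)])
    have "d k (\<lambda>s. y s \<ominus> \<phi> b s) = (\<lambda>s. \<zero>)"
      using hom_vec(4)[OF d module_free yv pb] free_minus[OF d_closed[OF yv] d_closed[OF pb]]
        \<phi>(2)[OF b(1)] b(2) vecD(1)[OF d_closed[OF yv]] by (simp add: a_minus_def r_neg)
    then have "(\<lambda>s. y s \<ominus> \<phi> b s) \<in> K (Suc k)" unfolding K_Suc using vec_minus[OF yv pb] by simp
    then obtain a where a: "a \<in> vec (I (Suc (Suc k)))" "(\<lambda>s. y s \<ominus> \<phi> b s) = d (Suc k) a" unfolding K_def by blast
    obtain c where c: "c \<in> vec (Sum_Type.Plus (I (Suc (Suc k))) Q)" "?g c = d (Suc k) a \<oplus>\<^bsub>free_module R (I (Suc k))\<^esub> \<phi> b"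
      by (rule sum_map_surj[OF module_free d \<phi>(1) a(1) b(1)])
    have "?g c = y"
      unfolding c(2) a(2)[symmetric] using vecD(1)[OF yv] vecD(1)[OF pb] by (simp add: a_minus_def a_assoc l_neg)
    then show "diag_map v (basis_vec R i) \<in> ?g ` vec (Sum_Type.Plus (I (Suc (Suc k))) Q)"
      unfolding y_def[symmetric] using c(1) by blast
  qed
  then show ?thesis using fin Q(1,4) by (simp add: card_cartesian_product card_Plus mult.commute)
qed

text \<open>A basis element of m^2 is nonzero, and \<omega> is faithful.\<close>

lemma m2_acts:
  assumes l: "L \<noteq> {}" obtains h x where "h \<in> m2" "x \<in> carrier \<omega>" "h \<cdot>\<^sub>w x \<noteq> \<zero>\<^sub>w"
proof -
  obtain i0 where i0: "i0 \<in> L" using l by blast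
  have h: "w (basis_vec R i0) \<in> m2" using w_image vec_basis[OF i0] by auto
  have "w (basis_vec R i0) \<noteq> \<zero>"
  proof
    assume "w (basis_vec R i0) = \<zero>"
    from w_ind[OF vec_basis[OF i0] this, of i0] show False using m_proper(1) by (simp add: basis_vec_def)
  qed
  then obtain x where "x \<in> carrier \<omega>" "w (basis_vec R i0) \<cdot>\<^sub>w x \<noteq> \<zero>\<^sub>w" by (rule faithful[OF m2_simps(1)[OF h]])
  then show ?thesis using that h by blast
qed

text \<open>m (\<open>K 0\<close>) lies in m^2 F_0 and is killed by \<open>\<epsilon>\<close>,
  whereas m^2 \<omega> \<noteq> 0. Some u in m^2 F_0 is therefore outside \<open>K 0\<close>, and it
  can be added to the basis of m (\<open>K 0\<close>).\<close>

lemma bound_strict: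
  assumes l: "L \<noteq> {}" and Q: "finite Q" "\<delta> \<in> module_hom R (free_module R Q) (free_module R (I 0))"
    "\<delta> ` vec Q = d 0 ` ivec m (I 1)" and ind: "\<And>c i. c \<in> vec Q \<Longrightarrow> \<delta> c = (\<lambda>s. \<zero>) \<Longrightarrow> c i \<in> m"
  shows "card Q < card L * card (I 0)"
proof -
  obtain h x where h: "h \<in> m2" and x: "x \<in> carrier \<omega>" "h \<cdot>\<^sub>w x \<noteq> \<zero>\<^sub>w" by (rule m2_acts[OF l])
  obtain y where y: "y \<in> vec (I 0)" "x = \<epsilon> y" using x(1) eps_surj by blast
  define u where "u = (\<lambda>s. h \<otimes> y s)"
  have u: "u \<in> ivec m2 (I 0)"
    unfolding u_def using vec_smult[OF m2_simps(1)[OF h] y(1)] m2_simps(7)[OF vecD(1)[OF y(1)] h] by (simp add: ivec_def)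
  then have uv: "u \<in> vec (I 0)" by (simp add: ivec_def)
  have uK: "u \<notin> K 0" unfolding K_0 u_def using hom_vec(2)[OF eps m2_simps(1)[OF h] y(1)] x(2) y(2) by simp
  define g where "g = (\<lambda>c :: unit \<Rightarrow> 'a. (\<lambda>s. c () \<otimes> u s))"
  have g: "g \<in> module_hom R (free_module R (UNIV :: unit set)) (free_module R (I 0))"
    using uv vecD(1)[OF uv] by (intro module_homI) (auto simp: g_def l_distr m_assoc vecD(1))
  let ?f = "sum_map (free_module R (I 0)) \<delta> g" and ?P = "Sum_Type.Plus Q (UNIV :: unit set)"
  have \<delta>K: "\<delta> c \<in> K 0" "\<delta> c \<in> ivec m2 (I 0)" if c: "c \<in> vec Q" for c
  proof -
    have "\<delta> c \<in> d 0 ` ivec m (I 1)" unfolding Q(3)[symmetric] using c by blast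
    then obtain a where a: "a \<in> ivec m (I 1)" "\<delta> c = d 0 a" by blast
    show "\<delta> c \<in> K 0" unfolding K_def a(2) using a(1) by (simp add: ivec_def)
    show "\<delta> c \<in> ivec m2 (I 0)" unfolding a(2) using d_ivec(2)[of a 0] a(1) by simp
  qed
  have fe: "?f c = (\<lambda>s. \<delta> (\<lambda>s. c (Inl s)) s \<oplus> c (Inr ()) \<otimes> u s)" for c by (simp add: sum_map_def g_def)
  have fm2: "?f c \<in> ivec m2 (I 0)" if c: "c \<in> vec ?P" for c
    unfolding fe
    by (rule subm_vec(3)[OF ivec_submodule[OF ideal_m2] \<delta>K(2)[OF vec_Plus(1)[OF c]]
        subm_vec(4)[OF ivec_submodule[OF ideal_m2] vecD(1)[OF c] u]])
  have "card ?P \<le> card (I 0 \<times> L)"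
  proof (rule card_le_cover[OF module_free zero_submodule _ _ sum_map_hom[OF module_free Q(2) g] diag_map_hom[OF w fin]])
    show "finite ?P" "finite (I 0 \<times> L)" using Q(1) fin L by simp_all
    show "?f (basis_vec R i) \<in> diag_map w ` vec (I 0 \<times> L)" if "i \<in> ?P" for i
      using diag_w(2)[OF fin] fm2[OF vec_basis[OF that]] by blast
    show "diag_map w a \<in> {\<lambda>s. \<zero>}" if "a \<in> ivec m (I 0 \<times> L)" for a using diag_w(3)[OF fin that] by simp
    fix c i assume c: "c \<in> vec ?P" and "?f c \<in> {\<lambda>s. \<zero>}"
    then have f0: "\<delta> (\<lambda>s. c (Inl s)) s \<oplus> c (Inr ()) \<otimes> u s = \<zero>" for s unfolding fe by (simp add: fun_eq_iff)
    let ?r = "c (Inr ())" and ?x = "\<delta> (\<lambda>s. c (Inl s))"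
    have rc: "?r \<in> carrier R" by (rule vecD(1)[OF c])
    note xK = \<delta>K(1)[OF vec_Plus(1)[OF c]]
    have xc: "?x s \<in> carrier R" for s using \<delta>K(2)[OF vec_Plus(1)[OF c]] m2_simps(1) by (simp add: ivec_def)
    have uc: "u s \<in> carrier R" for s by (rule vecD(1)[OF uv])
    have r: "?r \<in> m"
    proof (rule ccontr)
      assume "?r \<notin> m"
      then have U: "?r \<in> Units R" by (rule unitI[OF rc])
      have ru: "?r \<otimes> u s = \<ominus> ?x s" for s 
        using minus_equality[of "?r \<otimes> u s" "?x s"] f0[of s] a_comm[of "?x s" "?r \<otimes> u s"] xc rc uc by simp
      have "u s = inv ?r \<otimes> (?r \<otimes> u s)" for s using U uc rc by (simp add: m_assoc[symmetric])
      then have us: "u s = (\<ominus> (inv ?r)) \<otimes> ?x s" for s unfolding ru using U xc by (simp add: l_minus r_minus)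
      have "(\<lambda>s. (\<ominus> (inv ?r)) \<otimes> ?x s) \<in> K 0" by (rule subm_vec(4)[OF K_submodule _ xK]) (use U in simp)
      then show False using uK us by (metis ext)
    qed
    have "?r \<otimes> u s = \<zero>" for s using m3_zero(2)[OF _ r] u by (simp add: ivec_def)
    then have "?x s = \<zero>" for s using f0[of s] xc[of s] by simp
    then have "?x = (\<lambda>s. \<zero>)" by (rule ext)
    from ind[OF vec_Plus(1)[OF c] this] have lm: "c (Inl s) \<in> m" for s .
    show "c i \<in> m"
    proof (cases i)
      case (Inr y)
      then show ?thesis using r by simp
    qed (use lm in simp)
  qed
  then show ?thesis using Q(1) fin by (simp add: card_cartesian_product card_Plus mult.commute)
qed

text \<open>\<open>\<epsilon>\<close> maps m F_0 onto m \<omega> with kernel \<open>K 0\<close>.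
  Modulo m^2 F_0, the module m F_0 is thus generated by the b_1 generators of \<open>K 0\<close> and
  lifts of a basis of m \<omega> / m^2 \<omega>, of which there are at most \<open>card E\<close> by
  \<open>card_le_m_basis\<close>.\<close>

lemma bound_first:
  assumes l: "L \<noteq> {}" shows "card E * card (I 0) \<le> card (I 1) + card E"
proof -
  have ne: "m2w \<noteq> {\<zero>\<^sub>w}"
  proof -
    obtain h x where "h \<in> m2" "x \<in> carrier \<omega>" "h \<cdot>\<^sub>w x \<noteq> \<zero>\<^sub>w" by (rule m2_acts[OF l])
    then show ?thesis using m2w(2)[of x h] by auto
  qed
  have f0: "(\<lambda>c. \<epsilon> (diag_map v c)) \<in> module_hom R (free_module R (I 0 \<times> E)) \<omega>"
    by (rule module_hom_comp[OF diag_map_hom[OF v fin] eps])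
  have mwI: "\<epsilon> c \<in> mw" if "c \<in> ivec m (I 0)" for c unfolding mw_def by (rule imageI[OF that])
  have "(\<lambda>c. \<epsilon> (diag_map v c)) ` vec (I 0 \<times> E) \<subseteq> mw" using mwI diag_v(1)[OF fin] by blast
  moreover have "\<exists>c\<in>vec (I 0 \<times> E). y \<ominus>\<^bsub>\<omega>\<^esub> \<epsilon> (diag_map v c) \<in> m2w" if y: "y \<in> mw" for y
  proof -
    obtain a where a: "a \<in> ivec m (I 0)" "y = \<epsilon> a" using y unfolding mw_def by blast
    obtain c where c: "c \<in> vec (I 0 \<times> E)" "a = diag_map v c" using a(1) diag_v(2)[OF fin] by blast
    have "y \<ominus>\<^bsub>\<omega>\<^esub> \<epsilon> (diag_map v c) = \<zero>\<^sub>w"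
      unfolding a(2) c(2) a_minus_def by (rule W.M.r_neg[OF module_hom_closed[OF f0 c(1)]])
    then show ?thesis using c(1) is_submoduleD(3)[OF m2w(1)] by (intro bexI[of _ c]) simp_all
  qed
  moreover have "finite (I 0 \<times> E)" using fin E by simp
  moreover have "mw \<subseteq> carrier \<omega>" by (rule is_submoduleD(1)[OF mw(1)])
  ultimately obtain J :: "(nat \<times> nat) set" and \<zeta> where \<zeta>: "finite J" "\<zeta> \<in> module_hom R (free_module R J) \<omega>"
    "\<zeta> ` vec J \<subseteq> mw" and gen: "\<And>y. y \<in> mw \<Longrightarrow> \<exists>c\<in>vec J. y \<ominus>\<^bsub>\<omega>\<^esub> \<zeta> c \<in> m2w"
    and ind: "\<And>c i. c \<in> vec J \<Longrightarrow> \<zeta> c \<in> m2w \<Longrightarrow> c i \<in> m"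
    by - (rule minimal_generators[OF module_omega m2w(1) _ f0], assumption+, blast)
  have "card J \<le> card E"
    
  proof (rule card_le_m_basis[OF E v v_image \<zeta>(1,2) _ ne])
    show "\<zeta> c \<in> mw" if "c \<in> vec J" for c using \<zeta>(3) that by blast
    show "c i \<in> m" if "c \<in> vec J" "\<zeta> c \<in> m2w" for c i by (rule ind[OF that])
  qed
  have "\<zeta> (basis_vec R s) \<in> \<epsilon> ` ivec m (I 0)" if "s \<in> J" for s
    using \<zeta>(3) vec_basis[OF that] unfolding mw_def by blast
  from free_lift_into[OF module_free module_omega eps \<zeta>(2) ivec_submodule[OF ideal_m] this]
  obtain \<phi> where \<phi>: "\<phi> \<in> module_hom R (free_module R J) (free_module R (I 0))"
    "\<And>x. x \<in> vec J \<Longrightarrow> \<epsilon> (\<phi> x) = \<zeta> x" "\<And>x. x \<in> vec J \<Longrightarrow> \<phi> x \<in> ivec m (I 0)"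
    by blast
  have d0: "d 0 \<in> module_hom R (free_module R (I 1)) (free_module R (I 0))" using d[of 0] by simp
  let ?g = "sum_map (free_module R (I 0)) (d 0) \<phi>"
  have "card (I 0 \<times> E) \<le> card (Sum_Type.Plus (I 1) J)"
  proof (rule card_le_span[OF module_free ivec_submodule[OF ideal_m2] _ _ diag_map_hom[OF v fin] sum_map_hom[OF module_free d0 \<phi>(1)]])
    show "finite (I 0 \<times> E)" "finite (Sum_Type.Plus (I 1) J)" using fin \<zeta>(1) E by simp_all
    show "c i \<in> m" if "c \<in> vec (I 0 \<times> E)" "diag_map v c \<in> ivec m2 (I 0)" for c i
      by (rule diag_v(4)[OF fin that])
    show "?g a \<in> ivec m2 (I 0)" if "a \<in> vec (Sum_Type.Plus (I 1) J)" "\<And>j. a j \<in> m" for a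
    proof (rule hom_ivec_product[OF sum_map_hom[OF module_free d0 \<phi>(1)] ideal_m _ _ ideal_m2 m2I])
      show "a \<in> ivec m (Sum_Type.Plus (I 1) J)" using that by (simp add: ivec_def)
      fix s assume "s \<in> Sum_Type.Plus (I 1) J"
      note c = vec_basis[OF this]
      show "?g (basis_vec R s) \<in> ivec m (I 0)"
        using subm_vec(3)[OF ivec_submodule[OF ideal_m] d_ivec(1)[of _ 0] \<phi>(3)[OF vec_Plus(2)[OF c]]] vec_Plus(1)[OF c]
        by (simp add: sum_map_def)
    qed
    fix i assume i: "i \<in> I 0 \<times> E"
    define y where "y = diag_map v (basis_vec R i)"
    have y: "y \<in> ivec m (I 0)" unfolding y_def by (rule diag_v(1)[OF fin vec_basis[OF i]])
    then have yv: "y \<in> vec (I 0)" by (simp add: ivec_def)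
    obtain c where c: "c \<in> vec J" "\<epsilon> y \<ominus>\<^bsub>\<omega>\<^esub> \<zeta> c \<in> m2w" using gen[OF mwI[OF y]] by blast
    then obtain u where u: "u \<in> ivec m2 (I 0)" "\<epsilon> y \<ominus>\<^bsub>\<omega>\<^esub> \<zeta> c = \<epsilon> u" unfolding m2w_def by blast
    have uv: "u \<in> vec (I 0)" using u(1) by (simp add: ivec_def)
    have pv: "\<phi> c \<in> vec (I 0)" by (rule module_hom_closed[OF \<phi>(1) c(1)])
    \<comment> \<open>The image of y is a combination of the basis \<open>\<zeta>\<close> up to the
      image of some u in m^2 F_0; subtracting the lifts of both gives an element of
      \<open>K 0\<close>.\<close>
    define z where "z = (\<lambda>s. (y s \<ominus> \<phi> c s) \<ominus> u s)"
    have zv: "z \<in> vec (I 0)" unfolding z_def by (rule vec_minus[OF vec_minus[OF yv pv] uv])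
    have "\<epsilon> z = \<epsilon> u \<ominus>\<^bsub>\<omega>\<^esub> \<epsilon> u"
      unfolding z_def hom_vec(4)[OF eps module_omega vec_minus[OF yv pv] uv] hom_vec(4)[OF eps module_omega yv pv]
        \<phi>(2)[OF c(1)] u(2) ..
    then have "\<epsilon> z = \<zero>\<^sub>w" using W.M.r_neg[OF module_hom_closed[OF eps uv]] by (simp add: a_minus_def)
    then have "z \<in> K 0" unfolding K_0 using zv by simp
    then obtain a where a: "a \<in> vec (I 1)" "z = d 0 a" unfolding K_def by auto
    obtain b where b: "b \<in> vec (Sum_Type.Plus (I 1) J)" "?g b = d 0 a \<oplus>\<^bsub>free_module R (I 0)\<^esub> \<phi> c"
      by (rule sum_map_surj[OF module_free d0 \<phi>(1) a(1) c(1)])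
    have yu: "(\<lambda>s. y s \<ominus> u s) \<in> vec (I 0)" by (rule vec_minus[OF yv uv])
    have gb: "?g b = (\<lambda>s. y s \<ominus> u s)"
    proof
      fix s
      have "y s \<in> carrier R" "u s \<in> carrier R" "\<phi> c s \<in> carrier R" by (rule vecD(1)[OF yv] vecD(1)[OF uv] vecD(1)[OF pv])+
      then show "?g b s = y s \<ominus> u s"
        unfolding b(2) a(2)[symmetric] z_def by (simp add: a_minus_def) algebra
    qed
    have "y \<ominus>\<^bsub>free_module R (I 0)\<^esub> ?g b = u"
    proof
      fix s
      have "y s \<in> carrier R" "u s \<in> carrier R" by (rule vecD(1)[OF yv] vecD(1)[OF uv])+
      then show "(y \<ominus>\<^bsub>free_module R (I 0)\<^esub> ?g b) s = u s"
        unfolding gb free_minus[OF yv yu] by algebra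
    qed
    then show "\<exists>a\<in>vec (Sum_Type.Plus (I 1) J). diag_map v (basis_vec R i) \<ominus>\<^bsub>free_module R (I 0)\<^esub> ?g a \<in> ivec m2 (I 0)"
      unfolding y_def[symmetric] using b(1) u(1) by (intro bexI[of _ b]) simp_all
  qed
  then show ?thesis using \<open>card J \<le> card E\<close> fin \<zeta>(1) by (simp add: card_cartesian_product card_Plus mult.commute)
qed

text \<open>One basis \<open>Q\<close> of m (\<open>K 0\<close>) has to serve in every inequality
  involving q, so it is fixed before the bounds are collected.\<close>

lemma not_two_generators:
  assumes T: "tor_vanishes 0 (Suc (Suc k))" and r: "card (I 0) \<ge> 2" shows False
proof -
  obtain Q :: "nat set" and \<delta> where Q: "finite Q" "\<delta> \<in> module_hom R (free_module R Q) (free_module R (I 0))"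
    "\<delta> ` vec Q = d 0 ` ivec m (I (Suc 0))" and ind: "\<And>c i. c \<in> vec Q \<Longrightarrow> \<delta> c = (\<lambda>s. \<zero>) \<Longrightarrow> c i \<in> m"
    and q: "card Q \<le> card L * card (I 0)"
    by (rule dm_basis[of 0]) (blast intro: that)
  note Q3 = Q(3)[folded One_nat_def]
  have ne: "I i \<noteq> {}" for i by (rule I_nonempty[OF r])
  have T1: "tor_vanishes (Suc (Suc k)) 0" by (rule tor_vanishes_sym[OF T])
  have T2: "tor_vanishes 1 (Suc k)" by (rule tor_vanishes_shift) (use T in simp)
  have T3: "tor_vanishes 2 k" by (rule tor_vanishes_shift) (use T in simp)
  note lift = of_nat_mono[where 'a = int]
  show False
  proof (rule no_growth[where b = "\<lambda>i. int (card (I i))" and e = "int (card E)" and l = "int (card L)"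
      and q = "int (card Q)" and k = k])
    show "0 < int (card (I i))" for i using ne[of i] fin[of i] by (simp add: card_gt_0_iff)
    show "2 \<le> int (card (I 0))" using r by simp
    show "int (card (I (Suc (Suc k)))) * int (card (I 1)) \<le> int (card (I (Suc k))) * int (card Q)"
      using lift[OF bound_products[OF T1 Q(1,2) Q3]] by (simp only: of_nat_mult of_nat_add)
    show "int (card (I 1)) * int (card (I (Suc k))) * int (card L) \<le> int (card (I 2)) * int (card (I (Suc (Suc k))))"
      using lift[OF bound_socle[OF T2]] by (simp only: of_nat_mult of_nat_add)
    have "card (I 2) + card Q \<le> card E * card (I 1)"
      by (rule bound_second[OF T3 ne Q(1,2) Q3]) (rule ind)
    from lift[OF this] show "int (card (I 2)) + int (card Q) \<le> int (card E) * int (card (I 1))"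
      by (simp only: of_nat_mult of_nat_add)
    show "int (card E) * int (card (I (Suc i))) \<le> int (card (I (Suc (Suc i)))) + int (card L) * int (card (I i))" for i
      using lift[OF bound_growth[of i]] by (simp only: of_nat_mult of_nat_add)
    show "int (card Q) \<le> int (card L) * int (card (I 0))" using lift[OF q] by (simp only: of_nat_mult)
    assume "0 < int (card L)"
    then have l: "L \<noteq> {}" by auto
    have "card Q < card L * card (I 0)" by (rule bound_strict[OF l Q(1,2) Q3]) (rule ind)
    then show "int (card Q) < int (card L) * int (card (I 0))" by (simp only: of_nat_less_iff of_nat_mult[symmetric])
    show "int (card E) * int (card (I 0)) \<le> int (card (I 1)) + int (card E)"
      using lift[OF bound_first[OF l]] by (simp only: of_nat_mult of_nat_add)
  qed simp_all
qed

end

theorem (in minimal_resolution) cyclic_if_tor_vanishes: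
  assumes T: "tor_vanishes 0 (Suc (Suc k))" shows "card (I 0) \<le> 1"
proof (rule ccontr)
  assume "\<not> ?thesis"
  then have r: "card (I 0) \<ge> 2" by simp
  obtain E :: "nat set" and v where E: "finite E" "v \<in> module_hom R (free_module R E) (ring_module R)" "v ` vec E = m"
    and vi: "\<And>c i. c \<in> vec E \<Longrightarrow> v c \<in> m2 \<Longrightarrow> c i \<in> m" by (rule m_basis) (blast intro: that)
  obtain L :: "nat set" and w where L: "finite L" "w \<in> module_hom R (free_module R L) (ring_module R)" "w ` vec L = m2"
    and wi: "\<And>c i. c \<in> vec L \<Longrightarrow> w c = \<zero> \<Longrightarrow> c i \<in> m" by (rule ideal_basis[OF ideal_m2]) (blast intro: that)
  interpret counted_resolution R m \<omega> I \<epsilon> d E L v w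
    by unfold_locales (fact E L vi wi)+
  show False by (rule not_two_generators[OF T r])
qed

section \<open>Passing from Tor to the minimal resolution\<close>

text \<open>The first factor starts in degree n of the canonical resolution, the second in degree 0
  of the minimal one. Shifting brings the first down to degree 0 and the second up to n; there
  \<open>tor_independent_cover\<close> replaces the canonical cover of \<omega> by
  \<open>\<epsilon>\<close>.\<close>

lemma (in minimal_resolution) tor_vanishes_if_Tor_trivial:
  assumes "trivial_module (Tor R (Suc n) \<omega> \<omega>)" shows "tor_vanishes 0 n"
proof -
  let ?B = "\<lambda>k. res_basis R \<omega> k" and ?b = "res_boundary R"
  interpret free_cover R \<omega> "I 0" \<epsilon>
    by unfold_locales (rule eps, rule eps_surj)
  have kernel: "kernel_of = K 0" by (simp add: kernel_of_def K_0)
  have hom: "?b \<in> module_hom R (free_module R (?B (Suc k))) (free_module R (?B k))" for k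
    using res_boundary_hom[OF module_omega, of k] by (simp add: free_resolution_def del: res_basis.simps)
  have exact: "?b ` vec (?B (Suc (Suc k))) = {x \<in> vec (?B (Suc k)). ?b x = (\<lambda>s. \<zero>)}" for k
    using free_resolution_exact(3)[OF module_omega, of k] by (simp add: free_resolution_def del: res_basis.simps)
  have "tor_independent R (?B n) (?b ` vec (?B (Suc n))) (I 0) (K 0)"
    using assms Tor_trivial_iff[OF module_omega, of n] unfolding kernel by blast
  moreover have "tor_independent R (?B n) (?b ` vec (?B (Suc n))) (I k) (K k) \<Longrightarrow>
    tor_independent R (?B 0) (?b ` vec (?B (Suc 0))) (I (k + n)) (K (k + n))" for k
  proof (induction n arbitrary: k)
    case 0
    then show ?case by (simp del: res_basis.simps)
  next
    case (Suc n)
    have "tor_independent R (?B n) (?b ` vec (?B (Suc n))) (I (Suc k)) {x \<in> vec (I (Suc k)). d k x = (\<lambda>s. \<zero>)}"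
      by (rule tor_independent_shift[OF hom d]) (use Suc.prems in \<open>simp only: exact K_def\<close>)
    then show ?case using Suc.IH[of "Suc k"] by (simp add: K_Suc del: res_basis.simps)
  qed
  ultimately have "tor_independent R (?B 0) (?b ` vec (?B (Suc 0))) (I n) (K n)"
    by (metis add_0)
  then have "tor_independent R (?B 0) {x \<in> vec (?B 0). res_augmentation R \<omega> x = \<zero>\<^sub>w} (I n) (K n)"
    using free_resolution_exact(2)[OF module_omega] by (simp add: free_resolution_def del: res_basis.simps)
  from tor_independent_cover[OF module_omega _ _ eps eps_surj K_submodule this]
  show ?thesis
    using res_augmentation_hom[OF module_omega] free_resolution_exact(1)[OF module_omega]
    by (simp add: free_resolution_def K_0 del: res_basis.simps)
qed

section \<open>Gorenstein rings\<close>

text \<open>Since \<omega> may live on any type, injectivity has to be carried over to R on its own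
  type by an isomorphism.\<close>

lemma injective_module_iso:
  fixes E :: "('a, 'b, 'm) module_scheme" and E' :: "('a, 'c, 'n) module_scheme"
  assumes E: "injective_module R E" and E': "module R E'" and h: "h \<in> module_hom R E' E" and b: "bij_betw h (carrier E') (carrier E)"
  shows "injective_module R E'"
  unfolding injective_module_def
proof (intro conjI allI impI E')
  fix A B :: "('a, 'a) module" and i f
  assume *: "module R A \<and> module R B \<and> i \<in> module_hom R A B \<and> inj_on i (carrier A) \<and> f \<in> module_hom R A E'"
  interpret E': module R E' by fact
  define k where "k = inv_into (carrier E') h"
  have k: "k y \<in> carrier E'" "h (k y) = y" if "y \<in> carrier E" for y
    using that b inv_into_into[of y h "carrier E'"] f_inv_into_f[of y h "carrier E'"]
    by (auto simp: k_def bij_betw_def)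
  have kh: "k (h x) = x" if "x \<in> carrier E'" for x
    using that b by (simp add: k_def bij_betw_def inv_into_f_f)
  have hk: "k \<in> module_hom R E E'"
  proof (rule module_homI)
    show "k y \<in> carrier E'" if "y \<in> carrier E" for y by (rule k(1)[OF that])
    show "k (x \<oplus>\<^bsub>E\<^esub> y) = k x \<oplus>\<^bsub>E'\<^esub> k y" if "x \<in> carrier E" "y \<in> carrier E" for x y
      using kh[of "k x \<oplus>\<^bsub>E'\<^esub> k y"] module_hom_add[OF h k(1)[OF that(1)] k(1)[OF that(2)]] that k by simp
    show "k (a \<odot>\<^bsub>E\<^esub> x) = a \<odot>\<^bsub>E'\<^esub> k x" if "a \<in> carrier R" "x \<in> carrier E" for a x
      using kh[of "a \<odot>\<^bsub>E'\<^esub> k x"] module_hom_smult[OF h that(1) k(1)[OF that(2)]] that k by simp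
  qed
  have "(\<lambda>x. h (f x)) \<in> module_hom R A E" using * h by (blast intro: module_hom_comp)
  then obtain g where g: "g \<in> module_hom R B E" "\<forall>x\<in>carrier A. g (i x) = h (f x)"
    using E * unfolding injective_module_def by blast
  have "k (g (i x)) = f x" if "x \<in> carrier A" for x
    using g(2) that kh * module_hom_closed[of f R A E' x] by simp
  then show "\<exists>g\<in>module_hom R B E'. \<forall>x\<in>carrier A. g (i x) = f x"
    using module_hom_comp[OF g(1) hk] by (intro bexI[of _ "\<lambda>x. k (g x)"]) simp_all
qed

text \<open>R in degree 0, followed by zero modules, is an injective resolution of length 0.\<close>

lemma (in cring) self_injective_resolution:
  assumes inj: "injective_module R (ring_module R)" shows "finite_self_injective_dimension R"
proof -
  interpret RM: module R "ring_module R" by (rule module_ring)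
  define Z where "Z = (ring_module R)\<lparr>carrier := {\<zero>}\<rparr>"
  have "submodule {\<zero>} R (ring_module R)" using RM.is_submodule_zero by (simp add: RM.submodule_iff)
  then have Z: "module R Z" unfolding Z_def by (rule submodule.submodule_is_module[OF _ RM.module_axioms])
  have Zs: "carrier Z = {\<zero>}" "\<zero>\<^bsub>Z\<^esub> = \<zero>" "\<zero> \<oplus>\<^bsub>Z\<^esub> \<zero> = \<zero>" "a \<in> carrier R \<Longrightarrow> a \<odot>\<^bsub>Z\<^esub> \<zero> = \<zero>" for a
    by (simp_all add: Z_def)
  have injZ: "injective_module R Z"
    unfolding injective_module_def
  proof (intro conjI allI impI Z)
    fix A B :: "('a, 'a) module" and i f
    assume *: "module R A \<and> module R B \<and> i \<in> module_hom R A B \<and> inj_on i (carrier A) \<and> f \<in> module_hom R A Z"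
    have "f x = \<zero>" if "x \<in> carrier A" for x using * module_hom_closed[of f R A Z x] that Zs(1) by simp
    moreover have "(\<lambda>x. \<zero>) \<in> module_hom R B Z"
      using Zs by (intro module_homI) simp_all
    ultimately show "\<exists>g\<in>module_hom R B Z. \<forall>x\<in>carrier A. g (i x) = f x" by (intro bexI[of _ "\<lambda>x. \<zero>"]) auto
  qed
  define I where "I n = (if n = 0 then ring_module R else Z)" for n :: nat
  have I: "I 0 = ring_module R" "I (Suc n) = Z" "I 1 = Z" for n by (simp_all add: I_def)
  have "injective_resolution R (ring_module R) I (\<lambda>n x. \<zero>) (\<lambda>x. x)"
    unfolding injective_resolution_def
  proof (intro conjI allI)
    show "injective_module R (I n)" for n using inj injZ by (simp add: I_def)
    show "(\<lambda>x. \<zero>) \<in> module_hom R (I n) (I (Suc n))" for n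
      unfolding I using Zs by (intro module_homI) simp_all
    show "(\<lambda>x. \<zero>) ` carrier (I n) = {x \<in> carrier (I (Suc n)). \<zero> = \<zero>\<^bsub>I (Suc (Suc n))\<^esub>}" for n
    proof -
      have "carrier (I n) \<noteq> {}" using Zs(1) by (cases n) (auto simp: I)
      then show ?thesis unfolding I Zs by auto
    qed
  qed (simp_all add: I Zs module_hom_id)
  moreover have "trivial_module (I k)" if "k > 0" for k using that Zs by (simp add: I_def trivial_module_def)
  ultimately show ?thesis unfolding finite_self_injective_dimension_def by blast
qed

context dualizing_cube
begin

text \<open>An element that annihilates the generator annihilates all of \<omega>, hence is zero by
  \<open>faithful\<close>. So r \<mapsto> r w is an isomorphism from R to \<omega>, and R is
  injective over itself.\<close>

lemma gorenstein_if_cyclic: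
  assumes w: "w \<in> carrier \<omega>" and gen: "\<And>x. x \<in> carrier \<omega> \<Longrightarrow> \<exists>r\<in>carrier R. x = r \<cdot>\<^sub>w w"
  shows "gorenstein_local_ring R m"
proof -
  have h: "(\<lambda>r. r \<cdot>\<^sub>w w) \<in> module_hom R (ring_module R) \<omega>"
    using w by (intro module_homI) (simp_all add: W.smult_l_distr W.smult_assoc1)
  have ann: "r = \<zero>" if r: "r \<in> carrier R" "r \<cdot>\<^sub>w w = \<zero>\<^sub>w" for r
  proof (rule ccontr)
    assume "r \<noteq> \<zero>"
    then obtain x where x: "x \<in> carrier \<omega>" "r \<cdot>\<^sub>w x \<noteq> \<zero>\<^sub>w" by (rule faithful[OF r(1)])
    obtain s where s: "s \<in> carrier R" "x = s \<cdot>\<^sub>w w" using gen[OF x(1)] by blast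
    have "r \<cdot>\<^sub>w x = s \<cdot>\<^sub>w (r \<cdot>\<^sub>w w)" unfolding s(2) using r(1) s(1) w by (simp add: W.smult_assoc1[symmetric] m_comm)
    then show False using x(2) r(2) s(1) by simp
  qed
  have "inj_on (\<lambda>r. r \<cdot>\<^sub>w w) (carrier R)"
  proof (rule inj_onI)
    fix r s assume rs: "r \<in> carrier R" "s \<in> carrier R" "r \<cdot>\<^sub>w w = s \<cdot>\<^sub>w w"
    have "(r \<ominus> s) \<cdot>\<^sub>w w = \<zero>\<^sub>w"
      using rs w by (simp add: a_minus_def W.smult_l_distr W.smult_l_minus W.M.r_neg)
    then have "r \<ominus> s = \<zero>" using rs by (intro ann) simp_all
    then show "r = s" using rs by simp
  qed
  moreover have "(\<lambda>r. r \<cdot>\<^sub>w w) ` carrier R = carrier \<omega>" using gen w by auto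
  ultimately have b: "bij_betw (\<lambda>r. r \<cdot>\<^sub>w w) (carrier (ring_module R)) (carrier \<omega>)" by (simp add: bij_betw_def)
  show ?thesis
    unfolding gorenstein_local_ring_def
    using local_R noeth_ring_imp_noetherian[OF artinian_noeth[OF artinian]]
      self_injective_resolution[OF injective_module_iso[OF injective_omega module_ring h b]] by blast
qed

end

lemma (in minimal_resolution) gorenstein_if_one_generator:
  assumes "card (I 0) \<le> 1" shows "gorenstein_local_ring R m"
proof -
  have "\<exists>i. I 0 \<subseteq> {i}" using assms card_le_Suc0_iff_eq[OF fin] by (metis One_nat_def insertI1 subsetI)
  then obtain i where i: "I 0 \<subseteq> {i}" by blast
  have "I 0 \<noteq> {}"
  proof
    assume e: "I 0 = {}"
    obtain c where c: "c \<in> vec (I 0)" "soc = \<epsilon> c" using soc(1) eps_surj by blast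
    have "c = (\<lambda>s. \<zero>)" using vecD(2)[OF c(1)] e by auto
    then show False using c(2) soc(2) hom_vec(3)[OF eps module_omega] by simp
  qed
  then have i0: "i \<in> I 0" using i by blast
  show ?thesis
  proof (rule gorenstein_if_cyclic[OF module_hom_closed[OF eps vec_basis[OF i0]]])
    fix x assume "x \<in> carrier \<omega>"
    then obtain c where c: "c \<in> vec (I 0)" "x = \<epsilon> c" using eps_surj by blast
    note ci = vecD(1)[OF c(1), of i]
    have "c = (\<lambda>s. c i \<otimes> basis_vec R i s)"
    proof
      fix s show "c s = c i \<otimes> basis_vec R i s"
        using vecD(2)[OF c(1), of s] ci i by (cases "s = i") (auto simp: basis_vec_def)
    qed
    then have "x = c i \<cdot>\<^sub>w \<epsilon> (basis_vec R i)"
      using hom_vec(2)[OF eps ci vec_basis[OF i0]] c(2) by simp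
    then show "\<exists>r\<in>carrier R. x = r \<cdot>\<^sub>w \<epsilon> (basis_vec R i)" using ci by blast
  qed
qed

section \<open>Descent of Baer's condition along an injective resolution\<close>

context dualizing_cube
begin

text \<open>For a socle element s of R, Baer's condition on the image gives x = s h with h = d y.
  Then s y maps to x, and m kills it because m kills s.\<close>

lemma socle_lift:
  assumes E: "module R E" "module R E'" and d: "d \<in> module_hom R E E'" and D: "baer_submodule E' (d ` carrier E)"
    and x: "x \<in> d ` carrier E" "\<And>a. a \<in> m \<Longrightarrow> a \<odot>\<^bsub>E'\<^esub> x = \<zero>\<^bsub>E'\<^esub>"
  obtains z where "z \<in> carrier E" "d z = x" "\<And>a. a \<in> m \<Longrightarrow> a \<odot>\<^bsub>E\<^esub> z = \<zero>\<^bsub>E\<^esub>"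
proof -
  interpret E: module R E by fact
  interpret E': module R E' by fact
  obtain s where s: "s \<in> carrier R" "s \<noteq> \<zero>" "\<And>a. a \<in> m \<Longrightarrow> a \<otimes> s = \<zero>"
    by (rule ring_socle_element) (blast intro: that)
  have "is_submodule R E' (d ` carrier E)" by (rule is_submodule_image[OF E d E.is_submodule_carrier])
  moreover have "r \<odot>\<^bsub>E'\<^esub> x = \<zero>\<^bsub>E'\<^esub>" if "r \<in> carrier R" "r \<otimes> s \<in> {\<zero>}" for r using x(2)[OF zero_product_in_m[OF that(1) s(1,2)]] that(2) by simp
  ultimately obtain h where h: "h \<in> d ` carrier E" "s \<odot>\<^bsub>E'\<^esub> h = x"
    using baer_extension[OF E(2) _ D zeroideal s(1) x(1)] by metis
  then obtain y where y: "y \<in> carrier E" "h = d y" by blast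
  show ?thesis
  proof (rule that[of "s \<odot>\<^bsub>E\<^esub> y"])
    show "d (s \<odot>\<^bsub>E\<^esub> y) = x" using module_hom_smult[OF d s(1) y(1)] y(2) h(2) by simp
    show "a \<odot>\<^bsub>E\<^esub> (s \<odot>\<^bsub>E\<^esub> y) = \<zero>\<^bsub>E\<^esub>" if "a \<in> m" for a
      using E.smult_assoc1[OF m_simps(1)[OF that] s(1) y(1)] s(3)[OF that] y(1) by simp
  qed (use s y in simp)
qed

text \<open>Starting from 1, elements of m are multiplied on as long as the product stays outside
  \<open>B\<close>; m^3 = 0 ends this after at most two steps.\<close>

lemma socle_element_modulo:
  assumes B: "ideal B R" "B \<noteq> carrier R" obtains t where "t \<in> carrier R" "t \<notin> B" "\<And>a. a \<in> m \<Longrightarrow> a \<otimes> t \<in> B"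
proof -
  have one: "\<one> \<notin> B" using B ideal.one_imp_carrier by blast
  have "\<exists>t. t \<in> carrier R \<and> t \<notin> B \<and> (\<forall>a\<in>m. a \<otimes> t \<in> B)"
  proof (rule ccontr)
    assume neg: "\<not> ?thesis"
    then obtain a where a: "a \<in> m" "a \<otimes> \<one> \<notin> B" using one by blast
    then have ac: "a \<in> carrier R" "a \<notin> B" using m_simps(1)[OF a(1)] by auto
    then obtain b where b: "b \<in> m" "b \<otimes> a \<notin> B" using neg by blast
    have "b \<otimes> a \<in> carrier R" using m_simps(1)[OF b(1)] ac(1) by simp
    then obtain c where c: "c \<in> m" "c \<otimes> (b \<otimes> a) \<notin> B" using neg b(2) by blast
    have "c \<otimes> (b \<otimes> a) = \<zero>" by (rule m3_zero(2)[OF m2I[OF b(1) a(1)] c(1)])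
    then show False using c(2) ideal_simps(2)[OF B(1)] by simp
  qed
  then show ?thesis using that by blast
qed

lemma maximal_ideal_in_family:
  assumes "F \<noteq> {}" "\<And>J. J \<in> F \<Longrightarrow> ideal J R"
  obtains B where "B \<in> F" "\<And>J. J \<in> F \<Longrightarrow> B \<subseteq> J \<Longrightarrow> J = B"
proof -
  interpret N: noetherian_ring R by (rule noeth_ring_imp_noetherian[OF artinian_noeth[OF artinian]])
  have "\<exists>B\<in>F. \<forall>J\<in>F. B \<subseteq> J \<longrightarrow> J = B"
  proof (rule subset_Zorn)
    fix C assume C: "subset.chain F C"
    show "\<exists>U\<in>F. \<forall>X\<in>C. X \<subseteq> U"
    proof (cases "C = {}")
      case True
      then show ?thesis using assms(1) by blast
    next
      case False
      have "subset.chain {I. ideal I R} C" using C assms(2) by (auto simp: subset.chain_def)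
      then have "\<Union>C \<in> C" by (rule N.ideal_chain_is_trivial[OF False])
      then show ?thesis using C by (auto simp: subset.chain_def)
    qed
  qed
  then show ?thesis using that by blast
qed

text \<open>A solution \<open>u\<close> of \<open>f a = a u\<close> in \<open>E\<close> is corrected step by step until it lies in the kernel:
  \<open>t\<close> represents a socle element modulo \<open>{r. r u \<in> ker d}\<close>, and \<open>t (d u)\<close> lifts to the socle of \<open>E\<close>.\<close>

lemma baer_kernel:
  assumes E: "module R E" "module R E'" and d: "d \<in> module_hom R E E'" and BE: "baer_submodule E (carrier E)"
    and D: "baer_submodule E' (d ` carrier E)"
  shows "baer_submodule E {x \<in> carrier E. d x = \<zero>\<^bsub>E'\<^esub>}"
  unfolding baer_submodule_def
proof (intro allI impI)
  interpret E: module R E by fact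
  interpret E': module R E' by fact
  let ?K = "{x \<in> carrier E. d x = \<zero>\<^bsub>E'\<^esub>}"
  fix A f assume A: "ideal A R" and f: "f \<in> module_hom R ((ring_module R)\<lparr>carrier := A\<rparr>) E" and fK: "f ` A \<subseteq> ?K"
  define U where "U = {u \<in> carrier E. \<forall>a\<in>A. f a = a \<odot>\<^bsub>E\<^esub> u}"
  define B where "B u = {r \<in> carrier R. r \<odot>\<^bsub>E'\<^esub> d u = \<zero>\<^bsub>E'\<^esub>}" for u
  note dc = module_hom_closed[OF d]
  have Bi: "ideal (B u) R" if "u \<in> carrier E" for u unfolding B_def by (rule E'.ideal_annihilator[OF dc[OF that]])
  have AB: "A \<subseteq> B u" if u: "u \<in> U" for u
  proof
    fix a assume a: "a \<in> A"
    have uc: "u \<in> carrier E" and fa: "f a = a \<odot>\<^bsub>E\<^esub> u" using u a by (auto simp: U_def)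
    have "a \<in> carrier R" by (rule ideal_simps(1)[OF A a])
    then show "a \<in> B u" using fK a module_hom_smult[OF d _ uc, of a] fa by (auto simp: B_def)
  qed
  have "f ` A \<subseteq> carrier E" using fK by blast
  then have "U \<noteq> {}" using BE A f unfolding baer_submodule_def U_def by blast
  \<comment> \<open>The corrections stop at a solution whose ideal \<open>B u\<close> is maximal,
    which exists because R is Noetherian; a proper \<open>B u\<close> could still be
    enlarged.\<close>
  then obtain u where u: "u \<in> U" and mx: "\<And>u'. u' \<in> U \<Longrightarrow> B u \<subseteq> B u' \<Longrightarrow> B u' = B u"
    using maximal_ideal_in_family[of "B ` U"] Bi unfolding U_def by (smt (verit) imageE image_eqI image_is_empty mem_Collect_eq)
  have uc: "u \<in> carrier E" using u by (simp add: U_def)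
  have "B u = carrier R"
  proof (rule ccontr)
    assume "B u \<noteq> carrier R"
    then obtain t where t: "t \<in> carrier R" "t \<notin> B u" "\<And>a. a \<in> m \<Longrightarrow> a \<otimes> t \<in> B u"
      by (rule socle_element_modulo[OF Bi[OF uc]]) (blast intro: that)
    have tu: "t \<odot>\<^bsub>E\<^esub> u \<in> carrier E" using t(1) uc by simp
    have dtu: "d (t \<odot>\<^bsub>E\<^esub> u) = t \<odot>\<^bsub>E'\<^esub> d u" by (rule module_hom_smult[OF d t(1) uc])
    have "a \<odot>\<^bsub>E'\<^esub> d (t \<odot>\<^bsub>E\<^esub> u) = \<zero>\<^bsub>E'\<^esub>" if "a \<in> m" for a
      using t(3)[OF that] E'.smult_assoc1[OF m_simps(1)[OF that] t(1) dc[OF uc]] dtu by (simp add: B_def)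
    then obtain z where z: "z \<in> carrier E" "d z = d (t \<odot>\<^bsub>E\<^esub> u)" "\<And>a. a \<in> m \<Longrightarrow> a \<odot>\<^bsub>E\<^esub> z = \<zero>\<^bsub>E\<^esub>"
      using socle_lift[OF E d D imageI[OF tu]] by metis
    have nz: "\<ominus>\<^bsub>E\<^esub> z \<in> carrier E" using z(1) by simp
    have "r \<odot>\<^bsub>E\<^esub> \<ominus>\<^bsub>E\<^esub> z = \<zero>\<^bsub>E\<^esub>" if r: "r \<in> carrier R" "r \<otimes> t \<in> B u" for r
    proof -
      have "r \<in> m"
      proof (rule ccontr)
        assume "r \<notin> m"
        then have v: "r \<in> Units R" by (rule unitI[OF r(1)])
        have "inv r \<otimes> (r \<otimes> t) \<in> B u" by (rule ideal_simps(6)[OF Bi[OF uc] _ r(2)]) (use v in simp)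
        then show False using t(1,2) r(1) v by (simp add: m_assoc[symmetric])
      qed
      then show ?thesis using z(1,3) r(1) by (simp add: E.smult_r_minus)
    qed
    \<comment> \<open>Being killed by \<open>B u\<close>, h leaves u a solution and loses nothing
      from \<open>B u\<close>. As t h = -z and d z = t (d u), the new ideal also contains
      \<open>t\<close>.\<close>
    then obtain h where h: "h \<in> carrier E" "\<And>b. b \<in> B u \<Longrightarrow> b \<odot>\<^bsub>E\<^esub> h = \<zero>\<^bsub>E\<^esub>" "t \<odot>\<^bsub>E\<^esub> h = \<ominus>\<^bsub>E\<^esub> z"
      using baer_extension[OF E(1) E.is_submodule_carrier BE Bi[OF uc] t(1) nz] by metis
    let ?u = "u \<oplus>\<^bsub>E\<^esub> h"
    have "f a = a \<odot>\<^bsub>E\<^esub> ?u" if a: "a \<in> A" for a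
    proof -
      have "a \<odot>\<^bsub>E\<^esub> h = \<zero>\<^bsub>E\<^esub>" using h(2) AB[OF u] a by blast
      then show ?thesis using u a uc h(1) ideal_simps(1)[OF A a] by (simp add: U_def E.smult_r_distr)
    qed
    then have u': "?u \<in> U" using uc h(1) by (simp add: U_def)
    have du: "r \<odot>\<^bsub>E'\<^esub> d ?u = r \<odot>\<^bsub>E'\<^esub> d u \<oplus>\<^bsub>E'\<^esub> d (r \<odot>\<^bsub>E\<^esub> h)" if "r \<in> carrier R" for r
      using module_hom_add[OF d uc h(1)] module_hom_smult[OF d that h(1)] that dc[OF uc] dc[OF h(1)] by (simp add: E'.smult_r_distr)
    have d0: "d \<zero>\<^bsub>E\<^esub> = \<zero>\<^bsub>E'\<^esub>" by (rule module_hom_zero[OF E d])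
    have "B u \<subseteq> B ?u"
    proof
      fix b assume b: "b \<in> B u"
      then have "b \<in> carrier R" "b \<odot>\<^bsub>E'\<^esub> d u = \<zero>\<^bsub>E'\<^esub>" by (simp_all add: B_def)
      then show "b \<in> B ?u" using du[of b] h(2)[OF b] d0 by (simp add: B_def)
    qed
    then have "B ?u = B u" by (rule mx[OF u'])
    moreover have "t \<in> B ?u"
    proof -
      have "d (t \<odot>\<^bsub>E\<^esub> h) = (\<ominus> \<one>) \<odot>\<^bsub>E'\<^esub> d z"
        unfolding h(3) using module_hom_smult[OF d _ z(1), of "\<ominus> \<one>"] z(1) by (simp add: E.smult_l_minus)
      also have "\<dots> = \<ominus>\<^bsub>E'\<^esub> d z" using dc[OF z(1)] by (simp add: E'.smult_l_minus)
      finally show ?thesis using du[OF t(1)] z(2) dtu t(1) dc[OF uc] by (simp add: B_def E'.M.r_neg)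
    qed
    ultimately show False using t(2) by simp
  qed
  then have "\<one> \<in> B u" by simp
  then have "u \<in> ?K" using uc dc[OF uc] by (simp add: B_def)
  then show "\<exists>x\<in>?K. \<forall>a\<in>A. f a = a \<odot>\<^bsub>E\<^esub> x" using u by (auto simp: U_def)
qed

text \<open>\<open>baer_kernel\<close> passes the condition from the kernel in degree k + 1 to the
  one in degree k, since the former is the image of \<open>d k\<close>. The zero module in degree n
  + 1 starts the descent, and the kernel in degree 0 is the copy of R.\<close>

lemma self_baer:
  assumes "finite_self_injective_dimension R" shows "baer_submodule (ring_module R) (carrier R)"
proof -
  obtain n I d e where res: "injective_resolution R (ring_module R) I d e"
    and triv: "\<And>k. k > n \<Longrightarrow> trivial_module (I k :: ('a, 'a) module)"
    using assms unfolding finite_self_injective_dimension_def by blast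
  have inj: "\<And>k. injective_module R (I k)" and e: "e \<in> module_hom R (ring_module R) (I 0)" "inj_on e (carrier R)"
    and d: "\<And>k. d k \<in> module_hom R (I k) (I (Suc k))"
    and ex: "e ` carrier R = {x \<in> carrier (I 0). d 0 x = \<zero>\<^bsub>I 1\<^esub>}"
      "\<And>k. d k ` carrier (I k) = {x \<in> carrier (I (Suc k)). d (Suc k) x = \<zero>\<^bsub>I (Suc (Suc k))\<^esub>}"
    using res unfolding injective_resolution_def by auto
  have mod: "module R (I k)" for k using inj[of k] by (simp add: injective_module_def)
  define Z where "Z k = {x \<in> carrier (I k). d k x = \<zero>\<^bsub>I (Suc k)\<^esub>}" for k
  have step: "baer_submodule (I k) (Z k)" if "baer_submodule (I (Suc k)) (Z (Suc k))" for k
    unfolding Z_def by (rule baer_kernel[OF mod mod d injective_baer[OF inj]]) (use that ex(2) in \<open>simp add: Z_def\<close>)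
  have top: "baer_submodule (I (Suc n)) (Z (Suc n))"
    unfolding baer_submodule_def
  proof (intro allI impI)
    fix A f assume A: "ideal A R" and f: "f ` A \<subseteq> Z (Suc n)"
    interpret M: module R "I (Suc n)" by (rule mod)
    have c: "carrier (I (Suc n)) = {\<zero>\<^bsub>I (Suc n)\<^esub>}" using triv[of "Suc n"] by (simp add: trivial_module_def)
    have "\<zero>\<^bsub>I (Suc n)\<^esub> \<in> Z (Suc n)" using module_hom_zero[OF mod mod d] by (simp add: Z_def)
    moreover have "f a = a \<odot>\<^bsub>I (Suc n)\<^esub> \<zero>\<^bsub>I (Suc n)\<^esub>" if "a \<in> A" for a
    proof -
      have "f a \<in> carrier (I (Suc n))" using f that by (auto simp: Z_def)
      then show ?thesis using c ideal_simps(1)[OF A that] by simp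
    qed
    ultimately show "\<exists>x\<in>Z (Suc n). \<forall>a\<in>A. f a = a \<odot>\<^bsub>I (Suc n)\<^esub> x" by blast
  qed
  \<comment> \<open>Subtraction is truncated: once i has reached n + 1, the degree remains
    0.\<close>
  have "baer_submodule (I (Suc n - i)) (Z (Suc n - i))" for i
  proof (induction i)
    case (Suc i)
    show ?case
    proof (cases "i < Suc n")
      case True
      then have "Suc n - i = Suc (Suc n - Suc i)" by simp
      then show ?thesis using Suc step by metis
    qed (use Suc in simp)
  qed (simp add: top)
  from this[of "Suc n"] have B0: "baer_submodule (I 0) (e ` carrier R)" unfolding ex(1) by (simp add: Z_def)
  show ?thesis
    unfolding baer_submodule_def
  proof (intro allI impI)
    fix A f assume A: "ideal A R" and f: "f \<in> module_hom R ((ring_module R)\<lparr>carrier := A\<rparr>) (ring_module R)" and fA: "f ` A \<subseteq> carrier R"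
    have ef: "(\<lambda>a. e (f a)) \<in> module_hom R ((ring_module R)\<lparr>carrier := A\<rparr>) (I 0)" by (rule module_hom_comp[OF f e(1)])
    have efA: "(\<lambda>a. e (f a)) ` A \<subseteq> e ` carrier R" using fA by blast
    have "\<exists>x\<in>e ` carrier R. \<forall>a\<in>A. e (f a) = a \<odot>\<^bsub>I 0\<^esub> x"
      using B0[unfolded baer_submodule_def, THEN spec, THEN spec, THEN mp, OF A, THEN mp, OF ef, THEN mp, OF efA] .
    then obtain r where r: "r \<in> carrier R" "\<And>a. a \<in> A \<Longrightarrow> e (f a) = a \<odot>\<^bsub>I 0\<^esub> e r" by blast
    have "f a = a \<odot>\<^bsub>ring_module R\<^esub> r" if a: "a \<in> A" for a
    proof (rule inj_onD[OF e(2)])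
      have ac: "a \<in> carrier R" by (rule ideal_simps(1)[OF A a])
      show "e (f a) = e (a \<odot>\<^bsub>ring_module R\<^esub> r)" using r(2)[OF a] module_hom_smult[OF e(1) ac, of r] r(1) by simp
      show "f a \<in> carrier R" "a \<odot>\<^bsub>ring_module R\<^esub> r \<in> carrier R" using fA a ac r(1) by auto
    qed
    then show "\<exists>x\<in>carrier R. \<forall>a\<in>A. f a = a \<odot>\<^bsub>ring_module R\<^esub> x" using r(1) by blast
  qed
qed

text \<open>\<open>w\<close> is chosen with s w = soc for a socle element s of R. Baer's condition
  makes the socle of R one-dimensional, so every nonzero r has s among its multiples; then r w = 0
  would imply soc = 0. Hence R w is a copy of R, and Baer's condition for R shows that it is all of
  \<omega>.\<close>

lemma free_if_self_baer:
  assumes B: "baer_submodule (ring_module R) (carrier R)"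
  obtains w where "w \<in> carrier \<omega>" "\<And>r. r \<in> carrier R \<Longrightarrow> r \<cdot>\<^sub>w w = \<zero>\<^sub>w \<Longrightarrow> r = \<zero>"
    "\<And>y. y \<in> carrier \<omega> \<Longrightarrow> \<exists>r\<in>carrier R. y = r \<cdot>\<^sub>w w"
proof -
  interpret RM: module R "ring_module R" by (rule module_ring)
  have Rs: "is_submodule R (ring_module R) (carrier R)" using RM.is_submodule_carrier by simp
  obtain s where s: "s \<in> carrier R" "s \<noteq> \<zero>" "\<And>a. a \<in> m \<Longrightarrow> a \<otimes> s = \<zero>" by (rule ring_socle_element) (blast intro: that)
  have "r \<cdot>\<^sub>w soc = \<zero>\<^sub>w" if "r \<in> carrier R" "r \<otimes> s \<in> {\<zero>}" for r
    using soc(3)[OF zero_product_in_m[OF that(1) s(1,2)]] that(2) by simp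
  then obtain w where w: "w \<in> carrier \<omega>" "s \<cdot>\<^sub>w w = soc"
    using baer_extension[OF module_omega W.is_submodule_carrier injective_baer[OF injective_omega] zeroideal s(1) soc(1)] by metis
  have ann: "r = \<zero>" if r: "r \<in> carrier R" "r \<cdot>\<^sub>w w = \<zero>\<^sub>w" for r
  proof (rule ccontr)
    assume "r \<noteq> \<zero>"
    then obtain u where u: "u \<in> carrier R" "u \<otimes> r \<noteq> \<zero>" "\<And>a. a \<in> m \<Longrightarrow> a \<otimes> (u \<otimes> r) = \<zero>"
      by (rule socle_of_ring[OF r(1)]) (blast intro: that)
    have tc: "u \<otimes> r \<in> carrier (ring_module R)" "u \<otimes> r \<in> carrier R" using u r by simp_all
    have "c \<odot>\<^bsub>ring_module R\<^esub> (u \<otimes> r) = \<zero>\<^bsub>ring_module R\<^esub>" if "c \<in> carrier R" "c \<otimes> s \<in> {\<zero>}" for c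
      using u(3)[OF zero_product_in_m[OF that(1) s(1,2)]] that(2) by simp
    then obtain x where x: "x \<in> carrier R" "s \<odot>\<^bsub>ring_module R\<^esub> x = u \<otimes> r"
      using baer_extension[OF module_ring Rs B zeroideal s(1) tc(2)] by metis
    have sx: "x \<otimes> s = u \<otimes> r" using x s(1) m_comm by simp
    then have "x \<notin> m" using s(3) u(2) by metis
    then have v: "x \<in> Units R" by (rule unitI[OF x(1)])
    have "s = inv x \<otimes> (u \<otimes> r)" unfolding sx[symmetric] using v x(1) s(1) by (simp add: m_assoc[symmetric])
    then have "soc = (inv x \<otimes> u) \<cdot>\<^sub>w (r \<cdot>\<^sub>w w)" unfolding w(2)[symmetric] using v u(1) r(1) w(1) by (simp add: W.smult_assoc1 m_assoc)
    then show False using soc(2) r(2) v u(1) by simp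
  qed
  have inj: "r = r'" if "r \<in> carrier R" "r' \<in> carrier R" "r \<cdot>\<^sub>w w = r' \<cdot>\<^sub>w w" for r r'
  proof -
    have "(r \<ominus> r') \<cdot>\<^sub>w w = \<zero>\<^sub>w" using that w(1) by (simp add: a_minus_def W.smult_l_distr W.smult_l_minus W.M.r_neg)
    then have "r \<ominus> r' = \<zero>" using that by (intro ann) simp_all
    then show ?thesis using that by simp
  qed
  have "\<exists>r\<in>carrier R. y = r \<cdot>\<^sub>w w" if y: "y \<in> carrier \<omega>" for y
  proof -
    \<comment> \<open>\<open>A\<close> consists of the scalars that bring y into R w. Assigning to
      them the resulting coefficient is a map from \<open>A\<close> to R, hence multiplication by
      some x, and y - x w is killed by \<open>A\<close>.\<close>
    define A where "A = {a \<in> carrier R. \<exists>r\<in>carrier R. a \<cdot>\<^sub>w y = r \<cdot>\<^sub>w w}"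
    have A: "ideal A R"
      unfolding is_submodule_ring[symmetric]
    proof (rule is_submoduleI)
      show "\<zero>\<^bsub>ring_module R\<^esub> \<in> A" unfolding A_def using y w(1) by (auto intro!: bexI[of _ \<zero>])
      fix a assume a: "a \<in> A"
      then obtain r where r: "r \<in> carrier R" "a \<cdot>\<^sub>w y = r \<cdot>\<^sub>w w" unfolding A_def by blast
      have ac: "a \<in> carrier R" using a by (simp add: A_def)
      show "a \<in> carrier (ring_module R)" using ac by simp
      show "c \<odot>\<^bsub>ring_module R\<^esub> a \<in> A" if "c \<in> carrier R" for c
        unfolding A_def using that ac r y w(1) by (auto intro!: bexI[of _ "c \<otimes> r"] simp: W.smult_assoc1)
      fix a' assume a': "a' \<in> A"
      then obtain r' where r': "r' \<in> carrier R" "a' \<cdot>\<^sub>w y = r' \<cdot>\<^sub>w w" unfolding A_def by blast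
      have ac': "a' \<in> carrier R" using a' by (simp add: A_def)
      show "a \<oplus>\<^bsub>ring_module R\<^esub> a' \<in> A"
        unfolding A_def using ac ac' r r' y w(1) by (auto intro!: bexI[of _ "r \<oplus> r'"] simp: W.smult_l_distr)
    qed
    define f where "f a = (SOME r. r \<in> carrier R \<and> a \<cdot>\<^sub>w y = r \<cdot>\<^sub>w w)" for a
    have f: "f a \<in> carrier R" "a \<cdot>\<^sub>w y = f a \<cdot>\<^sub>w w" "a \<in> carrier R" if "a \<in> A" for a
      using that someI_ex[of "\<lambda>r. r \<in> carrier R \<and> a \<cdot>\<^sub>w y = r \<cdot>\<^sub>w w"] unfolding A_def f_def by blast+
    have fh: "f \<in> module_hom R ((ring_module R)\<lparr>carrier := A\<rparr>) (ring_module R)"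
    proof (rule module_homI; simp)
      fix a assume a: "a \<in> A"
      show "f a \<in> carrier R" by (rule f(1)[OF a])
      show "f (c \<otimes> a) = c \<otimes> f a" if c: "c \<in> carrier R" for c
      proof -
        have ca: "c \<otimes> a \<in> A" by (rule ideal_simps(6)[OF A c a])
        have "f (c \<otimes> a) \<cdot>\<^sub>w w = (c \<otimes> f a) \<cdot>\<^sub>w w"
          unfolding f(2)[OF ca, symmetric] using c f[OF a] y w(1) by (simp add: W.smult_assoc1)
        then show ?thesis using f(1)[OF a] f(1)[OF ca] c by (intro inj) simp_all
      qed
      fix a' assume a': "a' \<in> A"
      have aa: "a \<oplus> a' \<in> A" by (rule ideal_simps(3)[OF A a a'])
      have "f (a \<oplus> a') \<cdot>\<^sub>w w = (f a \<oplus> f a') \<cdot>\<^sub>w w"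
        unfolding f(2)[OF aa, symmetric] using f[OF a] f[OF a'] y w(1) by (simp add: W.smult_l_distr)
      then show "f (a \<oplus> a') = f a \<oplus> f a'" using f(1)[OF a] f(1)[OF a'] f(1)[OF aa] by (intro inj) simp_all
    qed
    have fA: "f ` A \<subseteq> carrier R" using f(1) by blast
    have "\<exists>x\<in>carrier R. \<forall>a\<in>A. f a = a \<odot>\<^bsub>ring_module R\<^esub> x"
      using B[unfolded baer_submodule_def, THEN spec, THEN spec, THEN mp, OF A, THEN mp, OF fh, THEN mp, OF fA] .
    then obtain x where x: "x \<in> carrier R" "\<And>a. a \<in> A \<Longrightarrow> f a = a \<otimes> x" by auto
    define z where "z = y \<ominus>\<^bsub>\<omega>\<^esub> x \<cdot>\<^sub>w w"
    have zc: "z \<in> carrier \<omega>" using y x(1) w(1) by (simp add: z_def)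
    have kill: "a \<cdot>\<^sub>w z = \<zero>\<^sub>w" if a: "a \<in> A" for a
    proof -
      have "a \<cdot>\<^sub>w z = a \<cdot>\<^sub>w y \<ominus>\<^bsub>\<omega>\<^esub> (a \<otimes> x) \<cdot>\<^sub>w w"
        using f(3)[OF a] y x(1) w(1) by (simp add: z_def a_minus_def W.smult_r_distr W.smult_r_minus W.smult_assoc1)
      then show ?thesis using f(1,2)[OF a] x(2)[OF a] w(1) by (simp add: a_minus_def W.M.r_neg)
    qed
    have "z = \<zero>\<^sub>w"
    proof (rule ccontr)
      assume nz: "z \<noteq> \<zero>\<^sub>w"
      note mult = W.is_submodule_multiples[OF zc]
      have "{r \<cdot>\<^sub>w z | r. r \<in> carrier R} \<noteq> {\<zero>\<^sub>w}" using nz mult(2) by blast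
      then have "soc \<in> {r \<cdot>\<^sub>w z | r. r \<in> carrier R}" by (rule soc(4)[OF mult(1)])
      then obtain r where r: "r \<in> carrier R" "soc = r \<cdot>\<^sub>w z" by blast
      have "r \<cdot>\<^sub>w z = r \<cdot>\<^sub>w y \<ominus>\<^bsub>\<omega>\<^esub> (r \<otimes> x) \<cdot>\<^sub>w w"
        using r(1) y x(1) w(1) by (simp add: z_def a_minus_def W.smult_r_distr W.smult_r_minus W.smult_assoc1)
      then have "r \<cdot>\<^sub>w z \<oplus>\<^bsub>\<omega>\<^esub> (r \<otimes> x) \<cdot>\<^sub>w w = r \<cdot>\<^sub>w y"
        using r(1) y x(1) w(1) by (simp add: a_minus_def W.M.a_assoc W.M.l_neg)
      \<comment> \<open>Since soc = s w is itself in R w, the scalar r that takes z to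
        \<open>soc\<close> belongs to \<open>A\<close>, and so it would have to kill z.\<close>
      then have "r \<cdot>\<^sub>w y = (s \<oplus> r \<otimes> x) \<cdot>\<^sub>w w"
        using r x(1) s(1) w by (simp add: W.smult_l_distr)
      then have "r \<in> A" unfolding A_def using r(1) s(1) x(1) by blast
      then show False using kill r(2) soc(2) by simp
    qed
    moreover have "z \<oplus>\<^bsub>\<omega>\<^esub> x \<cdot>\<^sub>w w = y" using y x(1) w(1) by (simp add: z_def a_minus_def W.M.a_assoc W.M.l_neg)
    ultimately have "y = x \<cdot>\<^sub>w w" using x(1) w(1) by simp
    then show ?thesis using x(1) by blast
  qed
  then show ?thesis using that w(1) ann by blast
qed

text \<open>\<omega> is free on one generator, so its cover by R has kernel zero. Matrices with rows
  in the zero module vanish, and \<open>Tor_trivial_iff\<close> has nothing left to check.\<close>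

theorem Tor_trivial_if_gorenstein:
  assumes "gorenstein_local_ring R m" shows "trivial_module (Tor R (Suc n) \<omega> \<omega>)"
proof -
  have "baer_submodule (ring_module R) (carrier R)"
    using assms self_baer by (simp add: gorenstein_local_ring_def)
  then obtain w where w: "w \<in> carrier \<omega>" "\<And>r. r \<in> carrier R \<Longrightarrow> r \<cdot>\<^sub>w w = \<zero>\<^sub>w \<Longrightarrow> r = \<zero>"
    "\<And>y. y \<in> carrier \<omega> \<Longrightarrow> \<exists>r\<in>carrier R. y = r \<cdot>\<^sub>w w"
    by (rule free_if_self_baer) (blast intro: that)
  let ?p = "\<lambda>c :: nat \<Rightarrow> 'a. c 0 \<cdot>\<^sub>w w"
  interpret free_cover R \<omega> "{0 :: nat}" ?p
  proof
    show ph: "?p \<in> module_hom R (free_module R {0}) \<omega>"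
      using w(1) vecD(1)[of _ "{0 :: nat}" 0] by (intro module_homI) (auto simp: W.smult_l_distr W.smult_assoc1)
    have "?p ` vec {0} \<subseteq> carrier \<omega>" by (rule image_subsetI) (rule module_hom_closed[OF ph])
    moreover have "y \<in> ?p ` vec {0}" if y: "y \<in> carrier \<omega>" for y
    proof -
      obtain r where r: "r \<in> carrier R" "y = r \<cdot>\<^sub>w w" using w(3)[OF y] by blast
      have rv: "(\<lambda>s. r \<otimes> basis_vec R (0 :: nat) s) \<in> vec {0}" by (rule vec_smult[OF r(1) vec_basis]) simp
      have "y = ?p (\<lambda>s. r \<otimes> basis_vec R 0 s)" using r by (simp add: basis_vec_def)
      then show ?thesis using rv by (rule image_eqI)
    qed
    ultimately show "?p ` vec {0} = carrier \<omega>" by blast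
  qed
  have "c = (\<lambda>s. \<zero>)" if "c \<in> kernel_of" for c
  proof
    have c: "c \<in> vec {0}" "c 0 \<cdot>\<^sub>w w = \<zero>\<^sub>w" using that by (auto simp: kernel_of_def)
    show "c s = \<zero>" for s using w(2)[OF vecD(1)[OF c(1)] c(2)] vecD(2)[OF c(1), of s] by (cases "s = 0") auto
  qed
  then have "z p = \<zero>" if "z \<in> tensor_span R (vec (res_basis R \<omega> n)) kernel_of" for z p
    using tensor_span_ideal'[OF zeroideal order.refl _ that, of p] by auto
  then have "z = (\<lambda>p. \<zero>)" if "z \<in> tensor_span R (vec (res_basis R \<omega> n)) kernel_of" for z using that by auto
  then have "tor_independent R (res_basis R \<omega> n) (res_boundary R ` vec (res_basis R \<omega> (Suc n))) {0} kernel_of"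
    unfolding tor_independent_def by (metis IntD2 subsetI tensor_span.zero)
  then show ?thesis using Tor_trivial_iff[OF module_omega] by blast
qed

text \<open>The group is Tor in degree n + 1. For n = 0 the symmetric matrix applies; counting needs
  n = k + 2 because it uses the splitting (2, k). This leaves out n = 1.\<close>

theorem gorenstein_if_Tor_trivial:
  assumes "trivial_module (Tor R (Suc n) \<omega> \<omega>)" "n \<noteq> 1" shows "gorenstein_local_ring R m"
proof -
  obtain I :: "nat \<Rightarrow> nat set" and \<epsilon> d where "minimal_resolution R m \<omega> I \<epsilon> d" by (rule minimal_resolution_exists)
  then interpret minimal_resolution R m \<omega> I \<epsilon> d .
  have T: "tor_vanishes 0 n" by (rule tor_vanishes_if_Tor_trivial[OF assms(1)])
  have "card (I 0) \<le> 1"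
  proof (cases "n = 0")
    case True
    then show ?thesis using T cyclic_if_tor_1_vanishes by simp
  next
    case False
    then obtain k where "n = Suc (Suc k)" using assms(2) by (metis One_nat_def not0_implies_Suc)
    then show ?thesis using T cyclic_if_tor_vanishes by blast
  qed
  then show ?thesis by (rule gorenstein_if_one_generator)
qed

end

theorem theorem2p10:
  fixes R :: "('a, 'r) ring_scheme" and m :: "'a set" and \<omega> :: "('a, 'b, 'w) module_scheme"
  assumes "local_ring R m"
    and "artinian_ring R"
    and "(m \<cdot>\<^bsub>R\<^esub> m) \<cdot>\<^bsub>R\<^esub> m = {\<zero>\<^bsub>R\<^esub>}"
    and "dualizing_module R m \<omega>"
  shows
    "(gorenstein_local_ring R m \<longleftrightarrow> trivial_module (Tor R 1 \<omega> \<omega>)) \<and>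
     (gorenstein_local_ring R m \<longleftrightarrow>
        trivial_module (Tor R 2 \<omega> \<omega>) \<and> trivial_module (Tor R 3 \<omega> \<omega>)) \<and>
     (gorenstein_local_ring R m \<longleftrightarrow>
        (\<exists>j\<ge>3. trivial_module (Tor R j \<omega> \<omega>) \<and> trivial_module (Tor R (j + 1) \<omega> \<omega>) \<and>
               trivial_module (Tor R (j + 2) \<omega> \<omega>)))"
proof -
  interpret dualizing_cube R m \<omega>
    using assms by (auto simp: dualizing_cube_def dualizing_cube_axioms_def local_cube_def local_cube_axioms_def local_ring_def)
  have vanish: "trivial_module (Tor R n \<omega> \<omega>)" if "gorenstein_local_ring R m" "n > 0" for n
    using Tor_trivial_if_gorenstein[OF that(1), of "n - 1"] that(2) by simp
  have gorenstein: "gorenstein_local_ring R m" if "trivial_module (Tor R n \<omega> \<omega>)" "n > 0" "n \<noteq> 2" for n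
    using gorenstein_if_Tor_trivial[of "n - 1"] that by simp
  show ?thesis
  proof (intro conjI iffI)
    show "\<exists>j\<ge>3. trivial_module (Tor R j \<omega> \<omega>) \<and> trivial_module (Tor R (j + 1) \<omega> \<omega>) \<and> trivial_module (Tor R (j + 2) \<omega> \<omega>)"
      if "gorenstein_local_ring R m"
      by (rule exI[of _ 3]) (simp add: vanish[OF that])
    show "gorenstein_local_ring R m"
      if "\<exists>j\<ge>3. trivial_module (Tor R j \<omega> \<omega>) \<and> trivial_module (Tor R (j + 1) \<omega> \<omega>) \<and> trivial_module (Tor R (j + 2) \<omega> \<omega>)"
      using that gorenstein by force
    show "gorenstein_local_ring R m" if "trivial_module (Tor R 1 \<omega> \<omega>)" by (rule gorenstein[OF that]) simp_all
    show "gorenstein_local_ring R m" if "trivial_module (Tor R 2 \<omega> \<omega>) \<and> trivial_module (Tor R 3 \<omega> \<omega>)"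
      by (rule gorenstein[of 3]) (use that in simp_all)
  qed (simp_all add: vanish)
qed

end
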